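(* Let $\mathbb{F}$ be the field of real numbers or the field of complex numbers, let $\mathcal{A}=\mathcal{A}_0\oplus\mathcal{A}_1$ be a finite-dimensional $\mathbb{Z}_2$-graded associative algebra over $\mathbb{F}$ with a supersymmetric nondegenerate associative bilinear form $\langle\cdot,\cdot\rangle$, and let $\iota$ be a nonnegative integer. Let $\mathcal{P}$, $\hat{\mathcal{A}}$, $\mathcal{D}$, $\mathcal{G}$, $\tilde{\mathcal{P}}$, $\Omega$ be as defined in the context. Take $$L_0=\sum_{m=-\infty}^{\iota+1}\sigma_m\partial^m\quad\text{with }\sigma_m\in\mathcal{A}_0,\qquad \kappa\in\mathcal{A}_0\cap\mathrm{Center}(\mathcal{A}),$$ and set $$L=L_0+\sum_{i\in\mathbb{Z}_2,\;j=(j_1,j_2)\in I_i}u_{i,j}\varsigma_{i,j_1}\partial^{j_2}\in\mathcal{D}.$$ Define linear maps $H_1,H_2:\Omega\to\mathcal{G}$ by $$H_1(\varpi)=\kappa[L,\varpi]_-+[(\kappa\varpi)_-,L],\qquad H_2(\varpi)=(L\varpi)_-L-L(\varpi L)_-\qquad(\varpi\in\Omega),$$ where $[L,\varpi]_-=([L,\varpi])_-$. Then the pair $(H_1,H_2)$ forms a Hamiltonian superpair; that is, $\lambda_1H_1+\lambda_2H_2$ is a Hamiltonian superoperator for all $\lambda_1,\lambda_2\in\mathbb{F}$.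
   Context: $\mathbb{N}$ is the set of nonnegative integers; $\overline{m_1,m_2}=\{m_1,\dots,m_2\}$ if $m_1\le m_2$, $\emptyset$ otherwise. Abstract Hamiltonian superoperators. Let $(\mathcal{G},[\cdot,\cdot])$ be a Lie superalgebra and $M$ a $\mathcal{G}$-module. A $q$-form ($q\ge1$) of $\mathcal{G}$ with values in $M$ is a multilinear map $\omega:\mathcal{G}^q\to M$ with $\omega(\xi_1,\dots,\xi_q)=-(-1)^{ij}\omega(\xi_1,\dots,\xi_{\ell-1},\xi_{\ell+1},\xi_\ell,\xi_{\ell+2},\dots,\xi_q)$ for $\xi_\ell\in\mathcal{G}_i$, $\xi_{\ell+1}\in\mathcal{G}_j$; $c^q(\mathcal{G},M)$ is the set of $q$-forms. The differential $d:c^q(\mathcal{G},M)\to c^{q+1}(\mathcal{G},M)$ is, for $\xi_k\in\mathcal{G}_{i_k}$, $$d\omega(\xi_1,\dots,\xi_{q+1})=\sum_{\ell=1}^{q+1}(-1)^{\ell+1+i_\ell(i_1+\cdots+i_{\ell-1})}\xi_\ell\,\omega(\xi_1,\dots,\check\xi_\ell,\dots,\xi_{q+1})$$ $$+\sum_{\ell_1<\ell_2}(-1)^{\ell_1+\ell_2+(i_{\ell_1}+i_{\ell_2})(i_1+\cdots+i_{\ell_1-1})+i_{\ell_2}(i_{\ell_1+1}+\cdots+i_{\ell_2-1})}\omega([\xi_{\ell_1},\xi_{\ell_2}],\xi_1,\dots,\check\xi_{\ell_1},\dots,\check\xi_{\ell_2},\dots,\xi_{q+1}),$$ where $\check{\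 }$ means deletion. For $u\in M$, $du(\xi)=\xi(u)$. Let $\Omega\subset c^1(\mathcal{G},M)$ be a subspace with $dM\subset\Omega$ and $H:\Omega\to\mathcal{G}$ linear. $H$ is $\mathbb{Z}_2$-graded if $H(\Omega)=H(\Omega)_0\oplus H(\Omega)_1$ with $H(\Omega)_i=H(\Omega)\cap\mathcal{G}_i$; it is super skew-symmetric if $\phi_1(H\phi_2)=-(-1)^{i_1i_2}\phi_2(H\phi_1)$ whenever $H\phi_j\in H(\Omega)_{i_j}$. In that case a 2-form $\omega_H$ on $H(\Omega)$ is defined by $\omega_H(H\phi_1,H\phi_2)=\phi_2(H\phi_1)$. A super skew-symmetric $\mathbb{Z}_2$-graded linear map $H$ is a Hamiltonian superoperator if (a) $H(\Omega)$ is a subalgebra of $\mathcal{G}$; (b) the left and right radicals of $\omega_H$ are $\mathbb{Z}_2$-graded and $d\omega_H\equiv0$ on $H(\Omega)$. Two $\mathbb{Z}_2$-graded linear maps $H_1,H_2:\Omega\to\mathcal{G}$ form a Hamiltonian (super)pair if $\lambda_1H_1+\lambda_2H_2$ is a Hamiltonian superoperator for all $\lambda_1,\lambda_2\in\mathbb{F}$. Supersymmetric associative form on $\mathcal{A}$: $\langle\mathcal{A}_0,\mathcal{A}_1\rangle=\{0\}$, $\langle u,v\rangle=(-1)^{i_1i_2}\langle v,u\rangle$, $\langle uv,w\rangle=\langle u,vw\rangle$ for $u\in\mathcal{A}_{i_1},v\in\mathcal{A}_{i_2},w\in\mathcal{A}$. Concrete setting. Let $k_i=\dim\mathcal{A}_i$,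 $I_i=\overline{1,k_i}\times(-\mathbb{N}\cup\overline{1,\iota})$ for $i\in\mathbb{Z}_2$, and let $\{\varsigma_{i,l}\mid l\in\overline{1,k_i}\}$ be a basis of $\mathcal{A}_i$. $\mathcal{P}=\mathcal{P}_0\oplus\mathcal{P}_1$ is the super commutative algebra of supersymmetric polynomials in the symbols $u_{i,j}^{(m)}$ ($i\in\mathbb{Z}_2$, $j\in I_i$, $m\in\mathbb{N}$; $u_{i,j}^{(0)}=u_{i,j}$), where $u^{(m)}_{i,j}$ has parity $i$ (even ones commute, odd ones anticommute); these represent the $x$-derivatives of $C^\infty$ functions $u_{i,j}$ of a real variable $x$ taking values in the even ($i=0$) or odd ($i=1$) part of an exterior algebra. $\partial_{u_{i,j}^{(m)}}$ is the superderivation of $\mathcal{P}$ of parity $i$ dual to $u_{i,j}^{(m)}$, and $\partial=\sum_{i\in\mathbb{Z}_2,\,j\in I_i,\,m\in\mathbb{N}}u_{i,j}^{(m+1)}\partial_{u_{i,j}^{(m)}}$ (representing $d/dx$); write $f^{(m)}=\partial^m(f)$. $\hat{\mathcal{A}}$ is the free $\mathcal{P}$-module on $\{\varsigma_{i,l}\}$, with grading $\hat{\mathcal{A}}_i=\sum_{j\in\overline{1,k_0}}\mathcal{P}_i\varsigma_{0,j}+\sum_{j\in\overline{1,k_1}}\mathcal{P}_{1+i}\varsigma_{1,j}$, multiplication $(f\varsigma_{i_1,j_1})(g\varsigma_{i_2,j_2})=(-1)^{i_1p}fg\,\varsigma_{i_1,j_1}\varsigma_{i_2,j_2}$ and $\mathcal{P}$-valued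 form $\langle f\varsigma_{i_1,j_1},g\varsigma_{i_2,j_2}\rangle=(-1)^{i_1p}fg\langle\varsigma_{i_1,j_1},\varsigma_{i_2,j_2}\rangle$ for $f\in\mathcal{P}$, $g\in\mathcal{P}_p$. Extend $\partial$ to $\hat{\mathcal{A}}$ by $\partial(f\varsigma_{i,j})=\partial(f)\varsigma_{i,j}$. $\mathcal{D}=\{\sum_{l=-\infty}^n\phi_l\partial^l\mid n\in\mathbb{Z},\phi_l\in\hat{\mathcal{A}}\}$ with multiplication $(\phi\partial^m)(\psi\partial^n)=\sum_{p=0}^\infty\binom{m}{p}\phi\psi^{(p)}\partial^{m+n-p}$ ($m,n\in\mathbb{Z}$, $\psi^{(p)}=\partial^p(\psi)$), and likewise $\partial^m\psi=\sum_{p\ge0}\binom mp\psi^{(p)}\partial^{m-p}$; it is $\mathbb{Z}_2$-graded by $\mathcal{D}_i=\{\sum\phi_l\partial^l\mid\phi_l\in\hat{\mathcal{A}}_i\}$, with superbracket $[v_1,v_2]=v_1v_2-(-1)^{i_1i_2}v_2v_1$ for $v_1\in\mathcal{D}_{i_1},v_2\in\mathcal{D}_{i_2}$. For $v=\sum_j\phi_j\partial^j\in\mathcal{D}$, $v_+=\sum_{j\ge0}\phi_j\partial^j$ and $v_-=\sum_{j\ge1}\phi_{-j}\partial^{-j}$. $\mathcal{G}=\{\sum_{l=-\infty}^{\iota}\phi_l\partial^l\mid\phi_l\in\hat{\mathcal{A}}\}$, $\mathcal{G}_i=\mathcal{G}\cap\mathcal{D}_i$. For $v=\sum_{i\in\mathbb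 Z_2,(j_1,j_2)\in I_i}f_{i,(j_1,j_2)}\varsigma_{i,j_1}\partial^{j_2}\in\mathcal{G}$, put $\partial_v=\sum_{i,\,j\in I_i,\,m\in\mathbb{N}}f_{i,j}^{(m)}\partial_{u_{i,j}^{(m)}}$ acting on $\mathcal{P}$, and let $\partial_v$ act on $\mathcal{G}$ coefficientwise: $\partial_v(\sum g_{i,(j_1,j_2)}\varsigma_{i,j_1}\partial^{j_2})=\sum\partial_v(g_{i,(j_1,j_2)})\varsigma_{i,j_1}\partial^{j_2}$. The Lie superbracket on $\mathcal{G}$ (used in the definition of Hamiltonian superoperator) is $[v,w]_0=\partial_v(w)-(-1)^{i_1i_2}\partial_w(v)$ for $v\in\mathcal{G}_{i_1},w\in\mathcal{G}_{i_2}$. $\tilde{\mathcal{P}}=\mathcal{P}/\partial(\mathcal{P})$, $\tilde f=f+\partial(\mathcal{P})$; it is a $\mathcal{G}$-module by $v(\tilde f)=(\partial_v(f))^\sim$, and is taken as the module $M$. The bilinear map $\langle\cdot,\cdot\rangle:\mathcal{D}\times\mathcal{D}\to\tilde{\mathcal{P}}$ is $\langle\sum_m\phi_m\partial^m,\sum_m\psi_m\partial^m\rangle=\sum_{j\in\mathbb{Z}}(\langle\phi_j,\psi_{-j-1}\rangle)^\sim$. Finally $\Omega=\sum_{m=-\iota-1}^\infty\partial^m\hat{\mathcal{A}}\subset\mathcal{D}$ (finite sums), identified with a space of one-forms with values in $\tilde{\mathcal{P}}$ by $\varpi(v)=\langle v,\varpi\rangle$ for $v\in\mathcal{G}$, 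$\varpi\in\Omega$.
   Formalization: In the pairing of D with D, the second argument is expanded as the sum of ∂^m ψ_m (coefficients on the right, as in Ω); with coefficients of both arguments on the left, H_1 is not super skew-symmetric, e.g. A=F, κ=1, ι=0, L_0=0, one-forms u and ∂^2 u with u=u_{0,(1,-1)}. *)

theory Defs
  imports
    Complex_Main
    "HOL-Library.Z2"
    "HOL-Library.FSet"
    "HOL-Library.Multiset"
    "HOL-Library.Poly_Mapping"
    "HOL-Library.Function_Algebras"
    "HOL-Library.Product_Lexorder"
    "HOL-Computational_Algebra.Formal_Power_Series"
begin

section \<open>Abstract Hamiltonian superoperators\<close>

text \<open>The real or the complex field, up to isomorphism.\<close>

class real_or_complex = field_char_0 +
  assumes real_or_complex:
    "(\<exists>h :: 'a \<Rightarrow> real. bij h \<and> (\<forall>x y. h (x + y) = h x + h y \<and> h (x * y) = h x * h y)) \<or>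
     (\<exists>h :: 'a \<Rightarrow> complex. bij h \<and> (\<forall>x y. h (x + y) = h x + h y \<and> h (x * y) = h x * h y))"

instance real :: real_or_complex
  by standard (rule disjI1, rule exI[of _ "\<lambda>x. x"], auto simp: bij_def)

instance complex :: real_or_complex
  by standard (rule disjI2, rule exI[of _ "\<lambda>x. x"], auto simp: bij_def)

text \<open>Parities are elements of the field \<open>bit\<close> with two elements; \<open>psign i\<close> is $(-1)^i$.\<close>

definition psign :: "bit \<Rightarrow> 'f::ring_1" where
  "psign i = (if i = 0 then 1 else - 1)"

text \<open>A graded space is given by its family \<open>G\<close> of homogeneous components inside an ambient
  space; \<open>gcar G\<close> is the sum of the components.\<close>

definition gcar :: "(bit \<Rightarrow> 'g::plus set) \<Rightarrow> 'g set" where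
  "gcar G = {x + y | x y. x \<in> G 0 \<and> y \<in> G 1}"

locale lie_superalgebra = VG: vector_space scG
  for scG :: "'f::field \<Rightarrow> 'g::ab_group_add \<Rightarrow> 'g" +
  fixes G :: "bit \<Rightarrow> 'g set" and br :: "'g \<Rightarrow> 'g \<Rightarrow> 'g"
  assumes G_subspace: "VG.subspace (G i)"
    and G_direct: "G 0 \<inter> G 1 = {0}"
    and br_graded: "\<lbrakk>x \<in> G i; y \<in> G j\<rbrakk> \<Longrightarrow> br x y \<in> G (i + j)"
    and br_add_left: "\<lbrakk>x \<in> gcar G; y \<in> gcar G; z \<in> gcar G\<rbrakk> \<Longrightarrow> br (x + y) z = br x z + br y z"
    and br_add_right: "\<lbrakk>x \<in> gcar G; y \<in> gcar G; z \<in> gcar G\<rbrakk> \<Longrightarrow> br x (y + z) = br x y + br x z"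
    and br_scale_left: "\<lbrakk>x \<in> gcar G; y \<in> gcar G\<rbrakk> \<Longrightarrow> br (scG c x) y = scG c (br x y)"
    and br_scale_right: "\<lbrakk>x \<in> gcar G; y \<in> gcar G\<rbrakk> \<Longrightarrow> br x (scG c y) = scG c (br x y)"
    and br_skew: "\<lbrakk>x \<in> G i; y \<in> G j\<rbrakk> \<Longrightarrow> br x y = - scG (psign (i * j)) (br y x)"
    and br_jacobi: "\<lbrakk>x \<in> G i; y \<in> G j; z \<in> gcar G\<rbrakk> \<Longrightarrow>
      br x (br y z) = br (br x y) z + scG (psign (i * j)) (br y (br x z))"

locale lie_superalgebra_module = lie_superalgebra scG G br + VM: vector_space scM
  for scG :: "'f::field \<Rightarrow> 'g::ab_group_add \<Rightarrow> 'g" and G br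
    and scM :: "'f \<Rightarrow> 'm::ab_group_add \<Rightarrow> 'm" +
  fixes M :: "'m set" and act :: "'g \<Rightarrow> 'm \<Rightarrow> 'm"
  assumes M_subspace: "VM.subspace M"
    and act_closed: "\<lbrakk>x \<in> gcar G; u \<in> M\<rbrakk> \<Longrightarrow> act x u \<in> M"
    and act_add_left: "\<lbrakk>x \<in> gcar G; y \<in> gcar G; u \<in> M\<rbrakk> \<Longrightarrow> act (x + y) u = act x u + act y u"
    and act_add_right: "\<lbrakk>x \<in> gcar G; u \<in> M; w \<in> M\<rbrakk> \<Longrightarrow> act x (u + w) = act x u + act x w"
    and act_scale_left: "\<lbrakk>x \<in> gcar G; u \<in> M\<rbrakk> \<Longrightarrow> act (scG c x) u = scM c (act x u)"
    and act_scale_right: "\<lbrakk>x \<in> gcar G; u \<in> M\<rbrakk> \<Longrightarrow> act x (scM c u) = scM c (act x u)"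
    and act_bracket: "\<lbrakk>x \<in> G i; y \<in> G j; u \<in> M\<rbrakk> \<Longrightarrow>
      act (br x y) u = act x (act y u) - scM (psign (i * j)) (act y (act x u))"
begin

text \<open>Forms of degree \<open>q\<close> are functions on lists of length \<open>q\<close>; only their values on lists with
  entries in the algebra matter.\<close>

definition forms :: "nat \<Rightarrow> ('g list \<Rightarrow> 'm) set" where
  "forms q = {\<omega>.
     (\<forall>xs. set xs \<subseteq> gcar G \<and> length xs = q \<longrightarrow> \<omega> xs \<in> M) \<and>
     (\<forall>xs ys x y c. set xs \<union> set ys \<union> {x, y} \<subseteq> gcar G \<and> length xs + length ys + 1 = q \<longrightarrow>
        \<omega> (xs @ (x + y) # ys) = \<omega> (xs @ x # ys) + \<omega> (xs @ y # ys) \<and>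
        \<omega> (xs @ scG c x # ys) = scM c (\<omega> (xs @ x # ys))) \<and>
     (\<forall>xs ys x y i j. set xs \<union> set ys \<subseteq> gcar G \<and> x \<in> G i \<and> y \<in> G j \<and>
          length xs + length ys + 2 = q \<longrightarrow>
        \<omega> (xs @ x # y # ys) = - scM (psign (i * j)) (\<omega> (xs @ y # x # ys)))}"

text \<open>\<open>differential p \<omega> \<xi>s\<close> is the value of $d\omega$ at the list \<open>\<xi>s\<close> of homogeneous arguments whose
  parities are the entries of the list \<open>p\<close>. List positions start at 0, which shifts
  $(-1)^{\ell+1}$ to $(-1)^\ell$ and leaves $(-1)^{\ell_1+\ell_2}$ unchanged.\<close>

definition del :: "nat \<Rightarrow> 'g list \<Rightarrow> 'g list" where
  "del l xs = take l xs @ drop (Suc l) xs"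

definition differential :: "bit list \<Rightarrow> ('g list \<Rightarrow> 'm) \<Rightarrow> 'g list \<Rightarrow> 'm" where
  "differential p \<omega> \<xi>s =
     (\<Sum>l<length \<xi>s. scM ((- 1) ^ l * psign (p ! l * (\<Sum>r<l. p ! r)))
        (act (\<xi>s ! l) (\<omega> (del l \<xi>s)))) +
     (\<Sum>l2<length \<xi>s. \<Sum>l1<l2.
        scM ((- 1) ^ (l1 + l2) *
             psign ((p ! l1 + p ! l2) * (\<Sum>r<l1. p ! r) + p ! l2 * (\<Sum>r=l1+1..<l2. p ! r)))
        (\<omega> (br (\<xi>s ! l1) (\<xi>s ! l2) # del l1 (del l2 \<xi>s))))"

definition graded :: "'g set \<Rightarrow> bool" where
  "graded S \<longleftrightarrow> S = {x + y | x y. x \<in> S \<inter> G 0 \<and> y \<in> S \<inter> G 1}"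

end

text \<open>The elements of \<open>\<Omega>\<close> are identified with one-forms through the injective linear map \<open>ev\<close>:
  \<open>ev \<phi> \<xi>\<close> is the value $\phi(\xi)$.\<close>

locale hamiltonian_setting =
  lie_superalgebra_module scG G br scM M act + VW: vector_space scW
  for scG :: "'f::field \<Rightarrow> 'g::ab_group_add \<Rightarrow> 'g" and G br
    and scM :: "'f \<Rightarrow> 'm::ab_group_add \<Rightarrow> 'm" and M act
    and scW :: "'f \<Rightarrow> 'w::ab_group_add \<Rightarrow> 'w" +
  fixes \<Omega> :: "'w set" and ev :: "'w \<Rightarrow> 'g \<Rightarrow> 'm"
  assumes \<Omega>_subspace: "VW.subspace \<Omega>"
    and ev_form: "\<phi> \<in> \<Omega> \<Longrightarrow> (\<lambda>\<xi>s. ev \<phi> (hd \<xi>s)) \<in> forms 1"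
    and ev_add: "\<lbrakk>\<phi> \<in> \<Omega>; \<psi> \<in> \<Omega>; \<xi> \<in> gcar G\<rbrakk> \<Longrightarrow> ev (\<phi> + \<psi>) \<xi> = ev \<phi> \<xi> + ev \<psi> \<xi>"
    and ev_scale: "\<lbrakk>\<phi> \<in> \<Omega>; \<xi> \<in> gcar G\<rbrakk> \<Longrightarrow> ev (scW c \<phi>) \<xi> = scM c (ev \<phi> \<xi>)"
    and ev_inj: "\<lbrakk>\<phi> \<in> \<Omega>; \<psi> \<in> \<Omega>; \<And>\<xi>. \<xi> \<in> gcar G \<Longrightarrow> ev \<phi> \<xi> = ev \<psi> \<xi>\<rbrakk> \<Longrightarrow> \<phi> = \<psi>"
    and dM_in_\<Omega>: "u \<in> M \<Longrightarrow> \<exists>\<phi>\<in>\<Omega>. \<forall>\<xi>\<in>gcar G. ev \<phi> \<xi> = act \<xi> u"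
begin

definition linear_map :: "('w \<Rightarrow> 'g) \<Rightarrow> bool" where
  "linear_map H \<longleftrightarrow> H ` \<Omega> \<subseteq> gcar G \<and>
     (\<forall>\<phi>\<in>\<Omega>. \<forall>\<psi>\<in>\<Omega>. H (\<phi> + \<psi>) = H \<phi> + H \<psi>) \<and> (\<forall>c. \<forall>\<phi>\<in>\<Omega>. H (scW c \<phi>) = scG c (H \<phi>))"

definition graded_linear_map :: "('w \<Rightarrow> 'g) \<Rightarrow> bool" where
  "graded_linear_map H \<longleftrightarrow> linear_map H \<and> graded (H ` \<Omega>)"

definition super_skew_symmetric :: "('w \<Rightarrow> 'g) \<Rightarrow> bool" where
  "super_skew_symmetric H \<longleftrightarrow>
     (\<forall>\<phi>1\<in>\<Omega>. \<forall>\<phi>2\<in>\<Omega>. \<forall>i1 i2. H \<phi>1 \<in> G i1 \<and> H \<phi>2 \<in> G i2 \<longrightarrow>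
        ev \<phi>1 (H \<phi>2) = - scM (psign (i1 * i2)) (ev \<phi>2 (H \<phi>1)))"

text \<open>\<open>form_of H [H \<phi>1, H \<phi>2] = ev \<phi>2 (H \<phi>1)\<close>; for super skew-symmetric \<open>H\<close> this does not depend
  on the chosen preimage of the second argument.\<close>

definition form_of :: "('w \<Rightarrow> 'g) \<Rightarrow> 'g list \<Rightarrow> 'm" where
  "form_of H \<xi>s = ev (inv_into \<Omega> H (\<xi>s ! 1)) (\<xi>s ! 0)"

definition left_radical :: "('w \<Rightarrow> 'g) \<Rightarrow> 'g set" where
  "left_radical H = {x \<in> H ` \<Omega>. \<forall>y\<in>H ` \<Omega>. form_of H [x, y] = 0}"

definition right_radical :: "('w \<Rightarrow> 'g) \<Rightarrow> 'g set" where
  "right_radical H = {y \<in> H ` \<Omega>. \<forall>x\<in>H ` \<Omega>. form_of H [x, y] = 0}"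

definition hamiltonian_superoperator :: "('w \<Rightarrow> 'g) \<Rightarrow> bool" where
  "hamiltonian_superoperator H \<longleftrightarrow>
     graded_linear_map H \<and> super_skew_symmetric H \<and>
     (\<forall>x\<in>H ` \<Omega>. \<forall>y\<in>H ` \<Omega>. br x y \<in> H ` \<Omega>) \<and>
     graded (left_radical H) \<and> graded (right_radical H) \<and>
     (\<forall>i1 i2 i3. \<forall>x1\<in>H ` \<Omega> \<inter> G i1. \<forall>x2\<in>H ` \<Omega> \<inter> G i2. \<forall>x3\<in>H ` \<Omega> \<inter> G i3.
        differential [i1, i2, i3] (form_of H) [x1, x2, x3] = 0)"

definition hamiltonian_superpair :: "('w \<Rightarrow> 'g) \<Rightarrow> ('w \<Rightarrow> 'g) \<Rightarrow> bool" where
  "hamiltonian_superpair H1 H2 \<longleftrightarrow>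
     graded_linear_map H1 \<and> graded_linear_map H2 \<and>
     (\<forall>c1 c2. hamiltonian_superoperator (\<lambda>\<phi>. scG c1 (H1 \<phi>) + scG c2 (H2 \<phi>)))"

end

section \<open>Supersymmetric polynomials\<close>

text \<open>The symbol $u_{i,(j_1,j_2)}^{(m)}$ is the pair of its parity \<open>i\<close> and the triple
  \<open>(j1, j2, m)\<close>. A monomial is a multiset of even symbols together with a finite set of odd symbols,
  the latter standing for their product in increasing order. At this level all index triples are
  admitted; the index sets $I_0$, $I_1$ are imposed by \<open>spoly_on\<close> below.\<close>

type_synonym sym = "nat \<times> int \<times> nat"
type_synonym mono = "sym multiset \<times> sym fset"
type_synonym 'f spoly = "mono \<Rightarrow>\<^sub>0 'f"

definition scl :: "'f::field \<Rightarrow> ('k \<Rightarrow>\<^sub>0 'f) \<Rightarrow> ('k \<Rightarrow>\<^sub>0 'f)" where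
  "scl c p = Poly_Mapping.map ((*) c) p"

definition lin_ext :: "(mono \<Rightarrow> 'f spoly) \<Rightarrow> 'f::field spoly \<Rightarrow> 'f spoly" where
  "lin_ext g p = (\<Sum>s\<in>Poly_Mapping.keys p. scl (Poly_Mapping.lookup p s) (g s))"

text \<open>The sign of a product is determined by the number of transpositions needed to sort the
  concatenation of the two increasing lists of odd symbols.\<close>

fun mono_mult :: "mono \<Rightarrow> mono \<Rightarrow> 'f::field spoly" where
  "mono_mult (a, S) (b, T) =
     (if S |\<inter>| T = {||}
      then Poly_Mapping.single (a + b, S |\<union>| T) ((- 1) ^ card {(s, t). s |\<in>| S \<and> t |\<in>| T \<and> t < s})
      else 0)"

definition sp_mult :: "'f::field spoly \<Rightarrow> 'f spoly \<Rightarrow> 'f spoly" (infixl "\<odot>" 70) where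
  "p \<odot> q = lin_ext (\<lambda>s. lin_ext (\<lambda>t. mono_mult s t) q) p"

definition sp_const :: "'f::field \<Rightarrow> 'f spoly" where
  "sp_const c = Poly_Mapping.single ({#}, {||}) c"

definition U :: "bit \<Rightarrow> sym \<Rightarrow> 'f::field spoly" where
  "U i w = Poly_Mapping.single (if i = 0 then ({#w#}, {||}) else ({#}, {|w|})) 1"

definition mono_parity :: "mono \<Rightarrow> bit" where
  "mono_parity s = of_nat (fcard (snd s))"

definition sp_part :: "bit \<Rightarrow> 'f::field spoly \<Rightarrow> 'f spoly" where
  "sp_part i p = Poly_Mapping.mapp (\<lambda>s c. if mono_parity s = i then c else 0) p"

text \<open>\<open>sp_partial i w\<close> is the superderivation $\partial_{u_{i,j}^{(m)}}$ for \<open>w = (j1, j2, m)\<close>; an odd one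
  acts from the left, so it passes the odd symbols smaller than \<open>w\<close>.\<close>

fun mono_partial :: "bit \<Rightarrow> sym \<Rightarrow> mono \<Rightarrow> 'f::field spoly" where
  "mono_partial i w (a, S) =
     (if i = 0 then Poly_Mapping.single (a - {#w#}, S) (of_nat (count a w))
      else if w |\<in>| S then Poly_Mapping.single (a, S |-| {|w|}) ((- 1) ^ card {s. s |\<in>| S \<and> s < w})
      else 0)"

definition sp_partial :: "bit \<Rightarrow> sym \<Rightarrow> 'f::field spoly \<Rightarrow> 'f spoly" where
  "sp_partial i w p = lin_ext (mono_partial i w) p"

definition ddx :: "'f::field spoly \<Rightarrow> 'f spoly" where
  "ddx p = Sum_any (\<lambda>(i, j1, j2, m). U i (j1, j2, Suc m) \<odot> sp_partial i (j1, j2, m) p)"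

text \<open>The subalgebra generated by the symbols with \<open>j\<close> in \<open>I 0\<close> or \<open>I 1\<close>.\<close>

definition monos_on :: "(bit \<Rightarrow> (nat \<times> int) set) \<Rightarrow> mono set" where
  "monos_on I = {(a, S). (\<forall>(j1, j2, m)\<in>set_mset a. (j1, j2) \<in> I 0) \<and>
                        (\<forall>(j1, j2, m)\<in>fset S. (j1, j2) \<in> I 1)}"

definition spoly_on :: "(bit \<Rightarrow> (nat \<times> int) set) \<Rightarrow> 'f::field spoly set" where
  "spoly_on I = {p. Poly_Mapping.keys p \<subseteq> monos_on I}"

lemma lookup_scl [simp]: "Poly_Mapping.lookup (scl c p) k = c * Poly_Mapping.lookup p k"
  by (simp add: scl_def Poly_Mapping.map.rep_eq when_def)

lemma scl_add: "scl c (p + q) = scl c p + scl c q"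
  by (rule poly_mapping_eqI) (simp add: lookup_add algebra_simps)

lemma scl_add_left: "scl (c + d) p = scl c p + scl d p"
  by (rule poly_mapping_eqI) (simp add: lookup_add algebra_simps)

lemma scl_zero [simp]: "scl 0 p = 0" "scl c 0 = 0"
  by (rule poly_mapping_eqI, simp)+

lemma scl_scl: "scl c (scl d p) = scl (c * d) p"
  by (rule poly_mapping_eqI) simp

lemma scl_sum: "scl c (sum f A) = (\<Sum>x\<in>A. scl c (f x))"
  by (rule poly_mapping_eqI) (simp add: lookup_sum sum_distrib_left)

lemma lin_ext_superset:
  assumes "finite A" "Poly_Mapping.keys p \<subseteq> A"
  shows "lin_ext g p = (\<Sum>s\<in>A. scl (Poly_Mapping.lookup p s) (g s))"
  unfolding lin_ext_def
  by (rule sum.mono_neutral_left) (use assms in \<open>auto simp: in_keys_iff\<close>)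

lemma lin_ext_add: "lin_ext g (p + q) = lin_ext g p + lin_ext g q"
proof -
  let ?A = "Poly_Mapping.keys p \<union> Poly_Mapping.keys q"
  have "lin_ext g (p + q) = (\<Sum>s\<in>?A. scl (Poly_Mapping.lookup (p + q) s) (g s))"
    by (rule lin_ext_superset) (auto dest: subsetD[OF keys_add])
  also have "\<dots> = (\<Sum>s\<in>?A. scl (Poly_Mapping.lookup p s) (g s)) +
      (\<Sum>s\<in>?A. scl (Poly_Mapping.lookup q s) (g s))"
    by (simp add: lookup_add scl_add_left sum.distrib)
  also have "\<dots> = lin_ext g p + lin_ext g q"
    by (simp add: lin_ext_superset[of ?A p] lin_ext_superset[of ?A q])
  finally show ?thesis .
qed

lemma lin_ext_scl: "lin_ext g (scl c p) = scl c (lin_ext g p)"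
proof -
  have "lin_ext g (scl c p) =
      (\<Sum>s\<in>Poly_Mapping.keys p. scl (Poly_Mapping.lookup (scl c p) s) (g s))"
    by (rule lin_ext_superset) (auto simp: in_keys_iff)
  then show ?thesis by (simp add: lin_ext_def scl_sum scl_scl)
qed

lemma lin_ext_zero [simp]: "lin_ext g 0 = 0"
  by (simp add: lin_ext_def)

lemma sp_mult_add_right: "p \<odot> (q + r) = p \<odot> q + p \<odot> r"
  by (simp add: sp_mult_def lin_ext_add) (simp add: lin_ext_def scl_add sum.distrib)

lemma sp_mult_scl_right: "p \<odot> scl c q = scl c (p \<odot> q)"
  by (simp add: sp_mult_def lin_ext_scl)
     (simp add: lin_ext_def scl_scl scl_sum mult.commute mult.left_commute)

lemma sp_mult_zero_right [simp]: "p \<odot> 0 = 0"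
  by (simp add: sp_mult_def) (simp add: lin_ext_def)

lemma sp_partial_add: "sp_partial i w (p + q) = sp_partial i w p + sp_partial i w q"
  by (simp add: sp_partial_def lin_ext_add)

lemma sp_partial_scl: "sp_partial i w (scl c p) = scl c (sp_partial i w p)"
  by (simp add: sp_partial_def lin_ext_scl)

lemma sp_partial_support: "finite {(i, w). sp_partial i w p \<noteq> 0}"
proof (rule finite_subset)
  let ?V = "\<lambda>s::mono. {0, 1 :: bit} \<times> (set_mset (fst s) \<union> fset (snd s))"
  show "finite (\<Union>s\<in>Poly_Mapping.keys p. ?V s)" by auto
  show "{(i, w). sp_partial i w p \<noteq> 0} \<subseteq> (\<Union>s\<in>Poly_Mapping.keys p. ?V s)"
  proof clarify
    fix i w assume nz: "sp_partial i w p \<noteq> 0"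
    then obtain s where s: "s \<in> Poly_Mapping.keys p" "mono_partial i w s \<noteq> (0 :: 'a spoly)"
      unfolding sp_partial_def lin_ext_def by (metis (no_types, lifting) scl_zero(2) sum.neutral)
    have "i \<in> {0, 1}" by (cases i) auto
    moreover have "w \<in> set_mset (fst s) \<union> fset (snd s)"
      proof (rule ccontr)
      obtain a S where as: "s = (a, S)" by (cases s)
      assume "w \<notin> set_mset (fst s) \<union> fset (snd s)"
      then have "count a w = 0" "w |\<notin>| S" by (auto simp: as not_in_iff)
      then show False using s(2) by (simp add: as split: if_splits)
    qed
    ultimately show "(i, w) \<in> (\<Union>s\<in>Poly_Mapping.keys p. ?V s)" using s(1) by blast
  qed
qed

lemma ddx_support:
  "finite {x. (case x of (i, j1, j2, m) \<Rightarrow> U i (j1, j2, Suc m) \<odot> sp_partial i (j1, j2, m) p) \<noteq> 0}"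
  by (rule finite_subset[OF _ sp_partial_support[of p]]) auto

lemma ddx_add: "ddx (p + q) = ddx p + ddx q"
  unfolding ddx_def
  by (subst Sum_any.distrib[OF ddx_support ddx_support, symmetric])
     (auto intro!: Sum_any.cong simp: sp_partial_add sp_mult_add_right)

lemma scl_Sum_any:
  assumes "finite {x. f x \<noteq> 0}"
  shows "scl c (Sum_any f) = Sum_any (\<lambda>x. scl c (f x))"
proof -
  have "Sum_any (\<lambda>x. scl c (f x)) = (\<Sum>x\<in>{x. f x \<noteq> 0}. scl c (f x))"
    by (rule Sum_any.expand_superset[OF assms]) auto
  then show ?thesis by (simp add: Sum_any.expand_set scl_sum)
qed

lemma ddx_scl: "ddx (scl c p) = scl c (ddx p)"
  unfolding ddx_def
  by (subst scl_Sum_any[OF ddx_support])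
     (auto intro!: Sum_any.cong simp: sp_partial_scl sp_mult_scl_right)

lemma ddx_zero [simp]: "ddx 0 = 0"
  using ddx_scl[of 0 0] by simp

lemma ddx_uminus: "ddx (- p) = - ddx p"
  using ddx_add[of p "- p"] by (simp add: minus_unique)

text \<open>The quotient by the image of $\partial$. It is formed for the algebra in all symbols; by the
  lemma \<open>til_eq_iff\<close> the image of \<open>spoly_on I\<close> in it is the quotient of \<open>spoly_on I\<close> by its own image
  under $\partial$.\<close>

definition til_rel :: "'f::field spoly \<Rightarrow> 'f spoly \<Rightarrow> bool" where
  "til_rel p q \<longleftrightarrow> (\<exists>h. p - q = ddx h)"

lemma til_rel_refl: "p = q \<Longrightarrow> til_rel p q"
  by (auto simp: til_rel_def intro: exI[of _ 0])

lemma til_rel_equivp: "equivp (til_rel :: 'f::field spoly \<Rightarrow> _)"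
proof (rule equivpI)
  show "reflp (til_rel :: 'f spoly \<Rightarrow> _)"
    by (rule reflpI) (simp add: til_rel_refl)
  show "symp (til_rel :: 'f spoly \<Rightarrow> _)"
  proof (rule sympI)
    fix p q :: "'f spoly" assume "til_rel p q"
    then obtain h where "p - q = ddx h" unfolding til_rel_def by blast
    then have "q - p = ddx (- h)" using minus_diff_eq[of p q] by (simp add: ddx_uminus)
    then show "til_rel q p" unfolding til_rel_def by blast
  qed
  show "transp (til_rel :: 'f spoly \<Rightarrow> _)"
  proof (rule transpI)
    fix p q r :: "'f spoly" assume "til_rel p q" "til_rel q r"
    then obtain h h' where "p - q = ddx h" "q - r = ddx h'" unfolding til_rel_def by blast
    then have "ddx (h + h') = (p - q) + (q - r)" by (simp add: ddx_add)
    then have "p - r = ddx (h + h')" by simp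
    then show "til_rel p r" unfolding til_rel_def by blast
  qed
qed

quotient_type (overloaded) 'f tpoly = "'f::field spoly" / til_rel
  morphisms rep_til til
  by (rule til_rel_equivp)

instantiation tpoly :: (field) ab_group_add
begin

lift_definition zero_tpoly :: "'a tpoly" is 0 .

lift_definition plus_tpoly :: "'a tpoly \<Rightarrow> 'a tpoly \<Rightarrow> 'a tpoly" is "(+)"
proof -
  fix p q r t :: "'a spoly" assume "til_rel p q" "til_rel r t"
  then obtain h h' where "p - q = ddx h" "r - t = ddx h'" unfolding til_rel_def by blast
  then have "ddx (h + h') = (p - q) + (r - t)" by (simp add: ddx_add)
  then have "(p + r) - (q + t) = ddx (h + h')" by simp
  then show "til_rel (p + r) (q + t)" unfolding til_rel_def by blast
qed

lift_definition uminus_tpoly :: "'a tpoly \<Rightarrow> 'a tpoly" is uminus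
proof -
  fix p q :: "'a spoly" assume "til_rel p q"
  then obtain h where "p - q = ddx h" unfolding til_rel_def by blast
  then have "ddx (- h) = - (p - q)" by (simp add: ddx_uminus)
  then have "- p - - q = ddx (- h)" by simp
  then show "til_rel (- p) (- q)" unfolding til_rel_def by blast
qed

definition minus_tpoly :: "'a tpoly \<Rightarrow> 'a tpoly \<Rightarrow> 'a tpoly" where
  "minus_tpoly X Y = X + - Y"

instance
proof
  fix a b c :: "'a tpoly"
  show "a + b + c = a + (b + c)" by transfer (rule til_rel_refl, rule add.assoc)
  show "a + b = b + a" by transfer (rule til_rel_refl, rule add.commute)
  show "0 + a = a" by transfer (rule til_rel_refl, rule add_0_left)
  show "- a + a = 0" by transfer (rule til_rel_refl, rule left_minus)
  show "a - b = a + - b" by (rule minus_tpoly_def)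
qed

end

lift_definition tscl :: "'f::field \<Rightarrow> 'f tpoly \<Rightarrow> 'f tpoly" is scl
proof -
  fix c :: 'f and p q :: "'f spoly" assume "til_rel p q"
  then obtain h where "p - q = ddx h" unfolding til_rel_def by blast
  then have "p = q + ddx h" by (simp add: algebra_simps)
  then have "scl c p - scl c q = ddx (scl c h)" by (simp add: scl_add ddx_scl)
  then show "til_rel (scl c p) (scl c q)" unfolding til_rel_def by blast
qed

lemma lin_ext_single: "lin_ext g (Poly_Mapping.single s c) = scl c (g s)"
  using lin_ext_superset[of "{s}" "Poly_Mapping.single s c" g] by simp

lemma keys_scl: "Poly_Mapping.keys (scl c p) \<subseteq> Poly_Mapping.keys p"
  by (auto simp: in_keys_iff)

lemma U_partial_keys:
  assumes "t \<in> Poly_Mapping.keys (U i (j1, j2, Suc m) \<odot> mono_partial i (j1, j2, m) s :: 'f::field spoly)"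
  shows "t \<in> monos_on I \<longleftrightarrow> s \<in> monos_on I"
proof -
  obtain a S where s: "s = (a, S)" by (cases s)
  let ?w = "(j1, j2, m)" and ?w' = "(j1, j2, Suc m)"
  show ?thesis
  proof (cases "i = 0")
    case True
    have eq: "U i ?w' \<odot> mono_partial i ?w s =
        (scl (of_nat (count a ?w)) (Poly_Mapping.single ({#?w'#} + (a - {#?w#}), S) 1) :: 'f spoly)"
      by (rule poly_mapping_eqI)
         (simp add: s True U_def sp_mult_def lin_ext_single lookup_single when_def)
    let ?X = "({#?w'#} + (a - {#?w#}), S)"
    have nz: "of_nat (count a ?w) * Poly_Mapping.lookup (Poly_Mapping.single ?X 1) t \<noteq> (0 :: 'f)"
      using assms unfolding eq by (simp only: in_keys_iff lookup_scl simp_thms)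
    have t: "t = ?X"
    proof (rule ccontr)
      assume "t \<noteq> ?X"
      then have "Poly_Mapping.lookup (Poly_Mapping.single ?X (1 :: 'f)) t = 0"
        by (intro lookup_single_not_eq) (rule not_sym)
      with nz show False by (simp only: mult_zero_right simp_thms)
    qed
    have "?w \<in># a"
    proof (rule ccontr)
      assume "?w \<notin># a"
      then have "count a ?w = 0" by (simp only: not_in_iff)
      with nz show False by (simp only: mult_zero_left of_nat_0 simp_thms)
    qed
    then obtain b where "a = add_mset ?w b" by (metis mset_add)
    then show ?thesis by (auto simp: t s monos_on_def)
  next
    case False
    have w: "?w |\<in>| S" using assms False by (auto simp: s split: if_splits)
    obtain c where "mono_partial i ?w s = (Poly_Mapping.single (a, S |-| {|?w|}) c :: 'f spoly)"
      using False w by (simp add: s)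
    then have "t = (a, {|?w'|} |\<union>| (S |-| {|?w|}))"
      using assms False
      by (auto simp: U_def sp_mult_def lin_ext_single in_keys_iff lookup_single when_def
          split: if_splits)
    then obtain R where t: "t = (a, R)" and R: "fset R = insert ?w' (fset (S |-| {|?w|}))" by auto
    have "fset S = insert ?w (fset (S |-| {|?w|}))" using w by auto
    then obtain B where "fset S = insert ?w B" "fset R = insert ?w' B" using R by blast
    then show ?thesis by (simp add: s t monos_on_def)
  qed
qed

lemma keys_lin_ext:
  assumes "t \<in> Poly_Mapping.keys (lin_ext g p)"
  obtains s where "s \<in> Poly_Mapping.keys p" "t \<in> Poly_Mapping.keys (g s)"
proof -
  have "t \<in> (\<Union>s\<in>Poly_Mapping.keys p. Poly_Mapping.keys (scl (Poly_Mapping.lookup p s) (g s)))"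
    using assms unfolding lin_ext_def by (rule subsetD[OF keys_sum])
  then obtain s where s: "s \<in> Poly_Mapping.keys p"
    "t \<in> Poly_Mapping.keys (scl (Poly_Mapping.lookup p s) (g s))" by (rule UN_E)
  show ?thesis by (rule that[OF s(1) subsetD[OF keys_scl s(2)]])
qed

lemma U_partial_lin_ext: "U i w' \<odot> sp_partial i w p = lin_ext (\<lambda>s. U i w' \<odot> mono_partial i w s) p"
proof -
  have "q \<odot> sum f A = (\<Sum>x\<in>A. q \<odot> f x)" for q and f :: "mono \<Rightarrow> 'a spoly" and A
    by (induction A rule: infinite_finite_induct) (simp_all add: sp_mult_add_right)
  then show ?thesis by (simp add: sp_partial_def lin_ext_def sp_mult_scl_right)
qed

lemma ddx_keys:
  assumes "t \<in> Poly_Mapping.keys (ddx p)"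
  obtains s where "s \<in> Poly_Mapping.keys p" "t \<in> monos_on I \<longleftrightarrow> s \<in> monos_on I"
proof -
  let ?f = "\<lambda>(i, j1, j2, m). U i (j1, j2, Suc m) \<odot> sp_partial i (j1, j2, m) p"
  have "t \<in> (\<Union>x\<in>{x. ?f x \<noteq> 0}. Poly_Mapping.keys (?f x))"
    using assms unfolding ddx_def Sum_any.expand_set by (rule subsetD[OF keys_sum])
  then obtain x where x: "t \<in> Poly_Mapping.keys (?f x)" by (rule UN_E)
  obtain i j1 j2 m where xe: "x = (i, j1, j2, m)" by (rule prod_cases4)
  have "t \<in> Poly_Mapping.keys (lin_ext (\<lambda>s. U i (j1, j2, Suc m) \<odot> mono_partial i (j1, j2, m) s) p)"
    using x by (simp only: xe prod.case U_partial_lin_ext)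
  then show ?thesis
    by (rule keys_lin_ext) (rule that, assumption, rule U_partial_keys)
qed

lemma til_eq_iff:
  assumes "p \<in> spoly_on I" "q \<in> spoly_on I"
  shows "til p = til q \<longleftrightarrow> (\<exists>h\<in>spoly_on I. p - q = ddx h)"
proof
  assume "til p = til q"
  then obtain h where h: "p - q = ddx h"
    using tpoly.abs_eq_iff[of p q] by (auto simp: til_rel_def)
  define k where "k = Poly_Mapping.mapp (\<lambda>s c. if s \<in> monos_on I then c else 0) h"
  have k: "k \<in> spoly_on I"
    by (auto simp: spoly_on_def k_def in_keys_iff lookup_mapp when_def split: if_splits)
  have hk: "s \<notin> monos_on I" if "s \<in> Poly_Mapping.keys (h - k)" for s
    using that by (auto simp: k_def in_keys_iff lookup_mapp when_def lookup_minus split: if_splits)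
  have eq: "p - q - ddx k = ddx (h - k)"
    using ddx_add[of h "- k"] by (simp add: h ddx_uminus)
  have sub: "Poly_Mapping.keys (p - q - ddx k) \<subseteq> monos_on I"
  proof
    fix t assume "t \<in> Poly_Mapping.keys (p - q - ddx k)"
    then consider "t \<in> Poly_Mapping.keys p" | "t \<in> Poly_Mapping.keys q" | "t \<in> Poly_Mapping.keys (ddx k)"
      by (simp only: in_keys_iff lookup_minus) (metis diff_zero)
    then show "t \<in> monos_on I"
    proof cases
      case 3
      then obtain s where "s \<in> Poly_Mapping.keys k" "t \<in> monos_on I \<longleftrightarrow> s \<in> monos_on I"
        by (rule ddx_keys)
      then show ?thesis using k by (auto simp: spoly_on_def)
    qed (use assms in \<open>auto simp: spoly_on_def\<close>)
  qed
  have out: "t \<notin> monos_on I" if "t \<in> Poly_Mapping.keys (ddx (h - k))" for t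
  proof -
    obtain s where "s \<in> Poly_Mapping.keys (h - k)" "t \<in> monos_on I \<longleftrightarrow> s \<in> monos_on I"
      using \<open>t \<in> Poly_Mapping.keys (ddx (h - k))\<close> by (rule ddx_keys)
    then show ?thesis using hk by simp
  qed
  have "Poly_Mapping.keys (p - q - ddx k) = {}"
  proof (rule equals0I)
    fix t assume t: "t \<in> Poly_Mapping.keys (p - q - ddx k)"
    show False by (rule notE[OF out[OF t[unfolded eq]] subsetD[OF sub t]])
  qed
  then have "p - q = ddx k" by simp
  then show "\<exists>h\<in>spoly_on I. p - q = ddx h" using k by blast
next
  assume "\<exists>h\<in>spoly_on I. p - q = ddx h"
  then show "til p = til q" using tpoly.abs_eq_iff[of p q] by (auto simp: til_rel_def)
qed

section \<open>Pseudo-differential operators over a free module\<close>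

text \<open>An element of $\hat{\mathcal A}$ is the finitely supported family of its coefficients with
  respect to the basis elements $\varsigma_{i,l}$, written to the left of them; an element of
  $\mathcal D$ is the family of the coefficients of the powers of $\partial$, again written on the
  left, and vanishes for all large indices. Addition is pointwise.\<close>

type_synonym 'f ahat = "(bit \<times> nat) \<Rightarrow>\<^sub>0 'f spoly"
type_synonym 'f psdo = "int \<Rightarrow> 'f ahat"

definition ah_scl :: "'f::field \<Rightarrow> 'f ahat \<Rightarrow> 'f ahat" where
  "ah_scl c \<phi> = Poly_Mapping.map (scl c) \<phi>"

definition ah_ddx :: "'f::field ahat \<Rightarrow> 'f ahat" where
  "ah_ddx \<phi> = Poly_Mapping.map ddx \<phi>"

definition ah_lmult :: "'f::field spoly \<Rightarrow> 'f ahat \<Rightarrow> 'f ahat" where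
  "ah_lmult f \<phi> = Poly_Mapping.map (\<lambda>g. f \<odot> g) \<phi>"

definition ah_part :: "bit \<Rightarrow> 'f::field ahat \<Rightarrow> 'f ahat" where
  "ah_part i \<phi> = Poly_Mapping.mapp (\<lambda>(j, l) f. sp_part (i + j) f) \<phi>"

definition d_scl :: "'f::field \<Rightarrow> 'f psdo \<Rightarrow> 'f psdo" where
  "d_scl c v = (\<lambda>l. ah_scl c (v l))"

definition d_part :: "bit \<Rightarrow> 'f::field psdo \<Rightarrow> 'f psdo" where
  "d_part i v = (\<lambda>l. ah_part i (v l))"

definition d_minus :: "'f::field psdo \<Rightarrow> 'f psdo" where
  "d_minus v = (\<lambda>l. if l < 0 then v l else 0)"

definition d_const :: "'f::field ahat \<Rightarrow> 'f psdo" where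
  "d_const \<phi> = (\<lambda>l. if l = 0 then \<phi> else 0)"

text \<open>\<open>d_power m \<psi>\<close> is the operator $\partial^m\psi$.\<close>

definition d_power :: "int \<Rightarrow> 'f::field_char_0 ahat \<Rightarrow> 'f psdo" where
  "d_power m \<psi> = (\<lambda>l. if l \<le> m
     then ah_scl (of_int m gchoose nat (m - l)) ((ah_ddx ^^ nat (m - l)) \<psi>) else 0)"

text \<open>The coefficients $\psi_m$ of an operator written in the form $\sum_m\partial^m\psi_m$,
  obtained from $\phi\partial^n=\sum_{p\ge0}(-1)^p\binom np\partial^{n-p}\phi^{(p)}$.\<close>

definition right_coeff :: "'f::field_char_0 psdo \<Rightarrow> int \<Rightarrow> 'f ahat" where
  "right_coeff w m = Sum_any (\<lambda>p::nat.
     ah_scl ((- 1) ^ p * (of_int (m + int p) gchoose p)) ((ah_ddx ^^ p) (w (m + int p))))"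

lemma lookup_ah_scl [simp]: "Poly_Mapping.lookup (ah_scl c \<phi>) x = scl c (Poly_Mapping.lookup \<phi> x)"
  by (simp add: ah_scl_def Poly_Mapping.map.rep_eq when_def)

lemma lookup_ah_ddx [simp]: "Poly_Mapping.lookup (ah_ddx \<phi>) x = ddx (Poly_Mapping.lookup \<phi> x)"
  by (simp add: ah_ddx_def Poly_Mapping.map.rep_eq when_def)

lemma ah_ddx_pow_scl: "(ah_ddx ^^ p) (ah_scl c \<phi>) = ah_scl c ((ah_ddx ^^ p) \<phi>)"
  by (induction p) (auto intro!: poly_mapping_eqI simp: ddx_scl)

lemma ah_ddx_pow_zero [simp]: "(ah_ddx ^^ p) 0 = 0"
  by (induction p) (auto intro!: poly_mapping_eqI)

lemma ah_scl_zero [simp]: "ah_scl 0 \<phi> = 0" "ah_scl c 0 = 0"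
  by (auto intro!: poly_mapping_eqI)

lemma ah_scl_one [simp]: "ah_scl 1 \<phi> = \<phi>"
  by (auto intro!: poly_mapping_eqI)

lemma ah_scl_scl: "ah_scl c (ah_scl d \<phi>) = ah_scl (c * d) \<phi>"
  by (auto intro!: poly_mapping_eqI simp: scl_scl)

lemma ah_scl_sum_left: "(\<Sum>x\<in>S. ah_scl (c x) \<phi>) = ah_scl (sum c S) \<phi>"
  by (induction S rule: infinite_finite_induct)
     (auto intro!: poly_mapping_eqI simp: lookup_add algebra_simps)

lemma right_coeff_power: "right_coeff (d_power m \<psi>) n = (if n = m then \<psi> else 0)"
proof -
  let ?f = "\<lambda>p::nat. ah_scl ((- 1) ^ p * (of_int (n + int p) gchoose p))
    ((ah_ddx ^^ p) (d_power m \<psi> (n + int p)))"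
  define N where "N = nat (m - n)"
  have zero: "?f p = 0" if "m < n + int p" for p
    using that by (simp add: d_power_def)
  show ?thesis
  proof (cases "n \<le> m")
    case False
    then have "?f p = 0" for p by (intro zero) simp
    then show ?thesis using False by (simp add: right_coeff_def)
  next
    case True
    have "{p. ?f p \<noteq> 0} \<subseteq> {0..N}" using zero True by (force simp: N_def)
    then have "right_coeff (d_power m \<psi>) n = sum ?f {0..N}"
      unfolding right_coeff_def by (rule Sum_any.expand_superset[rotated]) simp
    also have "\<dots> = (\<Sum>p\<in>{0..N}. ah_scl ((- of_int n - 1 gchoose p) * (of_int m gchoose (N - p)))
        ((ah_ddx ^^ N) \<psi>))"
    proof (rule sum.cong[OF refl])
      fix p assume "p \<in> {0..N}"
      then have p: "n + int p \<le> m" "nat (m - (n + int p)) = N - p" "p + (N - p) = N"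
        using True by (auto simp: N_def)
      have "(- 1) ^ p * (of_int (n + int p) gchoose p) = (- of_int n - 1 gchoose p :: 'a)"
        by (subst gbinomial_negated_upper)
           (simp add: mult.assoc[symmetric] power_mult_distrib[symmetric])
      then show "?f p = ah_scl ((- of_int n - 1 gchoose p) * (of_int m gchoose (N - p)))
          ((ah_ddx ^^ N) \<psi>)"
        using p(3) by (simp add: d_power_def p(1,2) ah_ddx_pow_scl ah_scl_scl
            comp_apply[symmetric, of "ah_ddx ^^ p"] funpow_add[symmetric])
    qed
    also have "\<dots> = ah_scl ((of_nat N - 1) gchoose N) ((ah_ddx ^^ N) \<psi>)"
    proof -
      have "(- of_int n - 1) + of_int m = (of_nat N - 1 :: 'a)"
        using True by (simp add: N_def of_nat_nat)
      then show ?thesis by (simp only: ah_scl_sum_left gbinomial_Vandermonde)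
    qed
    also have "\<dots> = (if n = m then \<psi> else 0)"
    proof (cases "n = m")
      case False
      then obtain K where K: "N = Suc K" using True by (cases N) (auto simp: N_def)
      have "(of_nat N - 1 gchoose N :: 'a) = of_nat K gchoose Suc K"
        by (simp add: K)
      also have "\<dots> = 0"
        by (simp only: binomial_gbinomial[symmetric] binomial_eq_0 lessI of_nat_0)
      finally show ?thesis using False by simp
    qed (simp add: N_def)
    finally show ?thesis .
  qed
qed

text \<open>The derivation $\partial_v$. Like \<open>ddx\<close> it is written as a sum over all symbols: only those
  occurring in \<open>p\<close> contribute, so the sum is finite and the index sets need not be mentioned.\<close>

definition evo :: "'f::field psdo \<Rightarrow> 'f spoly \<Rightarrow> 'f spoly" where
  "evo v p = Sum_any (\<lambda>(i, j1, j2, m).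
     (ddx ^^ m) (Poly_Mapping.lookup (v j2) (i, j1)) \<odot> sp_partial i (j1, j2, m) p)"

definition evo_d :: "'f::field psdo \<Rightarrow> 'f psdo \<Rightarrow> 'f psdo" where
  "evo_d v w = (\<lambda>l. Poly_Mapping.map (evo v) (w l))"

definition evo_bracket :: "'f::field psdo \<Rightarrow> 'f psdo \<Rightarrow> 'f psdo" where
  "evo_bracket v w = (\<Sum>i1\<in>{0, 1}. \<Sum>i2\<in>{0, 1}.
     evo_d (d_part i1 v) (d_part i2 w) - d_scl (psign (i1 * i2)) (evo_d (d_part i2 w) (d_part i1 v)))"

section \<open>The algebra and its Hamiltonian superpair\<close>

locale super_frobenius_algebra = vector_space sA
  for sA :: "'f::real_or_complex \<Rightarrow> 'a::ring \<Rightarrow> 'a" +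
  fixes A :: "bit \<Rightarrow> 'a set" and form :: "'a \<Rightarrow> 'a \<Rightarrow> 'f"
  assumes scale_mult_left: "sA c x * y = sA c (x * y)"
    and scale_mult_right: "x * sA c y = sA c (x * y)"
    and finite_dimensional: "\<exists>B. finite B \<and> span B = UNIV"
    and A_subspace: "subspace (A i)"
    and A_sum: "\<exists>y\<in>A 0. \<exists>z\<in>A 1. x = y + z"
    and A_direct: "A 0 \<inter> A 1 = {0}"
    and A_mult: "\<lbrakk>x \<in> A i; y \<in> A j\<rbrakk> \<Longrightarrow> x * y \<in> A (i + j)"
    and form_add_left: "form (x + y) z = form x z + form y z"
    and form_add_right: "form x (y + z) = form x y + form x z"
    and form_scale_left: "form (sA c x) y = c * form x y"
    and form_scale_right: "form x (sA c y) = c * form x y"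
    and form_even_odd: "\<lbrakk>x \<in> A 0; y \<in> A 1\<rbrakk> \<Longrightarrow> form x y = 0"
    and form_supersymmetric: "\<lbrakk>x \<in> A i; y \<in> A j\<rbrakk> \<Longrightarrow> form x y = psign (i * j) * form y x"
    and form_associative: "form (x * y) z = form x (y * z)"
    and form_nondegenerate: "(\<And>y. form x y = 0) \<Longrightarrow> x = 0"

text \<open>\<open>e i l\<close> is the basis element $\varsigma_{i,l}$, and \<open>dim (A i)\<close> is $k_i$.\<close>

locale kp_superalgebra = super_frobenius_algebra sA A form
  for sA :: "'f::real_or_complex \<Rightarrow> 'a::ring \<Rightarrow> 'a" and A form +
  fixes \<iota> :: nat and e :: "bit \<Rightarrow> nat \<Rightarrow> 'a"
  assumes basis_inj: "inj_on (e i) {1..dim (A i)}"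
    and basis_independent: "independent (e i ` {1..dim (A i)})"
    and basis_span: "span (e i ` {1..dim (A i)}) = A i"
begin

definition I :: "bit \<Rightarrow> (nat \<times> int) set" where
  "I i = {1..dim (A i)} \<times> ({..0} \<union> {1..int \<iota>})"

definition P :: "'f spoly set" where
  "P = spoly_on I"

definition P_part :: "bit \<Rightarrow> 'f spoly set" where
  "P_part i = {p \<in> P. \<forall>s\<in>Poly_Mapping.keys p. mono_parity s = i}"

definition Ah_part :: "bit \<Rightarrow> 'f ahat set" where
  "Ah_part i = {\<phi>. \<forall>j l. Poly_Mapping.lookup \<phi> (j, l) \<in> P_part (i + j) \<and>
     (l \<notin> {1..dim (A j)} \<longrightarrow> Poly_Mapping.lookup \<phi> (j, l) = 0)}"

definition Ah :: "'f ahat set" where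
  "Ah = gcar Ah_part"

text \<open>Coordinates of an element of \<open>A\<close> as constant polynomials.\<close>

definition emb :: "'a \<Rightarrow> 'f ahat" where
  "emb a = (\<Sum>i\<in>{0, 1}. \<Sum>l = 1..dim (A i). Poly_Mapping.single (i, l)
     (sp_const (representation (\<Union>j. e j ` {1..dim (A j)}) a (e i l))))"

definition ah_mult :: "'f ahat \<Rightarrow> 'f ahat \<Rightarrow> 'f ahat" where
  "ah_mult \<phi> \<psi> = (\<Sum>(i1, j1)\<in>Poly_Mapping.keys \<phi>. \<Sum>(i2, j2)\<in>Poly_Mapping.keys \<psi>. \<Sum>p\<in>{0, 1}.
     ah_lmult (scl (psign (i1 * p))
         (Poly_Mapping.lookup \<phi> (i1, j1) \<odot> sp_part p (Poly_Mapping.lookup \<psi> (i2, j2))))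
       (emb (e i1 j1 * e i2 j2)))"

definition ah_form :: "'f ahat \<Rightarrow> 'f ahat \<Rightarrow> 'f spoly" where
  "ah_form \<phi> \<psi> = (\<Sum>(i1, j1)\<in>Poly_Mapping.keys \<phi>. \<Sum>(i2, j2)\<in>Poly_Mapping.keys \<psi>. \<Sum>p\<in>{0, 1}.
     scl (psign (i1 * p) * form (e i1 j1) (e i2 j2))
       (Poly_Mapping.lookup \<phi> (i1, j1) \<odot> sp_part p (Poly_Mapping.lookup \<psi> (i2, j2))))"

text \<open>For operators that vanish for large indices only finitely many triples contribute to a given
  coefficient of the product.\<close>

definition d_mult :: "'f psdo \<Rightarrow> 'f psdo \<Rightarrow> 'f psdo" where
  "d_mult v w = (\<lambda>r. Sum_any (\<lambda>(m, n, p::nat).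
     if m + n - int p = r
     then ah_scl (of_int m gchoose p) (ah_mult (v m) ((ah_ddx ^^ p) (w n))) else 0))"

definition d_bracket :: "'f psdo \<Rightarrow> 'f psdo \<Rightarrow> 'f psdo" where
  "d_bracket v w = (\<Sum>i1\<in>{0, 1}. \<Sum>i2\<in>{0, 1}.
     d_mult (d_part i1 v) (d_part i2 w) -
     d_scl (psign (i1 * i2)) (d_mult (d_part i2 w) (d_part i1 v)))"

definition G :: "bit \<Rightarrow> 'f psdo set" where
  "G i = {v. (\<forall>l. v l \<in> Ah_part i) \<and> (\<forall>l>int \<iota>. v l = 0)}"

definition Pt :: "'f tpoly set" where
  "Pt = til ` P"

text \<open>The choice of the representative is immaterial because \<open>evo v\<close> commutes with \<open>ddx\<close>.\<close>

definition t_act :: "'f psdo \<Rightarrow> 'f tpoly \<Rightarrow> 'f tpoly" where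
  "t_act v X = til (evo v (inv_into P til X))"

definition \<Omega> :: "'f psdo set" where
  "\<Omega> = {\<Sum>m\<in>S. d_power m (\<psi> m) | S \<psi>.
     finite S \<and> S \<subseteq> {- int \<iota> - 1..} \<and> (\<forall>m\<in>S. \<psi> m \<in> Ah)}"

text \<open>In the pairing of $v=\sum_m\phi_m\partial^m$ with $w$, the second argument is expanded as
  $w=\sum_m\partial^m\psi_m$, with the coefficients on the right, as in the definition of \<open>\<Omega>\<close>.
  With the coefficients of both arguments on the left, $\sum_j\langle\phi_j,\psi_{-j-1}\rangle$
  would not be super symmetric modulo the image of $\partial$, and the maps below would not be super
  skew-symmetric.\<close>

definition pairing :: "'f psdo \<Rightarrow> 'f psdo \<Rightarrow> 'f tpoly" where
  "pairing v w = Sum_any (\<lambda>j. til (ah_form (v j) (right_coeff w (- j - 1))))"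

definition Lax :: "(int \<Rightarrow> 'a) \<Rightarrow> 'f psdo" where
  "Lax \<sigma> = (\<lambda>l. emb (\<sigma> l) +
     (\<Sum>i\<in>{0, 1}. \<Sum>j1 | (j1, l) \<in> I i. Poly_Mapping.single (i, j1) (U i (j1, l, 0))))"

definition H1 :: "(int \<Rightarrow> 'a) \<Rightarrow> 'a \<Rightarrow> 'f psdo \<Rightarrow> 'f psdo" where
  "H1 \<sigma> \<kappa> w =
     d_mult (d_const (emb \<kappa>)) (d_minus (d_bracket (Lax \<sigma>) w)) +
     d_bracket (d_minus (d_mult (d_const (emb \<kappa>)) w)) (Lax \<sigma>)"

definition H2 :: "(int \<Rightarrow> 'a) \<Rightarrow> 'f psdo \<Rightarrow> 'f psdo" where
  "H2 \<sigma> w =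
     d_mult (d_minus (d_mult (Lax \<sigma>) w)) (Lax \<sigma>) -
     d_mult (Lax \<sigma>) (d_minus (d_mult w (Lax \<sigma>)))"

end

end

theory Submission
  imports Defs
begin

text \<open>Write $a_-$ for the part of negative order of an operator $a$. Both maps of the pair
  are values of two constructions that make sense for every even operator $L$: the quadratic
  operator $H_2(a)=(La)_-L-L(aL)_-$ and, for a central even constant $\kappa$, the linear operator
  $H_1(a)=\kappa([L,a]_--[L,a_-])$. Replacing $L$ by $L+t\kappa$ changes $H_2$ into $H_2+tH_1$;
  the term of second order in $t$ vanishes because $\kappa$ is central
  (\<open>quad_op_shift\<close>). The shift only changes the constant coefficient $\sigma_0$ of
  the Lax operator. Hence every combination $\lambda_1H_1+\lambda_2H_2$ with $\lambda_2\ne0$ is a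
  multiple of the quadratic operator of another Lax operator, the remaining combinations are
  multiples of $H_1$, and it suffices to treat one quadratic and one linear operator.

  Three facts about the operators $\mathcal D$ are used. They form an associative superalgebra
  (\<open>gprod_assoc\<close>), on which evolutionary vector fields act by superderivations
  (\<open>evo_d_mult\<close>). The residue form \<open>tr v w\<close>, the residue of
  $\langle v,w\rangle$ modulo total derivatives, is invariant and supersymmetric
  (\<open>tr_assoc\<close>, \<open>tr_supersym\<close>), vanishes on pairs of differential
  operators and on pairs of operators of negative order (\<open>tr_plus_plus\<close>,
  \<open>tr_minus_minus\<close>), and agrees with the pairing of $\mathcal G$ with $\Omega$
  (\<open>pairing_tr\<close>). Finally $\partial_vL=v$ for the Lax operator and $v\in\mathcal G$
  (\<open>Lax_coordinate_op\<close>), because the coefficients of $L$ are the coordinates up to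
  constants.

  The last fact makes the derivative of $H$ along $x\in\mathcal G$ explicit: it arises by
  replacing one factor $L$ by $x$. Its transpose with respect to the residue form is the
  supercommutator of a product $X$ on $\mathcal D$ (\<open>quad_diff_adjoint\<close>,
  \<open>lin_diff_adjoint\<close>), namely $X(a,b)=a(Lb)_+-(aL)_-b$ in the quadratic case and
  $\kappa(a_+b_+-a_-b_-)$ in the linear case. Two properties of $X$ imply that $H$ is Hamiltonian.
  The first is that the difference of the derivatives of $H$ along $Ha$ and along $Hb$, applied to
  $b$ and to $a$, is $H$ of the supercommutator of $a$ and $b$ under $X$
  (\<open>quad_op_prod\<close>, \<open>lin_diff_prod\<close>), so that
  $$[Ha,Hb]=H\bigl(\partial_{Ha}b\mp\partial_{Hb}a+X(a,b)\mp X(b,a)\bigr),$$ with the sign $\mp$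
  given by the parities. The second is that the cyclic sum of \<open>tr (H a) (X b c)\<close>
  vanishes (\<open>quad_op_cyclic\<close>, \<open>lin_op_cyclic\<close>). The first property shows
  that the image is a subalgebra. Inserted into $d\omega_H$, it leaves only two cyclic sums of the
  second kind, for $(a,b,c)$ and $(a,c,b)$ (\<open>form_closed\<close>). The locale
  \<open>poisson_operator\<close> isolates this argument.

  The image of $H$ has to be computed on $\Omega$, whereas the formulas above produce arbitrary
  elements of $\mathcal D$. This is no restriction: $L$ has order at most $\iota+1$, so $H$
  vanishes on operators of order less than $-\iota-1$, and modulo those every operator lies in
  $\Omega$ (\<open>Omega_approx\<close>).

  That distinct elements of $\Omega$ define distinct one-forms, and that $\Omega$ contains the
  differentials of functionals, rests on the calculus of variations: a polynomial $F$ vanishes if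
  $u^{(N)}F$ is a total derivative for all $N$ (\<open>mult_total_derivative_zero\<close>), and
  integration by parts turns $\partial_vf$ into the pairing of $v$ with the variational
  derivatives of $f$ (\<open>differential_in_Omega\<close>).\<close>

section \<open>Supersymmetric polynomials\<close>

text \<open>Parities are calculated with as elements of a field. Rewriting sums and products of
  bits into bit operations would put the ring laws out of reach of the simplifier.\<close>

declare add_bit_eq_xor [simp del] mult_bit_eq_and [simp del]

abbreviation mon :: "mono \<Rightarrow> 'f::field spoly" where
  "mon s \<equiv> Poly_Mapping.single s 1"

lemma single_eq_scl_mon: "Poly_Mapping.single s c = scl c (mon s)"
  by (rule poly_mapping_eqI) (simp add: lookup_single when_def)

lemma spoly_decomp: "p = (\<Sum>s\<in>Poly_Mapping.keys p. scl (Poly_Mapping.lookup p s) (mon s))"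
proof (rule poly_mapping_eqI)
  fix k
  show "Poly_Mapping.lookup p k =
    Poly_Mapping.lookup (\<Sum>s\<in>Poly_Mapping.keys p. scl (Poly_Mapping.lookup p s) (mon s)) k"
    by (cases "k \<in> Poly_Mapping.keys p")
       (auto simp: lookup_sum lookup_single when_def in_keys_iff if_distrib[of "(*) _"] sum.delta
         cong: if_cong)
qed

lemma additive_sum:
  assumes "\<And>p q. f (p + q) = f p + f q"
  shows "f (sum g B) = (\<Sum>x\<in>B. f (g x) :: 'b::ab_group_add)"
proof -
  have "f 0 = 0" using assms[of 0 0] by simp
  then show ?thesis by (induction B rule: infinite_finite_induct) (simp_all add: assms)
qed

text \<open>Identities between linear maps are checked on monomials. Nested applications reduce
  multilinear identities, such as associativity, to signs of monomials.\<close>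

lemma spoly_linear_eqI:
  assumes "\<And>p q. f (p + q) = f p + f q" "\<And>c p. f (scl c p) = scl c (f p)"
    and "\<And>p q. g (p + q) = g p + g q" "\<And>c p. g (scl c p) = scl c (g p)"
    and "\<And>s. s \<in> Poly_Mapping.keys p \<Longrightarrow> f (mon s) = g (mon s)"
  shows "f p = (g p :: 'f::field spoly)"
proof -
  have "f p = (\<Sum>s\<in>Poly_Mapping.keys p. scl (Poly_Mapping.lookup p s) (f (mon s)))"
    by (subst spoly_decomp[of p]) (simp add: additive_sum[of f, OF assms(1)] assms(2))
  also have "\<dots> = (\<Sum>s\<in>Poly_Mapping.keys p. scl (Poly_Mapping.lookup p s) (g (mon s)))"
    by (simp add: assms(5))
  also have "\<dots> = g p"
    by (subst (3) spoly_decomp[of p]) (simp add: additive_sum[of g, OF assms(3)] assms(4))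
  finally show ?thesis .
qed

lemma scl_one [simp]: "scl 1 p = p"
  by (rule poly_mapping_eqI) simp

lemma scl_uminus_left [simp]: "scl (- c) p = - scl c p"
  by (rule poly_mapping_eqI) simp

lemma scl_uminus [simp]: "scl c (- p) = - scl c p"
  by (rule poly_mapping_eqI) simp

lemma scl_diff: "scl c (p - q) = scl c p - scl c q"
  by (rule poly_mapping_eqI) (simp add: lookup_minus algebra_simps)

lemma sp_mult_add_left: "(p + q) \<odot> r = p \<odot> r + q \<odot> r"
  by (simp add: sp_mult_def lin_ext_add)

lemma sp_mult_scl_left: "scl c p \<odot> r = scl c (p \<odot> r)"
  by (simp add: sp_mult_def lin_ext_scl)

lemma sp_mult_zero_left [simp]: "0 \<odot> p = 0"
  by (simp add: sp_mult_def)

lemma sp_mult_uminus_left [simp]: "(- p) \<odot> q = - (p \<odot> q)"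
  using sp_mult_add_left[of p "- p" q] by (simp add: minus_unique)

lemma sp_mult_uminus_right [simp]: "p \<odot> (- q) = - (p \<odot> q)"
  using sp_mult_add_right[of p q "- q"] by (simp add: minus_unique)

lemma sp_mult_diff_left: "(p - q) \<odot> r = p \<odot> r - q \<odot> r"
  using sp_mult_add_left[of p "- q" r] by simp

lemma sp_mult_diff_right: "p \<odot> (q - r) = p \<odot> q - p \<odot> r"
  using sp_mult_add_right[of p q "- r"] by simp

lemma sp_mult_sum_left: "sum f B \<odot> q = (\<Sum>x\<in>B. f x \<odot> q)"
  by (rule additive_sum) (simp add: sp_mult_add_left)

lemma sp_mult_sum_right: "p \<odot> sum f B = (\<Sum>x\<in>B. p \<odot> f x)"
  by (rule additive_sum) (simp add: sp_mult_add_right)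

text \<open>The value 0 for equal symbols makes the sign of a product with a repeated odd symbol
  vanish. The rules for signs of unions then need no case distinction on disjointness where the
  product is zero anyway.\<close>

definition swap_sign :: "sym \<Rightarrow> sym \<Rightarrow> 'f::field" where
  "swap_sign s t = (if t < s then - 1 else if t = s then 0 else 1)"

definition msign :: "sym fset \<Rightarrow> sym fset \<Rightarrow> 'f::field" where
  "msign S T = (\<Prod>s\<in>fset S. \<Prod>t\<in>fset T. swap_sign s t)"

lemma swap_sign_sq: "s \<noteq> t \<Longrightarrow> swap_sign s t * swap_sign s t = 1"
  by (simp add: swap_sign_def)

lemma swap_sign_swap: "swap_sign s t = - swap_sign t s"
  by (auto simp: swap_sign_def)

lemma msign_zero: "x |\<in>| S \<Longrightarrow> x |\<in>| T \<Longrightarrow> msign S T = 0"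
  unfolding msign_def
  by (auto simp: swap_sign_def intro!: prod_zero bexI[of _ x])

lemma msign_union_left: "S |\<inter>| T = {||} \<Longrightarrow> msign (S |\<union>| T) W = msign S W * (msign T W :: 'f::field)"
  unfolding msign_def
  by (simp add: prod.union_disjoint fset_eq_iff disjoint_iff)

lemma msign_union_right: "T |\<inter>| W = {||} \<Longrightarrow> msign S (T |\<union>| W) = msign S T * msign S W"
  unfolding msign_def
  by (simp add: prod.union_disjoint fset_eq_iff disjoint_iff prod.distrib)

lemma msign_swap: "msign S T = (- 1) ^ (fcard S * fcard T) * msign T S"
proof -
  have "msign S T = (\<Prod>s\<in>fset S. \<Prod>t\<in>fset T. (- 1) * swap_sign t s)"
    unfolding msign_def by (subst swap_sign_swap) simp
  also have "\<dots> = (\<Prod>s\<in>fset S. \<Prod>t\<in>fset T. - 1) * (\<Prod>s\<in>fset S. \<Prod>t\<in>fset T. swap_sign t s)"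
    by (simp only: prod.distrib)
  also have "(\<Prod>s\<in>fset S. \<Prod>t\<in>fset T. swap_sign t s) = (msign T S :: 'a)"
    unfolding msign_def by (rule prod.swap)
  finally show ?thesis by (simp add: fcard.rep_eq power_mult[symmetric] mult.commute)
qed

lemma msign_eq:
  "msign S T = (if S |\<inter>| T = {||} then (- 1) ^ card {(s, t). s |\<in>| S \<and> t |\<in>| T \<and> t < s} else 0)"
proof (cases "S |\<inter>| T = {||}")
  case True
  have "{(s, t). s |\<in>| S \<and> t |\<in>| T \<and> t < s} = Sigma (fset S) (\<lambda>s. {t\<in>fset T. t < s})"
    by auto
  then have "card {(s, t). s |\<in>| S \<and> t |\<in>| T \<and> t < s} = (\<Sum>s\<in>fset S. card {t\<in>fset T. t < s})"
    by simp
  moreover have "(\<Prod>t\<in>fset T. swap_sign s t) = ((- 1) ^ card {t\<in>fset T. t < s} :: 'a)"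
    if "s |\<in>| S" for s
  proof -
    have "(\<Prod>t\<in>fset T. swap_sign s t) = (\<Prod>t\<in>fset T. if t < s then - 1 else 1 :: 'a)"
      by (rule prod.cong[OF refl]) (use True that in \<open>auto simp: swap_sign_def\<close>)
    then show ?thesis by (simp add: prod.If_cases Int_def)
  qed
  ultimately show ?thesis using True
    by (simp add: msign_def power_sum)
next
  case False
  then show ?thesis using msign_zero by force
qed

lemma mon_mult: "mon (a, S) \<odot> mon (b, T) = scl (msign S T) (mon (a + b, S |\<union>| T))"
  by (simp add: sp_mult_def lin_ext_single msign_eq single_eq_scl_mon[of _ "_ ^ _"])

text \<open>On monomials both sides carry the sign of sorting the concatenation of three words,
  and both signs factor into the pairwise signs. If a symbol is repeated, both sides vanish.\<close>

lemma sp_mult_assoc: "(p \<odot> q) \<odot> r = p \<odot> (q \<odot> r)"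
proof (rule spoly_linear_eqI[where p = p])
  fix s
  show "mon s \<odot> q \<odot> r = mon s \<odot> (q \<odot> r)"
  proof (rule spoly_linear_eqI[where p = q])
    fix t
    show "mon s \<odot> mon t \<odot> r = mon s \<odot> (mon t \<odot> r)"
    proof (rule spoly_linear_eqI[where p = r])
      fix w :: mono
      obtain a S b T c W where [simp]: "s = (a, S)" "t = (b, T)" "w = (c, W)"
        by (metis prod.exhaust)
      have "msign S T * msign (S |\<union>| T) W = msign T W * (msign S (T |\<union>| W) :: 'a)"
      proof (cases "S |\<inter>| T = {||} \<and> T |\<inter>| W = {||}")
        case True
        then show ?thesis by (simp add: msign_union_left msign_union_right)
      next
        case False
        then consider x where "x |\<in>| S" "x |\<in>| T" | x where "x |\<in>| T" "x |\<in>| W" by auto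
        then show ?thesis
        proof cases
          case 1
          then show ?thesis using msign_zero[of x S T, where 'a = 'a] msign_zero[of x S "T |\<union>| W", where 'a = 'a]
            by simp
        next
          case 2
          then show ?thesis using msign_zero[of x T W, where 'a = 'a] msign_zero[of x "S |\<union>| T" W, where 'a = 'a]
            by simp
        qed
      qed
      then show "mon s \<odot> mon t \<odot> mon w = (mon s \<odot> (mon t \<odot> mon w) :: 'a spoly)"
        by (simp add: mon_mult sp_mult_scl_left sp_mult_scl_right scl_scl add.assoc sup_assoc)
    qed (simp_all add: sp_mult_add_right sp_mult_scl_right)
  qed (simp_all add: sp_mult_add_right sp_mult_scl_right sp_mult_add_left sp_mult_scl_left)
qed (simp_all add: sp_mult_add_left sp_mult_scl_left)

lemma sp_const_eq: "sp_const c = scl c (sp_const 1)"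
  by (simp add: sp_const_def single_eq_scl_mon[of _ c])

lemma sp_one_left [simp]: "sp_const 1 \<odot> p = p"
  by (rule spoly_linear_eqI[where p = p])
     (auto simp: sp_mult_add_right sp_mult_scl_right sp_const_def mon_mult msign_def)

lemma sp_one_right [simp]: "p \<odot> sp_const 1 = p"
  by (rule spoly_linear_eqI[where p = p])
     (auto simp: sp_mult_add_left sp_mult_scl_left sp_const_def mon_mult msign_def)

lemma sp_const_right: "p \<odot> sp_const c = scl c p"
  by (subst sp_const_eq) (simp add: sp_mult_scl_right)

section \<open>Parity\<close>

definition sp_hom :: "bit \<Rightarrow> 'f::field spoly \<Rightarrow> bool" where
  "sp_hom i p \<longleftrightarrow> (\<forall>s\<in>Poly_Mapping.keys p. mono_parity s = i)"

lemma bit_cases2: "(i::bit) = 0 \<or> i = 1"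
  by (cases i) auto

lemma bit_self_add [simp]: "(i::bit) + i = 0"
  by (cases i) auto

lemma bit_add_self_left [simp]: "(i::bit) + (i + j) = j"
  by (cases i; cases j) auto

lemma bit_add_commute_self [simp]: "(i::bit) + (j + i) = j"
  by (cases i; cases j) auto

lemma bit_mult_self [simp]: "(i::bit) * i = i"
  by (cases i) auto

lemma psign_0 [simp]: "psign 0 = 1"
  by (simp add: psign_def)

lemma psign_1 [simp]: "psign 1 = - 1"
  by (simp add: psign_def)

lemma psign_add: "psign (i + j) = psign i * psign j"
  by (cases i; cases j) auto

lemma psign_sq [simp]: "psign i * psign i = 1"
  by (cases i) auto

lemma psign_sq_left [simp]: "psign i * (psign i * x) = x"
  by (cases i) auto

lemma psign_of_nat: "psign (of_nat n) = (- 1) ^ n"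
  by (induction n) (simp_all add: psign_add)

lemma sp_hom_zero [simp]: "sp_hom i 0"
  by (simp add: sp_hom_def)

lemma sp_hom_add: "sp_hom i p \<Longrightarrow> sp_hom i q \<Longrightarrow> sp_hom i (p + q)"
  using keys_add[of p q] by (auto simp: sp_hom_def)

lemma sp_hom_scl: "sp_hom i p \<Longrightarrow> sp_hom i (scl c p)"
  using keys_scl[of c p] by (auto simp: sp_hom_def)

lemma sp_hom_sum: "(\<And>x. x \<in> B \<Longrightarrow> sp_hom i (f x)) \<Longrightarrow> sp_hom i (sum f B)"
  by (induction B rule: infinite_finite_induct) (auto intro: sp_hom_add)

lemma sp_hom_mon [simp]: "sp_hom i (mon s) \<longleftrightarrow> mono_parity s = i"
  by (auto simp: sp_hom_def)

lemma sp_hom_const [simp]: "sp_hom 0 (sp_const c)"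
  by (auto simp: sp_hom_def sp_const_def mono_parity_def fcard_fempty split: if_splits)

lemma sp_hom_U [simp]: "sp_hom i (U i w)"
  using bit_cases2[of i] by (auto simp: U_def mono_parity_def fcard_fempty fcard_finsert_if)

lemma lookup_sp_part:
  "Poly_Mapping.lookup (sp_part i p) s = (if mono_parity s = i then Poly_Mapping.lookup p s else 0)"
  by (auto simp: sp_part_def lookup_mapp when_def in_keys_iff)

lemma sp_part_add: "sp_part i (p + q) = sp_part i p + sp_part i q"
  by (rule poly_mapping_eqI) (simp add: lookup_sp_part lookup_add)

lemma sp_part_scl: "sp_part i (scl c p) = scl c (sp_part i p)"
  by (rule poly_mapping_eqI) (simp add: lookup_sp_part)

lemma sp_part_zero [simp]: "sp_part i 0 = 0"
  by (rule poly_mapping_eqI) (simp add: lookup_sp_part)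

lemma sp_hom_sp_part [simp]: "sp_hom i (sp_part i p)"
  by (auto simp: sp_hom_def in_keys_iff lookup_sp_part split: if_splits)

lemma sp_part_sum: "sp_part 0 p + sp_part 1 p = p"
proof (rule poly_mapping_eqI)
  fix s show "Poly_Mapping.lookup (sp_part 0 p + sp_part 1 p) s = Poly_Mapping.lookup p s"
    using bit_cases2[of "mono_parity s"] by (auto simp: lookup_sp_part lookup_add)
qed

lemma sp_part_hom: "sp_hom i p \<Longrightarrow> sp_part j p = (if i = j then p else 0)"
  by (rule poly_mapping_eqI) (auto simp: lookup_sp_part sp_hom_def in_keys_iff)

lemma sp_hom_cases:
  assumes "\<And>p q. f (p + q) = f p + f q" "\<And>p q. g (p + q) = g p + g q"
    and "\<And>i. f (sp_part i p) = g (sp_part i p)"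
  shows "f p = (g p :: 'b::ab_group_add)"
  using assms(1)[of "sp_part 0 p" "sp_part 1 p"] assms(2)[of "sp_part 0 p" "sp_part 1 p"] assms(3)
  by (simp add: sp_part_sum)

lemma mono_parity_union:
  "msign (snd s) (snd t) \<noteq> (0::'f::field) \<Longrightarrow>
    mono_parity (fst s + fst t, snd s |\<union>| snd t) = mono_parity s + mono_parity t"
proof -
  assume "msign (snd s) (snd t) \<noteq> (0::'f)"
  then have "fset (snd s) \<inter> fset (snd t) = {}" using msign_zero by blast
  then show ?thesis by (simp add: mono_parity_def fcard.rep_eq card_Un_disjoint)
qed

lemma sp_hom_mult:
  assumes "sp_hom i p" "sp_hom j q" shows "sp_hom (i + j) (p \<odot> q)"
proof -
  have "sp_hom (i + j) (scl c (mon s) \<odot> scl d (mon t) :: 'a spoly)"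
    if "s \<in> Poly_Mapping.keys p" "t \<in> Poly_Mapping.keys q" for c d s t
  proof -
    obtain a S b T where st: "s = (a, S)" "t = (b, T)" by (metis prod.exhaust)
    have "sp_hom (i + j) (scl (msign S T) (mon (a + b, S |\<union>| T)) :: 'a spoly)"
    proof (cases "msign S T = (0::'a)")
      case False
      then have "mono_parity (a + b, S |\<union>| T) = i + j"
        using mono_parity_union[of s t] assms that by (simp add: st sp_hom_def)
      then show ?thesis by (intro sp_hom_scl) simp
    qed simp
    then show ?thesis by (simp add: st sp_mult_scl_left sp_mult_scl_right mon_mult sp_hom_scl)
  qed
  then have "sp_hom (i + j) ((\<Sum>s\<in>Poly_Mapping.keys p. scl (Poly_Mapping.lookup p s) (mon s)) \<odot>
      (\<Sum>t\<in>Poly_Mapping.keys q. scl (Poly_Mapping.lookup q t) (mon t)))"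
    unfolding sp_mult_sum_left sp_mult_sum_right by (intro sp_hom_sum)
  then show ?thesis by (simp only: spoly_decomp[symmetric])
qed

lemma sp_mult_supercomm:
  assumes "sp_hom i p" "sp_hom j q"
  shows "p \<odot> q = scl (psign (i * j)) (q \<odot> p)"
proof (rule spoly_linear_eqI[where p = p])
  fix s assume s: "s \<in> Poly_Mapping.keys p"
  show "mon s \<odot> q = scl (psign (i * j)) (q \<odot> mon s)"
  proof (rule spoly_linear_eqI[where p = q])
    fix t assume t: "t \<in> Poly_Mapping.keys q"
    obtain a S b T where st: "s = (a, S)" "t = (b, T)" by (metis prod.exhaust)
    have "psign (i * j) = ((- 1) ^ (fcard S * fcard T) :: 'a)"
      using assms s t unfolding psign_of_nat[symmetric] of_nat_mult
      by (force simp: sp_hom_def st mono_parity_def)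
    then have "msign S T = psign (i * j) * (msign T S :: 'a)"
      by (simp only: msign_swap[of S T])
    then have "mon s \<odot> mon t = (scl (psign (i * j) * msign T S) (mon (a + b, S |\<union>| T)) :: 'a spoly)"
      by (simp only: st mon_mult)
    also have "\<dots> = scl (psign (i * j)) (mon t \<odot> mon s)"
      by (simp only: st mon_mult scl_scl add.commute[of b a] sup_commute[of T S])
    finally show "mon s \<odot> mon t = scl (psign (i * j)) (mon t \<odot> mon s :: 'a spoly)" .
  qed (simp_all add: sp_mult_add_right sp_mult_scl_right sp_mult_add_left sp_mult_scl_left scl_add scl_scl mult.commute)
qed (simp_all add: sp_mult_add_right sp_mult_scl_right sp_mult_add_left sp_mult_scl_left scl_add scl_scl mult.commute)

section \<open>Superderivations\<close>

text \<open>The sign with which the odd derivative with respect to \<open>w\<close> acts on the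
  product of the symbols in \<open>S\<close>: a factor $-1$ for each symbol that precedes
  \<open>w\<close>. Writing it through \<open>swap_sign\<close> makes it comparable with
  \<open>msign\<close>.\<close>

definition dsign :: "sym \<Rightarrow> sym fset \<Rightarrow> 'f::field" where
  "dsign w S = (if w |\<in>| S then \<Prod>s\<in>fset S - {w}. swap_sign w s else 0)"

lemma dsign_eq: "dsign w S = (if w |\<in>| S then (- 1) ^ card {s. s |\<in>| S \<and> s < w} else 0)"
proof -
  have "(\<Prod>s\<in>fset S - {w}. swap_sign w s) = (\<Prod>s\<in>fset S - {w}. if s < w then - 1 else 1 :: 'a)"
    by (rule prod.cong[OF refl]) (auto simp: swap_sign_def)
  also have "\<dots> = (- 1) ^ card ((fset S - {w}) \<inter> {s. s < w})"
    by (simp add: prod.If_cases)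
  also have "(fset S - {w}) \<inter> {s. s < w} = {s. s |\<in>| S \<and> s < w}" by auto
  finally show ?thesis by (simp add: dsign_def)
qed

lemma mono_partial_1: "mono_partial 1 w (a, S) = scl (dsign w S) (mon (a, S |-| {|w|}))"
  by (simp add: dsign_eq single_eq_scl_mon[of _ "_ ^ _"])

lemma mono_partial_0: "mono_partial 0 w (a, S) = scl (of_nat (count a w)) (mon (a - {#w#}, S))"
  by (simp add: single_eq_scl_mon[of _ "of_nat _"])

lemma msign_remove_left:
  assumes "w |\<in>| S"
  shows "msign S T = msign (S |-| {|w|}) T * (\<Prod>t\<in>fset T. swap_sign w t)"
  unfolding msign_def using assms
  by (subst prod.remove[of _ w]) (auto simp: mult.commute)

lemma msign_remove_right:
  assumes "w |\<in>| T"
  shows "msign S T = msign S (T |-| {|w|}) * (\<Prod>s\<in>fset S. swap_sign s w)"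
proof -
  have "(\<Prod>t\<in>fset T. swap_sign s t) = (\<Prod>t\<in>fset (T |-| {|w|}). swap_sign s t) * (swap_sign s w :: 'a)" for s
    using assms by (subst prod.remove[of _ w]) (auto simp: mult.commute)
  then show ?thesis by (simp add: msign_def prod.distrib)
qed

lemma prod_swap_sign_sq: "w \<notin> B \<Longrightarrow> (\<Prod>s\<in>B. swap_sign w s) * (\<Prod>s\<in>B. swap_sign w s) = (1::'f::field)"
  by (simp add: prod.distrib[symmetric]) (rule prod.neutral, auto intro!: swap_sign_sq)

lemma prod_swap_sign_swap:
  "w \<notin> B \<Longrightarrow> (\<Prod>s\<in>B. swap_sign s w) * (\<Prod>s\<in>B. swap_sign w s) = ((- 1) ^ card B ::'f::field)"
proof -
  assume "w \<notin> B"
  then have "swap_sign s w * swap_sign w s = (- 1 :: 'f)" if "s \<in> B" for s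
    using that by (auto simp: swap_sign_def)
  then show ?thesis by (simp add: prod.distrib[symmetric])
qed

lemma fset_remove: "fset (S |-| {|w|}) = fset S - {w}"
  by auto

text \<open>For odd \<open>w\<close> the derivative picks \<open>w\<close> from the left factor
  or, after passing all odd symbols of the left factor, from the right one. If \<open>w\<close>
  occurs in both factors the product is zero, and the two terms on the right cancel: the sign
  $(-1)^{|S|}$ of passing the left factor \<open>S\<close> is opposite to that of passing the
  $|S|-1$ symbols of \<open>S\<close> other than \<open>w\<close>.\<close>

lemma partial_mono_mult:
  "sp_partial i w (mon s \<odot> mon t) =
    sp_partial i w (mon s) \<odot> mon t + scl (psign (i * mono_parity s)) (mon s \<odot> sp_partial i w (mon t))"
proof -
  obtain a S b T where st: "s = (a, S)" "t = (b, T)" by (metis prod.exhaust)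
  consider "i = 0" | "i = 1" using bit_cases2 by auto
  then show ?thesis
  proof cases
    case 1
    have "scl (of_nat (count a w)) (mon (a - {#w#} + b, S |\<union>| T)) =
        (scl (of_nat (count a w)) (mon (a + b - {#w#}, S |\<union>| T)) :: 'a spoly)"
      by (cases "w \<in># a") (auto simp: not_in_iff)
    moreover have "scl (of_nat (count b w)) (mon (a + (b - {#w#}), S |\<union>| T)) =
        (scl (of_nat (count b w)) (mon (a + b - {#w#}, S |\<union>| T)) :: 'a spoly)"
      by (cases "w \<in># b") (auto simp: not_in_iff)
    moreover have "sp_partial i w (mon s \<odot> mon t) = scl (msign S T)
        (scl (of_nat (count a w)) (mon (a + b - {#w#}, S |\<union>| T)) +
         scl (of_nat (count b w)) (mon (a + b - {#w#}, S |\<union>| T)) :: 'a spoly)"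
      by (simp add: 1 st mon_mult sp_partial_scl sp_partial_def lin_ext_scl lin_ext_single mono_partial_0
          scl_add_left del: mono_partial.simps)
    moreover have "sp_partial i w (mon s) \<odot> mon t = scl (msign S T)
        (scl (of_nat (count a w)) (mon (a - {#w#} + b, S |\<union>| T)) :: 'a spoly)"
      by (simp add: 1 st mon_mult sp_partial_def lin_ext_single mono_partial_0 sp_mult_scl_left scl_scl
          mult.commute del: mono_partial.simps)
    moreover have "scl (psign (i * mono_parity s)) (mon s \<odot> sp_partial i w (mon t)) = scl (msign S T)
        (scl (of_nat (count b w)) (mon (a + (b - {#w#}), S |\<union>| T)) :: 'a spoly)"
      by (simp add: 1 st mon_mult sp_partial_def lin_ext_single mono_partial_0 sp_mult_scl_right scl_scl
          mult.commute del: mono_partial.simps)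
    ultimately show ?thesis by (simp only: scl_add)
  next
    case 2
    have par: "psign (mono_parity s) = ((- 1) ^ fcard S :: 'a)"
      by (simp add: st mono_parity_def psign_of_nat)
    have L: "sp_partial i w (mon s \<odot> mon t) =
        scl (msign S T * dsign w (S |\<union>| T)) (mon (a + b, (S |\<union>| T) |-| {|w|}) :: 'a spoly)"
      by (simp add: 2 st mon_mult sp_partial_scl sp_partial_def lin_ext_single lin_ext_scl mono_partial_1 scl_scl
          del: mono_partial.simps)
    have R1: "sp_partial i w (mon s) \<odot> mon t =
        scl (dsign w S * msign (S |-| {|w|}) T) (mon (a + b, (S |-| {|w|}) |\<union>| T) :: 'a spoly)"
      by (simp add: 2 st mon_mult sp_partial_def lin_ext_single mono_partial_1 scl_scl sp_mult_scl_left
          del: mono_partial.simps)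
    have R2: "scl (psign (i * mono_parity s)) (mon s \<odot> sp_partial i w (mon t)) =
        scl ((- 1) ^ fcard S * dsign w T * msign S (T |-| {|w|})) (mon (a + b, S |\<union>| (T |-| {|w|})) :: 'a spoly)"
      using par by (simp add: 2 st mon_mult sp_partial_def lin_ext_single mono_partial_1 scl_scl sp_mult_scl_right
          mult.assoc del: mono_partial.simps)
    let ?S = "S |-| {|w|}" and ?T = "T |-| {|w|}"
    have wST: "w \<notin> fset ?S" "w \<notin> fset ?T" by auto
    consider "w |\<in>| S" "w |\<in>| T" | "w |\<in>| S" "w |\<notin>| T" | "w |\<notin>| S" "w |\<in>| T" | "w |\<notin>| S" "w |\<notin>| T"
      by blast
    then show ?thesis
    proof cases
      case 1
      have eq: "?S |\<union>| T = S |\<union>| T" "S |\<union>| ?T = S |\<union>| T" using 1 by auto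
      have c: "fcard S = Suc (card (fset ?S))"
        using fcard_Suc_fminus1[OF 1(1)] by (simp only: fcard.rep_eq)
      have "dsign w S * msign ?S T = (msign ?S ?T * (\<Prod>s\<in>fset ?S. swap_sign s w) * (\<Prod>s\<in>fset ?S. swap_sign w s) :: 'a)"
        using 1 by (simp add: dsign_def fset_remove msign_remove_right[of w T] mult_ac)
      then have a1: "dsign w S * msign ?S T = (msign ?S ?T * (- 1) ^ card (fset ?S) :: 'a)"
        using prod_swap_sign_swap[OF wST(1), where 'f = 'a] by (simp add: mult.assoc)
      have "dsign w T * msign S ?T = (msign ?S ?T * ((\<Prod>t\<in>fset ?T. swap_sign w t) * (\<Prod>t\<in>fset ?T. swap_sign w t)) :: 'a)"
        using 1 by (simp add: dsign_def fset_remove msign_remove_left[of w S] mult_ac)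
      then have a2: "dsign w T * msign S ?T = (msign ?S ?T :: 'a)"
        using prod_swap_sign_sq[OF wST(2), where 'f = 'a] by simp
      show ?thesis unfolding L R1 R2 eq a1 mult.assoc a2
        using 1 by (simp add: msign_zero[of w] c scl_add_left[symmetric] mult.commute)
    next
      case 2
      have eq: "(S |\<union>| T) |-| {|w|} = ?S |\<union>| T" using 2 by auto
      have *: "msign S T * dsign w (S |\<union>| T) = (dsign w S * msign ?S T :: 'a)"
      proof (cases "S |\<inter>| T = {||}")
        case True
        have "fset (S |\<union>| T) - {w} = fset ?S \<union> fset T" "fset ?S \<inter> fset T = {}"
          using 2 True by auto
        then have "dsign w (S |\<union>| T) = (dsign w S * (\<Prod>t\<in>fset T. swap_sign w t) :: 'a)"
          using 2 by (simp add: dsign_def prod.union_disjoint fset_remove del: union_fset minus_fset)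
        then show ?thesis
          using prod_swap_sign_sq[of w "fset T", where 'f = 'a] 2
          by (simp add: msign_remove_left[of w S] mult_ac)
      next
        case False
        then obtain x where "x |\<in>| S" "x |\<in>| T" by auto
        then show ?thesis using 2 msign_zero[of x S T, where 'a = 'a] msign_zero[of x ?S T, where 'a = 'a] by auto
      qed
      have "dsign w T = (0 :: 'a)" using 2 by (simp add: dsign_def)
      then show ?thesis unfolding L R1 R2 eq * by simp
    next
      case 3
      have eq: "(S |\<union>| T) |-| {|w|} = S |\<union>| ?T" using 3 by auto
      have *: "msign S T * dsign w (S |\<union>| T) = ((- 1) ^ fcard S * dsign w T * msign S ?T :: 'a)"
      proof (cases "S |\<inter>| T = {||}")
        case True
        have "fset (S |\<union>| T) - {w} = fset S \<union> fset ?T" "fset S \<inter> fset ?T = {}"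
          using 3 True by auto
        then have "dsign w (S |\<union>| T) = ((\<Prod>s\<in>fset S. swap_sign w s) * dsign w T :: 'a)"
          using 3 by (simp add: dsign_def prod.union_disjoint fset_remove del: union_fset minus_fset)
        then show ?thesis
          using prod_swap_sign_swap[of w "fset S", where 'f = 'a] 3
          by (simp add: msign_remove_right[of w T] mult_ac fcard.rep_eq)
      next
        case False
        then obtain x where "x |\<in>| S" "x |\<in>| T" by auto
        then show ?thesis using 3 msign_zero[of x S T, where 'a = 'a] msign_zero[of x S ?T, where 'a = 'a] by auto
      qed
      have "dsign w S = (0 :: 'a)" using 3 by (simp add: dsign_def)
      then show ?thesis unfolding L R1 R2 eq * by simp
    next
      case 4
      then show ?thesis unfolding L R1 R2 by (simp add: dsign_def)
    qed
  qed
qed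

definition superderivation :: "bit \<Rightarrow> ('f::field spoly \<Rightarrow> 'f spoly) \<Rightarrow> bool" where
  "superderivation k d \<longleftrightarrow> (\<forall>p q. d (p + q) = d p + d q) \<and> (\<forall>c p. d (scl c p) = scl c (d p)) \<and>
     (\<forall>i p q. sp_hom i p \<longrightarrow> d (p \<odot> q) = d p \<odot> q + scl (psign (k * i)) (p \<odot> d q))"

lemma superderivation_partial: "superderivation i (sp_partial i w)"
  unfolding superderivation_def
proof (intro conjI allI impI)
  fix j and p q :: "'a spoly" assume p: "sp_hom j p"
  show "sp_partial i w (p \<odot> q) = sp_partial i w p \<odot> q + scl (psign (i * j)) (p \<odot> sp_partial i w q)"
  proof (rule spoly_linear_eqI[where p = p])
    fix s assume s: "s \<in> Poly_Mapping.keys p"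
    then have "mono_parity s = j" using p by (simp add: sp_hom_def)
    then show "sp_partial i w (mon s \<odot> q) =
        sp_partial i w (mon s) \<odot> q + scl (psign (i * j)) (mon s \<odot> sp_partial i w q)"
      by - (rule spoly_linear_eqI[where p = q], simp_all add: partial_mono_mult sp_mult_add_right sp_mult_scl_right sp_partial_add
           sp_partial_scl scl_add scl_scl mult.commute)
  qed (simp_all add: sp_mult_add_left sp_mult_scl_left sp_partial_add sp_partial_scl scl_add scl_scl
       mult.commute)
qed (simp_all add: sp_partial_add sp_partial_scl)

lemma sp_hom_partial:
  assumes "sp_hom j p" shows "sp_hom (i + j) (sp_partial i w p)"
proof -
  have "sp_hom (i + j) (sp_partial i w (mon s) :: 'a spoly)" if "s \<in> Poly_Mapping.keys p" for s
  proof -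
    obtain a S where s: "s = (a, S)" by (cases s)
    have par: "mono_parity s = j" using assms that by (simp add: sp_hom_def)
    consider "i = 0" | "i = 1" using bit_cases2 by auto
    then show ?thesis
    proof cases
      case 1
      then show ?thesis using par
        by (simp add: sp_partial_def lin_ext_single s mono_partial_0 mono_parity_def
            del: mono_partial.simps) (rule sp_hom_scl, simp add: mono_parity_def)
    next
      case 2
      have "w |\<in>| S \<Longrightarrow> mono_parity (a, S |-| {|w|}) = 1 + j"
        using par by (cases "fcard S") (auto simp: s mono_parity_def fcard.rep_eq fset_remove)
      then show ?thesis
        by (simp add: 2 sp_partial_def lin_ext_single s mono_partial_1 del: mono_partial.simps)
           (cases "w |\<in>| S", auto intro!: sp_hom_scl simp: dsign_def)
    qed
  qed
  then have "sp_hom (i + j) (sp_partial i w (\<Sum>s\<in>Poly_Mapping.keys p. scl (Poly_Mapping.lookup p s) (mon s)))"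
    unfolding additive_sum[of "sp_partial i w", OF sp_partial_add] sp_partial_scl
    by (intro sp_hom_sum sp_hom_scl)
  then show ?thesis by (simp only: spoly_decomp[symmetric])
qed

text \<open>Both $\partial$ and $\partial_v$ have this form, and everything they have in common is
  proved for it. Only the symbols that occur in \<open>p\<close> contribute to the sum.\<close>

definition vfield :: "(bit \<Rightarrow> sym \<Rightarrow> 'f::field spoly) \<Rightarrow> 'f spoly \<Rightarrow> 'f spoly" where
  "vfield c p = Sum_any (\<lambda>(i, w). c i w \<odot> sp_partial i w p)"

lemma vfield_finite: "finite {x. (case x of (i, w) \<Rightarrow> c i w \<odot> sp_partial i w p) \<noteq> 0}"
  by (rule finite_subset[OF _ sp_partial_support[of p]]) auto

lemma vfield_superset:
  assumes "finite B" "\<And>i w. sp_partial i w p \<noteq> 0 \<Longrightarrow> (i, w) \<in> B"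
  shows "vfield c p = (\<Sum>(i, w)\<in>B. c i w \<odot> sp_partial i w p)"
  unfolding vfield_def
  by (rule Sum_any.expand_superset[OF assms(1)]) (use assms(2) in force)

lemma ddx_vfield: "ddx = vfield (\<lambda>i (j1, j2, m). U i (j1, j2, Suc m))"
  by (rule ext) (simp add: ddx_def vfield_def case_prod_beta)

lemma evo_vfield: "evo v = vfield (\<lambda>i (j1, j2, m). (ddx ^^ m) (Poly_Mapping.lookup (v j2) (i, j1)))"
  by (rule ext) (simp add: evo_def vfield_def case_prod_beta)

lemma vfield_add: "vfield c (p + q) = vfield c p + vfield c q"
  unfolding vfield_def
  by (subst Sum_any.distrib[OF vfield_finite vfield_finite, symmetric])
     (auto intro!: Sum_any.cong simp: sp_partial_add sp_mult_add_right)

lemma vfield_scl: "vfield c (scl b p) = scl b (vfield c p)"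
  unfolding vfield_def
  by (subst scl_Sum_any[OF vfield_finite])
     (auto intro!: Sum_any.cong simp: sp_partial_scl sp_mult_scl_right)

lemma vfield_add_coeff: "vfield (\<lambda>i w. c i w + d i w) p = vfield c p + vfield d p"
  unfolding vfield_def
  by (subst Sum_any.distrib[OF vfield_finite vfield_finite, symmetric])
     (auto intro!: Sum_any.cong simp: sp_mult_add_left)

lemma vfield_scl_coeff: "vfield (\<lambda>i w. scl b (c i w)) p = scl b (vfield c p)"
  unfolding vfield_def
  by (subst scl_Sum_any[OF vfield_finite])
     (auto intro!: Sum_any.cong simp: sp_mult_scl_left)

text \<open>A vector field of parity \<open>k\<close> has coefficients of parity
  \<open>k + i\<close> in front of derivatives of parity \<open>i\<close>. Moving the coefficient
  past \<open>p\<close> turns the sign of the partial derivative into that of the vector field.\<close>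

lemma superderivation_vfield:
  assumes c: "\<And>i w. sp_hom (k + i) (c i w)"
  shows "superderivation k (vfield c)"
  unfolding superderivation_def
proof (intro conjI allI impI)
  fix j and p q :: "'a spoly" assume p: "sp_hom j p"
  define B where "B = {(i, w). sp_partial i w p \<noteq> 0} \<union> {(i, w). sp_partial i w q \<noteq> 0} \<union>
    {(i, w). sp_partial i w (p \<odot> q) \<noteq> 0}"
  have B: "finite B" unfolding B_def by (intro finite_UnI sp_partial_support)
  have "vfield c (p \<odot> q) = (\<Sum>(i, w)\<in>B. c i w \<odot> sp_partial i w (p \<odot> q))"
    by (rule vfield_superset[OF B]) (auto simp: B_def)
  also have "\<dots> = (\<Sum>(i, w)\<in>B. (c i w \<odot> sp_partial i w p) \<odot> q +
      scl (psign (k * j)) (p \<odot> (c i w \<odot> sp_partial i w q)))"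
  proof (rule sum.cong[OF refl], clarify)
    fix i w
    have "c i w \<odot> p = scl (psign ((k + i) * j)) (p \<odot> c i w)"
      by (rule sp_mult_supercomm[OF c p])
    then have "c i w \<odot> (p \<odot> sp_partial i w q) = scl (psign ((k + i) * j)) (p \<odot> (c i w \<odot> sp_partial i w q))"
      by (simp add: sp_mult_assoc[symmetric] sp_mult_scl_left)
    moreover have "psign (i * j) * psign (k * j + i * j) = (psign (k * j) :: 'a)"
      by (simp add: psign_add mult.left_commute)
    ultimately show "c i w \<odot> sp_partial i w (p \<odot> q) = (c i w \<odot> sp_partial i w p) \<odot> q +
      scl (psign (k * j)) (p \<odot> (c i w \<odot> sp_partial i w q))"
      using superderivation_partial[of i w, where 'a = 'a] p
      by (simp add: superderivation_def sp_mult_add_right sp_mult_scl_right sp_mult_assoc scl_scl distrib_right)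
  qed
  also have "\<dots> = vfield c p \<odot> q + scl (psign (k * j)) (p \<odot> vfield c q)"
    by (subst (1 2) vfield_superset[OF B])
       (auto simp: B_def sum.distrib case_prod_unfold sp_mult_sum_left sp_mult_sum_right scl_sum)
  finally show "vfield c (p \<odot> q) = vfield c p \<odot> q + scl (psign (k * j)) (p \<odot> vfield c q)" .
qed (simp_all add: vfield_add vfield_scl)

lemma sp_hom_vfield:
  assumes c: "\<And>i w. sp_hom (k + i) (c i w)" and p: "sp_hom j p"
  shows "sp_hom (k + j) (vfield c p)"
proof -
  have "sp_hom (k + j) (c i w \<odot> sp_partial i w p)" for i w
    using sp_hom_mult[OF c[of i w] sp_hom_partial[OF p, of i w]]
    by (simp add: add.assoc)
  then show ?thesis unfolding vfield_def Sum_any.expand_set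
    by (intro sp_hom_sum) auto
qed

lemma sp_partial_U: "sp_partial i w (U j t) = (if i = j \<and> w = t then sp_const 1 else 0)"
  using bit_cases2[of i] bit_cases2[of j]
  by (auto simp: U_def sp_partial_def lin_ext_single sp_const_def mono_partial_1 mono_partial_0 dsign_def
      simp del: mono_partial.simps)

lemma partial_const [simp]: "sp_partial i w (sp_const a) = 0"
  using bit_cases2[of i]
  by (auto simp: sp_const_def sp_partial_def lin_ext_single mono_partial_0 mono_partial_1 dsign_def
      simp del: mono_partial.simps)

lemma vfield_const [simp]: "vfield c (sp_const a) = 0"
  by (simp add: vfield_def)

lemma ddx_const [simp]: "ddx (sp_const a) = 0"
  by (simp add: ddx_vfield)

lemma vfield_U: "vfield c (U i w) = c i w"
  by (subst vfield_superset[of "{(i, w)}"]) (auto simp: sp_partial_U split: if_splits)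

text \<open>The symbols generate the algebra, so the kernel of a superderivation that contains
  them is everything.\<close>

lemma superderivation_zero_imp:
  fixes d :: "'f::field_char_0 spoly \<Rightarrow> 'f spoly"
  assumes d: "superderivation k d" and U0: "\<And>i w. d (U i w) = 0"
  shows "d p = 0"
proof -
  have add: "d (p + q) = d p + d q" and scl: "d (scl c p) = scl c (d p)" for p q c
    using d by (simp_all add: superderivation_def)
  have prod: "d (p \<odot> q) = d p \<odot> q + scl (psign (k * i)) (p \<odot> d q)" if "sp_hom i p" for i p q
    using d that by (simp add: superderivation_def)
  have "d (sp_const 1) + d (sp_const 1) = d (sp_const 1)"
    using prod[of 0 "sp_const 1" "sp_const 1"] by simp
  then have one: "d (mon ({#}, {||})) = 0" by (simp add: sp_const_def)
  have odd: "d (mon ({#}, S)) = 0" for S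
  proof (induction S)
    case (insert w S)
    have "U 1 w \<odot> mon ({#}, S) = (scl (msign {|w|} S) (mon ({#}, finsert w S)) :: 'f spoly)"
      by (simp add: U_def mon_mult)
    moreover have "msign {|w|} S * msign {|w|} S = (1 :: 'f)"
      using insert prod_swap_sign_sq[of w "fset S", where 'f = 'f] by (simp add: msign_def)
    ultimately have "mon ({#}, finsert w S) = scl (msign {|w|} S) (U 1 w \<odot> mon ({#}, S) :: 'f spoly)"
      by (simp add: scl_scl)
    then show ?case using prod[of 1 "U 1 w" "mon ({#}, S)"] insert by (simp add: scl U0)
  qed (rule one)
  have mons: "d (mon (a, S)) = 0" for a S
  proof (induction a)
    case (add w a)
    have "mon (add_mset w a, S) = (U 0 w \<odot> mon (a, S) :: 'f spoly)"
      by (simp add: U_def mon_mult msign_def)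
    then show ?case using prod[of 0 "U 0 w" "mon (a, S)"] add by (simp add: U0)
  qed (rule odd)
  show ?thesis
    by (rule spoly_linear_eqI[where g = "\<lambda>p. 0"]) (simp_all add: add scl, metis mons prod.exhaust)
qed

lemma superderivation_eqI:
  fixes d d' :: "'f::field_char_0 spoly \<Rightarrow> 'f spoly"
  assumes "superderivation k d" "superderivation k d'" "\<And>i w. d (U i w) = d' (U i w)"
  shows "d p = d' p"
proof -
  have "superderivation k (\<lambda>p. d p - d' p)"
    using assms(1,2) by (auto simp: superderivation_def sp_mult_diff_left sp_mult_diff_right scl_diff algebra_simps)
  from superderivation_zero_imp[OF this, of p] show ?thesis by (simp add: assms(3))
qed

text \<open>The mixed terms $d(p)\,d'(q)$ cancel in the supercommutator, as in the ungraded case.\<close>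

lemma superderivation_commutator:
  assumes d: "superderivation k d" and d': "superderivation l d'"
    and hom: "\<And>i p. sp_hom i p \<Longrightarrow> sp_hom (k + i) (d p)"  "\<And>i p. sp_hom i p \<Longrightarrow> sp_hom (l + i) (d' p)"
  shows "superderivation (k + l) (\<lambda>p. d (d' p) - scl (psign (k * l)) (d' (d p)))"
  unfolding superderivation_def
proof (intro conjI allI impI)
  fix i and p q :: "'a spoly" assume p: "sp_hom i p"
  have add: "d (p + q) = d p + d q" "d (scl c p) = scl c (d p)"
     "d' (p + q) = d' p + d' q" "d' (scl c p) = scl c (d' p)" for p q c
    using d d' by (simp_all add: superderivation_def)
  have prod: "d (p \<odot> q) = d p \<odot> q + scl (psign (k * i)) (p \<odot> d q)"
    "d' (p \<odot> q) = d' p \<odot> q + scl (psign (l * i)) (p \<odot> d' q)" if "sp_hom i p" for i p q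
    using d d' that by (simp_all add: superderivation_def)
  show "d (d' (p \<odot> q)) - scl (psign (k * l)) (d' (d (p \<odot> q))) =
    (d (d' p) - scl (psign (k * l)) (d' (d p))) \<odot> q +
    scl (psign ((k + l) * i)) (p \<odot> (d (d' q) - scl (psign (k * l)) (d' (d q))))"
    using bit_cases2[of i] bit_cases2[of k] bit_cases2[of l]
    by (auto simp: add prod[OF p] prod[OF hom(1)[OF p]] prod[OF hom(2)[OF p]]
      sp_mult_diff_left sp_mult_diff_right sp_mult_scl_left sp_mult_scl_right scl_add scl_diff scl_scl algebra_simps)
qed (use d d' in \<open>simp_all add: superderivation_def scl_add scl_diff scl_scl algebra_simps\<close>)

lemma sp_hom_ddx: "sp_hom i p \<Longrightarrow> sp_hom i (ddx p)"
proof -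
  have "sp_hom (0 + i) (case w of (j1, j2, m) \<Rightarrow> U i (j1, j2, Suc m))" for i w
    by (cases w) simp
  from sp_hom_vfield[OF this, of i p] show "sp_hom i p \<Longrightarrow> sp_hom i (ddx p)" by (simp add: ddx_vfield)
qed

lemma superderivation_ddx: "superderivation 0 (ddx :: 'f::field_char_0 spoly \<Rightarrow> _)"
proof -
  have "sp_hom (0 + i) (case w of (j1, j2, m) \<Rightarrow> U i (j1, j2, Suc m))" for i w
    by (cases w) simp
  from superderivation_vfield[OF this] show ?thesis by (simp add: ddx_vfield)
qed

lemma ddx_mult: "ddx (p \<odot> q) = ddx p \<odot> q + p \<odot> (ddx q :: 'f::field_char_0 spoly)"
proof -
  have "ddx (sp_part i p \<odot> q) = ddx (sp_part i p) \<odot> q + sp_part i p \<odot> ddx q" for i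
    using superderivation_ddx[where 'f = 'f] by (auto simp: superderivation_def) (metis scl_one sp_hom_sp_part)
  then show ?thesis
    by - (rule sp_hom_cases[where f = "\<lambda>p. ddx (p \<odot> q)"], simp_all add: sp_mult_add_left ddx_add algebra_simps)
qed

lemma ddx_U: "ddx (U i (j1, j2, m)) = U i (j1, j2, Suc m)"
  by (simp add: ddx_vfield vfield_U)

lemma sp_hom_ddx_pow: "sp_hom i p \<Longrightarrow> sp_hom i ((ddx ^^ m) p)"
  by (induction m) (auto intro: sp_hom_ddx)

lemma ddx_pow_add: "(ddx ^^ m) (p + q) = (ddx ^^ m) p + (ddx ^^ m) q"
  by (induction m) (simp_all add: ddx_add)

lemma ddx_pow_scl: "(ddx ^^ m) (scl c p) = scl c ((ddx ^^ m) p)"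
  by (induction m) (simp_all add: ddx_scl)

lemma ddx_pow_zero [simp]: "(ddx ^^ m) 0 = 0"
  by (induction m) simp_all

lemma sp_part_ddx: "sp_part i (ddx p) = ddx (sp_part i p)"
  by (rule sp_hom_cases[where f = "\<lambda>p. sp_part i (ddx p)"])
     (simp_all add: sp_part_add ddx_add sp_part_hom[OF sp_hom_ddx[OF sp_hom_sp_part]] sp_part_hom[OF sp_hom_sp_part])

section \<open>Evolutionary vector fields\<close>

text \<open>The basis element $\varsigma_{i,j}$ itself has parity \<open>i\<close>, which shifts
  the parity of its coefficient.\<close>

definition evo_hom :: "bit \<Rightarrow> 'f::field psdo \<Rightarrow> bool" where
  "evo_hom k v \<longleftrightarrow> (\<forall>i j1 j2. sp_hom (k + i) (Poly_Mapping.lookup (v j2) (i, j1)))"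

lemma evo_coeff_hom:
  "evo_hom k v \<Longrightarrow> sp_hom (k + i) (case w of (j1, j2, m) \<Rightarrow> (ddx ^^ m) (Poly_Mapping.lookup (v j2) (i, j1)))"
  by (cases w) (simp add: evo_hom_def sp_hom_ddx_pow)

lemma evo_add: "evo v (p + q) = evo v p + evo v q"
  by (simp add: evo_vfield vfield_add)

lemma evo_scl: "evo v (scl c p) = scl c (evo v p)"
  by (simp add: evo_vfield vfield_scl)

lemma evo_zero [simp]: "evo v 0 = 0"
  using evo_scl[of v 0 0] by simp

lemma evo_add_left: "evo (v + w) p = evo v p + evo w p"
  unfolding evo_vfield vfield_add_coeff[symmetric]
  by (rule arg_cong[where f = "\<lambda>c. vfield c p"]) (auto simp: fun_eq_iff lookup_add ddx_pow_add)

lemma evo_scl_left: "evo (d_scl c v) p = scl c (evo v p)"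
  unfolding evo_vfield vfield_scl_coeff[symmetric]
  by (rule arg_cong[where f = "\<lambda>c. vfield c p"]) (auto simp: fun_eq_iff d_scl_def ddx_pow_scl)

lemma superderivation_evo: "evo_hom k v \<Longrightarrow> superderivation k (evo v)"
  unfolding evo_vfield by (rule superderivation_vfield[OF evo_coeff_hom])

lemma sp_hom_evo: "evo_hom k v \<Longrightarrow> sp_hom j p \<Longrightarrow> sp_hom (k + j) (evo v p)"
  unfolding evo_vfield by (rule sp_hom_vfield[OF evo_coeff_hom])

lemma evo_mult:
  "evo_hom k v \<Longrightarrow> sp_hom i p \<Longrightarrow> evo v (p \<odot> q) = evo v p \<odot> q + scl (psign (k * i)) (p \<odot> evo v q)"
  using superderivation_evo[of k v] by (simp add: superderivation_def)

lemma evo_U: "evo v (U i (j1, j2, m)) = (ddx ^^ m) (Poly_Mapping.lookup (v j2) (i, j1))"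
  by (simp add: evo_vfield vfield_U)

text \<open>The commutator of the two superderivations is a superderivation, and it vanishes on
  the symbols because $\partial_v(u^{(m)})=\partial^m(\partial_vu)$ by definition.\<close>

lemma evo_ddx:
  fixes v :: "'f::field_char_0 psdo"
  assumes v: "evo_hom k v"
  shows "evo v (ddx p) = ddx (evo v p)"
proof -
  have "superderivation (k + 0) (\<lambda>p. evo v (ddx p) - scl (psign (k * 0)) (ddx (evo v p)))"
    by (rule superderivation_commutator[OF superderivation_evo[OF v] superderivation_ddx])
       (auto intro: sp_hom_evo[OF v] sp_hom_ddx)
  moreover have "evo v (ddx (U i w)) - scl (psign (k * 0)) (ddx (evo v (U i w))) = 0" for i w
    by (cases w) (simp add: ddx_U evo_U)
  ultimately have "evo v (ddx p) - scl (psign (k * 0)) (ddx (evo v p)) = 0"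
    by (rule superderivation_zero_imp)
  then show ?thesis by simp
qed

text \<open>Basis elements are indexed by \<open>{1..k}\<close>; the range should not be rewritten
  to \<open>{Suc 0..k}\<close>.\<close>

declare One_nat_def [simp del]

section \<open>Polynomials in the admissible symbols\<close>

lemma spoly_on_zero [simp]: "0 \<in> spoly_on I"
  by (simp add: spoly_on_def)

lemma spoly_on_add: "p \<in> spoly_on I \<Longrightarrow> q \<in> spoly_on I \<Longrightarrow> p + q \<in> spoly_on I"
  using keys_add[of p q] by (auto simp: spoly_on_def)

lemma spoly_on_scl: "p \<in> spoly_on I \<Longrightarrow> scl c p \<in> spoly_on I"
  using keys_scl[of c p] by (auto simp: spoly_on_def)

lemma spoly_on_sum: "(\<And>x. x \<in> B \<Longrightarrow> f x \<in> spoly_on I) \<Longrightarrow> sum f B \<in> spoly_on I"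
  by (induction B rule: infinite_finite_induct) (auto intro: spoly_on_add)

lemma spoly_on_Sum_any: "(\<And>x. f x \<in> spoly_on I) \<Longrightarrow> Sum_any f \<in> spoly_on I"
  unfolding Sum_any.expand_set by (rule spoly_on_sum)

lemma spoly_on_mon: "s \<in> monos_on I \<Longrightarrow> mon s \<in> spoly_on I"
  by (simp add: spoly_on_def)

lemma spoly_on_const [simp]: "sp_const c \<in> spoly_on I"
  by (simp add: spoly_on_def sp_const_def monos_on_def)

lemma spoly_on_U: "(j1, j2) \<in> I i \<Longrightarrow> U i (j1, j2, m) \<in> spoly_on I"
  using bit_cases2[of i] by (auto simp: U_def monos_on_def intro: spoly_on_mon)

lemma spoly_on_mult:
  assumes "p \<in> spoly_on I" "q \<in> spoly_on I" shows "p \<odot> q \<in> spoly_on I"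
proof -
  have "scl c (mon s) \<odot> scl d (mon t) \<in> (spoly_on I :: 'a spoly set)"
    if "s \<in> Poly_Mapping.keys p" "t \<in> Poly_Mapping.keys q" for c d s t
  proof -
    obtain a S b T where st: "s = (a, S)" "t = (b, T)" by (metis prod.exhaust)
    have "s \<in> monos_on I" "t \<in> monos_on I" using assms that by (auto simp: spoly_on_def)
    then have "(a + b, S |\<union>| T) \<in> monos_on I" by (auto simp: st monos_on_def)
    then show ?thesis
      by (simp add: st sp_mult_scl_left sp_mult_scl_right mon_mult spoly_on_scl spoly_on_mon)
  qed
  then have "(\<Sum>s\<in>Poly_Mapping.keys p. scl (Poly_Mapping.lookup p s) (mon s)) \<odot>
      (\<Sum>t\<in>Poly_Mapping.keys q. scl (Poly_Mapping.lookup q t) (mon t)) \<in> spoly_on I"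
    unfolding sp_mult_sum_left sp_mult_sum_right by (intro spoly_on_sum)
  then show ?thesis by (simp only: spoly_decomp[symmetric])
qed

lemma spoly_on_partial:
  assumes "p \<in> spoly_on I" shows "sp_partial i w p \<in> spoly_on I"
proof -
  have "sp_partial i w (mon s) \<in> (spoly_on I :: 'a spoly set)" if "s \<in> Poly_Mapping.keys p" for s
  proof -
    obtain a S where s: "s = (a, S)" by (cases s)
    have "(a, S) \<in> monos_on I" using assms that by (auto simp: spoly_on_def s)
    then have "(a - {#w#}, S) \<in> monos_on I" "(a, S |-| {|w|}) \<in> monos_on I"
      by (auto simp: monos_on_def dest: in_diffD)
    then show ?thesis using bit_cases2[of i]
      by (auto simp: s sp_partial_def lin_ext_single mono_partial_0 mono_partial_1
        simp del: mono_partial.simps intro!: spoly_on_scl spoly_on_mon)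
  qed
  then have "sp_partial i w (\<Sum>s\<in>Poly_Mapping.keys p. scl (Poly_Mapping.lookup p s) (mon s)) \<in> spoly_on I"
    unfolding additive_sum[of "sp_partial i w", OF sp_partial_add] sp_partial_scl
    by (intro spoly_on_sum spoly_on_scl)
  then show ?thesis by (simp only: spoly_decomp[symmetric])
qed

lemma spoly_on_ddx: "p \<in> spoly_on I \<Longrightarrow> ddx p \<in> spoly_on I"
  unfolding spoly_on_def mem_Collect_eq
proof
  fix t assume p: "Poly_Mapping.keys p \<subseteq> monos_on I" and t: "t \<in> Poly_Mapping.keys (ddx p)"
  show "t \<in> monos_on I"
    by (rule ddx_keys[OF t, of I]) (use p in blast)
qed

lemma spoly_on_ddx_pow: "p \<in> spoly_on I \<Longrightarrow> (ddx ^^ m) p \<in> spoly_on I"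
  by (induction m) (auto intro: spoly_on_ddx)

lemma spoly_on_sp_part: "p \<in> spoly_on I \<Longrightarrow> sp_part i p \<in> spoly_on I"
  by (auto simp: spoly_on_def in_keys_iff lookup_sp_part split: if_splits)

lemma spoly_on_evo:
  assumes "\<And>i j1 j2. Poly_Mapping.lookup (v j2) (i, j1) \<in> spoly_on I" "p \<in> spoly_on I"
  shows "evo v p \<in> spoly_on I"
  unfolding evo_vfield vfield_def
proof (rule spoly_on_Sum_any)
  fix x :: "bit \<times> sym"
  obtain i j1 j2 m where x: "x = (i, j1, j2, m)" by (rule prod_cases4)
  show "(case x of (i, w) \<Rightarrow> (case w of (j1, j2, m) \<Rightarrow>
      (ddx ^^ m) (Poly_Mapping.lookup (v j2) (i, j1))) \<odot> sp_partial i w p) \<in> spoly_on I"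
    unfolding x prod.case by (intro spoly_on_mult spoly_on_ddx_pow spoly_on_partial assms)
qed

section \<open>The free module\<close>

lemma lookup_ah_lmult [simp]: "Poly_Mapping.lookup (ah_lmult f \<phi>) x = f \<odot> Poly_Mapping.lookup \<phi> x"
  by (simp add: ah_lmult_def Poly_Mapping.map.rep_eq when_def)

lemma lookup_ah_part: "Poly_Mapping.lookup (ah_part i \<phi>) (j, l) = sp_part (i + j) (Poly_Mapping.lookup \<phi> (j, l))"
  by (simp add: ah_part_def lookup_mapp when_def in_keys_iff)

definition ah_evo :: "'f::field psdo \<Rightarrow> 'f ahat \<Rightarrow> 'f ahat" where
  "ah_evo v \<phi> = Poly_Mapping.map (evo v) \<phi>"

lemma lookup_ah_evo [simp]: "Poly_Mapping.lookup (ah_evo v \<phi>) x = evo v (Poly_Mapping.lookup \<phi> x)"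
  by (simp add: ah_evo_def Poly_Mapping.map.rep_eq when_def)

lemma evo_d_eq: "evo_d v w = (\<lambda>l. ah_evo v (w l))"
  by (simp add: evo_d_def ah_evo_def)

lemma ah_ddx_add: "ah_ddx (\<phi> + \<psi>) = ah_ddx \<phi> + ah_ddx \<psi>"
  by (rule poly_mapping_eqI) (simp add: lookup_add ddx_add)

lemma ah_ddx_scl: "ah_ddx (ah_scl c \<phi>) = ah_scl c (ah_ddx \<phi>)"
  by (rule poly_mapping_eqI) (simp add: ddx_scl)

lemma ah_ddx_zero [simp]: "ah_ddx 0 = 0"
  by (rule poly_mapping_eqI) simp

lemma ah_ddx_pow_add: "(ah_ddx ^^ p) (\<phi> + \<psi>) = (ah_ddx ^^ p) \<phi> + (ah_ddx ^^ p) \<psi>"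
  by (induction p) (simp_all add: ah_ddx_add)

lemma ah_evo_add: "ah_evo v (\<phi> + \<psi>) = ah_evo v \<phi> + ah_evo v \<psi>"
  by (rule poly_mapping_eqI) (simp add: lookup_add evo_add)

lemma ah_evo_scl: "ah_evo v (ah_scl c \<phi>) = ah_scl c (ah_evo v \<phi>)"
  by (rule poly_mapping_eqI) (simp add: evo_scl)

lemma ah_evo_zero [simp]: "ah_evo v 0 = 0"
  by (rule poly_mapping_eqI) simp

lemma ah_evo_add_left: "ah_evo (v + w) \<phi> = ah_evo v \<phi> + ah_evo w \<phi>"
  by (rule poly_mapping_eqI) (simp add: lookup_add evo_add_left)

lemma ah_evo_scl_left: "ah_evo (d_scl c v) \<phi> = ah_scl c (ah_evo v \<phi>)"
  by (rule poly_mapping_eqI) (simp add: evo_scl_left)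

lemma ah_scl_add: "ah_scl c (\<phi> + \<psi>) = ah_scl c \<phi> + ah_scl c \<psi>"
  by (rule poly_mapping_eqI) (simp add: lookup_add scl_add)

lemma ah_scl_add_left: "ah_scl (c + d) \<phi> = ah_scl c \<phi> + ah_scl d \<phi>"
  by (rule poly_mapping_eqI) (simp add: lookup_add scl_add_left)

lemma ah_scl_uminus_one: "ah_scl (- 1) \<phi> = - \<phi>"
  by (rule poly_mapping_eqI) simp

lemma keysum_superset:
  assumes "finite S" "Poly_Mapping.keys \<phi> \<subseteq> S" "\<And>x. F x 0 = (0::'b::comm_monoid_add)"
  shows "(\<Sum>x\<in>Poly_Mapping.keys \<phi>. F x (Poly_Mapping.lookup \<phi> x)) = (\<Sum>x\<in>S. F x (Poly_Mapping.lookup \<phi> x))"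
  by (rule sum.mono_neutral_left) (use assms in \<open>auto simp: in_keys_iff\<close>)

text \<open>The support of \<open>\<phi> + \<psi>\<close> can be smaller than the union of the
  supports. Additivity of the summand makes the missing terms zero. This is what makes the product
  and the form biadditive.\<close>

lemma keysum_add:
  assumes "\<And>x f g. F x (f + g) = F x f + (F x g :: 'b::ab_group_add)"
  shows "(\<Sum>x\<in>Poly_Mapping.keys (\<phi> + \<psi>). F x (Poly_Mapping.lookup (\<phi> + \<psi>) x)) =
    (\<Sum>x\<in>Poly_Mapping.keys \<phi>. F x (Poly_Mapping.lookup \<phi> x)) +
    (\<Sum>x\<in>Poly_Mapping.keys \<psi>. F x (Poly_Mapping.lookup \<psi> x))"
proof -
  have z: "F x 0 = 0" for x using assms[of x 0 0] by simp
  let ?S = "Poly_Mapping.keys \<phi> \<union> Poly_Mapping.keys \<psi>"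
  show ?thesis
    using keysum_superset[of ?S "\<phi> + \<psi>" F] keysum_superset[of ?S \<phi> F] keysum_superset[of ?S \<psi> F]
      keys_add[of \<phi> \<psi>] z
    by (simp add: lookup_add assms sum.distrib)
qed

context kp_superalgebra
begin

definition hom_basis :: "'a set" where
  "hom_basis = (\<Union>j. e j ` {1..dim (A j)})"

lemma hom_basis_eq: "hom_basis = e 0 ` {1..dim (A 0)} \<union> e 1 ` {1..dim (A 1)}"
proof -
  have "(UNIV :: bit set) = {0, 1}" using bit_cases2 by auto
  have "hom_basis = (\<Union>j\<in>{0, 1}. e j ` {1..dim (A j)})"
    unfolding hom_basis_def \<open>UNIV = {0, 1}\<close> ..
  then show ?thesis by simp
qed

lemma e_in_A: "l \<in> {1..dim (A i)} \<Longrightarrow> e i l \<in> A i"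
  using basis_span[of i] span_base by blast

lemma A_0 [simp]: "0 \<in> A i"
  using A_subspace subspace_0 by blast

lemma A_add: "x \<in> A i \<Longrightarrow> y \<in> A i \<Longrightarrow> x + y \<in> A i"
  using A_subspace subspace_add by blast

lemma A_scale: "x \<in> A i \<Longrightarrow> sA c x \<in> A i"
  using A_subspace subspace_scale by blast

lemma A_sum_closed: "(\<And>x. x \<in> B \<Longrightarrow> f x \<in> A i) \<Longrightarrow> sum f B \<in> A i"
  using A_subspace subspace_sum by blast

lemma A_unique: "x \<in> A i \<Longrightarrow> x \<in> A j \<Longrightarrow> i \<noteq> j \<Longrightarrow> x = 0"
  using A_direct bit_cases2[of i] bit_cases2[of j] by auto

lemma e_eq_iff:
  assumes "l \<in> {1..dim (A i)}" "k \<in> {1..dim (A j)}"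
  shows "e i l = e j k \<longleftrightarrow> i = j \<and> l = k"
proof
  assume eq: "e i l = e j k"
  have "e i l \<noteq> 0"
  proof
    assume "e i l = 0"
    then have "0 \<in> e i ` {1..dim (A i)}" using assms(1) by (metis imageI)
    then show False using basis_independent[of i] dependent_zero by blast
  qed
  moreover have "e i l \<in> A i" "e i l \<in> A j" using e_in_A[OF assms(1)] e_in_A[OF assms(2)] eq by simp_all
  ultimately have ij: "i = j" using A_unique by blast
  then have "l = k" using inj_onD[OF basis_inj[of i], of l k] eq assms by simp
  with ij show "i = j \<and> l = k" by simp
qed simp

lemma hom_basis_independent: "independent hom_basis"
  unfolding independent_explicit_module
proof (intro allI impI)
  fix t u v assume t: "finite t" "t \<subseteq> hom_basis" "(\<Sum>v\<in>t. sA (u v) v) = 0" "v \<in> t"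
  let ?E = "\<lambda>i. e i ` {1..dim (A i)}"
  let ?s = "\<lambda>i. \<Sum>v\<in>t \<inter> ?E i. sA (u v) v"
  have sA: "?s i \<in> A i" for i
    by (rule A_sum_closed) (auto intro!: A_scale e_in_A)
  have dis: "?E 0 \<inter> ?E 1 = {}"
    unfolding disjoint_iff image_iff by (metis e_eq_iff zero_neq_one)
  have t_eq: "(t \<inter> ?E 0) \<union> (t \<inter> ?E 1) = t" using t(2) hom_basis_eq by blast
  have "sum (\<lambda>v. sA (u v) v) ((t \<inter> ?E 0) \<union> (t \<inter> ?E 1)) = ?s 0 + ?s 1"
    by (rule sum.union_disjoint) (use dis t(1) in blast)+
  then have "(\<Sum>v\<in>t. sA (u v) v) = ?s 0 + ?s 1" unfolding t_eq .
  then have eq: "?s 0 = - ?s 1" using t(3) by (simp add: eq_neg_iff_add_eq_0)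
  have "- ?s 1 \<in> A 1" using sA[of 1] A_subspace subspace_neg by blast
  then have z: "?s 0 = 0" "?s 1 = 0" using eq sA[of 0] A_unique[of "?s 0" 0 1] by auto
  have "v \<in> ?E 0 \<or> v \<in> ?E 1" using t(2,4) hom_basis_eq by blast
  then obtain i where i: "v \<in> ?E i" "?s i = 0" using z by blast
  have "finite (t \<inter> ?E i)" "t \<inter> ?E i \<subseteq> ?E i" "v \<in> t \<inter> ?E i" using t i by blast+
  with i(2) show "u v = 0"
    using basis_independent[of i, unfolded independent_explicit_module, rule_format, of "t \<inter> ?E i" u v] by simp
qed

lemma hom_basis_span: "span hom_basis = UNIV"
proof -
  have "x \<in> span hom_basis" for x
  proof -
    obtain y z where yz: "y \<in> A 0" "z \<in> A 1" "x = y + z" using A_sum by blast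
    have "A i \<subseteq> span hom_basis" for i
      using span_mono[of "e i ` {1..dim (A i)}" hom_basis] unfolding basis_span[of i] by (auto simp: hom_basis_def)
    then have "y \<in> span hom_basis" "z \<in> span hom_basis" using yz(1,2) by blast+
    then show ?thesis unfolding yz(3) by (rule span_add)
  qed
  then show ?thesis by blast
qed

text \<open>Coordinates outside the range of the basis are set to zero, because
  \<open>e i l\<close> is arbitrary there.\<close>

definition coord :: "'a \<Rightarrow> bit \<Rightarrow> nat \<Rightarrow> 'f" where
  "coord a i l = (if l \<in> {1..dim (A i)} then representation hom_basis a (e i l) else 0)"

lemma coord_add: "coord (a + b) i l = coord a i l + coord b i l"
  by (simp add: coord_def representation_add[OF hom_basis_independent] hom_basis_span)

lemma coord_scale: "coord (sA c a) i l = c * coord a i l"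
  by (simp add: coord_def representation_scale[OF hom_basis_independent] hom_basis_span)

lemma coord_e: "k \<in> {1..dim (A j)} \<Longrightarrow> coord (e j k) i l = (if i = j \<and> l = k then 1 else 0)"
proof -
  assume k: "k \<in> {1..dim (A j)}"
  then have "e j k \<in> hom_basis" unfolding hom_basis_def by blast
  then show ?thesis using e_eq_iff[of l i k j] k
    by (auto simp: coord_def representation_basis[OF hom_basis_independent])
qed

lemma coord_parity: "a \<in> A i \<Longrightarrow> i \<noteq> j \<Longrightarrow> coord a j l = 0"
proof -
  assume a: "a \<in> A i" and ij: "i \<noteq> j"
  have "representation hom_basis a = representation (e i ` {1..dim (A i)}) a"
    by (rule representation_extend[OF hom_basis_independent]) (use a basis_span in \<open>auto simp: hom_basis_def\<close>)
  moreover have "l \<in> {1..dim (A j)} \<Longrightarrow> e j l \<notin> e i ` {1..dim (A i)}"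
    unfolding image_iff using e_eq_iff ij by blast
  ultimately show ?thesis using representation_ne_zero[of "e i ` {1..dim (A i)}" a] by (auto simp: coord_def)
qed

lemma sum_idx:
  "(\<Sum>b\<in>hom_basis. F b) = (\<Sum>i\<in>{0, 1}. \<Sum>l = 1..dim (A i). F (e i l))"
proof -
  have "e 0 ` {1..dim (A 0)} \<inter> e 1 ` {1..dim (A 1)} = {}"
    unfolding disjoint_iff image_iff by (metis e_eq_iff zero_neq_one)
  then show ?thesis unfolding hom_basis_eq
    by (simp add: sum.union_disjoint sum.reindex[OF basis_inj])
qed

lemma coord_sum: "(\<Sum>i\<in>{0, 1}. \<Sum>l = 1..dim (A i). sA (coord a i l) (e i l)) = a"
proof -
  have "finite hom_basis" by (simp add: hom_basis_eq)
  then have "(\<Sum>b\<in>hom_basis. sA (representation hom_basis a b) b) = a"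
    using sum_representation_eq[OF hom_basis_independent, of a hom_basis] by (simp add: hom_basis_span)
  then show ?thesis unfolding sum_idx by (simp add: coord_def)
qed

lemma lookup_emb: "Poly_Mapping.lookup (emb a) (i, l) = sp_const (coord a i l)"
proof -
  have "(\<Sum>k = 1..dim (A i). Poly_Mapping.lookup (Poly_Mapping.single (i, k) (sp_const (representation hom_basis a (e i k)))) (i, l))
      = sp_const (coord a i l)"
    by (auto simp: lookup_single when_def coord_def sum.delta sp_const_def)
  moreover have "(\<Sum>k = 1..dim (A j). Poly_Mapping.lookup (Poly_Mapping.single (j, k) (sp_const (representation hom_basis a (e j k)))) (i, l))
      = 0" if "j \<noteq> i" for j
    using that by (simp add: lookup_single when_def)
  ultimately show ?thesis using bit_cases2[of i]
    by (auto simp: emb_def hom_basis_def[symmetric] lookup_add lookup_sum)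
qed

lemma sp_const_add: "sp_const (c + d) = sp_const c + sp_const d"
  by (simp add: sp_const_def single_add)

lemma emb_add: "emb (a + b) = emb a + emb b"
  by (rule poly_mapping_eqI, clarify) (simp add: lookup_emb lookup_add coord_add sp_const_add)

lemma sp_const_mult: "sp_const (c * d) = scl c (sp_const d)"
  by (rule poly_mapping_eqI) (simp add: sp_const_def lookup_single when_def)

lemma emb_scale: "emb (sA c a) = ah_scl c (emb a)"
  by (rule poly_mapping_eqI, clarify) (simp add: lookup_emb coord_scale sp_const_mult)

text \<open>\<open>tens f a\<close> is the element $f\otimes a$ of
  $\mathcal P\otimes\mathcal A=\hat{\mathcal A}$. Formulas for the product and the form stated for
  arbitrary homogeneous \<open>a\<close> avoid structure constants.\<close>

definition tens :: "'f spoly \<Rightarrow> 'a \<Rightarrow> 'f ahat" where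
  "tens f a = ah_lmult f (emb a)"

lemma lookup_tens: "Poly_Mapping.lookup (tens f a) (i, l) = scl (coord a i l) f"
  by (simp add: tens_def lookup_emb sp_const_right)

lemma tens_add_left: "tens (f + g) a = tens f a + tens g a"
  by (rule poly_mapping_eqI, clarify) (simp add: lookup_tens lookup_add scl_add)

lemma tens_add_right: "tens f (a + b) = tens f a + tens f b"
  by (rule poly_mapping_eqI, clarify) (simp add: lookup_tens lookup_add coord_add scl_add_left)

lemma tens_scl_left: "tens (scl c f) a = ah_scl c (tens f a)"
  by (rule poly_mapping_eqI, clarify) (simp add: lookup_tens scl_scl mult.commute)

lemma tens_scl_right: "tens f (sA c a) = ah_scl c (tens f a)"
  by (rule poly_mapping_eqI, clarify) (simp add: lookup_tens coord_scale scl_scl)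

lemma tens_zero [simp]: "tens 0 a = 0" "tens f 0 = 0"
  using tens_add_left[of 0 0 a] tens_add_right[of f 0 0] by simp_all

lemma tens_sum_right: "tens f (sum g B) = (\<Sum>x\<in>B. tens f (g x))"
  by (rule additive_sum) (rule tens_add_right)

lemma emb_tens: "emb a = tens (sp_const 1) a"
  by (rule poly_mapping_eqI, clarify) (simp add: lookup_tens lookup_emb sp_const_mult[symmetric])

lemma tens_e: "l \<in> {1..dim (A i)} \<Longrightarrow> tens f (e i l) = Poly_Mapping.single (i, l) f"
  by (rule poly_mapping_eqI, clarify) (auto simp: lookup_tens coord_e lookup_single when_def)

lemma ah_ddx_tens: "ah_ddx (tens f a) = tens (ddx f) a"
  by (rule poly_mapping_eqI, clarify) (simp add: lookup_tens ddx_scl)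

lemma ah_evo_tens: "ah_evo v (tens f a) = tens (evo v f) a"
  by (rule poly_mapping_eqI, clarify) (simp add: lookup_tens evo_scl)

lemma P_part_iff: "p \<in> P_part i \<longleftrightarrow> p \<in> P \<and> sp_hom i p"
  by (simp add: P_part_def sp_hom_def)

lemma P_zero [simp]: "0 \<in> P" by (simp add: P_def)
lemma P_const [simp]: "sp_const c \<in> P" by (simp add: P_def)
lemma P_add: "p \<in> P \<Longrightarrow> q \<in> P \<Longrightarrow> p + q \<in> P" by (simp add: P_def spoly_on_add)
lemma P_scl: "p \<in> P \<Longrightarrow> scl c p \<in> P" by (simp add: P_def spoly_on_scl)
lemma P_mult: "p \<in> P \<Longrightarrow> q \<in> P \<Longrightarrow> p \<odot> q \<in> P" by (simp add: P_def spoly_on_mult)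
lemma P_ddx: "p \<in> P \<Longrightarrow> ddx p \<in> P" by (simp add: P_def spoly_on_ddx)
lemma P_sp_part: "p \<in> P \<Longrightarrow> sp_part i p \<in> P" by (simp add: P_def spoly_on_sp_part)
lemma P_sum: "(\<And>x. x \<in> B \<Longrightarrow> f x \<in> P) \<Longrightarrow> sum f B \<in> P" by (simp add: P_def spoly_on_sum)

lemma P_part_intros:
  "0 \<in> P_part i" "p \<in> P_part i \<Longrightarrow> q \<in> P_part i \<Longrightarrow> p + q \<in> P_part i"
  "p \<in> P_part i \<Longrightarrow> scl c p \<in> P_part i" "p \<in> P_part i \<Longrightarrow> q \<in> P_part j \<Longrightarrow> p \<odot> q \<in> P_part (i + j)"
  "p \<in> P_part i \<Longrightarrow> ddx p \<in> P_part i" "p \<in> P \<Longrightarrow> sp_part i p \<in> P_part i" "sp_const c \<in> P_part 0"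
  by (auto simp: P_part_iff P_add P_scl P_mult P_ddx P_sp_part sp_hom_add sp_hom_scl sp_hom_mult sp_hom_ddx)

lemma P_part_sum: "(\<And>x. x \<in> B \<Longrightarrow> f x \<in> P_part i) \<Longrightarrow> sum f B \<in> P_part i"
  by (auto simp: P_part_iff intro: P_sum sp_hom_sum)

lemma Ah_partD: "\<phi> \<in> Ah_part i \<Longrightarrow> Poly_Mapping.lookup \<phi> (j, l) \<in> P_part (i + j)"
  "\<phi> \<in> Ah_part i \<Longrightarrow> l \<notin> {1..dim (A j)} \<Longrightarrow> Poly_Mapping.lookup \<phi> (j, l) = 0"
  by (auto simp: Ah_part_def)

lemma Ah_part_zero [simp]: "0 \<in> Ah_part i"
  by (simp add: Ah_part_def P_part_intros)

lemma Ah_part_add: "\<phi> \<in> Ah_part i \<Longrightarrow> \<psi> \<in> Ah_part i \<Longrightarrow> \<phi> + \<psi> \<in> Ah_part i"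
  by (auto simp: Ah_part_def lookup_add P_part_intros)

lemma Ah_part_scl: "\<phi> \<in> Ah_part i \<Longrightarrow> ah_scl c \<phi> \<in> Ah_part i"
  by (auto simp: Ah_part_def P_part_intros)

lemma Ah_part_sum: "(\<And>x. x \<in> B \<Longrightarrow> f x \<in> Ah_part i) \<Longrightarrow> sum f B \<in> Ah_part i"
  by (induction B rule: infinite_finite_induct) (auto intro: Ah_part_add)

lemma Ah_part_ddx: "\<phi> \<in> Ah_part i \<Longrightarrow> ah_ddx \<phi> \<in> Ah_part i"
  by (auto simp: Ah_part_def P_part_intros)

lemma Ah_part_ddx_pow: "\<phi> \<in> Ah_part i \<Longrightarrow> (ah_ddx ^^ p) \<phi> \<in> Ah_part i"
  by (induction p) (auto intro: Ah_part_ddx)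

lemma coord_out: "l \<notin> {1..dim (A i)} \<Longrightarrow> coord a i l = 0"
  unfolding coord_def by (rule if_not_P)

lemma tens_Ah: "f \<in> P_part (k + i) \<Longrightarrow> a \<in> A i \<Longrightarrow> tens f a \<in> Ah_part k"
proof -
  assume f: "f \<in> P_part (k + i)" and a: "a \<in> A i"
  have "scl (coord a j l) f \<in> P_part (k + j)" for j l
    using P_part_intros(3)[OF f, of "coord a j l"] coord_parity[OF a, of j l] P_part_intros(1)
    by (cases "i = j") auto
  then show "tens f a \<in> Ah_part k" unfolding Ah_part_def by (auto simp: lookup_tens coord_out)
qed

lemma emb_Ah: "a \<in> A i \<Longrightarrow> emb a \<in> Ah_part i"
  unfolding emb_tens by (rule tens_Ah[where i = i]) (simp_all add: P_part_intros)

lemma ah_decomp: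
  assumes "\<And>i l. l \<notin> {1..dim (A i)} \<Longrightarrow> Poly_Mapping.lookup \<phi> (i, l) = 0"
  shows "\<phi> = (\<Sum>i\<in>{0, 1}. \<Sum>l = 1..dim (A i). tens (Poly_Mapping.lookup \<phi> (i, l)) (e i l))"
proof (rule poly_mapping_eqI, clarify)
  fix i l
  have "(\<Sum>k = 1..dim (A i). Poly_Mapping.lookup (tens (Poly_Mapping.lookup \<phi> (i, k)) (e i k)) (i, l)) =
     (\<Sum>k = 1..dim (A i). if k = l then Poly_Mapping.lookup \<phi> (i, l) else 0)"
    by (rule sum.cong) (auto simp: lookup_tens coord_e)
  also have "\<dots> = Poly_Mapping.lookup \<phi> (i, l)" using assms by (auto simp: sum.delta)
  finally have 1: "(\<Sum>k = 1..dim (A i). Poly_Mapping.lookup (tens (Poly_Mapping.lookup \<phi> (i, k)) (e i k)) (i, l)) =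
     Poly_Mapping.lookup \<phi> (i, l)" .
  have 2: "(\<Sum>k = 1..dim (A j). Poly_Mapping.lookup (tens (Poly_Mapping.lookup \<phi> (j, k)) (e j k)) (i, l)) = 0"
    if "j \<noteq> i" for j
    by (rule sum.neutral) (use that in \<open>auto simp: lookup_tens coord_e\<close>)
  show "Poly_Mapping.lookup \<phi> (i, l) = Poly_Mapping.lookup
    (\<Sum>i\<in>{0, 1}. \<Sum>l = 1..dim (A i). tens (Poly_Mapping.lookup \<phi> (i, l)) (e i l)) (i, l)"
    using 1 2 bit_cases2[of i] by (auto simp: lookup_add lookup_sum)
qed

text \<open>Since $\hat{\mathcal A}$ is spanned by the elements $f\otimes a$ with \<open>f\<close>
  and \<open>a\<close> homogeneous, multilinear identities in $\hat{\mathcal A}$ reduce to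
  identities in $\mathcal P$ and in $\mathcal A$.\<close>

lemma Ah_induct [consumes 1, case_names zero add tens]:
  assumes \<phi>: "\<phi> \<in> Ah_part k" and zero: "Q 0"
    and add: "\<And>\<phi> \<psi>. \<phi> \<in> Ah_part k \<Longrightarrow> \<psi> \<in> Ah_part k \<Longrightarrow> Q \<phi> \<Longrightarrow> Q \<psi> \<Longrightarrow> Q (\<phi> + \<psi>)"
    and tens: "\<And>f i a. f \<in> P_part (k + i) \<Longrightarrow> a \<in> A i \<Longrightarrow> Q (tens f a)"
  shows "Q \<phi>"
proof -
  have sum: "sum f B \<in> Ah_part k \<and> Q (sum f B)" if "\<And>x. x \<in> B \<Longrightarrow> f x \<in> Ah_part k \<and> Q (f x)"
    for f and B :: "'c set"
    using that by (induction B rule: infinite_finite_induct) (auto intro: zero add Ah_part_add)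
  have "(\<Sum>i\<in>{0, 1}. \<Sum>l = 1..dim (A i). tens (Poly_Mapping.lookup \<phi> (i, l)) (e i l)) \<in> Ah_part k \<and>
    Q (\<Sum>i\<in>{0, 1}. \<Sum>l = 1..dim (A i). tens (Poly_Mapping.lookup \<phi> (i, l)) (e i l))"
    by (rule sum, rule sum, rule conjI) (auto intro!: tens_Ah tens Ah_partD(1)[OF \<phi>] e_in_A)
  then show ?thesis using ah_decomp[of \<phi>] Ah_partD(2)[OF \<phi>] by simp
qed

lemma Ah_iff: "\<phi> \<in> Ah \<longleftrightarrow> (\<forall>j l. Poly_Mapping.lookup \<phi> (j, l) \<in> P \<and>
     (l \<notin> {1..dim (A j)} \<longrightarrow> Poly_Mapping.lookup \<phi> (j, l) = 0))" (is "_ \<longleftrightarrow> ?R")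
proof
  assume "\<phi> \<in> Ah"
  then obtain \<phi>0 \<phi>1 where "\<phi> = \<phi>0 + \<phi>1" "\<phi>0 \<in> Ah_part 0" "\<phi>1 \<in> Ah_part 1"
    unfolding Ah_def gcar_def by blast
  then show ?R by (auto simp: lookup_add Ah_part_def P_part_iff P_add)
next
  assume R: ?R
  have "ah_part i \<phi> \<in> Ah_part i" for i
    using R by (auto simp: Ah_part_def lookup_ah_part P_part_intros)
  moreover have "\<phi> = ah_part 0 \<phi> + ah_part 1 \<phi>"
  proof (rule poly_mapping_eqI, clarify)
    fix j l show "Poly_Mapping.lookup \<phi> (j, l) = Poly_Mapping.lookup (ah_part 0 \<phi> + ah_part 1 \<phi>) (j, l)"
      using sp_part_sum[of "Poly_Mapping.lookup \<phi> (j, l)"] bit_cases2[of j]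
      by (auto simp: lookup_add lookup_ah_part add.commute)
  qed
  ultimately show "\<phi> \<in> Ah" unfolding Ah_def gcar_def by blast
qed

subsection \<open>The product\<close>

definition mult_term :: "bit \<times> nat \<Rightarrow> bit \<times> nat \<Rightarrow> 'f spoly \<Rightarrow> 'f spoly \<Rightarrow> 'f ahat" where
  "mult_term x y f g = (\<Sum>p\<in>{0, 1}. tens (scl (psign (fst x * p)) (f \<odot> sp_part p g))
     (e (fst x) (snd x) * e (fst y) (snd y)))"

lemma ah_mult_eq: "ah_mult \<phi> \<psi> = (\<Sum>x\<in>Poly_Mapping.keys \<phi>. \<Sum>y\<in>Poly_Mapping.keys \<psi>.
    mult_term x y (Poly_Mapping.lookup \<phi> x) (Poly_Mapping.lookup \<psi> y))"
  unfolding ah_mult_def mult_term_def tens_def by (simp add: case_prod_unfold)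

lemma mult_term_add:
  "mult_term x y (f + f') g = mult_term x y f g + mult_term x y f' g"
  "mult_term x y f (g + g') = mult_term x y f g + mult_term x y f g'"
  by (simp_all add: mult_term_def sp_mult_add_left sp_mult_add_right sp_part_add scl_add tens_add_left)

lemma mult_term_scl:
  "mult_term x y (scl c f) g = ah_scl c (mult_term x y f g)"
  "mult_term x y f (scl c g) = ah_scl c (mult_term x y f g)"
  by (simp_all add: mult_term_def sp_mult_scl_left sp_mult_scl_right sp_part_scl tens_scl_left ah_scl_add
      ah_scl_scl mult.commute)

lemma mult_term_zero [simp]: "mult_term x y 0 g = 0" "mult_term x y f 0 = 0"
  using mult_term_add(1)[of x y 0 0 g] mult_term_add(2)[of x y f 0 0] by simp_all

lemma ah_mult_add_left: "ah_mult (\<phi> + \<phi>') \<psi> = ah_mult \<phi> \<psi> + ah_mult \<phi>' \<psi>"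
  unfolding ah_mult_eq
  by (rule keysum_add[where F = "\<lambda>x f. \<Sum>y\<in>Poly_Mapping.keys \<psi>. mult_term x y f (Poly_Mapping.lookup \<psi> y)"])
     (simp add: mult_term_add sum.distrib)

lemma ah_mult_add_right: "ah_mult \<phi> (\<psi> + \<psi>') = ah_mult \<phi> \<psi> + ah_mult \<phi> \<psi>'"
proof -
  have "ah_mult \<phi> \<psi> = (\<Sum>y\<in>Poly_Mapping.keys \<psi>. \<Sum>x\<in>Poly_Mapping.keys \<phi>.
    mult_term x y (Poly_Mapping.lookup \<phi> x) (Poly_Mapping.lookup \<psi> y))" for \<psi>
    unfolding ah_mult_eq by (rule sum.swap)
  then show ?thesis
    using keysum_add[where F = "\<lambda>y f. \<Sum>x\<in>Poly_Mapping.keys \<phi>. mult_term x y (Poly_Mapping.lookup \<phi> x) f"]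
    by (simp add: mult_term_add sum.distrib)
qed

lemma ah_mult_zero [simp]: "ah_mult 0 \<psi> = 0" "ah_mult \<phi> 0 = 0"
  using ah_mult_add_left[of 0 0 \<psi>] ah_mult_add_right[of \<phi> 0 0] by simp_all

lemma ah_mult_single: "ah_mult (Poly_Mapping.single x f) (Poly_Mapping.single y g) = mult_term x y f g"
  unfolding ah_mult_eq by auto

lemma ah_mult_sum_left: "ah_mult (sum f B) \<psi> = (\<Sum>x\<in>B. ah_mult (f x) \<psi>)"
  by (rule additive_sum) (rule ah_mult_add_left)

lemma ah_mult_sum_right: "ah_mult \<psi> (sum f B) = (\<Sum>x\<in>B. ah_mult \<psi> (f x))"
  by (rule additive_sum) (rule ah_mult_add_right)

lemma tens_eq_sum: "tens f a = (\<Sum>i\<in>{0, 1}. \<Sum>l = 1..dim (A i). Poly_Mapping.single (i, l) (scl (coord a i l) f))"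
proof -
  have "tens f a = (\<Sum>i\<in>{0, 1}. \<Sum>l = 1..dim (A i). tens f (sA (coord a i l) (e i l)))"
    by (subst (1) coord_sum[of a, symmetric]) (simp only: tens_sum_right)
  also have "\<dots> = (\<Sum>i\<in>{0, 1}. \<Sum>l = 1..dim (A i). Poly_Mapping.single (i, l) (scl (coord a i l) f))"
    unfolding tens_scl_right tens_scl_left[symmetric] by (intro sum.cong refl) (rule tens_e)
  finally show ?thesis .
qed

lemma tens_parity_sum:
  assumes "a \<in> A i"
  shows "tens f a = (\<Sum>l = 1..dim (A i). Poly_Mapping.single (i, l) (scl (coord a i l) f))"
proof -
  have "(\<Sum>l = 1..dim (A j). Poly_Mapping.single (j, l) (scl (coord a j l) f)) = 0" if "j \<noteq> i" for j
    by (rule sum.neutral) (use coord_parity[OF assms] that in auto)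
  then show ?thesis unfolding tens_eq_sum using bit_cases2[of i] by auto
qed

lemma coord_parity_sum:
  assumes "a \<in> A i"
  shows "(\<Sum>l = 1..dim (A i). sA (coord a i l) (e i l)) = a"
proof -
  have "(\<Sum>l = 1..dim (A j). sA (coord a j l) (e j l)) = 0" if "j \<noteq> i" for j
    by (rule sum.neutral) (use coord_parity[OF assms] that in auto)
  then show ?thesis using coord_sum[of a] bit_cases2[of i] by auto
qed

lemma mult_term_hom:
  "sp_hom p g \<Longrightarrow> mult_term (i, l) (j, k) f g = tens (scl (psign (i * p)) (f \<odot> g)) (e i l * e j k)"
  using bit_cases2[of p] by (auto simp: mult_term_def sp_part_hom)

text \<open>The sign rule $(f\otimes a)(g\otimes b)=(-1)^{ip}fg\otimes ab$ for all homogeneous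
  \<open>a\<close>, not only for basis elements: the sign involves \<open>a\<close> only through
  its parity.\<close>

lemma ah_mult_tens:
  assumes a: "a \<in> A i" and g: "sp_hom p g"
  shows "ah_mult (tens f a) (tens g b) = tens (scl (psign (i * p)) (f \<odot> g)) (a * b)"
proof -
  let ?X = "scl (psign (i * p)) (f \<odot> g)"
  have "ah_mult (tens f a) (tens g b) = (\<Sum>j\<in>{0, 1}. \<Sum>k = 1..dim (A j). \<Sum>l = 1..dim (A i).
      tens ?X (sA (coord a i l) (e i l) * sA (coord b j k) (e j k)))"
    unfolding tens_parity_sum[OF a] tens_eq_sum[of g] ah_mult_sum_left ah_mult_sum_right ah_mult_single
    by (simp only: mult_term_scl mult_term_hom[OF g] scale_mult_left scale_mult_right tens_scl_right)
  also have "\<dots> = tens ?X ((\<Sum>l = 1..dim (A i). sA (coord a i l) (e i l)) *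
      (\<Sum>j\<in>{0, 1}. \<Sum>k = 1..dim (A j). sA (coord b j k) (e j k)))"
    by (simp only: sum_distrib_left sum_distrib_right tens_sum_right)
  finally show ?thesis by (simp only: coord_parity_sum[OF a] coord_sum)
qed

lemma Ah_part_mult:
  assumes "\<phi> \<in> Ah_part i" "\<psi> \<in> Ah_part j" shows "ah_mult \<phi> \<psi> \<in> Ah_part (i + j)"
  using assms(1)
proof (induction rule: Ah_induct)
  case (tens f k a)
  from assms(2) show ?case
  proof (induction rule: Ah_induct)
    case (tens g l b)
    have "f \<odot> g \<in> P_part ((i + j) + (k + l))"
      using P_part_intros(4)[OF \<open>f \<in> _\<close> \<open>g \<in> _\<close>] by (simp add: ac_simps)
    moreover have "ah_mult (tens f a) (tens g b) = tens (scl (psign (k * (j + l))) (f \<odot> g)) (a * b)"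
      by (rule ah_mult_tens) (use tens \<open>a \<in> A k\<close> in \<open>auto simp: P_part_iff\<close>)
    ultimately show ?case
      using A_mult[OF \<open>a \<in> A k\<close> \<open>b \<in> A l\<close>] by (auto intro: tens_Ah[where i = "k + l"] P_part_intros(3))
  qed (simp_all add: ah_mult_add_right Ah_part_add)
qed (simp_all add: ah_mult_add_left Ah_part_add)

text \<open>On pure tensors the signs on both sides count the same transpositions; the rest is
  associativity in $\mathcal P$ and in $\mathcal A$.\<close>

lemma ah_mult_assoc_hom:
  assumes "\<phi> \<in> Ah_part i" "\<psi> \<in> Ah_part j" "\<chi> \<in> Ah_part k"
  shows "ah_mult (ah_mult \<phi> \<psi>) \<chi> = ah_mult \<phi> (ah_mult \<psi> \<chi>)"
  using assms(1)
proof (induction rule: Ah_induct)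
  case (tens f i' a)
  note fa = tens
  from assms(2) show ?case
  proof (induction rule: Ah_induct)
    case (tens g j' b)
    note gb = tens
    from assms(3) show ?case
    proof (induction rule: Ah_induct)
      case (tens h k' c)
      have hom: "sp_hom (j + j') g" "sp_hom (k + k') h" "sp_hom (j + j' + (k + k')) (g \<odot> h)"
        using gb tens by (auto simp: P_part_iff intro: sp_hom_mult)
      have ab: "a * b \<in> A (i' + j')" by (rule A_mult) (use fa gb in auto)
      show ?case
        unfolding ah_mult_tens[OF fa(2) hom(1)] ah_mult_tens[OF gb(2) hom(2)] ah_mult_tens[OF ab hom(2)]
          tens_scl_left[of _ "g \<odot> h"]
        unfolding tens_scl_left[symmetric] ah_mult_tens[OF fa(2) sp_hom_scl[OF hom(3)]]
        by (simp add: sp_mult_scl_left sp_mult_scl_right scl_scl sp_mult_assoc mult.assoc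
           psign_add[symmetric] algebra_simps)
    qed (simp_all add: ah_mult_add_right)
  qed (simp_all add: ah_mult_add_right ah_mult_add_left)
qed (simp_all add: ah_mult_add_left)

lemma ah_ddx_mult_hom:
  assumes "\<phi> \<in> Ah_part i" "\<psi> \<in> Ah_part j"
  shows "ah_ddx (ah_mult \<phi> \<psi>) = ah_mult (ah_ddx \<phi>) \<psi> + ah_mult \<phi> (ah_ddx \<psi>)"
  using assms(1)
proof (induction rule: Ah_induct)
  case (tens f i' a)
  note fa = tens
  from assms(2) show ?case
  proof (induction rule: Ah_induct)
    case (tens g j' b)
    have hom: "sp_hom (j + j') g" using tens by (simp add: P_part_iff)
    show ?case
      by (simp add: ah_ddx_tens ah_mult_tens[OF fa(2) hom] ah_mult_tens[OF fa(2) sp_hom_ddx[OF hom]]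
          ddx_scl ddx_mult scl_add tens_add_left)
  qed (simp_all add: ah_mult_add_right ah_ddx_add algebra_simps)
qed (simp_all add: ah_mult_add_left ah_ddx_add algebra_simps)

lemma ah_evo_mult_hom:
  assumes v: "evo_hom k v" and "\<phi> \<in> Ah_part i" "\<psi> \<in> Ah_part j"
  shows "ah_evo v (ah_mult \<phi> \<psi>) = ah_mult (ah_evo v \<phi>) \<psi> + ah_scl (psign (k * i)) (ah_mult \<phi> (ah_evo v \<psi>))"
  using assms(2)
proof (induction rule: Ah_induct)
  case (tens f i' a)
  note fa = tens
  from assms(3) show ?case
  proof (induction rule: Ah_induct)
    case (tens g j' b)
    have hom: "sp_hom (j + j') g" "sp_hom (i + i') f" using fa tens by (simp_all add: P_part_iff)
    show ?case
      by (simp add: ah_evo_tens ah_mult_tens[OF fa(2) hom(1)] ah_mult_tens[OF fa(2) sp_hom_evo[OF v hom(1)]]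
          evo_scl evo_mult[OF v hom(2)] scl_add tens_add_left tens_scl_left[symmetric] scl_scl
          psign_add distrib_left mult.commute mult.left_commute)
  qed (simp_all add: ah_mult_add_right ah_evo_add ah_scl_add algebra_simps)
qed (simp_all add: ah_mult_add_left ah_evo_add ah_scl_add algebra_simps)

subsection \<open>The form\<close>

definition form_term :: "bit \<times> nat \<Rightarrow> bit \<times> nat \<Rightarrow> 'f spoly \<Rightarrow> 'f spoly \<Rightarrow> 'f spoly" where
  "form_term x y f g = (\<Sum>p\<in>{0, 1}.
     scl (psign (fst x * p) * form (e (fst x) (snd x)) (e (fst y) (snd y))) (f \<odot> sp_part p g))"

lemma ah_form_eq: "ah_form \<phi> \<psi> = (\<Sum>x\<in>Poly_Mapping.keys \<phi>. \<Sum>y\<in>Poly_Mapping.keys \<psi>.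
    form_term x y (Poly_Mapping.lookup \<phi> x) (Poly_Mapping.lookup \<psi> y))"
  unfolding ah_form_def form_term_def by (simp add: case_prod_unfold)

lemma form_term_add:
  "form_term x y (f + f') g = form_term x y f g + form_term x y f' g"
  "form_term x y f (g + g') = form_term x y f g + form_term x y f g'"
  by (simp_all add: form_term_def sp_mult_add_left sp_mult_add_right sp_part_add scl_add)

lemma form_term_scl:
  "form_term x y (scl c f) g = scl c (form_term x y f g)"
  "form_term x y f (scl c g) = scl c (form_term x y f g)"
  by (simp_all add: form_term_def sp_mult_scl_left sp_mult_scl_right sp_part_scl scl_add
      scl_scl mult.commute mult.left_commute)

lemma form_term_zero [simp]: "form_term x y 0 g = 0" "form_term x y f 0 = 0"
  using form_term_add(1)[of x y 0 0 g] form_term_add(2)[of x y f 0 0] by simp_all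

lemma ah_form_add_left: "ah_form (\<phi> + \<phi>') \<psi> = ah_form \<phi> \<psi> + ah_form \<phi>' \<psi>"
  unfolding ah_form_eq
  by (rule keysum_add[where F = "\<lambda>x f. \<Sum>y\<in>Poly_Mapping.keys \<psi>. form_term x y f (Poly_Mapping.lookup \<psi> y)"])
     (simp add: form_term_add sum.distrib)

lemma ah_form_add_right: "ah_form \<phi> (\<psi> + \<psi>') = ah_form \<phi> \<psi> + ah_form \<phi> \<psi>'"
proof -
  have "ah_form \<phi> \<psi> = (\<Sum>y\<in>Poly_Mapping.keys \<psi>. \<Sum>x\<in>Poly_Mapping.keys \<phi>.
    form_term x y (Poly_Mapping.lookup \<phi> x) (Poly_Mapping.lookup \<psi> y))" for \<psi>
    unfolding ah_form_eq by (rule sum.swap)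
  then show ?thesis
    using keysum_add[where F = "\<lambda>y f. \<Sum>x\<in>Poly_Mapping.keys \<phi>. form_term x y (Poly_Mapping.lookup \<phi> x) f"]
    by (simp add: form_term_add sum.distrib)
qed

lemma ah_form_zero [simp]: "ah_form 0 \<psi> = 0" "ah_form \<phi> 0 = 0"
  using ah_form_add_left[of 0 0 \<psi>] ah_form_add_right[of \<phi> 0 0] by simp_all

lemma ah_form_single: "ah_form (Poly_Mapping.single x f) (Poly_Mapping.single y g) = form_term x y f g"
  unfolding ah_form_eq by auto

lemma ah_form_sum_left: "ah_form (sum f B) \<psi> = (\<Sum>x\<in>B. ah_form (f x) \<psi>)"
  by (rule additive_sum) (rule ah_form_add_left)

lemma ah_form_sum_right: "ah_form \<psi> (sum f B) = (\<Sum>x\<in>B. ah_form \<psi> (f x))"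
  by (rule additive_sum) (rule ah_form_add_right)

lemma form_sum_left: "form (sum f B) a = (\<Sum>x\<in>B. form (f x) a)"
  by (rule additive_sum[where f = "\<lambda>x. form x a"]) (rule form_add_left)

lemma form_sum_right: "form a (sum f B) = (\<Sum>x\<in>B. form a (f x))"
  by (rule additive_sum) (rule form_add_right)

lemma form_term_hom:
  "sp_hom p g \<Longrightarrow> form_term (i, l) (j, k) f g = scl (form (e i l) (e j k)) (scl (psign (i * p)) (f \<odot> g))"
  using bit_cases2[of p] by (auto simp: form_term_def sp_part_hom scl_scl mult.commute)

lemma ah_form_tens:
  assumes a: "a \<in> A i" and g: "sp_hom p g"
  shows "ah_form (tens f a) (tens g b) = scl (form a b) (scl (psign (i * p)) (f \<odot> g))"
proof -
  let ?X = "scl (psign (i * p)) (f \<odot> g)"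
  have scl_sum_left: "(\<Sum>x\<in>B. scl (c x) ?X) = scl (sum c B) ?X" for c and B :: "'c set"
    by (rule additive_sum[where f = "\<lambda>c. scl c ?X", symmetric]) (rule scl_add_left)
  have "ah_form (tens f a) (tens g b) = (\<Sum>j\<in>{0, 1}. \<Sum>k = 1..dim (A j). \<Sum>l = 1..dim (A i).
      scl (form (sA (coord a i l) (e i l)) (sA (coord b j k) (e j k))) ?X)"
    unfolding tens_parity_sum[OF a] tens_eq_sum[of g] ah_form_sum_left ah_form_sum_right ah_form_single
    by (simp only: form_term_scl form_term_hom[OF g] form_scale_left form_scale_right scl_scl mult.assoc mult.left_commute)
  also have "\<dots> = scl (form (\<Sum>l = 1..dim (A i). sA (coord a i l) (e i l))
      (\<Sum>j\<in>{0, 1}. \<Sum>k = 1..dim (A j). sA (coord b j k) (e j k))) ?X"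
    by (simp only: form_sum_left form_sum_right scl_sum_left)
  finally show ?thesis by (simp only: coord_parity_sum[OF a] coord_sum)
qed

lemma form_parity: "a \<in> A i \<Longrightarrow> b \<in> A j \<Longrightarrow> i \<noteq> j \<Longrightarrow> form a b = 0"
  using form_even_odd[of a b] form_even_odd[of b a] form_supersymmetric[of a i b j]
    bit_cases2[of i] bit_cases2[of j] by auto

lemma ah_form_P_part:
  assumes "\<phi> \<in> Ah_part i" "\<psi> \<in> Ah_part j" shows "ah_form \<phi> \<psi> \<in> P_part (i + j)"
  using assms(1)
proof (induction rule: Ah_induct)
  case (tens f k a)
  note fa = tens
  from assms(2) show ?case
  proof (induction rule: Ah_induct)
    case (tens g l b)
    show ?case
    proof (cases "k = l")
      case True
      then have "f \<odot> g \<in> P_part (i + j)"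
        using P_part_intros(4)[OF fa(1) tens(1)] by (simp add: ac_simps)
      then show ?thesis using tens by (simp add: ah_form_tens[OF fa(2), of "j + l"] P_part_iff P_scl sp_hom_scl)
    next
      case False
      then show ?thesis using tens by (simp add: ah_form_tens[OF fa(2), of "j + l"] form_parity[OF fa(2)] P_part_iff)
    qed
  qed (simp_all add: ah_form_add_right P_part_intros)
qed (simp_all add: ah_form_add_left P_part_intros)

text \<open>On pure tensors the form of \<open>a\<close> and \<open>b\<close> is nonzero only if
  they have equal parity, and then the signs from \<open>sp_mult_supercomm\<close> and from the
  form on $\mathcal A$ multiply to the required one.\<close>

lemma ah_form_supersym:
  assumes "\<phi> \<in> Ah_part i" "\<psi> \<in> Ah_part j"
  shows "ah_form \<phi> \<psi> = scl (psign (i * j)) (ah_form \<psi> \<phi>)"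
  using assms(1)
proof (induction rule: Ah_induct)
  case (tens f k a)
  note fa = tens
  from assms(2) show ?case
  proof (induction rule: Ah_induct)
    case (tens g l b)
    have hom: "sp_hom (i + k) f" "sp_hom (j + l) g" using fa tens by (simp_all add: P_part_iff)
    show ?case
    proof (cases "k = l")
      case True
      have "f \<odot> g = scl (psign ((i + k) * (j + l))) (g \<odot> f)" by (rule sp_mult_supercomm[OF hom])
      moreover have "form a b = psign (k * l) * form b a" by (rule form_supersymmetric[OF fa(2) tens(2)])
      ultimately show ?thesis
        using bit_cases2[of i] bit_cases2[of j] bit_cases2[of k] True
        by (auto simp: ah_form_tens[OF fa(2) hom(2)] ah_form_tens[OF tens(2) hom(1)])
    next
      case False
      then show ?thesis using form_parity[OF fa(2) tens(2)] form_parity[OF tens(2) fa(2)]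
        by (simp add: ah_form_tens[OF fa(2) hom(2)] ah_form_tens[OF tens(2) hom(1)])
    qed
  qed (simp_all add: ah_form_add_right ah_form_add_left scl_add)
qed (simp_all add: ah_form_add_left ah_form_add_right scl_add)

lemma ah_form_assoc_hom:
  assumes "\<phi> \<in> Ah_part i" "\<psi> \<in> Ah_part j" "\<chi> \<in> Ah_part k"
  shows "ah_form (ah_mult \<phi> \<psi>) \<chi> = ah_form \<phi> (ah_mult \<psi> \<chi>)"
  using assms(1)
proof (induction rule: Ah_induct)
  case (tens f i' a)
  note fa = tens
  from assms(2) show ?case
  proof (induction rule: Ah_induct)
    case (tens g j' b)
    note gb = tens
    from assms(3) show ?case
    proof (induction rule: Ah_induct)
      case (tens h k' c)
      have hom: "sp_hom (j + j') g" "sp_hom (k + k') h" "sp_hom (j + j' + (k + k')) (g \<odot> h)"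
        using gb tens by (auto simp: P_part_iff intro: sp_hom_mult)
      have ab: "a * b \<in> A (i' + j')" by (rule A_mult) (use fa gb in auto)
      show ?case
        unfolding ah_mult_tens[OF fa(2) hom(1)] ah_mult_tens[OF gb(2) hom(2)] ah_form_tens[OF ab hom(2)]
          ah_form_tens[OF fa(2) sp_hom_scl[OF hom(3)]]
        by (simp add: sp_mult_scl_left sp_mult_scl_right scl_scl sp_mult_assoc mult.assoc
           psign_add[symmetric] form_associative algebra_simps)
    qed (simp_all add: ah_mult_add_right ah_form_add_right)
  qed (simp_all add: ah_mult_add_right ah_mult_add_left ah_form_add_right ah_form_add_left)
qed (simp_all add: ah_mult_add_left ah_form_add_left)

lemma ah_form_ddx_hom:
  assumes "\<phi> \<in> Ah_part i" "\<psi> \<in> Ah_part j"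
  shows "ddx (ah_form \<phi> \<psi>) = ah_form (ah_ddx \<phi>) \<psi> + ah_form \<phi> (ah_ddx \<psi>)"
  using assms(1)
proof (induction rule: Ah_induct)
  case (tens f i' a)
  note fa = tens
  from assms(2) show ?case
  proof (induction rule: Ah_induct)
    case (tens g j' b)
    have hom: "sp_hom (j + j') g" using tens by (simp add: P_part_iff)
    show ?case
      by (simp add: ah_ddx_tens ah_form_tens[OF fa(2) hom] ah_form_tens[OF fa(2) sp_hom_ddx[OF hom]]
          ddx_scl ddx_mult scl_add)
  qed (simp_all add: ah_form_add_right ah_ddx_add ddx_add algebra_simps)
qed (simp_all add: ah_form_add_left ah_ddx_add ddx_add algebra_simps)

lemma ah_form_evo_hom:
  assumes v: "evo_hom k v" and "\<phi> \<in> Ah_part i" "\<psi> \<in> Ah_part j"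
  shows "evo v (ah_form \<phi> \<psi>) = ah_form (ah_evo v \<phi>) \<psi> + scl (psign (k * i)) (ah_form \<phi> (ah_evo v \<psi>))"
  using assms(2)
proof (induction rule: Ah_induct)
  case (tens f i' a)
  note fa = tens
  from assms(3) show ?case
  proof (induction rule: Ah_induct)
    case (tens g j' b)
    have hom: "sp_hom (j + j') g" "sp_hom (i + i') f" using fa tens by (simp_all add: P_part_iff)
    show ?case
      by (simp add: ah_evo_tens ah_form_tens[OF fa(2) hom(1)] ah_form_tens[OF fa(2) sp_hom_evo[OF v hom(1)]]
          evo_scl evo_mult[OF v hom(2)] scl_add scl_scl
          psign_add distrib_left mult.commute mult.left_commute)
  qed (simp_all add: ah_form_add_right ah_evo_add evo_add scl_add algebra_simps)
qed (simp_all add: ah_form_add_left ah_evo_add evo_add scl_add algebra_simps)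

subsection \<open>Inhomogeneous elements\<close>

lemma AhE:
  assumes "\<phi> \<in> Ah"
  obtains \<phi>0 \<phi>1 where "\<phi> = \<phi>0 + \<phi>1" "\<phi>0 \<in> Ah_part 0" "\<phi>1 \<in> Ah_part 1"
  using assms unfolding Ah_def gcar_def by blast

lemma Ah_part_Ah: "\<phi> \<in> Ah_part i \<Longrightarrow> \<phi> \<in> Ah"
  unfolding Ah_iff by (auto simp: Ah_part_def P_part_iff)

lemma Ah_zero [simp]: "0 \<in> Ah"
  by (simp add: Ah_iff)

lemma Ah_add: "\<phi> \<in> Ah \<Longrightarrow> \<psi> \<in> Ah \<Longrightarrow> \<phi> + \<psi> \<in> Ah"
  by (simp add: Ah_iff lookup_add P_add)

lemma Ah_scl: "\<phi> \<in> Ah \<Longrightarrow> ah_scl c \<phi> \<in> Ah"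
  by (simp add: Ah_iff P_scl)

lemma Ah_sum: "(\<And>x. x \<in> B \<Longrightarrow> f x \<in> Ah) \<Longrightarrow> sum f B \<in> Ah"
  by (induction B rule: infinite_finite_induct) (auto intro: Ah_add)

lemma Ah_ddx_pow: "\<phi> \<in> Ah \<Longrightarrow> (ah_ddx ^^ p) \<phi> \<in> Ah"
  by (induction p) (auto simp: Ah_iff P_ddx)

lemma Ah_mult: "\<phi> \<in> Ah \<Longrightarrow> \<psi> \<in> Ah \<Longrightarrow> ah_mult \<phi> \<psi> \<in> Ah"
  by (elim AhE) (auto simp: ah_mult_add_left ah_mult_add_right intro!: Ah_add intro: Ah_part_Ah[OF Ah_part_mult])

lemma ah_mult_assoc:
  assumes "\<phi> \<in> Ah" "\<psi> \<in> Ah" "\<chi> \<in> Ah"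
  shows "ah_mult (ah_mult \<phi> \<psi>) \<chi> = ah_mult \<phi> (ah_mult \<psi> \<chi>)"
  using assms by (elim AhE) (simp add: ah_mult_add_left ah_mult_add_right ah_mult_assoc_hom)

lemma ah_form_assoc:
  assumes "\<phi> \<in> Ah" "\<psi> \<in> Ah" "\<chi> \<in> Ah"
  shows "ah_form (ah_mult \<phi> \<psi>) \<chi> = ah_form \<phi> (ah_mult \<psi> \<chi>)"
  using assms by (elim AhE) (simp add: ah_mult_add_left ah_mult_add_right ah_form_add_left ah_form_add_right ah_form_assoc_hom)

lemma ah_ddx_mult:
  assumes "\<phi> \<in> Ah" "\<psi> \<in> Ah"
  shows "ah_ddx (ah_mult \<phi> \<psi>) = ah_mult (ah_ddx \<phi>) \<psi> + ah_mult \<phi> (ah_ddx \<psi>)"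
  using assms by (elim AhE) (simp add: ah_mult_add_left ah_mult_add_right ah_ddx_add ah_ddx_mult_hom algebra_simps)

lemma ah_form_ddx:
  assumes "\<phi> \<in> Ah" "\<psi> \<in> Ah"
  shows "ddx (ah_form \<phi> \<psi>) = ah_form (ah_ddx \<phi>) \<psi> + ah_form \<phi> (ah_ddx \<psi>)"
  using assms by (elim AhE) (simp add: ah_form_add_left ah_form_add_right ah_ddx_add ddx_add ah_form_ddx_hom algebra_simps)

lemma ah_mult_scl: "\<phi> \<in> Ah \<Longrightarrow> \<psi> \<in> Ah \<Longrightarrow> ah_mult (ah_scl c \<phi>) \<psi> = ah_scl c (ah_mult \<phi> \<psi>)"
  "\<phi> \<in> Ah \<Longrightarrow> \<psi> \<in> Ah \<Longrightarrow> ah_mult \<phi> (ah_scl c \<psi>) = ah_scl c (ah_mult \<phi> \<psi>)"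
proof -
  have part: "ah_mult (ah_scl c \<phi>) \<psi> = ah_scl c (ah_mult \<phi> \<psi>) \<and> ah_mult \<phi> (ah_scl c \<psi>) = ah_scl c (ah_mult \<phi> \<psi>)"
    if "\<phi> \<in> Ah_part i" "\<psi> \<in> Ah_part j" for \<phi> \<psi> i j
    using that(1)
  proof (induction rule: Ah_induct)
    case (tens f i' a)
    note fa = tens
    from that(2) show ?case
    proof (induction rule: Ah_induct)
      case (tens g j' b)
      have hom: "sp_hom (j + j') g" using tens by (simp add: P_part_iff)
      show ?case
        by (simp add: tens_scl_left[symmetric] ah_mult_tens[OF fa(2) hom] ah_mult_tens[OF fa(2) sp_hom_scl[OF hom]]
          sp_mult_scl_left sp_mult_scl_right scl_scl mult.commute)
    qed (simp_all add: ah_mult_add_right ah_scl_add)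
  qed (simp_all add: ah_mult_add_left ah_scl_add)
  show "\<phi> \<in> Ah \<Longrightarrow> \<psi> \<in> Ah \<Longrightarrow> ah_mult (ah_scl c \<phi>) \<psi> = ah_scl c (ah_mult \<phi> \<psi>)"
    "\<phi> \<in> Ah \<Longrightarrow> \<psi> \<in> Ah \<Longrightarrow> ah_mult \<phi> (ah_scl c \<psi>) = ah_scl c (ah_mult \<phi> \<psi>)"
    by (elim AhE, simp add: part ah_scl_add ah_mult_add_left ah_mult_add_right)+
qed

lemma ah_form_scl: "\<phi> \<in> Ah \<Longrightarrow> \<psi> \<in> Ah \<Longrightarrow> ah_form (ah_scl c \<phi>) \<psi> = scl c (ah_form \<phi> \<psi>)"
  "\<phi> \<in> Ah \<Longrightarrow> \<psi> \<in> Ah \<Longrightarrow> ah_form \<phi> (ah_scl c \<psi>) = scl c (ah_form \<phi> \<psi>)"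
proof -
  have part: "ah_form (ah_scl c \<phi>) \<psi> = scl c (ah_form \<phi> \<psi>) \<and> ah_form \<phi> (ah_scl c \<psi>) = scl c (ah_form \<phi> \<psi>)"
    if "\<phi> \<in> Ah_part i" "\<psi> \<in> Ah_part j" for \<phi> \<psi> i j
    using that(1)
  proof (induction rule: Ah_induct)
    case (tens f i' a)
    note fa = tens
    from that(2) show ?case
    proof (induction rule: Ah_induct)
      case (tens g j' b)
      have hom: "sp_hom (j + j') g" using tens by (simp add: P_part_iff)
      show ?case
        by (simp add: tens_scl_left[symmetric] ah_form_tens[OF fa(2) hom] ah_form_tens[OF fa(2) sp_hom_scl[OF hom]]
          sp_mult_scl_left sp_mult_scl_right scl_scl mult.commute mult.left_commute)
    qed (simp_all add: ah_form_add_right ah_scl_add scl_add)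
  qed (simp_all add: ah_form_add_left ah_scl_add scl_add)
  show "\<phi> \<in> Ah \<Longrightarrow> \<psi> \<in> Ah \<Longrightarrow> ah_form (ah_scl c \<phi>) \<psi> = scl c (ah_form \<phi> \<psi>)"
    "\<phi> \<in> Ah \<Longrightarrow> \<psi> \<in> Ah \<Longrightarrow> ah_form \<phi> (ah_scl c \<psi>) = scl c (ah_form \<phi> \<psi>)"
    by (elim AhE, simp add: part scl_add ah_scl_add ah_form_add_left ah_form_add_right)+
qed

subsection \<open>Constants\<close>

lemma ah_ddx_emb [simp]: "ah_ddx (emb a) = 0"
  by (simp add: emb_tens ah_ddx_tens ddx_const)

lemma ah_evo_emb [simp]: "ah_evo v (emb a) = 0"
  by (simp add: emb_tens ah_evo_tens evo_vfield vfield_const)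

text \<open>Constants are even polynomials, so no sign arises when an even central element of
  $\mathcal A$ passes a coefficient.\<close>

lemma emb_central:
  assumes "\<kappa> \<in> A 0" "\<And>a. \<kappa> * a = a * \<kappa>" "\<phi> \<in> Ah"
  shows "ah_mult (emb \<kappa>) \<phi> = ah_mult \<phi> (emb \<kappa>)"
proof -
  have part: "ah_mult (emb \<kappa>) \<phi> = ah_mult \<phi> (emb \<kappa>)" if "\<phi> \<in> Ah_part i" for \<phi> i
    using that
  proof (induction rule: Ah_induct)
    case (tens f j a)
    then have f: "sp_hom (i + j) f" by (simp add: P_part_iff)
    show ?case unfolding emb_tens
      by (simp add: ah_mult_tens[OF assms(1) f] ah_mult_tens[OF tens(2), of 0] assms(2))
  qed (simp_all add: ah_mult_add_left ah_mult_add_right)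
  from assms(3) show ?thesis by (elim AhE) (simp add: ah_mult_add_left ah_mult_add_right part)
qed

subsection \<open>The dual basis\<close>

text \<open>The form is assumed nondegenerate in the first argument; supersymmetry on homogeneous
  components carries this over to the second.\<close>

lemma form_nondegenerate_left:
  assumes "\<And>i l. l \<in> {1..dim (A i)} \<Longrightarrow> form (e i l) x = 0"
  shows "x = 0"
proof (rule form_nondegenerate)
  fix y
  have z: "form y x = 0" for y
    by (subst coord_sum[of y, symmetric], unfold form_sum_left)
       (intro sum.neutral ballI, simp add: form_scale_left assms)
  obtain x0 x1 where x: "x0 \<in> A 0" "x1 \<in> A 1" "x = x0 + x1" using A_sum by blast
  obtain y0 y1 where y: "y0 \<in> A 0" "y1 \<in> A 1" "y = y0 + y1" using A_sum by blast
  have "form y0 x1 = 0" "form y1 x0 = 0" "form x0 y1 = 0" "form x1 y0 = 0"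
    using form_parity x y by (metis zero_neq_one)+
  moreover have "form x0 y0 = form y0 x0" "form x1 y1 = - form y1 x1"
    using form_supersymmetric[OF x(1) y(1)] form_supersymmetric[OF x(2) y(2)] by simp_all
  ultimately show "form x y = 0" using z[of y0] z[of y1]
    by (simp add: x(3) y(3) form_add_left form_add_right)
qed

text \<open>The map $x\mapsto\sum_b\langle b,x\rangle b$ is injective by nondegeneracy, hence
  surjective by finite dimension, and preimages of basis elements are dual to the basis. Passing
  to the homogeneous component of the right parity keeps the duality, as the form is even.\<close>

lemma dual_basis_exists:
  "\<exists>d. \<forall>i. \<forall>l\<in>{1..dim (A i)}. d i l \<in> A i \<and>
     (\<forall>j. \<forall>k\<in>{1..dim (A j)}. form (e j k) (d i l) = (if j = i \<and> k = l then 1 else 0))"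
proof -
  have fin: "finite hom_basis" by (simp add: hom_basis_eq)
  interpret fd: finite_dimensional_vector_space sA hom_basis
    by unfold_locales (simp_all add: fin hom_basis_independent hom_basis_span)
  define \<Phi> where "\<Phi> x = (\<Sum>b\<in>hom_basis. sA (form b x) b)" for x
  have lin: "Vector_Spaces.linear sA sA \<Phi>"
    by unfold_locales (simp_all add: \<Phi>_def form_add_right form_scale_right scale_left_distrib sum.distrib scale_sum_right)
  have co: "representation hom_basis (\<Phi> x) b = form b x" if "b \<in> hom_basis" for b x
    unfolding \<Phi>_def using that fin
    by (subst representation_sum[OF hom_basis_independent])
       (simp_all add: hom_basis_span representation_scale[OF hom_basis_independent] representation_basis[OF hom_basis_independent]
         if_distrib[of "(*) _"] sum.delta cong: if_cong)
  have "inj \<Phi>"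
  proof (rule injI)
    fix x y assume eq: "\<Phi> x = \<Phi> y"
    have "form b (x - y) = 0" if "b \<in> hom_basis" for b
      using co[OF that, of x] co[OF that, of y] form_add_right[of b "x - y" y] eq by simp
    moreover have "e i l \<in> hom_basis" if "l \<in> {1..dim (A i)}" for i l using that unfolding hom_basis_def by blast
    ultimately have "x - y = 0" by (intro form_nondegenerate_left) blast
    then show "x = y" by simp
  qed
  then have surj: "surj \<Phi>" by (rule fd.linear_inj_imp_surj[OF lin])
  have "\<exists>d\<in>A i. \<forall>j. \<forall>k\<in>{1..dim (A j)}. form (e j k) d = (if j = i \<and> k = l then 1 else 0)"
    if l: "l \<in> {1..dim (A i)}" for i l
  proof -
    obtain x where x: "\<Phi> x = e i l" using surj by (metis surjD)
    have fx: "form (e j k) x = (if j = i \<and> k = l then 1 else 0)" if k: "k \<in> {1..dim (A j)}" for j k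
    proof -
      have B: "e j k \<in> hom_basis" "e i l \<in> hom_basis" using k l unfolding hom_basis_def by blast+
      show ?thesis using co[OF B(1), of x] e_eq_iff[OF k l] B
        by (simp add: x representation_basis[OF hom_basis_independent])
    qed
    obtain x0 x1 where x01: "x0 \<in> A 0" "x1 \<in> A 1" "x = x0 + x1" using A_sum by blast
    (* The component of x of the parity of e i l. *)
    define y where "y = (if i = 0 then x0 else x1)"
    have y: "y \<in> A i" using x01 bit_cases2[of i] by (auto simp: y_def)
    have "form (e j k) y = (if j = i \<and> k = l then 1 else 0)" if k: "k \<in> {1..dim (A j)}" for j k
    proof (cases "i = j")
      case True
      have "form (e j k) (x0 + x1) = form (e j k) y"
        using form_parity[OF e_in_A[OF k] x01(1)] form_parity[OF e_in_A[OF k] x01(2)] True bit_cases2[of j]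
        by (auto simp: y_def form_add_right)
      then show ?thesis using fx[OF k] x01 by simp
    next
      case False
      then show ?thesis using form_parity[OF e_in_A[OF k] y] by simp
    qed
    then show ?thesis using y by blast
  qed
  then have "\<forall>i l. \<exists>d. l \<in> {1..dim (A i)} \<longrightarrow> d \<in> A i \<and>
      (\<forall>j. \<forall>k\<in>{1..dim (A j)}. form (e j k) d = (if j = i \<and> k = l then 1 else 0))"
    by blast
  then obtain d where "\<forall>i l. l \<in> {1..dim (A i)} \<longrightarrow> d i l \<in> A i \<and>
      (\<forall>j. \<forall>k\<in>{1..dim (A j)}. form (e j k) (d i l) = (if j = i \<and> k = l then 1 else 0))"
    unfolding choice_iff by blast
  then show ?thesis by blast
qed

end

section \<open>Products of pseudo-differential operators\<close>

lemma sum_swap3: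
  "(\<Sum>l\<in>S. \<Sum>m\<in>M. \<Sum>n\<in>N. X l m n) = (\<Sum>m\<in>M. \<Sum>n\<in>N. \<Sum>l\<in>S. X l m n)"
proof -
  have "(\<Sum>l\<in>S. \<Sum>m\<in>M. \<Sum>n\<in>N. X l m n) = (\<Sum>m\<in>M. \<Sum>l\<in>S. \<Sum>n\<in>N. X l m n)"
    by (rule sum.swap)
  also have "\<dots> = (\<Sum>m\<in>M. \<Sum>n\<in>N. \<Sum>l\<in>S. X l m n)"
    by (rule sum.cong[OF refl], rule sum.swap)
  finally show ?thesis .
qed

lemma sum_swap4:
  "(\<Sum>l\<in>S. \<Sum>k\<in>K. \<Sum>m\<in>M. \<Sum>n\<in>N. X l k m n) = (\<Sum>m\<in>M. \<Sum>n\<in>N. \<Sum>k\<in>K. \<Sum>l\<in>S. X l k m n)"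
proof -
  have "(\<Sum>l\<in>S. \<Sum>k\<in>K. \<Sum>m\<in>M. \<Sum>n\<in>N. X l k m n) = (\<Sum>k\<in>K. \<Sum>l\<in>S. \<Sum>m\<in>M. \<Sum>n\<in>N. X l k m n)"
    by (rule sum.swap)
  also have "\<dots> = (\<Sum>k\<in>K. \<Sum>m\<in>M. \<Sum>n\<in>N. \<Sum>l\<in>S. X l k m n)"
    by (rule sum.cong[OF refl], rule sum_swap3)
  also have "\<dots> = (\<Sum>m\<in>M. \<Sum>n\<in>N. \<Sum>k\<in>K. \<Sum>l\<in>S. X l k m n)"
    by (rule sum_swap3)
  finally show ?thesis .
qed

text \<open>The product of operators and the residue form are built in the same way from a
  bilinear map on coefficients: the product of $\hat{\mathcal A}$ in one case, the
  $\mathcal P$-valued form in the other. Associativity of the product and invariance of the form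
  are then a single statement about \<open>F\<close>, and so are the two Leibniz rules for
  evolutionary vector fields \<open>Ev\<close>.\<close>

locale coeff_pairing = kp_superalgebra sA A form \<iota> e
  for sA :: "'f::real_or_complex \<Rightarrow> 'a::ring \<Rightarrow> 'a" and A form \<iota> e +
  fixes F :: "'f ahat \<Rightarrow> 'f ahat \<Rightarrow> 't::ab_group_add" and sc :: "'f \<Rightarrow> 't \<Rightarrow> 't"
    and Ev :: "'f psdo \<Rightarrow> 't \<Rightarrow> 't"
  assumes F_add_left: "F (a + b) c = F a c + F b c"
    and F_add_right: "F a (b + c) = F a b + F a c"
    and sc_add: "sc t (x + y) = sc t x + sc t y"
    and sc_add_left: "sc (t + d) x = sc t x + sc d x"
    and sc_sc: "sc t (sc d x) = sc (t * d) x"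
    and sc_one [simp]: "sc 1 x = x"
    and F_sc_left: "\<lbrakk>a \<in> Ah; b \<in> Ah\<rbrakk> \<Longrightarrow> F (ah_scl t a) b = sc t (F a b)"
    and F_sc_right: "\<lbrakk>a \<in> Ah; b \<in> Ah\<rbrakk> \<Longrightarrow> F a (ah_scl t b) = sc t (F a b)"
    and F_assoc: "\<lbrakk>a \<in> Ah; b \<in> Ah; c \<in> Ah\<rbrakk> \<Longrightarrow> F (ah_mult a b) c = F a (ah_mult b c)"
    and Ev_add: "Ev v (x + y) = Ev v x + Ev v y"
    and Ev_sc: "Ev v (sc t x) = sc t (Ev v x)"
    and Ev_F: "\<lbrakk>evo_hom k v; a \<in> Ah_part i; b \<in> Ah\<rbrakk> \<Longrightarrow>
      Ev v (F a b) = F (ah_evo v a) b + sc (psign (k * i)) (F a (ah_evo v b))"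
begin

lemma F_zero [simp]: "F 0 b = 0" "F a 0 = 0"
  using F_add_left[of 0 0 b] F_add_right[of a 0 0] by simp_all

lemma sc_zero [simp]: "sc c 0 = 0" "sc 0 x = 0"
  using sc_add[of c 0 0] sc_add_left[of 0 0 x] by simp_all

lemma Ev_zero [simp]: "Ev v 0 = 0"
  using Ev_add[of v 0 0] by simp

lemma F_sum_right: "F a (sum f B) = (\<Sum>x\<in>B. F a (f x))"
  by (rule additive_sum) (rule F_add_right)

lemma sc_sum: "sc c (sum f B) = (\<Sum>x\<in>B. sc c (f x))"
  by (rule additive_sum) (rule sc_add)

lemma sc_sum_left: "sc (sum f B) x = (\<Sum>b\<in>B. sc (f b) x)"
  by (rule additive_sum[where f = "\<lambda>c. sc c x"]) (rule sc_add_left)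

lemma Ev_sum: "Ev v (sum f B) = (\<Sum>x\<in>B. Ev v (f x))"
  by (rule additive_sum) (rule Ev_add)

text \<open>The contribution of $a\partial^m$ and $b\partial^n$ to order \<open>r\<close>: the
  number of derivatives that fall on \<open>b\<close> is $m+n-r$.\<close>

definition gterm :: "int \<Rightarrow> int \<Rightarrow> int \<Rightarrow> 'f ahat \<Rightarrow> 'f ahat \<Rightarrow> 't" where
  "gterm m n r a b = (if m + n \<ge> r
     then sc (of_int m gchoose nat (m + n - r)) (F a ((ah_ddx ^^ nat (m + n - r)) b)) else 0)"

definition gprod :: "'f psdo \<Rightarrow> 'f psdo \<Rightarrow> int \<Rightarrow> 't" where
  "gprod v w r = Sum_any (\<lambda>(m, n, p::nat).
     if m + n - int p = r
     then sc (of_int m gchoose p) (F (v m) ((ah_ddx ^^ p) (w n))) else 0)"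

lemma gterm_zero [simp]: "gterm m n r 0 b = 0" "gterm m n r a 0 = 0"
  by (simp_all add: gterm_def)

lemma gterm_add:
  "gterm m n r (a + a') b = gterm m n r a b + gterm m n r a' b"
  "gterm m n r a (b + b') = gterm m n r a b + gterm m n r a b'"
  by (simp_all add: gterm_def F_add_left F_add_right sc_add ah_ddx_pow_add)

lemma gterm_scl:
  "a \<in> Ah \<Longrightarrow> b \<in> Ah \<Longrightarrow> gterm m n r (ah_scl c a) b = sc c (gterm m n r a b)"
  "a \<in> Ah \<Longrightarrow> b \<in> Ah \<Longrightarrow> gterm m n r a (ah_scl c b) = sc c (gterm m n r a b)"
  by (simp_all add: gterm_def F_sc_left F_sc_right Ah_ddx_pow ah_ddx_pow_scl sc_sc mult.commute)

lemma gterm_sum_left: "gterm m n r (sum f B) b = (\<Sum>x\<in>B. gterm m n r (f x) b)"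
  by (rule additive_sum) (rule gterm_add)

lemma gterm_sum_right: "gterm m n r a (sum f B) = (\<Sum>x\<in>B. gterm m n r a (f x))"
  by (rule additive_sum) (rule gterm_add)

text \<open>For operators of order at most \<open>M\<close> and \<open>N\<close> only finitely
  many pairs contribute to order \<open>r\<close>. The box may be enlarged at will, which allows
  several products to be summed over a common box.\<close>

lemma gprod_box:
  assumes v: "\<And>m. m > M \<Longrightarrow> v m = 0" and w: "\<And>n. n > N \<Longrightarrow> w n = 0"
    and S: "finite S" "{r - N..M} \<subseteq> S" and T: "finite T" "{r - M..N} \<subseteq> T"
  shows "gprod v w r = (\<Sum>m\<in>S. \<Sum>n\<in>T. gterm m n r (v m) (w n))"
proof -
  let ?h = "\<lambda>(m, n). (m, n, nat (m + n - r))"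
  let ?g = "\<lambda>(m, n, p::nat). if m + n - int p = r
     then sc (of_int m gchoose p) (F (v m) ((ah_ddx ^^ p) (w n))) else 0"
  let ?C = "{x \<in> S \<times> T. fst x + snd x \<ge> r}"
  have fin: "finite ?C" using S T by simp
  have "gprod v w r = sum ?g (?h ` ?C)"
    unfolding gprod_def
  proof (rule Sum_any.expand_superset)
    show "finite (?h ` ?C)" using fin by simp
    show "{x. ?g x \<noteq> 0} \<subseteq> ?h ` ?C"
    proof
      fix x assume x: "x \<in> {x. ?g x \<noteq> 0}"
      obtain m n p where mnp: "x = (m, n, p)" by (rule prod_cases3)
      have r: "m + n - int p = r" and "v m \<noteq> 0" "w n \<noteq> 0"
        using x by (auto simp: mnp split: if_splits)
      then have "m \<le> M" "n \<le> N" using v w by (meson not_le)+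
      then have "m \<in> S" "n \<in> T" using r S T by auto
      then have "(m, n) \<in> ?C" using r by simp
      moreover have "x = ?h (m, n)" using r by (simp add: mnp)
      ultimately show "x \<in> ?h ` ?C" by blast
    qed
  qed
  also have "\<dots> = (\<Sum>x\<in>?C. ?g (?h x))"
    by (rule sum.reindex_cong[of ?h]) (auto simp: inj_on_def)
  also have "\<dots> = (\<Sum>x\<in>?C. gterm (fst x) (snd x) r (v (fst x)) (w (snd x)))"
    by (rule sum.cong) (auto simp: gterm_def)
  also have "\<dots> = (\<Sum>x\<in>S \<times> T. gterm (fst x) (snd x) r (v (fst x)) (w (snd x)))"
    by (rule sum.mono_neutral_left) (use S T in \<open>auto simp: gterm_def\<close>)
  also have "\<dots> = (\<Sum>m\<in>S. \<Sum>n\<in>T. gterm m n r (v m) (w n))"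
    by (simp add: sum.cartesian_product case_prod_unfold)
  finally show ?thesis .
qed

end

context kp_superalgebra
begin

sublocale mult_pairing: coeff_pairing sA A form \<iota> e ah_mult ah_scl ah_evo
proof unfold_locales
  fix k i a b and v :: "'f psdo" assume "evo_hom k v" "a \<in> Ah_part i" "b \<in> Ah"
  then show "ah_evo v (ah_mult a b) = ah_mult (ah_evo v a) b + ah_scl (psign (k * i)) (ah_mult a (ah_evo v b))"
    by (elim AhE) (simp add: ah_mult_add_left ah_mult_add_right ah_evo_add ah_scl_add ah_evo_mult_hom algebra_simps)
qed (simp_all add: ah_mult_add_left ah_mult_add_right ah_scl_add ah_scl_add_left ah_scl_scl ah_mult_scl
    ah_mult_assoc ah_evo_add ah_evo_scl)

sublocale form_pairing: coeff_pairing sA A form \<iota> e ah_form scl evo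
proof unfold_locales
  fix k i a b and v :: "'f psdo" assume "evo_hom k v" "a \<in> Ah_part i" "b \<in> Ah"
  then show "evo v (ah_form a b) = ah_form (ah_evo v a) b + scl (psign (k * i)) (ah_form a (ah_evo v b))"
    by (elim AhE) (simp add: ah_form_add_left ah_form_add_right ah_evo_add evo_add scl_add ah_form_evo_hom algebra_simps)
qed (simp_all add: ah_form_add_left ah_form_add_right scl_add scl_add_left scl_scl ah_form_scl
    ah_form_assoc evo_add evo_scl)

lemma d_mult_gprod: "d_mult v w = mult_pairing.gprod v w"
  by (rule ext) (simp add: d_mult_def mult_pairing.gprod_def)

definition order_le :: "int \<Rightarrow> 'f psdo \<Rightarrow> bool" where
  "order_le N v \<longleftrightarrow> (\<forall>l>N. v l = 0)"

lemma order_le_mono: "order_le N v \<Longrightarrow> N \<le> N' \<Longrightarrow> order_le N' v"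
  by (simp add: order_le_def)

text \<open>The component $\mathcal D_i$, and $\mathcal D$ below: a family of coefficients is an
  operator only if its orders are bounded from above.\<close>

definition Dp :: "bit \<Rightarrow> 'f psdo set" where
  "Dp i = {v. (\<forall>l. v l \<in> Ah_part i) \<and> (\<exists>N. order_le N v)}"

definition DD :: "'f psdo set" where
  "DD = {v. (\<forall>l. v l \<in> Ah) \<and> (\<exists>N. order_le N v)}"

lemma Leibniz:
  assumes "a \<in> Ah" "b \<in> Ah"
  shows "(ah_ddx ^^ p) (ah_mult a b) =
    (\<Sum>s\<le>p. ah_scl (of_nat (p choose s)) (ah_mult ((ah_ddx ^^ s) a) ((ah_ddx ^^ (p - s)) b)))"
proof (induction p)
  case (Suc p)
  let ?T = "\<lambda>s. ah_mult ((ah_ddx ^^ s) a) ((ah_ddx ^^ (Suc p - s)) b)"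
  let ?c = "\<lambda>s. of_nat (p choose s) :: 'f"
  have "(ah_ddx ^^ Suc p) (ah_mult a b) =
    (\<Sum>s\<le>p. ah_scl (?c s) (ah_ddx (ah_mult ((ah_ddx ^^ s) a) ((ah_ddx ^^ (p - s)) b))))"
    by (simp add: Suc additive_sum[of ah_ddx, OF ah_ddx_add] ah_ddx_scl)
  also have "\<dots> = (\<Sum>s\<le>p. ah_scl (?c s) (?T (Suc s)) + ah_scl (?c s) (?T s))"
    by (rule sum.cong[OF refl])
       (simp add: ah_ddx_mult Ah_ddx_pow assms ah_scl_add Suc_diff_le)
  also have "\<dots> = (\<Sum>s\<le>p. ah_scl (?c s) (?T (Suc s))) + (\<Sum>s\<le>Suc p. ah_scl (?c s) (?T s))"
    by (simp add: sum.distrib binomial_eq_0)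
  also have "\<dots> = (\<Sum>s\<le>p. ah_scl (?c s + ?c (Suc s)) (?T (Suc s))) + ah_scl (?c 0) (?T 0)"
    by (simp only: sum.atMost_Suc_shift ah_scl_add_left sum.distrib add_ac)
  also have "\<dots> = (\<Sum>s\<le>Suc p. ah_scl (of_nat (Suc p choose s)) (?T s))"
    by (simp only: sum.atMost_Suc_shift binomial_Suc_Suc of_nat_add binomial_n_0 add_ac)
  finally show ?case .
qed simp

end

context coeff_pairing
begin

text \<open>Both sides are combinations of $F(a,b^{(s)}c^{(N-s)})$ with \<open>N\<close> the total
  number of derivatives. On the left the coefficient is $\binom ms\binom{m+n-s}{N-s}$. On the
  right the Leibniz rule gives $\sum_q\binom m{N-q}\binom nq\binom{N-q}s$. Since
  $\binom m{N-q}\binom{N-q}s=\binom ms\binom{m-s}{N-q-s}$, the sum is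
  $\binom ms\binom{m+n-s}{N-s}$ by the Vandermonde identity.\<close>

lemma gprod_assoc_term:
  assumes Ah: "a \<in> Ah" "b \<in> Ah" "c \<in> Ah" and S: "finite S" "{r - k..m + n} \<subseteq> S" and T: "finite T" "{r - m..n + k} \<subseteq> T"
  shows "(\<Sum>l\<in>S. gterm l k r (mult_pairing.gterm m n l a b) c) = (\<Sum>l\<in>T. gterm m l r a (mult_pairing.gterm n k l b c))"
proof (cases "r \<le> m + n + k")
  case False
  have "(\<Sum>l\<in>S. gterm l k r (mult_pairing.gterm m n l a b) c) = 0"
    by (rule sum.neutral) (use False in \<open>auto simp: gterm_def mult_pairing.gterm_def\<close>)
  moreover have "(\<Sum>l\<in>T. gterm m l r a (mult_pairing.gterm n k l b c)) = 0"
    by (rule sum.neutral) (use False in \<open>auto simp: gterm_def mult_pairing.gterm_def\<close>)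
  ultimately show ?thesis by simp
next
  case True
  define N where "N = nat (m + n + k - r)"
  have N: "int N = m + n + k - r" using True by (simp add: N_def)
  let ?X = "\<lambda>s. F a (ah_mult ((ah_ddx ^^ s) b) ((ah_ddx ^^ (N - s)) c))"
  have "(\<Sum>l\<in>S. gterm l k r (mult_pairing.gterm m n l a b) c) = (\<Sum>l\<in>{r - k..m + n}. gterm l k r (mult_pairing.gterm m n l a b) c)"
    by (rule sum.mono_neutral_right) (use S in \<open>auto simp: gterm_def mult_pairing.gterm_def\<close>)
  also have "\<dots> = (\<Sum>s\<le>N. gterm (m + n - int s) k r (mult_pairing.gterm m n (m + n - int s) a b) c)"
    by (rule sum.reindex_bij_witness[of _ "\<lambda>s. m + n - int s" "\<lambda>l. nat (m + n - l)"]) (use N in auto)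
  also have "\<dots> = (\<Sum>s\<le>N. sc ((of_int m gchoose s) * (of_int (m + n - int s) gchoose (N - s))) (?X s))"
  proof (rule sum.cong[OF refl])
    fix s assume "s \<in> {..N}"
    then have s: "nat (m + n - int s + k - r) = N - s" "m + n - int s + k \<ge> r" using N by auto
    show "gterm (m + n - int s) k r (mult_pairing.gterm m n (m + n - int s) a b) c =
      sc ((of_int m gchoose s) * (of_int (m + n - int s) gchoose (N - s))) (?X s)"
      using s Ah by (simp add: gterm_def mult_pairing.gterm_def F_sc_left Ah_mult Ah_ddx_pow F_assoc sc_sc mult.commute)
  qed
  finally have L: "(\<Sum>l\<in>S. gterm l k r (mult_pairing.gterm m n l a b) c) =
    (\<Sum>s\<le>N. sc ((of_int m gchoose s) * (of_int (m + n - int s) gchoose (N - s))) (?X s))" .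
  have "(\<Sum>l\<in>T. gterm m l r a (mult_pairing.gterm n k l b c)) = (\<Sum>l\<in>{r - m..n + k}. gterm m l r a (mult_pairing.gterm n k l b c))"
    by (rule sum.mono_neutral_right) (use T in \<open>auto simp: gterm_def mult_pairing.gterm_def\<close>)
  also have "\<dots> = (\<Sum>q\<le>N. gterm m (n + k - int q) r a (mult_pairing.gterm n k (n + k - int q) b c))"
    by (rule sum.reindex_bij_witness[of _ "\<lambda>s. n + k - int s" "\<lambda>l. nat (n + k - l)"]) (use N in auto)
  also have "\<dots> = (\<Sum>q\<le>N. \<Sum>s\<le>N - q.
      sc ((of_int m gchoose (N - q)) * (of_int n gchoose q) * of_nat (N - q choose s)) (?X s))"
  proof (rule sum.cong[OF refl])
    fix q assume "q \<in> {..N}"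
    then have q: "nat (m + (n + k - int q) - r) = N - q" "m + (n + k - int q) \<ge> r" "q \<le> N" using N by auto
    have "(ah_ddx ^^ (N - q)) (ah_mult b ((ah_ddx ^^ q) c)) =
        (\<Sum>s\<le>N - q. ah_scl (of_nat (N - q choose s)) (ah_mult ((ah_ddx ^^ s) b) ((ah_ddx ^^ (N - s)) c)))"
    proof -
      have "(ah_ddx ^^ (N - q - s)) ((ah_ddx ^^ q) c) = (ah_ddx ^^ (N - s)) c" if "s \<le> N - q" for s
        using that q(3) by (simp add: comp_apply[symmetric, of "ah_ddx ^^ _"] funpow_add[symmetric] del: comp_apply)
      then show ?thesis by (subst Leibniz) (use Ah in \<open>simp_all add: Ah_ddx_pow\<close>)
    qed
    then show "gterm m (n + k - int q) r a (mult_pairing.gterm n k (n + k - int q) b c) = (\<Sum>s\<le>N - q.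
      sc ((of_int m gchoose (N - q)) * (of_int n gchoose q) * of_nat (N - q choose s)) (?X s))"
      using q Ah
      by (simp add: gterm_def mult_pairing.gterm_def ah_ddx_pow_scl F_sc_right Ah_mult Ah_ddx_pow F_sum_right
          sc_sum sc_sc mult.assoc Ah_sum Ah_scl)
  qed
  also have "\<dots> = (\<Sum>(q, s)\<in>Sigma {..N} (\<lambda>q. {..N - q}).
      sc ((of_int m gchoose (N - q)) * (of_int n gchoose q) * of_nat (N - q choose s)) (?X s))"
    by (simp add: sum.Sigma)
  also have "\<dots> = (\<Sum>(s, q)\<in>Sigma {..N} (\<lambda>s. {..N - s}).
      sc ((of_int m gchoose (N - q)) * (of_int n gchoose q) * of_nat (N - q choose s)) (?X s))"
    by (rule sum.reindex_bij_witness[of _ "\<lambda>(s, q). (q, s)" "\<lambda>(q, s). (s, q)"]) auto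
  also have "\<dots> = (\<Sum>s\<le>N. \<Sum>q\<le>N - s.
      sc ((of_int m gchoose (N - q)) * (of_int n gchoose q) * of_nat (N - q choose s)) (?X s))"
    by (simp add: sum.Sigma)
  also have "\<dots> = (\<Sum>s\<le>N. sc ((of_int m gchoose s) * (of_int (m + n - int s) gchoose (N - s))) (?X s))"
  proof (rule sum.cong[OF refl])
    fix s assume s: "s \<in> {..N}"
    have "(\<Sum>q\<le>N - s. (of_int m gchoose (N - q)) * (of_int n gchoose q) * of_nat (N - q choose s)) =
        (\<Sum>q\<le>N - s. (of_int m gchoose s) * ((of_int n gchoose q) * ((of_int m - of_nat s) gchoose (N - s - q))) :: 'f)"
    proof (rule sum.cong[OF refl])
      fix q assume "q \<in> {..N - s}"
      then have "s \<le> N - q" "N - q - s = N - s - q" using s by auto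
      then have "(of_int m gchoose (N - q)) * of_nat (N - q choose s) =
          (of_int m gchoose s) * ((of_int m - of_nat s) gchoose (N - s - q) :: 'f)"
        using gbinomial_trinomial_revision[of s "N - q" "of_int m :: 'f"] by (simp add: binomial_gbinomial)
      from arg_cong[OF this, of "\<lambda>x. x * (of_int n gchoose q)"]
      show "(of_int m gchoose (N - q)) * (of_int n gchoose q) * of_nat (N - q choose s) =
          (of_int m gchoose s) * ((of_int n gchoose q) * ((of_int m - of_nat s) gchoose (N - s - q)) :: 'f)"
        by (simp only: mult_ac)
    qed
    also have "\<dots> = (of_int m gchoose s) * ((of_int n + (of_int m - of_nat s)) gchoose (N - s))"
      by (simp only: sum_distrib_left[symmetric] gbinomial_Vandermonde atMost_atLeast0)
    also have "(of_int n + (of_int m - of_nat s) :: 'f) = of_int (m + n - int s)" by simp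
    finally show "(\<Sum>q\<le>N - s. sc ((of_int m gchoose (N - q)) * (of_int n gchoose q) * of_nat (N - q choose s)) (?X s)) =
        sc ((of_int m gchoose s) * (of_int (m + n - int s) gchoose (N - s))) (?X s)"
      by (simp only: sc_sum_left[symmetric])
  qed
  finally show ?thesis using L by simp
qed

end

context kp_superalgebra
begin

lemma mult_pairing_gterm_Ah_part: "a \<in> Ah_part i \<Longrightarrow> b \<in> Ah_part j \<Longrightarrow> mult_pairing.gterm m n r a b \<in> Ah_part (i + j)"
  by (auto simp: mult_pairing.gterm_def intro!: Ah_part_scl Ah_part_mult Ah_part_ddx_pow)

lemma mult_pairing_gterm_Ah: "a \<in> Ah \<Longrightarrow> b \<in> Ah \<Longrightarrow> mult_pairing.gterm m n r a b \<in> Ah"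
  by (auto simp: mult_pairing.gterm_def intro!: Ah_scl Ah_mult Ah_ddx_pow)

lemma form_pairing_gterm_P_part: "a \<in> Ah_part i \<Longrightarrow> b \<in> Ah_part j \<Longrightarrow> form_pairing.gterm m n r a b \<in> P_part (i + j)"
  by (auto simp: form_pairing.gterm_def intro!: P_part_intros ah_form_P_part Ah_part_ddx_pow)

lemma d_mult_box:
  assumes "order_le M v" "order_le N w" "finite S" "{r - N..M} \<subseteq> S" "finite T" "{r - M..N} \<subseteq> T"
  shows "d_mult v w r = (\<Sum>m\<in>S. \<Sum>n\<in>T. mult_pairing.gterm m n r (v m) (w n))"
  unfolding d_mult_gprod by (rule mult_pairing.gprod_box) (use assms in \<open>auto simp: order_le_def\<close>)

lemma order_le_mult:
  assumes "order_le M v" "order_le N w" shows "order_le (M + N) (d_mult v w)"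
  unfolding order_le_def
proof (intro allI impI)
  fix r assume r: "M + N < r"
  have "d_mult v w r = (\<Sum>m\<in>{r - N..M}. \<Sum>n\<in>{r - M..N}. mult_pairing.gterm m n r (v m) (w n))"
    by (rule d_mult_box[OF assms]) auto
  then show "d_mult v w r = 0" using r by simp
qed

lemma Dp_mult:
  assumes "v \<in> Dp i" "w \<in> Dp j" shows "d_mult v w \<in> Dp (i + j)"
proof -
  obtain M N where MN: "order_le M v" "order_le N w" using assms by (auto simp: Dp_def)
  have "d_mult v w r \<in> Ah_part (i + j)" for r
  proof -
    have "d_mult v w r = (\<Sum>m\<in>{r - N..M}. \<Sum>n\<in>{r - M..N}. mult_pairing.gterm m n r (v m) (w n))"
      by (rule d_mult_box[OF MN]) auto
    also have "\<dots> \<in> Ah_part (i + j)"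
      by (intro Ah_part_sum mult_pairing_gterm_Ah_part) (use assms in \<open>auto simp: Dp_def\<close>)
    finally show ?thesis .
  qed
  then show ?thesis using order_le_mult[OF MN] by (auto simp: Dp_def)
qed

lemma DD_mult:
  assumes "v \<in> DD" "w \<in> DD" shows "d_mult v w \<in> DD"
proof -
  obtain M N where MN: "order_le M v" "order_le N w" using assms by (auto simp: DD_def)
  have "d_mult v w r \<in> Ah" for r
  proof -
    have "d_mult v w r = (\<Sum>m\<in>{r - N..M}. \<Sum>n\<in>{r - M..N}. mult_pairing.gterm m n r (v m) (w n))"
      by (rule d_mult_box[OF MN]) auto
    also have "\<dots> \<in> Ah"
      by (intro Ah_sum mult_pairing_gterm_Ah) (use assms in \<open>auto simp: DD_def\<close>)
    finally show ?thesis .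
  qed
  then show ?thesis using order_le_mult[OF MN] by (auto simp: DD_def)
qed

end

context coeff_pairing
begin

lemma gprod_order_le_box:
  assumes "order_le M v" "order_le N w" "finite S" "{r - N..M} \<subseteq> S" "finite T" "{r - M..N} \<subseteq> T"
  shows "gprod v w r = (\<Sum>m\<in>S. \<Sum>n\<in>T. gterm m n r (v m) (w n))"
  by (rule gprod_box) (use assms in \<open>auto simp: order_le_def\<close>)

lemma gprod_assoc:
  assumes D: "v \<in> DD" "w \<in> DD" "u \<in> DD"
  shows "gprod (d_mult v w) u r = gprod v (d_mult w u) r"
proof -
  obtain M N K where bd: "order_le M v" "order_le N w" "order_le K u" using D by (auto simp: DD_def)
  (* A common range for the orders of all three factors. The absolute values make it large enough
     whatever the signs of the bounds. *)
  define lo where "lo = min (r - M - N) (min (r - M - K) (r - N - K)) - \<bar>M\<bar> - \<bar>N\<bar> - \<bar>K\<bar>"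
  define hi where "hi = max M (max N K)"
  let ?J = "{lo..hi}" and ?S = "{r - K..M + N}" and ?T = "{r - M..N + K}"
  have "gprod (d_mult v w) u r = (\<Sum>l\<in>?S. \<Sum>k\<in>?J. gterm l k r (d_mult v w l) (u k))"
    by (rule gprod_order_le_box[OF order_le_mult[OF bd(1,2)] bd(3)]) (auto simp: lo_def hi_def)
  also have "\<dots> = (\<Sum>l\<in>?S. \<Sum>k\<in>?J. \<Sum>m\<in>?J. \<Sum>n\<in>?J. gterm l k r (mult_pairing.gterm m n l (v m) (w n)) (u k))"
  proof (intro sum.cong refl)
    fix l k assume l: "l \<in> ?S"
    have "d_mult v w l = (\<Sum>m\<in>?J. \<Sum>n\<in>?J. mult_pairing.gterm m n l (v m) (w n))"
      by (rule d_mult_box[OF bd(1,2)]) (use l in \<open>auto simp: lo_def hi_def\<close>)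
    then show "gterm l k r (d_mult v w l) (u k) = (\<Sum>m\<in>?J. \<Sum>n\<in>?J. gterm l k r (mult_pairing.gterm m n l (v m) (w n)) (u k))"
      by (simp add: gterm_sum_left)
  qed
  also have "\<dots> = (\<Sum>m\<in>?J. \<Sum>n\<in>?J. \<Sum>k\<in>?J. \<Sum>l\<in>?S. gterm l k r (mult_pairing.gterm m n l (v m) (w n)) (u k))"
    by (rule sum_swap4)
  also have "\<dots> = (\<Sum>m\<in>?J. \<Sum>n\<in>?J. \<Sum>k\<in>?J. \<Sum>l\<in>?T. gterm m l r (v m) (mult_pairing.gterm n k l (w n) (u k)))"
  proof ((rule sum.cong[OF refl])+)
    fix m n k
    show "(\<Sum>l\<in>?S. gterm l k r (mult_pairing.gterm m n l (v m) (w n)) (u k)) = (\<Sum>l\<in>?T. gterm m l r (v m) (mult_pairing.gterm n k l (w n) (u k)))"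
    proof (cases "m \<le> M \<and> n \<le> N \<and> k \<le> K")
      case True
      then show ?thesis by (intro gprod_assoc_term) (use D in \<open>auto simp: DD_def\<close>)
    next
      (* Orders beyond the bounds need not lie in the boxes, but there a coefficient vanishes. *)
      case False
      then have "v m = 0 \<or> w n = 0 \<or> u k = 0" using bd by (auto simp: order_le_def)
      then show ?thesis by auto
    qed
  qed
  also have "\<dots> = (\<Sum>m\<in>?J. \<Sum>l\<in>?T. \<Sum>n\<in>?J. \<Sum>k\<in>?J. gterm m l r (v m) (mult_pairing.gterm n k l (w n) (u k)))"
    by (rule sum.cong[OF refl], rule sum_swap3[symmetric])
  also have "\<dots> = (\<Sum>m\<in>?J. \<Sum>l\<in>?T. gterm m l r (v m) (d_mult w u l))"
  proof (intro sum.cong refl)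
    fix l m assume l: "l \<in> ?T"
    have "d_mult w u l = (\<Sum>n\<in>?J. \<Sum>k\<in>?J. mult_pairing.gterm n k l (w n) (u k))"
      by (rule d_mult_box[OF bd(2,3)]) (use l in \<open>auto simp: lo_def hi_def\<close>)
    then show "(\<Sum>n\<in>?J. \<Sum>k\<in>?J. gterm m l r (v m) (mult_pairing.gterm n k l (w n) (u k))) = gterm m l r (v m) (d_mult w u l)"
      by (simp add: gterm_sum_right)
  qed
  also have "\<dots> = gprod v (d_mult w u) r"
    by (rule gprod_order_le_box[OF bd(1) order_le_mult[OF bd(2,3)], symmetric]) (auto simp: lo_def hi_def)
  finally show ?thesis .
qed

text \<open>One box in which all products involved in an additivity statement or in a Leibniz rule
  are finite sums. The last clause covers coefficientwise maps such as scaling and evolutionary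
  vector fields.\<close>

lemma gprod_common_box:
  assumes "v \<in> DD" "w \<in> DD" "v' \<in> DD" "w' \<in> DD"
  obtains J where "finite J" "gprod v w r = (\<Sum>m\<in>J. \<Sum>n\<in>J. gterm m n r (v m) (w n))"
    "gprod v' w r = (\<Sum>m\<in>J. \<Sum>n\<in>J. gterm m n r (v' m) (w n))"
    "gprod v w' r = (\<Sum>m\<in>J. \<Sum>n\<in>J. gterm m n r (v m) (w' n))"
    "gprod (v + v') w r = (\<Sum>m\<in>J. \<Sum>n\<in>J. gterm m n r (v m + v' m) (w n))"
    "gprod v (w + w') r = (\<Sum>m\<in>J. \<Sum>n\<in>J. gterm m n r (v m) (w n + w' n))"
    "\<And>f g. f 0 = (0::'f ahat) \<Longrightarrow> g 0 = (0::'f ahat) \<Longrightarrow> gprod (\<lambda>l. f (v l)) (\<lambda>l. g (w l)) r =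
      (\<Sum>m\<in>J. \<Sum>n\<in>J. gterm m n r (f (v m)) (g (w n)))"
proof -
  obtain M N M' N' where b: "order_le M v" "order_le N w" "order_le M' v'" "order_le N' w'" using assms by (auto simp: DD_def)
  define K where "K = max (max M N) (max M' N')"
  have bd: "order_le K v" "order_le K w" "order_le K v'" "order_le K w'" using b by (auto intro: order_le_mono simp: K_def)
  then have bd': "order_le K (v + v')" "order_le K (w + w')" by (auto simp: order_le_def)
  have f: "finite {r - K..K}" by simp
  have box: "gprod x y r = (\<Sum>m\<in>{r - K..K}. \<Sum>n\<in>{r - K..K}. gterm m n r (x m) (y n))"
    if "order_le K x" "order_le K y" for x y
    by (rule gprod_order_le_box[OF that]) auto
  show ?thesis
  proof (rule that[OF f box[OF bd(1,2)] box[OF bd(3,2)] box[OF bd(1,4)]])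
    show "gprod (v + v') w r = (\<Sum>m\<in>{r - K..K}. \<Sum>n\<in>{r - K..K}. gterm m n r (v m + v' m) (w n))"
      using box[OF bd'(1) bd(2)] by simp
    show "gprod v (w + w') r = (\<Sum>m\<in>{r - K..K}. \<Sum>n\<in>{r - K..K}. gterm m n r (v m) (w n + w' n))"
      using box[OF bd(1) bd'(2)] by simp
  next
    fix f g :: "'f ahat \<Rightarrow> 'f ahat" assume z: "f 0 = (0::'f ahat)" "g 0 = (0::'f ahat)"
    have "order_le K (\<lambda>l. f (v l))" "order_le K (\<lambda>l. g (w l))" using bd(1,2) z by (auto simp: order_le_def)
    then show "gprod (\<lambda>l. f (v l)) (\<lambda>l. g (w l)) r =
        (\<Sum>m\<in>{r - K..K}. \<Sum>n\<in>{r - K..K}. gterm m n r (f (v m)) (g (w n)))" by (rule box)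
  qed
qed

lemma gprod_add_left: "\<lbrakk>v \<in> DD; v' \<in> DD; w \<in> DD\<rbrakk> \<Longrightarrow> gprod (v + v') w r = gprod v w r + gprod v' w r"
  by (rule gprod_common_box[of v w v' w r]) (simp_all add: gterm_add sum.distrib)

lemma gprod_add_right: "\<lbrakk>v \<in> DD; w \<in> DD; w' \<in> DD\<rbrakk> \<Longrightarrow> gprod v (w + w') r = gprod v w r + gprod v w' r"
  by (rule gprod_common_box[of v w v w' r]) (simp_all add: gterm_add sum.distrib)

lemma gprod_scl_left:
  assumes "v \<in> DD" "w \<in> DD" shows "gprod (d_scl c v) w r = sc c (gprod v w r)"
proof (rule gprod_common_box[of v w v w r, OF assms assms])
  fix J assume J: "gprod v w r = (\<Sum>m\<in>J. \<Sum>n\<in>J. gterm m n r (v m) (w n))"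
    and J2: "\<And>f g. f 0 = (0::'f ahat) \<Longrightarrow> g 0 = (0::'f ahat) \<Longrightarrow> gprod (\<lambda>l. f (v l)) (\<lambda>l. g (w l)) r =
      (\<Sum>m\<in>J. \<Sum>n\<in>J. gterm m n r (f (v m)) (g (w n)))"
  have "gprod (d_scl c v) w r = (\<Sum>m\<in>J. \<Sum>n\<in>J. gterm m n r (ah_scl c (v m)) (w n))"
    using J2[of "ah_scl c" "\<lambda>x. x"] by (simp add: d_scl_def)
  then show ?thesis using assms by (simp add: J gterm_scl sc_sum DD_def)
qed

lemma gprod_scl_right:
  assumes "v \<in> DD" "w \<in> DD" shows "gprod v (d_scl c w) r = sc c (gprod v w r)"
proof (rule gprod_common_box[of v w v w r, OF assms assms])
  fix J assume J: "gprod v w r = (\<Sum>m\<in>J. \<Sum>n\<in>J. gterm m n r (v m) (w n))"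
    and J2: "\<And>f g. f 0 = (0::'f ahat) \<Longrightarrow> g 0 = (0::'f ahat) \<Longrightarrow> gprod (\<lambda>l. f (v l)) (\<lambda>l. g (w l)) r =
      (\<Sum>m\<in>J. \<Sum>n\<in>J. gterm m n r (f (v m)) (g (w n)))"
  have "gprod v (d_scl c w) r = (\<Sum>m\<in>J. \<Sum>n\<in>J. gterm m n r (v m) (ah_scl c (w n)))"
    using J2[of "\<lambda>x. x" "ah_scl c"] by (simp add: d_scl_def)
  then show ?thesis using assms by (simp add: J gterm_scl sc_sum DD_def)
qed

lemma ah_evo_ddx:
  fixes v :: "'f psdo"
  assumes "evo_hom k v" shows "ah_evo v (ah_ddx a) = ah_ddx (ah_evo v a)"
  by (rule poly_mapping_eqI) (simp add: evo_ddx[OF assms])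

lemma ah_evo_ddx_pow:
  fixes v :: "'f psdo"
  assumes "evo_hom k v" shows "ah_evo v ((ah_ddx ^^ p) a) = (ah_ddx ^^ p) (ah_evo v a)"
  by (induction p) (simp_all add: ah_evo_ddx[OF assms])

lemma Ev_gterm:
  assumes "evo_hom k v" "a \<in> Ah_part i" "b \<in> Ah"
  shows "Ev v (gterm m n r a b) = gterm m n r (ah_evo v a) b + sc (psign (k * i)) (gterm m n r a (ah_evo v b))"
  using Ev_F[OF assms(1,2) Ah_ddx_pow[OF assms(3)]]
  by (simp add: gterm_def Ev_sc ah_evo_ddx_pow[OF assms(1)] sc_add sc_sc mult.commute)

text \<open>Evolutionary vector fields commute with $\partial$, so they pass through the
  derivatives in the product and only the coefficientwise Leibniz rule remains.\<close>

lemma Ev_gprod: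
  assumes v: "evo_hom k v" and a: "a \<in> Dp i" "a \<in> DD" and b: "b \<in> DD"
  shows "Ev v (gprod a b r) = gprod (evo_d v a) b r + sc (psign (k * i)) (gprod a (evo_d v b) r)"
proof (rule gprod_common_box[of a b a b r, OF a(2) b a(2) b])
  fix J assume J: "gprod a b r = (\<Sum>m\<in>J. \<Sum>n\<in>J. gterm m n r (a m) (b n))"
    and J2: "\<And>f g. f 0 = (0::'f ahat) \<Longrightarrow> g 0 = (0::'f ahat) \<Longrightarrow> gprod (\<lambda>l. f (a l)) (\<lambda>l. g (b l)) r =
      (\<Sum>m\<in>J. \<Sum>n\<in>J. gterm m n r (f (a m)) (g (b n)))"
  have "gprod (evo_d v a) b r = (\<Sum>m\<in>J. \<Sum>n\<in>J. gterm m n r (ah_evo v (a m)) (b n))"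
    using J2[of "ah_evo v" "\<lambda>x. x"] by (simp add: evo_d_eq)
  moreover have "gprod a (evo_d v b) r = (\<Sum>m\<in>J. \<Sum>n\<in>J. gterm m n r (a m) (ah_evo v (b n)))"
    using J2[of "\<lambda>x. x" "ah_evo v"] by (simp add: evo_d_eq)
  moreover have "Ev v (gterm m n r (a m) (b n)) = gterm m n r (ah_evo v (a m)) (b n) +
      sc (psign (k * i)) (gterm m n r (a m) (ah_evo v (b n)))" for m n
    by (rule Ev_gterm[OF v]) (use a b in \<open>auto simp: Dp_def DD_def\<close>)
  ultimately show ?thesis by (simp add: J Ev_sum sum.distrib sc_sum)
qed

end

section \<open>The Euler operator\<close>

lemma sp_partial_zero [simp]: "sp_partial i w 0 = 0"
  using sp_partial_scl[of i w 0 0] by simp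

lemma sp_partial_mult:
  "sp_hom j p \<Longrightarrow> sp_partial i w (p \<odot> q) = sp_partial i w p \<odot> q + scl (psign (i * j)) (p \<odot> sp_partial i w q)"
  using superderivation_partial[of i w] unfolding superderivation_def by blast

text \<open>The commutator of $\partial/\partial u^{(m)}$ with $\partial$ is the superderivation
  $\partial/\partial u^{(m-1)}$, as both agree on the symbols.\<close>

lemma partial_ddx:
  fixes p :: "'f::field_char_0 spoly"
  shows "sp_partial i (j1, j2, m) (ddx p) = ddx (sp_partial i (j1, j2, m) p) +
    (case m of 0 \<Rightarrow> 0 | Suc k \<Rightarrow> sp_partial i (j1, j2, k) p)"
proof -
  let ?d = "\<lambda>p. sp_partial i (j1, j2, m) (ddx p) - ddx (sp_partial i (j1, j2, m) p)"
  let ?d' = "\<lambda>p. case m of 0 \<Rightarrow> 0 | Suc k \<Rightarrow> sp_partial i (j1, j2, k) p"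
  have "superderivation (i + 0) (\<lambda>p. sp_partial i (j1, j2, m) (ddx p) - scl (psign (i * 0)) (ddx (sp_partial i (j1, j2, m) p)) :: 'f spoly)"
    by (rule superderivation_commutator[OF superderivation_partial superderivation_ddx])
       (auto intro: sp_hom_partial sp_hom_ddx)
  then have "superderivation i (?d :: 'f spoly \<Rightarrow> _)" by simp
  moreover have "superderivation i (?d' :: 'f spoly \<Rightarrow> _)"
  proof (cases m)
    case 0
    then show ?thesis by (simp add: superderivation_def)
  qed (simp add: superderivation_partial)
  moreover have "?d (U j w) = (?d' (U j w) :: 'f spoly)" for j w
    by (cases w) (auto simp: ddx_U sp_partial_U split: nat.split)
  ultimately have "?d p = ?d' p" by (rule superderivation_eqI)
  then show ?thesis by (simp add: algebra_simps)
qed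

lemma partial_supercomm:
  fixes p :: "'f::field_char_0 spoly"
  shows "sp_partial i v (sp_partial j w p) = scl (psign (i * j)) (sp_partial j w (sp_partial i v p))"
proof -
  have "superderivation (i + j) (\<lambda>p. sp_partial i v (sp_partial j w p) -
      scl (psign (i * j)) (sp_partial j w (sp_partial i v p)) :: 'f spoly)"
    by (rule superderivation_commutator[OF superderivation_partial superderivation_partial])
       (auto intro: sp_hom_partial)
  then have "sp_partial i v (sp_partial j w p) - scl (psign (i * j)) (sp_partial j w (sp_partial i v p)) = 0"
    by (rule superderivation_zero_imp) (auto simp: sp_partial_U)
  then show ?thesis by simp
qed

lemma partial_order_finite: "\<exists>M. \<forall>m\<ge>M. sp_partial i (j1, j2, m) p = 0"
proof -
  have "finite ((\<lambda>(i, j1, j2, m). m) ` {(i, w). sp_partial i w p \<noteq> 0})"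
    by (intro finite_imageI sp_partial_support)
  then obtain M where M: "\<forall>n\<in>(\<lambda>(i, j1, j2, m). m) ` {(i, w). sp_partial i w p \<noteq> 0}. n < M"
    using finite_nat_set_iff_bounded by blast
  have "sp_partial i (j1, j2, m) p = 0" if "m \<ge> M" for m
  proof (rule ccontr)
    assume "sp_partial i (j1, j2, m) p \<noteq> 0"
    then have "(i, (j1, j2, m)) \<in> {(i, w). sp_partial i w p \<noteq> 0}" by simp
    then have "m \<in> (\<lambda>(i, j1, j2, m). m) ` {(i, w). sp_partial i w p \<noteq> 0}"
      by (rule rev_image_eqI) simp
    then have "m < M" using M by blast
    then show False using that by simp
  qed
  then show ?thesis by blast
qed

text \<open>The variational derivative, truncated at order \<open>K\<close>; the value is the same
  for all large \<open>K\<close>. The truncation keeps the sum finite without reference to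
  \<open>p\<close>.\<close>

definition euler :: "bit \<Rightarrow> nat \<Rightarrow> int \<Rightarrow> nat \<Rightarrow> 'f::field spoly \<Rightarrow> 'f spoly" where
  "euler i j1 j2 K p = (\<Sum>m<K. scl ((- 1) ^ m) ((ddx ^^ m) (sp_partial i (j1, j2, m) p)))"

text \<open>By \<open>partial_ddx\<close> the sum telescopes: the truncation at \<open>K\<close>
  equals a single boundary term that contains $\partial p/\partial u^{(K-1)}$, and this vanishes
  for large \<open>K\<close>.\<close>

lemma euler_ddx:
  fixes p :: "'f::field_char_0 spoly"
  shows "\<exists>M. \<forall>K\<ge>M. euler i j1 j2 K (ddx p) = 0"
proof -
  let ?d = "\<lambda>m. sp_partial i (j1, j2, m) p"
  let ?e = "\<lambda>K. case K of 0 \<Rightarrow> 0 | Suc k \<Rightarrow> ?d k"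
  have tel: "euler i j1 j2 K (ddx p) = - scl ((- 1) ^ K) ((ddx ^^ K) (?e K))" for K
  proof (induction K)
    case (Suc K)
    have "euler i j1 j2 (Suc K) (ddx p) =
        - scl ((- 1) ^ K) ((ddx ^^ K) (?e K)) + scl ((- 1) ^ K) ((ddx ^^ K) (ddx (?d K) + ?e K))"
      using Suc unfolding euler_def by (simp add: partial_ddx)
    also have "\<dots> = scl ((- 1) ^ K) ((ddx ^^ Suc K) (?d K))"
      by (simp add: ddx_pow_add scl_add funpow_swap1)
    finally show ?case by simp
  qed (simp add: euler_def)
  obtain M where "\<forall>m\<ge>M. ?d m = 0" using partial_order_finite by blast
  then have "euler i j1 j2 K (ddx p) = 0" if "K \<ge> Suc M" for K
    using tel[of K] that by (cases K) auto
  then show ?thesis by blast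
qed

text \<open>Each application of $\partial$ raises the top order by one and leaves the derivative
  with respect to the top symbol unchanged.\<close>

lemma partial_top:
  fixes q :: "'f::field_char_0 spoly"
  assumes "\<And>m. m > c \<Longrightarrow> sp_partial i (j1, j2, m) q = 0"
  shows "(\<forall>m>c + b. sp_partial i (j1, j2, m) ((ddx ^^ b) q) = 0) \<and>
    sp_partial i (j1, j2, c + b) ((ddx ^^ b) q) = sp_partial i (j1, j2, c) q"
proof (induction b)
  case (Suc b)
  show ?case
  proof (intro conjI allI impI)
    fix m assume "m > c + Suc b"
    then obtain k where "m = Suc k" "k > c + b" by (cases m) auto
    then show "sp_partial i (j1, j2, m) ((ddx ^^ Suc b) q) = 0"
      using Suc by (simp add: partial_ddx)
  next
    show "sp_partial i (j1, j2, c + Suc b) ((ddx ^^ Suc b) q) = sp_partial i (j1, j2, c) q"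
      using Suc by (simp add: partial_ddx)
  qed
qed (use assms in auto)

text \<open>This is the nondegeneracy of the pairing $(f,F)\mapsto(fF)^\sim$. The Euler operator
  of the family of symbols $u,u',u'',\dots$ annihilates $u^{(N)}F$. Suppose that $F$ involves this
  family, and let $k_0$ be the largest order that occurs. For $N>k_0$ the symbol of order $N+k_0$
  enters the Euler expression only through the terms of index $N$ and $k_0$, and its coefficient
  is $((-1)^N\pm(-1)^{k_0})\,\partial F/\partial u^{(k_0)}$ with a sign that does not depend on
  $N$. Two consecutive values of $N$ contradict each other. Hence $F$ does not involve the family,
  and then the Euler operator maps $uF$ to $F$, so that $F=0$.\<close>

lemma mult_total_derivative_zero:
  fixes F :: "'f::field_char_0 spoly"
  assumes "\<And>N. \<exists>h. U i (j1, j2, N) \<odot> F = ddx h"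
  shows "F = 0"
proof -
  let ?d = "\<lambda>m. sp_partial i (j1, j2, m)" and ?U = "\<lambda>N. U i (j1, j2, N) :: 'f spoly"
  have d_mult: "?d m (?U N \<odot> q) = (if m = N then q else 0) + scl (psign i) (?U N \<odot> ?d m q)" for m N q
    by (simp add: sp_partial_mult[of i] sp_partial_U)
  obtain M where M: "\<forall>m\<ge>M. ?d m F = 0" using partial_order_finite by blast
  have euler0: "\<exists>L. \<forall>K\<ge>L. euler i j1 j2 K (?U N \<odot> F) = 0" for N
  proof -
    obtain h where "?U N \<odot> F = ddx h" using assms by blast
    then show ?thesis using euler_ddx[of i j1 j2 h] by simp
  qed
  have no: "?d k F = 0" for k
  proof (rule ccontr)
    assume "?d k F \<noteq> 0"
    define k0 where "k0 = Max {m. ?d m F \<noteq> 0}"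
    have fin: "finite {m. ?d m F \<noteq> 0}"
      by (rule finite_subset[of _ "{..<M}"]) (use M in \<open>auto simp: not_le[symmetric]\<close>)
    then have k0: "?d k0 F \<noteq> 0" using Max_in[OF fin] \<open>?d k F \<noteq> 0\<close> by (auto simp: k0_def)
    have k0_max: "?d m F = 0" if "m > k0" for m
      using Max_ge[OF fin, of m] that by (auto simp: k0_def)
    have eq: "scl ((- 1) ^ N + psign i * (- 1) ^ k0) (?d k0 F) = 0" if N: "N > k0" for N
    proof -
      obtain L where L: "\<forall>K\<ge>L. euler i j1 j2 K (?U N \<odot> F) = 0" using euler0 by blast
      (* Large enough for the Euler operator to vanish and to contain the indices N and k0. *)
      define K where "K = max L (Suc N)"
      have KN: "N < K" "k0 < K" using N by (auto simp: K_def)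
      let ?q = "\<lambda>m. ?U N \<odot> ?d m F"
      have "0 = euler i j1 j2 K (?U N \<odot> F)" using L by (simp add: K_def)
      also have "\<dots> = (\<Sum>m<K. (if m = N then scl ((- 1) ^ N) ((ddx ^^ N) F) else 0) +
          scl (psign i * (- 1) ^ m) ((ddx ^^ m) (?q m)))"
        unfolding euler_def
        by (rule sum.cong[OF refl]) (auto simp: d_mult ddx_pow_add ddx_pow_scl scl_add scl_scl mult.commute)
      also have "\<dots> = scl ((- 1) ^ N) ((ddx ^^ N) F) + (\<Sum>m<K. scl (psign i * (- 1) ^ m) ((ddx ^^ m) (?q m)))"
        using KN by (simp add: sum.distrib)
      finally have "0 = scl ((- 1) ^ N) ((ddx ^^ N) F) + (\<Sum>m<K. scl (psign i * (- 1) ^ m) ((ddx ^^ m) (?q m)))" .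
      from arg_cong[OF this, of "?d (N + k0)"]
      have "0 = ?d (N + k0) (scl ((- 1) ^ N) ((ddx ^^ N) F) + (\<Sum>m<K. scl (psign i * (- 1) ^ m) ((ddx ^^ m) (?q m))))"
        by (simp only: sp_partial_zero)
      also have "\<dots> = scl ((- 1) ^ N) (?d (N + k0) ((ddx ^^ N) F)) +
          (\<Sum>m<K. scl (psign i * (- 1) ^ m) (?d (N + k0) ((ddx ^^ m) (?q m))))"
        by (simp add: sp_partial_add sp_partial_scl additive_sum[of "?d _", OF sp_partial_add])
      also have "?d (N + k0) ((ddx ^^ N) F) = ?d k0 F"
        using partial_top[of k0 i j1 j2 F N] k0_max by (simp add: add.commute)
      also have "(\<Sum>m<K. scl (psign i * (- 1) ^ m) (?d (N + k0) ((ddx ^^ m) (?q m)))) =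
          (\<Sum>m<K. if m = k0 then scl (psign i * (- 1) ^ k0) (?d k0 F) else 0)"
      proof (rule sum.cong[OF refl])
        fix m
        have dd: "?d l (?d m F) = 0" if "l > k0" for l
          using k0_max[OF that] partial_supercomm[of i "(j1, j2, l)" i "(j1, j2, m)" F]
            sp_partial_scl[of i "(j1, j2, m)" 0 F] by simp
        have ord: "?d l (?q m) = 0" if "l > N" for l
          using that N by (simp add: d_mult dd)
        consider "m < k0" | "m = k0" | "m > k0" by linarith
        then show "scl (psign i * (- 1) ^ m) (?d (N + k0) ((ddx ^^ m) (?q m))) =
            (if m = k0 then scl (psign i * (- 1) ^ k0) (?d k0 F) else 0)"
        proof cases
          case 1
          then show ?thesis using partial_top[of N i j1 j2 "?q m" m] ord by simp
        next
          case 2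
          then show ?thesis using partial_top[of N i j1 j2 "?q m" m] ord dd[OF N] by (simp add: d_mult)
        next
          case 3
          then show ?thesis using sp_partial_scl[of i "(j1, j2, N + k0)" 0 F] by (simp add: k0_max)
        qed
      qed
      also have "\<dots> = scl (psign i * (- 1) ^ k0) (?d k0 F)" using KN by simp
      finally show ?thesis by (simp add: scl_add_left)
    qed
    (* The sign (-1)^N changes between consecutive N, while the other one does not. *)
    from eq[of "Suc k0"] eq[of "Suc (Suc k0)"]
    have "scl ((- 1) ^ Suc (Suc k0) + psign i * (- 1) ^ k0 - ((- 1) ^ Suc k0 + psign i * (- 1) ^ k0)) (?d k0 F) = 0"
      by (simp only: diff_conv_add_uminus scl_add_left scl_uminus_left) simp
    then have "scl (2 * (- 1) ^ k0) (?d k0 F) = 0" by simp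
    then have "scl ((- 1) ^ k0 / 2) (scl (2 * (- 1) ^ k0) (?d k0 F)) = 0" by simp
    moreover have "(- 1) ^ k0 / 2 * (2 * (- 1) ^ k0) = (1 :: 'f)" by (cases "even k0") auto
    ultimately show False using k0 by (simp add: scl_scl)
  qed
  obtain L where L: "\<forall>K\<ge>L. euler i j1 j2 K (?U 0 \<odot> F) = 0" using euler0 by blast
  have "euler i j1 j2 (Suc L) (?U 0 \<odot> F) = (\<Sum>m<Suc L. if m = 0 then F else 0)"
    unfolding euler_def by (rule sum.cong[OF refl]) (auto simp: d_mult no)
  also have "\<dots> = F" by (simp add: sum.delta del: sum.lessThan_Suc)
  finally show ?thesis using L by simp
qed

section \<open>The quotient by total derivatives\<close>

lemma til_add: "til (p + q) = til p + til q"
  by (simp add: plus_tpoly.abs_eq)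

lemma til_scl: "til (scl c p) = tscl c (til p)"
  by (simp add: tscl.abs_eq)

lemma til_zero [simp]: "til 0 = 0"
  by (simp add: zero_tpoly_def)

lemma til_uminus: "til (- p) = - til p"
  by (simp add: uminus_tpoly.abs_eq)

lemma til_diff: "til (p - q) = til p - til q"
  using til_add[of p "- q"] by (simp add: til_uminus)

lemma til_sum: "til (sum f B) = (\<Sum>x\<in>B. til (f x))"
  by (rule additive_sum) (rule til_add)

lemma til_eq_0: "til p = 0 \<longleftrightarrow> (\<exists>h. p = ddx h)"
  unfolding til_zero[symmetric] tpoly.abs_eq_iff by (simp add: til_rel_def)

lemma til_ddx [simp]: "til (ddx p) = 0"
  by (auto simp: til_eq_0)

lemma til_surj: "\<exists>p. X = til p"
  by (rule tpoly.abs_induct[of "\<lambda>X. \<exists>p. X = til p"]) blast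

lemma tscl_add: "tscl c (X + Y) = tscl c X + tscl c Y"
proof -
  obtain p q where "X = til p" "Y = til q" using til_surj by metis
  then show ?thesis by (simp add: til_add[symmetric] til_scl[symmetric] scl_add)
qed

lemma tscl_add_left: "tscl (c + d) X = tscl c X + tscl d X"
proof -
  obtain p where "X = til p" using til_surj by metis
  then show ?thesis by (simp add: til_add[symmetric] til_scl[symmetric] scl_add_left)
qed

lemma tscl_tscl: "tscl c (tscl d X) = tscl (c * d) X"
proof -
  obtain p where "X = til p" using til_surj by metis
  then show ?thesis by (simp add: til_scl[symmetric] scl_scl)
qed

lemma tscl_one [simp]: "tscl 1 X = X"
proof -
  obtain p where "X = til p" using til_surj by metis
  then show ?thesis by (simp add: til_scl[symmetric])
qed

lemma vector_space_tscl: "vector_space (tscl :: 'f::field \<Rightarrow> _)"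
  by unfold_locales (simp_all add: tscl_add tscl_add_left tscl_tscl)

lemma tscl_zero [simp]: "tscl c 0 = 0" "tscl 0 X = 0"
  using tscl_add[of c 0 0] tscl_add_left[of 0 0 X] by simp_all

lemma tscl_uminus [simp]: "tscl c (- X) = - tscl c X" "tscl (- c) X = - tscl c X"
  by (rule minus_unique[symmetric], simp add: tscl_add[symmetric] tscl_add_left[symmetric])+

lemma tscl_diff: "tscl c (X - Y) = tscl c X - tscl c Y"
  using tscl_add[of c X "- Y"] by simp

lemma til_by_parts:
  fixes p q :: "'f::field_char_0 spoly"
  shows "til ((ddx ^^ n) p \<odot> q) = tscl ((- 1) ^ n) (til (p \<odot> (ddx ^^ n) q))"
proof (induction n arbitrary: q)
  case (Suc n)
  have "til (ddx ((ddx ^^ n) p) \<odot> q) + til ((ddx ^^ n) p \<odot> ddx q) = 0"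
    by (simp add: til_add[symmetric] ddx_mult[symmetric])
  then have "til (ddx ((ddx ^^ n) p) \<odot> q) = - til ((ddx ^^ n) p \<odot> ddx q)"
    by (simp add: eq_neg_iff_add_eq_0)
  then show ?case by (simp add: Suc funpow_swap1)
qed simp

text \<open>$\partial$ preserves parity, so a sum of components of different parities is a total
  derivative only if each of them is.\<close>

lemma til_parity_zero:
  assumes "sp_hom i p" "sp_hom j q" "i \<noteq> j" "til p + til q = 0"
  shows "til p = 0"
proof -
  obtain h where h: "p + q = ddx h" using assms(4) by (auto simp: til_add[symmetric] til_eq_0)
  have "sp_part i (p + q) = p" using assms by (simp add: sp_part_add sp_part_hom)
  then have "p = ddx (sp_part i h)" by (simp add: h sp_part_ddx)
  then show ?thesis by (auto simp: til_eq_0)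
qed

context kp_superalgebra
begin

section \<open>The graded space of operators\<close>

lemma Dp_iff: "v \<in> Dp i \<longleftrightarrow> (\<forall>l. v l \<in> Ah_part i) \<and> (\<exists>N. order_le N v)" by (simp add: Dp_def)
lemma DD_iff: "v \<in> DD \<longleftrightarrow> (\<forall>l. v l \<in> Ah) \<and> (\<exists>N. order_le N v)" by (simp add: DD_def)

lemma order_le_add: "order_le M v \<Longrightarrow> order_le N w \<Longrightarrow> order_le (max M N) (v + w)"
  by (auto simp: order_le_def)

lemma order_le_scl: "order_le N v \<Longrightarrow> order_le N (d_scl c v)"
  by (simp add: order_le_def d_scl_def)

lemma Dp_zero [simp]: "0 \<in> Dp i"
  by (simp add: Dp_iff) (auto simp: order_le_def)

lemma Dp_add: "v \<in> Dp i \<Longrightarrow> w \<in> Dp i \<Longrightarrow> v + w \<in> Dp i"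
  unfolding Dp_iff using order_le_add by (fastforce intro: Ah_part_add)

lemma Dp_scl: "v \<in> Dp i \<Longrightarrow> d_scl c v \<in> Dp i"
  unfolding Dp_iff using order_le_scl by (auto simp: d_scl_def intro: Ah_part_scl)

lemma d_scl_uminus_one: "d_scl (- 1) v = - v"
  by (rule ext) (simp add: d_scl_def ah_scl_uminus_one)

lemma Dp_uminus: "v \<in> Dp i \<Longrightarrow> - v \<in> Dp i"
  using Dp_scl[of v i "- 1"] by (simp add: d_scl_uminus_one)

lemma Dp_diff: "v \<in> Dp i \<Longrightarrow> w \<in> Dp i \<Longrightarrow> v - w \<in> Dp i"
  using Dp_add[of v i "- w"] by (simp add: Dp_uminus)

lemma Dp_DD: "v \<in> Dp i \<Longrightarrow> v \<in> DD"
  by (auto simp: Dp_iff DD_iff intro: Ah_part_Ah)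

lemma DD_zero [simp]: "0 \<in> DD" using Dp_DD[OF Dp_zero] .

lemma DD_add: "v \<in> DD \<Longrightarrow> w \<in> DD \<Longrightarrow> v + w \<in> DD"
  unfolding DD_iff using order_le_add by (fastforce intro: Ah_add)

lemma DD_scl: "v \<in> DD \<Longrightarrow> d_scl c v \<in> DD"
  unfolding DD_iff using order_le_scl by (auto simp: d_scl_def intro: Ah_scl)

lemma DD_uminus: "v \<in> DD \<Longrightarrow> - v \<in> DD"
  using DD_scl[of v "- 1"] by (simp add: d_scl_uminus_one)

lemma DD_diff: "v \<in> DD \<Longrightarrow> w \<in> DD \<Longrightarrow> v - w \<in> DD"
  using DD_add[of v "- w"] by (simp add: DD_uminus)

lemma ah_part_Ah_part: "\<phi> \<in> Ah \<Longrightarrow> ah_part i \<phi> \<in> Ah_part i"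
  by (auto simp: Ah_iff Ah_part_def lookup_ah_part P_part_intros)

lemma ah_part_sum: "ah_part 0 \<phi> + ah_part 1 \<phi> = \<phi>"
proof (rule poly_mapping_eqI, clarify)
  fix j l show "Poly_Mapping.lookup (ah_part 0 \<phi> + ah_part 1 \<phi>) (j, l) = Poly_Mapping.lookup \<phi> (j, l)"
    using sp_part_sum[of "Poly_Mapping.lookup \<phi> (j, l)"] bit_cases2[of j]
    by (auto simp: lookup_add lookup_ah_part add.commute)
qed

lemma ah_part_hom:
  assumes "\<phi> \<in> Ah_part i" shows "ah_part j \<phi> = (if i = j then \<phi> else 0)"
proof (rule poly_mapping_eqI, clarify)
  fix k l
  have "sp_hom (i + k) (Poly_Mapping.lookup \<phi> (k, l))"
    using Ah_partD(1)[OF assms] by (simp add: P_part_iff)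
  from sp_part_hom[OF this, of "j + k"]
  show "Poly_Mapping.lookup (ah_part j \<phi>) (k, l) = Poly_Mapping.lookup (if i = j then \<phi> else 0) (k, l)"
    by (simp add: lookup_ah_part)
qed

lemma ah_part_zero [simp]: "ah_part i 0 = 0"
  by (rule poly_mapping_eqI, clarify) (simp add: lookup_ah_part)

lemma ah_part_add: "ah_part i (\<phi> + \<psi>) = ah_part i \<phi> + ah_part i \<psi>"
  by (rule poly_mapping_eqI, clarify) (simp add: lookup_ah_part lookup_add sp_part_add)

lemma ah_part_scl: "ah_part i (ah_scl c \<phi>) = ah_scl c (ah_part i \<phi>)"
  by (rule poly_mapping_eqI, clarify) (simp add: lookup_ah_part sp_part_scl)

lemma order_le_part: "order_le N v \<Longrightarrow> order_le N (d_part i v)"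
  by (simp add: order_le_def d_part_def)

lemma d_part_Dp: "v \<in> DD \<Longrightarrow> d_part i v \<in> Dp i"
  unfolding Dp_iff DD_iff using order_le_part by (auto simp: d_part_def ah_part_Ah_part)

lemma d_part_sum: "d_part 0 v + d_part 1 v = v"
  by (rule ext) (simp add: d_part_def ah_part_sum)

lemma d_part_hom: "v \<in> Dp i \<Longrightarrow> d_part j v = (if i = j then v else 0)"
  by (rule ext) (auto simp: d_part_def Dp_iff ah_part_hom[of _ i])

lemma d_part_add: "d_part i (v + w) = d_part i v + d_part i w"
  by (rule ext) (simp add: d_part_def ah_part_add)

lemma d_part_scl: "d_part i (d_scl c v) = d_scl c (d_part i v)"
  by (rule ext) (simp add: d_part_def d_scl_def ah_part_scl)

lemma DD_E:
  assumes "v \<in> DD" obtains v0 v1 where "v = v0 + v1" "v0 \<in> Dp 0" "v1 \<in> Dp 1"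
  by (rule that[OF d_part_sum[symmetric] d_part_Dp[OF assms] d_part_Dp[OF assms]])

lemma Dp_unique: "v \<in> Dp i \<Longrightarrow> v \<in> Dp j \<Longrightarrow> i \<noteq> j \<Longrightarrow> v = 0"
  using d_part_hom[of v i i] d_part_hom[of v j i] by simp

lemma d_scl_add: "d_scl c (v + w) = d_scl c v + d_scl c w"
  by (rule ext) (simp add: d_scl_def ah_scl_add)

lemma d_scl_add_left: "d_scl (c + d) v = d_scl c v + d_scl d v"
  by (rule ext) (simp add: d_scl_def ah_scl_add_left)

lemma d_scl_d_scl: "d_scl c (d_scl d v) = d_scl (c * d) v"
  by (rule ext) (simp add: d_scl_def ah_scl_scl)

lemma d_scl_one [simp]: "d_scl 1 v = v"
  by (rule ext) (simp add: d_scl_def)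

lemma vector_space_d_scl: "vector_space (d_scl :: 'f \<Rightarrow> _)"
  by unfold_locales (simp_all add: d_scl_add d_scl_add_left d_scl_d_scl)

lemma d_scl_zero [simp]: "d_scl c 0 = 0" "d_scl 0 v = 0"
  using d_scl_add[of c 0 0] d_scl_add_left[of 0 0 v] by simp_all

lemma d_scl_uminus [simp]: "d_scl c (- v) = - d_scl c v" "d_scl (- c) v = - d_scl c v"
  by (rule minus_unique[symmetric], simp add: d_scl_add[symmetric] d_scl_add_left[symmetric])+

lemma d_scl_diff: "d_scl c (v - w) = d_scl c v - d_scl c w"
  using d_scl_add[of c v "- w"] by simp

subsection \<open>Multiplication\<close>

lemma d_mult_assoc:
  "\<lbrakk>v \<in> DD; w \<in> DD; u \<in> DD\<rbrakk> \<Longrightarrow> d_mult (d_mult v w) u = d_mult v (d_mult w u)"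
  by (rule ext) (simp add: d_mult_gprod[of "d_mult v w"] d_mult_gprod[of v "d_mult w u"] mult_pairing.gprod_assoc)

lemma d_mult_add_left: "\<lbrakk>v \<in> DD; v' \<in> DD; w \<in> DD\<rbrakk> \<Longrightarrow> d_mult (v + v') w = d_mult v w + d_mult v' w"
  by (rule ext) (simp add: d_mult_gprod mult_pairing.gprod_add_left)

lemma d_mult_add_right: "\<lbrakk>v \<in> DD; w \<in> DD; w' \<in> DD\<rbrakk> \<Longrightarrow> d_mult v (w + w') = d_mult v w + d_mult v w'"
  by (rule ext) (simp add: d_mult_gprod mult_pairing.gprod_add_right)

lemma d_mult_scl_left: "\<lbrakk>v \<in> DD; w \<in> DD\<rbrakk> \<Longrightarrow> d_mult (d_scl c v) w = d_scl c (d_mult v w)"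
  by (rule ext) (simp add: d_mult_gprod mult_pairing.gprod_scl_left d_scl_def[of c "mult_pairing.gprod _ _"])

lemma d_mult_scl_right: "\<lbrakk>v \<in> DD; w \<in> DD\<rbrakk> \<Longrightarrow> d_mult v (d_scl c w) = d_scl c (d_mult v w)"
  by (rule ext) (simp add: d_mult_gprod mult_pairing.gprod_scl_right d_scl_def[of c "mult_pairing.gprod _ _"])

lemma d_const_DD: "a \<in> A i \<Longrightarrow> d_const (emb a) \<in> Dp i"
  by (auto simp: Dp_iff d_const_def emb_Ah order_le_def)

text \<open>Only the term without derivatives survives, since $\binom0p=0$ for $p>0$.\<close>

lemma d_mult_const_left:
  assumes "a \<in> A i" "w \<in> DD" shows "d_mult (d_const (emb a)) w = (\<lambda>l. ah_mult (emb a) (w l))"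
proof
  fix r
  obtain N where N: "order_le N w" using assms by (auto simp: DD_iff)
  have "d_mult (d_const (emb a)) w r =
      (\<Sum>m\<in>{r - N..0} \<union> {0}. \<Sum>n\<in>{r..N} \<union> {r}. mult_pairing.gterm m n r (d_const (emb a) m) (w n))"
    by (rule d_mult_box[OF _ N]) (auto simp: order_le_def d_const_def)
  also have "\<dots> = (\<Sum>m\<in>{r - N..0} \<union> {0}. if m = 0 then (\<Sum>n\<in>{r..N} \<union> {r}. mult_pairing.gterm 0 n r (emb a) (w n)) else 0)"
    by (rule sum.cong[OF refl]) (simp add: d_const_def)
  also have "\<dots> = (\<Sum>n\<in>{r..N} \<union> {r}. mult_pairing.gterm 0 n r (emb a) (w n))"
    by (subst sum.delta) auto
  also have "\<dots> = (\<Sum>n\<in>{r..N} \<union> {r}. if n = r then ah_mult (emb a) (w r) else 0)"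
  proof (rule sum.cong[OF refl])
    fix n assume "n \<in> {r..N} \<union> {r}"
    then have "n \<ge> r" by auto
    show "mult_pairing.gterm 0 n r (emb a) (w n) = (if n = r then ah_mult (emb a) (w r) else 0)"
    proof (cases "n = r")
      case False
      then obtain q where "nat (n - r) = Suc q" using \<open>n \<ge> r\<close> by (cases "nat (n - r)") auto
      then show ?thesis using False by (simp add: mult_pairing.gterm_def)
    qed (simp add: mult_pairing.gterm_def)
  qed
  also have "\<dots> = ah_mult (emb a) (w r)" by (subst sum.delta) auto
  finally show "d_mult (d_const (emb a)) w r = ah_mult (emb a) (w r)" .
qed

text \<open>Only the term without derivatives survives, since the derivatives of a constant
  vanish.\<close>

lemma d_mult_const_right:
  assumes "a \<in> A i" "w \<in> DD" shows "d_mult w (d_const (emb a)) = (\<lambda>l. ah_mult (w l) (emb a))"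
proof
  fix r
  obtain N where N: "order_le N w" using assms by (auto simp: DD_iff)
  have "d_mult w (d_const (emb a)) r =
      (\<Sum>m\<in>{r..N} \<union> {r}. \<Sum>n\<in>{r - N..0} \<union> {0}. mult_pairing.gterm m n r (w m) (d_const (emb a) n))"
    by (rule d_mult_box[OF N]) (auto simp: order_le_def d_const_def)
  also have "\<dots> = (\<Sum>m\<in>{r..N} \<union> {r}. \<Sum>n\<in>{r - N..0} \<union> {0}. if n = 0 then mult_pairing.gterm m 0 r (w m) (emb a) else 0)"
    by (intro sum.cong[OF refl]) (simp add: d_const_def)
  also have "\<dots> = (\<Sum>m\<in>{r..N} \<union> {r}. mult_pairing.gterm m 0 r (w m) (emb a))"
    by (intro sum.cong[OF refl], subst sum.delta) auto
  also have "\<dots> = (\<Sum>m\<in>{r..N} \<union> {r}. if m = r then ah_mult (w r) (emb a) else 0)"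
  proof (rule sum.cong[OF refl])
    fix n assume "n \<in> {r..N} \<union> {r}"
    then have "n \<ge> r" by auto
    show "mult_pairing.gterm n 0 r (w n) (emb a) = (if n = r then ah_mult (w r) (emb a) else 0)"
    proof (cases "n = r")
      case False
      then obtain q where "nat (n - r) = Suc q" using \<open>n \<ge> r\<close> by (cases "nat (n - r)") auto
      then show ?thesis using False by (simp add: mult_pairing.gterm_def funpow_swap1[of _ _ "emb a"])
    qed (simp add: mult_pairing.gterm_def)
  qed
  also have "\<dots> = ah_mult (w r) (emb a)" by (subst sum.delta) auto
  finally show "d_mult w (d_const (emb a)) r = ah_mult (w r) (emb a)" .
qed

subsection \<open>Differential operators and the negative part\<close>

lemma Dp_minus: "v \<in> Dp i \<Longrightarrow> d_minus v \<in> Dp i"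
  by (auto simp: Dp_iff d_minus_def order_le_def)

lemma DD_minus: "v \<in> DD \<Longrightarrow> d_minus v \<in> DD"
  by (auto simp: DD_iff d_minus_def order_le_def)

lemma d_minus_add: "d_minus (v + w) = d_minus v + d_minus w"
  by (rule ext) (simp add: d_minus_def)

lemma d_minus_scl: "d_minus (d_scl c v) = d_scl c (d_minus v)"
  by (rule ext) (simp add: d_minus_def d_scl_def)

lemma order_le_neg: "order_le (- 1) v \<Longrightarrow> d_minus v = v"
  by (rule ext) (simp add: d_minus_def order_le_def)

lemma order_le_d_minus: "order_le (- 1) (d_minus v)"
  by (simp add: d_minus_def order_le_def)

lemma d_minus_mult_minus: "d_minus (d_mult (d_minus v) (d_minus w)) = d_mult (d_minus v) (d_minus w)"
  by (rule order_le_neg, rule order_le_mono[OF order_le_mult[OF order_le_d_minus order_le_d_minus]]) simp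

lemma gbinomial_int_zero: "0 \<le> m \<Longrightarrow> m < int p \<Longrightarrow> (of_int m gchoose p :: 'f) = 0"
proof -
  assume "0 \<le> m" "m < int p"
  then obtain k where "m = int k" "k < p" by (metis nonneg_int_cases of_nat_less_iff)
  then show ?thesis using binomial_gbinomial[of k p, where 'a = 'f] by (simp add: binomial_eq_0)
qed

text \<open>In a product of differential operators a term of negative order would need more than
  \<open>m\<close> derivatives produced by $\partial^m$ with $m\ge0$, and its binomial coefficient
  is zero.\<close>

lemma d_minus_mult_plus:
  assumes "v \<in> DD" "w \<in> DD"
  shows "d_minus (d_mult (v - d_minus v) (w - d_minus w)) = 0"
proof
  fix r
  obtain M N where MN: "order_le M v" "order_le N w" using assms by (auto simp: DD_iff)
  have bd: "order_le M (v - d_minus v)" "order_le N (w - d_minus w)"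
    using MN by (auto simp: order_le_def d_minus_def)
  show "d_minus (d_mult (v - d_minus v) (w - d_minus w)) r = 0 r"
  proof (cases "r < 0")
    case True
    have z: "mult_pairing.gterm m n r ((v - d_minus v) m) ((w - d_minus w) n) = 0" for m n
    proof (cases "m < 0 \<or> n < 0")
      case False
      then show ?thesis using True by (simp add: mult_pairing.gterm_def gbinomial_int_zero)
    qed (auto simp: d_minus_def)
    have "d_mult (v - d_minus v) (w - d_minus w) r =
        (\<Sum>m\<in>{r - N..M}. \<Sum>n\<in>{r - M..N}. mult_pairing.gterm m n r ((v - d_minus v) m) ((w - d_minus w) n))"
      by (rule d_mult_box[OF bd]) auto
    also have "\<dots> = 0" by (simp only: z sum.neutral_const)
    finally show ?thesis by (simp add: d_minus_def)
  qed (simp add: d_minus_def)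
qed

subsection \<open>The residue form\<close>

text \<open>The coefficient of $\partial^{-1}$ in the product of \<open>v\<close> and
  \<open>w\<close> taken with the form of coefficients, modulo total derivatives. Unlike
  \<open>pairing\<close>, it is expressed with all coefficients on the left, and its invariance
  and supersymmetry can be proved directly.\<close>

definition tr :: "'f psdo \<Rightarrow> 'f psdo \<Rightarrow> 'f tpoly" where
  "tr v w = til (form_pairing.gprod v w (- 1))"

lemma tr_box:
  assumes "order_le M v" "order_le N w" "finite S" "{- 1 - N..M} \<subseteq> S" "finite T" "{- 1 - M..N} \<subseteq> T"
  shows "tr v w = (\<Sum>m\<in>S. \<Sum>n\<in>T. til (form_pairing.gterm m n (- 1) (v m) (w n)))"
  unfolding tr_def by (subst form_pairing.gprod_order_le_box[OF assms]) (simp add: til_sum)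

lemma tr_add_left: "\<lbrakk>v \<in> DD; v' \<in> DD; w \<in> DD\<rbrakk> \<Longrightarrow> tr (v + v') w = tr v w + tr v' w"
  by (simp add: tr_def form_pairing.gprod_add_left til_add)

lemma tr_add_right: "\<lbrakk>v \<in> DD; w \<in> DD; w' \<in> DD\<rbrakk> \<Longrightarrow> tr v (w + w') = tr v w + tr v w'"
  by (simp add: tr_def form_pairing.gprod_add_right til_add)

lemma tr_scl_left: "\<lbrakk>v \<in> DD; w \<in> DD\<rbrakk> \<Longrightarrow> tr (d_scl c v) w = tscl c (tr v w)"
  by (simp add: tr_def form_pairing.gprod_scl_left til_scl)

lemma tr_scl_right: "\<lbrakk>v \<in> DD; w \<in> DD\<rbrakk> \<Longrightarrow> tr v (d_scl c w) = tscl c (tr v w)"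
  by (simp add: tr_def form_pairing.gprod_scl_right til_scl)

lemma tr_assoc: "\<lbrakk>v \<in> DD; w \<in> DD; u \<in> DD\<rbrakk> \<Longrightarrow> tr (d_mult v w) u = tr v (d_mult w u)"
  by (simp add: tr_def form_pairing.gprod_assoc)

text \<open>Put $T=m+n+1$. Integration by parts moves \<open>T\<close> derivatives with the sign
  $(-1)^T$, and the binomial coefficients match because
  $\binom nT=(-1)^T\binom{T-n-1}T=(-1)^T\binom mT$.\<close>

lemma gterm_residue_swap:
  assumes "a \<in> Ah_part i" "b \<in> Ah_part j"
  shows "til (form_pairing.gterm m n (- 1) a b) = tscl (psign (i * j)) (til (form_pairing.gterm n m (- 1) b a))"
proof (cases "m + n \<ge> - 1")
  case True
  define T where "T = nat (m + n + 1)"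
  have T: "int T = m + n + 1" using True by (simp add: T_def)
  have "til (ah_form b ((ah_ddx ^^ T) a)) = tscl ((- 1) ^ T) (til (ah_form ((ah_ddx ^^ T) b) a))"
    using assms
  proof (induction T arbitrary: a)
    case (Suc T)
    have h: "ddx (ah_form ((ah_ddx ^^ T) b) a) = ah_form (ah_ddx ((ah_ddx ^^ T) b)) a + ah_form ((ah_ddx ^^ T) b) (ah_ddx a)"
      by (rule ah_form_ddx[OF Ah_ddx_pow[OF Ah_part_Ah[OF Suc.prems(2)]] Ah_part_Ah[OF Suc.prems(1)]])
    then have "til (ah_form (ah_ddx ((ah_ddx ^^ T) b)) a) + til (ah_form ((ah_ddx ^^ T) b) (ah_ddx a)) = 0"
      by (simp only: til_add[symmetric] h[symmetric] til_ddx)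
    then have "til (ah_form ((ah_ddx ^^ T) b) (ah_ddx a)) = - til (ah_form (ah_ddx ((ah_ddx ^^ T) b)) a)"
      by (simp add: eq_neg_iff_add_eq_0 add.commute)
    then show ?case using Suc.IH[of "ah_ddx a"] Suc.prems by (simp add: funpow_swap1 Ah_part_ddx)
  qed simp
  moreover have "ah_form ((ah_ddx ^^ T) b) a = scl (psign (i * j)) (ah_form a ((ah_ddx ^^ T) b))"
    using ah_form_supersym[OF Ah_part_ddx_pow[OF assms(2)] assms(1)] by (simp add: mult.commute)
  moreover have "(of_int n gchoose T) = (- 1) ^ T * (of_int m gchoose T :: 'f)"
  proof -
    have "of_nat T - (of_int n :: 'f) - 1 = of_int (int T - n - 1)" by simp
    also have "int T - n - 1 = m" using T by simp
    finally show ?thesis using gbinomial_negated_upper[of "of_int n :: 'f" T] by simp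
  qed
  moreover have "(- 1) ^ T * ((- 1) ^ T * x) = (x :: 'f)" for x by (cases "even T") auto
  ultimately show ?thesis using True
    by (simp add: form_pairing.gterm_def T_def[symmetric] add.commute[of n m] til_scl tscl_tscl mult_ac)
qed (simp add: form_pairing.gterm_def)

lemma tr_supersym:
  assumes "v \<in> Dp i" "w \<in> Dp j"
  shows "tr v w = tscl (psign (i * j)) (tr w v)"
proof -
  obtain M N where MN: "order_le M v" "order_le N w" using assms by (auto simp: Dp_iff)
  let ?S = "{- 1 - N..M}" and ?T = "{- 1 - M..N}"
  have "tr v w = (\<Sum>m\<in>?S. \<Sum>n\<in>?T. til (form_pairing.gterm m n (- 1) (v m) (w n)))"
    by (rule tr_box[OF MN]) auto
  also have "\<dots> = (\<Sum>m\<in>?S. \<Sum>n\<in>?T. tscl (psign (i * j)) (til (form_pairing.gterm n m (- 1) (w n) (v m))))"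
    by (intro sum.cong[OF refl] gterm_residue_swap) (use assms in \<open>auto simp: Dp_iff\<close>)
  also have "\<dots> = tscl (psign (i * j)) (\<Sum>m\<in>?S. \<Sum>n\<in>?T. til (form_pairing.gterm n m (- 1) (w n) (v m)))"
    by (simp add: additive_sum[of "tscl _", OF tscl_add])
  also have "(\<Sum>m\<in>?S. \<Sum>n\<in>?T. til (form_pairing.gterm n m (- 1) (w n) (v m))) =
      (\<Sum>n\<in>?T. \<Sum>m\<in>?S. til (form_pairing.gterm n m (- 1) (w n) (v m)))" by (rule sum.swap)
  also have "\<dots> = tr w v" by (rule tr_box[OF MN(2,1), symmetric]) auto
  finally show ?thesis .
qed

lemma tr_low:
  assumes "order_le M v" "order_le N w" "M + N < - 1" shows "tr v w = 0"
proof -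
  have "tr v w = (\<Sum>m\<in>{- 1 - N..M}. \<Sum>n\<in>{- 1 - M..N}. til (form_pairing.gterm m n (- 1) (v m) (w n)))"
    by (rule tr_box[OF assms(1,2)]) auto
  then show ?thesis using assms(3) by simp
qed

lemma tr_minus_minus: "tr (d_minus v) (d_minus w) = 0"
  by (rule tr_low[OF order_le_d_minus order_le_d_minus]) simp

lemma tr_plus_plus:
  assumes "v \<in> DD" "w \<in> DD" shows "tr (v - d_minus v) (w - d_minus w) = 0"
proof -
  obtain M N where MN: "order_le M v" "order_le N w" using assms by (auto simp: DD_iff)
  have bd: "order_le M (v - d_minus v)" "order_le N (w - d_minus w)"
    using MN by (auto simp: order_le_def d_minus_def)
  have z: "form_pairing.gterm m n (- 1) ((v - d_minus v) m) ((w - d_minus w) n) = 0" for m n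
  proof (cases "m < 0 \<or> n < 0")
    case False
    then show ?thesis by (simp add: form_pairing.gterm_def gbinomial_int_zero)
  qed (auto simp: d_minus_def)
  have "tr (v - d_minus v) (w - d_minus w) = (\<Sum>m\<in>{- 1 - N..M}. \<Sum>n\<in>{- 1 - M..N}.
      til (form_pairing.gterm m n (- 1) ((v - d_minus v) m) ((w - d_minus w) n)))"
    by (rule tr_box[OF bd]) auto
  then show ?thesis by (simp only: z til_zero sum.neutral_const)
qed

lemma residue_P_part:
  assumes "v \<in> Dp i" "w \<in> Dp j" shows "form_pairing.gprod v w (- 1) \<in> P_part (i + j)"
proof -
  obtain M N where MN: "order_le M v" "order_le N w" using assms by (auto simp: Dp_iff)
  have "form_pairing.gprod v w (- 1) = (\<Sum>m\<in>{- 1 - N..M}. \<Sum>n\<in>{- 1 - M..N}. form_pairing.gterm m n (- 1) (v m) (w n))"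
    by (rule form_pairing.gprod_order_le_box[OF MN]) auto
  also have "\<dots> \<in> P_part (i + j)"
    by (intro P_part_sum form_pairing_gterm_P_part) (use assms in \<open>auto simp: Dp_iff\<close>)
  finally show ?thesis .
qed

lemma residue_P: "v \<in> DD \<Longrightarrow> w \<in> DD \<Longrightarrow> form_pairing.gprod v w (- 1) \<in> P"
proof -
  have hom: "form_pairing.gprod v w (- 1) \<in> P" if "v \<in> Dp i" "w \<in> Dp j" for v w i j
    using residue_P_part[OF that] by (simp add: P_part_iff)
  assume "v \<in> DD" "w \<in> DD"
  then obtain v0 v1 w0 w1 where "v = v0 + v1" "w = w0 + w1"
    and Dp: "v0 \<in> Dp 0" "v1 \<in> Dp 1" "w0 \<in> Dp 0" "w1 \<in> Dp 1"
    by (meson DD_E)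
  then have "form_pairing.gprod v w (- 1) = form_pairing.gprod v0 w0 (- 1) + form_pairing.gprod v0 w1 (- 1) + (form_pairing.gprod v1 w0 (- 1) + form_pairing.gprod v1 w1 (- 1))"
    by (simp add: form_pairing.gprod_add_left form_pairing.gprod_add_right Dp_DD DD_add)
  then show "form_pairing.gprod v w (- 1) \<in> P"
    using hom[OF Dp(1,3)] hom[OF Dp(1,4)] hom[OF Dp(2,3)] hom[OF Dp(2,4)] by (simp add: P_add)
qed

text \<open>The residue of homogeneous operators is homogeneous, so residues of different parities
  cannot cancel. This separates the homogeneous components of elements of the radicals.\<close>

lemma tr_parity_zero:
  assumes "v \<in> Dp i" "w \<in> Dp j" "v' \<in> Dp i'" "w' \<in> Dp j'" "i + j \<noteq> i' + j'" "tr v w + tr v' w' = 0"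
  shows "tr v w = 0" "tr v' w' = 0"
proof -
  have hom: "sp_hom (i + j) (form_pairing.gprod v w (- 1))" "sp_hom (i' + j') (form_pairing.gprod v' w' (- 1))"
    using residue_P_part[OF assms(1,2)] residue_P_part[OF assms(3,4)] by (simp_all add: P_part_iff)
  show "tr v w = 0"
    unfolding tr_def by (rule til_parity_zero[OF hom assms(5) assms(6)[unfolded tr_def]])
  then show "tr v' w' = 0" using assms(6) by simp
qed

section \<open>Evolutionary vector fields on operators\<close>

lemma G_iff: "v \<in> G i \<longleftrightarrow> (\<forall>l. v l \<in> Ah_part i) \<and> order_le (int \<iota>) v"
  by (simp add: G_def order_le_def)

lemma G_Dp: "v \<in> G i \<Longrightarrow> v \<in> Dp i"
  by (auto simp: G_iff Dp_iff)

lemma G_add: "v \<in> G i \<Longrightarrow> w \<in> G i \<Longrightarrow> v + w \<in> G i"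
  by (auto simp: G_def intro: Ah_part_add)

lemma G_scl: "v \<in> G i \<Longrightarrow> d_scl c v \<in> G i"
  by (auto simp: G_def d_scl_def intro: Ah_part_scl)

lemma G_zero [simp]: "0 \<in> G i"
  by (simp add: G_def)

lemma G_uminus: "v \<in> G i \<Longrightarrow> - v \<in> G i"
  using G_scl[of v i "- 1"] by (simp add: d_scl_uminus_one)

lemma G_diff: "v \<in> G i \<Longrightarrow> w \<in> G i \<Longrightarrow> v - w \<in> G i"
  using G_add[of v i "- w"] by (simp add: G_uminus)

lemma gcarG_iff: "v \<in> gcar G \<longleftrightarrow> v \<in> DD \<and> order_le (int \<iota>) v"
proof
  assume "v \<in> gcar G"
  then obtain x y where v: "v = x + y" "x \<in> G 0" "y \<in> G 1" unfolding gcar_def by blast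
  then have "order_le (int \<iota>) v" by (auto simp: G_def order_le_def)
  with v show "v \<in> DD \<and> order_le (int \<iota>) v" by (simp add: DD_add Dp_DD[OF G_Dp])
next
  assume v: "v \<in> DD \<and> order_le (int \<iota>) v"
  then have "d_part i v \<in> G i" for i
    using d_part_Dp[of v i] order_le_part[of "int \<iota>" v i] by (simp add: G_iff Dp_iff)
  then show "v \<in> gcar G" unfolding gcar_def using d_part_sum[of v, symmetric] by blast
qed

lemma gcarG_E:
  assumes "v \<in> gcar G" obtains v0 v1 where "v = v0 + v1" "v0 \<in> G 0" "v1 \<in> G 1"
  using assms unfolding gcar_def by blast

lemma G_gcarG: "v \<in> G i \<Longrightarrow> v \<in> gcar G"
  using Dp_DD[OF G_Dp, of v i] by (simp add: gcarG_iff G_iff)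

lemma gcarG_DD: "v \<in> gcar G \<Longrightarrow> v \<in> DD"
  by (simp add: gcarG_iff)

lemma gcarG_add: "v \<in> gcar G \<Longrightarrow> w \<in> gcar G \<Longrightarrow> v + w \<in> gcar G"
  by (simp add: gcarG_iff DD_add) (simp add: order_le_def)

lemma gcarG_scl: "v \<in> gcar G \<Longrightarrow> d_scl c v \<in> gcar G"
  by (simp add: gcarG_iff DD_scl order_le_scl)

lemma G_evo_hom: "v \<in> G k \<Longrightarrow> evo_hom k v"
  by (simp add: evo_hom_def G_def Ah_part_def P_part_iff)

lemma gcarG_coeff_P: "v \<in> gcar G \<Longrightarrow> Poly_Mapping.lookup (v l) (i, j) \<in> P"
  by (simp add: gcarG_iff DD_iff Ah_iff)

lemma evo_P: "v \<in> gcar G \<Longrightarrow> p \<in> P \<Longrightarrow> evo v p \<in> P"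
  unfolding P_def by (rule spoly_on_evo) (use gcarG_coeff_P in \<open>auto simp: P_def\<close>)

lemma ah_evo_Ah_part:
  assumes "v \<in> G k" "a \<in> Ah_part i" shows "ah_evo v a \<in> Ah_part (k + i)"
proof -
  have "evo v (Poly_Mapping.lookup a (j, l)) \<in> P_part (k + i + j)" for j l
    using Ah_partD(1)[OF assms(2), of j l] evo_P[OF G_gcarG[OF assms(1)]]
      sp_hom_evo[OF G_evo_hom[OF assms(1)]] by (auto simp: P_part_iff add.assoc)
  then show ?thesis using Ah_partD(2)[OF assms(2)] by (auto simp: Ah_part_def)
qed

lemma evo_d_apply: "evo_d v w l = ah_evo v (w l)"
  by (simp add: evo_d_eq)

lemma order_le_evo_d: "order_le N w \<Longrightarrow> order_le N (evo_d v w)"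
  by (simp add: order_le_def evo_d_apply)

lemma evo_d_Dp: "v \<in> G k \<Longrightarrow> w \<in> Dp i \<Longrightarrow> evo_d v w \<in> Dp (k + i)"
  unfolding Dp_iff using order_le_evo_d by (auto simp: evo_d_apply intro: ah_evo_Ah_part)

lemma evo_d_G: "v \<in> G k \<Longrightarrow> w \<in> G i \<Longrightarrow> evo_d v w \<in> G (k + i)"
  unfolding G_iff[of w] G_iff[of _ "k + i"] using order_le_evo_d by (auto simp: evo_d_apply intro: ah_evo_Ah_part)

lemma evo_d_add: "evo_d v (w + u) = evo_d v w + evo_d v u"
  by (rule ext) (simp add: evo_d_apply ah_evo_add)

lemma evo_d_scl: "evo_d v (d_scl c w) = d_scl c (evo_d v w)"
  by (rule ext) (simp add: evo_d_apply ah_evo_scl d_scl_def)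

lemma evo_d_add_left: "evo_d (v + w) u = evo_d v u + evo_d w u"
  by (rule ext) (simp add: evo_d_apply ah_evo_add_left)

lemma evo_d_scl_left: "evo_d (d_scl c v) u = d_scl c (evo_d v u)"
  by (rule ext) (simp add: evo_d_apply ah_evo_scl_left, simp add: d_scl_def evo_d_apply)

lemma evo_d_zero [simp]: "evo_d v 0 = 0" "evo_d 0 w = 0"
  using evo_d_add[of v 0 0] evo_d_add_left[of 0 0 w] by simp_all

lemma evo_d_uminus [simp]: "evo_d v (- w) = - evo_d v w" "evo_d (- v) w = - evo_d v w"
  using evo_d_scl[of v "- 1" w] evo_d_scl_left[of "- 1" v w] by simp_all

lemma evo_d_diff: "evo_d v (w - u) = evo_d v w - evo_d v u"
  using evo_d_add[of v w "- u"] by simp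

lemma evo_d_minus: "evo_d v (d_minus w) = d_minus (evo_d v w)"
  by (rule ext) (simp add: evo_d_apply d_minus_def)

lemma evo_d_DD:
  assumes "v \<in> G k" "w \<in> DD" shows "evo_d v w \<in> DD"
proof -
  obtain w0 w1 where w: "w = w0 + w1" "w0 \<in> Dp 0" "w1 \<in> Dp 1" using assms(2) by (rule DD_E)
  show ?thesis unfolding w(1) evo_d_add
    using evo_d_Dp[OF assms(1) w(2)] evo_d_Dp[OF assms(1) w(3)] by (simp add: DD_add Dp_DD)
qed

lemma evo_d_mult:
  assumes "v \<in> G k" "a \<in> Dp i" "b \<in> DD"
  shows "evo_d v (d_mult a b) = d_mult (evo_d v a) b + d_scl (psign (k * i)) (d_mult a (evo_d v b))"
proof
  fix r
  show "evo_d v (d_mult a b) r = (d_mult (evo_d v a) b + d_scl (psign (k * i)) (d_mult a (evo_d v b))) r"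
    using mult_pairing.Ev_gprod[OF G_evo_hom[OF assms(1)] assms(2) Dp_DD[OF assms(2)] assms(3), of r]
    by (simp add: evo_d_apply[of v "mult_pairing.gprod a b"] d_mult_gprod d_scl_def)
qed

lemma d_scl_apply: "d_scl c v l = ah_scl c (v l)"
  by (simp add: d_scl_def)

text \<open>Both sides are superderivations with the same values on the symbols, since
  evolutionary vector fields commute with $\partial$.\<close>

lemma evo_commutator:
  assumes "v \<in> G i" "w \<in> G j"
  shows "evo (evo_d v w - d_scl (psign (i * j)) (evo_d w v)) p =
    evo v (evo w p) - scl (psign (i * j)) (evo w (evo v p))"
proof -
  let ?b = "evo_d v w - d_scl (psign (i * j)) (evo_d w v)"
  have "?b \<in> G (i + j)"
    using evo_d_G[OF assms] evo_d_G[OF assms(2,1)] by (simp add: G_diff G_scl add.commute)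
  then have b: "superderivation (i + j) (evo ?b)" by (rule superderivation_evo[OF G_evo_hom])
  note hom = G_evo_hom[OF assms(1)] G_evo_hom[OF assms(2)]
  have c: "superderivation (i + j) (\<lambda>p. evo v (evo w p) - scl (psign (i * j)) (evo w (evo v p)))"
    by (rule superderivation_commutator[OF superderivation_evo[OF hom(1)] superderivation_evo[OF hom(2)]])
       (auto intro: sp_hom_evo hom)
  have pow: "evo v ((ddx ^^ m) q) = (ddx ^^ m) (evo v q)" "evo w ((ddx ^^ m) q) = (ddx ^^ m) (evo w q)" for m q
    by (induction m) (simp_all add: evo_ddx[OF hom(1)] evo_ddx[OF hom(2)])
  have "(ddx ^^ m) (x - y) = (ddx ^^ m) x - (ddx ^^ m) y" for m and x y :: "'f spoly"
    using ddx_pow_add[of m x "- y"] ddx_pow_scl[of m "- 1" y] by simp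
  then have "evo ?b (U k t) = evo v (evo w (U k t)) - scl (psign (i * j)) (evo w (evo v (U k t)))" for k t
    by (cases t) (simp add: evo_U pow evo_d_apply d_scl_def lookup_minus ddx_pow_scl)
  from superderivation_eqI[OF b c this] show ?thesis .
qed

lemma evo_d_commutator:
  assumes "v \<in> G i" "w \<in> G j"
  shows "evo_d (evo_d v w - d_scl (psign (i * j)) (evo_d w v)) u =
    evo_d v (evo_d w u) - d_scl (psign (i * j)) (evo_d w (evo_d v u))"
  by (rule ext, rule poly_mapping_eqI)
     (simp add: evo_d_apply evo_commutator[OF assms] lookup_minus d_scl_apply)

section \<open>The Lie superalgebra and its module\<close>

lemma bracket_hom:
  assumes "v \<in> G i" "w \<in> G j"
  shows "evo_bracket v w = evo_d v w - d_scl (psign (i * j)) (evo_d w v)"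
  using bit_cases2[of i] bit_cases2[of j]
  by (auto simp: evo_bracket_def d_part_hom[OF G_Dp[OF assms(1)]] d_part_hom[OF G_Dp[OF assms(2)]])

lemma bracket_add_left: "evo_bracket (v + v') w = evo_bracket v w + evo_bracket v' w"
  by (simp add: evo_bracket_def d_part_add evo_d_add evo_d_add_left d_scl_add algebra_simps)

lemma bracket_add_right: "evo_bracket v (w + w') = evo_bracket v w + evo_bracket v w'"
  by (simp add: evo_bracket_def d_part_add evo_d_add evo_d_add_left d_scl_add algebra_simps)

lemma bracket_scl_left: "evo_bracket (d_scl c v) w = d_scl c (evo_bracket v w)"
  by (simp add: evo_bracket_def d_part_scl evo_d_scl evo_d_scl_left d_scl_add d_scl_diff d_scl_d_scl mult.commute)

lemma bracket_scl_right: "evo_bracket v (d_scl c w) = d_scl c (evo_bracket v w)"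
  by (simp add: evo_bracket_def d_part_scl evo_d_scl evo_d_scl_left d_scl_add d_scl_diff d_scl_d_scl mult.commute)

lemma bracket_G:
  assumes "v \<in> G i" "w \<in> G j" shows "evo_bracket v w \<in> G (i + j)"
  unfolding bracket_hom[OF assms]
  using evo_d_G[OF assms] evo_d_G[OF assms(2,1)] by (simp add: G_diff G_scl add.commute)

lemma bracket_jacobi_hom:
  assumes x: "x \<in> G i" and y: "y \<in> G j" and z: "z \<in> G k"
  shows "evo_bracket x (evo_bracket y z) = evo_bracket (evo_bracket x y) z +
    d_scl (psign (i * j)) (evo_bracket y (evo_bracket x z))"
proof -
  note G = bracket_G[OF y z] bracket_G[OF x y] bracket_G[OF x z]
  show ?thesis
    unfolding bracket_hom[OF x G(1)] bracket_hom[OF G(2) z] bracket_hom[OF y G(3)]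
    unfolding bracket_hom[OF x y] bracket_hom[OF y z] bracket_hom[OF x z]
    unfolding evo_d_commutator[OF x y] evo_d_commutator[OF y z] evo_d_commutator[OF x z]
    using bit_cases2[of i] bit_cases2[of j] bit_cases2[of k]
    by (auto simp: evo_d_diff evo_d_scl d_scl_diff d_scl_d_scl evo_d_add)
qed

lemma lie_superalgebra_G: "lie_superalgebra d_scl G evo_bracket"
proof -
  interpret vs: vector_space "d_scl :: 'f \<Rightarrow> _" by (rule vector_space_d_scl)
  show ?thesis
  proof unfold_locales
    show "vs.subspace (G i)" for i
      by (rule vs.subspaceI) (auto intro: G_add G_scl)
    show "G 0 \<inter> G 1 = {0}" using Dp_unique[OF G_Dp G_Dp, of _ 0 1] by auto
    show "evo_bracket x y = - d_scl (psign (i * j)) (evo_bracket y x)" if "x \<in> G i" "y \<in> G j" for x y i j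
      using bit_cases2[of i] bit_cases2[of j]
      by (auto simp: bracket_hom[OF that] bracket_hom[OF that(2,1)])
  next
    fix x y z i j assume xyz: "x \<in> G i" "y \<in> G j" "z \<in> gcar G"
    from xyz(3) obtain z0 z1 where z: "z = z0 + z1" "z0 \<in> G 0" "z1 \<in> G 1" by (rule gcarG_E)
    show "evo_bracket x (evo_bracket y z) = evo_bracket (evo_bracket x y) z +
      d_scl (psign (i * j)) (evo_bracket y (evo_bracket x z))"
      unfolding z(1) bracket_add_right
      using bracket_jacobi_hom[OF xyz(1,2) z(2)] bracket_jacobi_hom[OF xyz(1,2) z(3)]
      by (simp add: d_scl_add)
  qed (simp_all add: bracket_G bracket_add_left bracket_add_right bracket_scl_left bracket_scl_right)
qed

lemma evo_ddx_gcar: "v \<in> gcar G \<Longrightarrow> evo v (ddx p) = ddx (evo v p)"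
  by (elim gcarG_E) (simp add: evo_add_left ddx_add evo_ddx[OF G_evo_hom])

text \<open>The action on classes does not depend on the representative, because $\partial_v$ maps
  total derivatives to total derivatives.\<close>

lemma t_act_til:
  assumes "v \<in> gcar G" "f \<in> P" shows "t_act v (til f) = til (evo v f)"
proof -
  define g where "g = inv_into P til (til f)"
  have "til g = til f" unfolding g_def by (rule f_inv_into_f) (use assms in auto)
  then have "til (g - f) = 0" by (simp add: til_diff)
  then obtain h where "g - f = ddx h" unfolding til_eq_0 by blast
  then have "g = f + ddx h" by (simp add: algebra_simps)
  then have "til (evo v g) = til (evo v f)"
    by (simp add: evo_add evo_ddx_gcar[OF assms(1)] til_add)
  then show ?thesis by (simp add: t_act_def g_def)
qed

lemma Pt_E: assumes "X \<in> Pt" obtains f where "f \<in> P" "X = til f"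
  using assms unfolding Pt_def by blast

lemma til_Pt: "f \<in> P \<Longrightarrow> til f \<in> Pt"
  by (simp add: Pt_def)

lemma module_Pt: "lie_superalgebra_module d_scl G evo_bracket tscl Pt t_act"
proof -
  interpret vs: vector_space "tscl :: 'f \<Rightarrow> _" by (rule vector_space_tscl)
  interpret lie_superalgebra d_scl G evo_bracket by (rule lie_superalgebra_G)
  show ?thesis
  proof unfold_locales
    show "vs.subspace Pt"
      by (rule vs.subspaceI)
         (auto elim!: Pt_E simp: til_add[symmetric] til_scl[symmetric] intro!: til_Pt P_add P_scl, metis P_zero til_Pt til_zero)
  next
    fix x u assume "x \<in> gcar G" "u \<in> Pt"
    then show "t_act x u \<in> Pt" by (elim Pt_E) (simp add: t_act_til til_Pt evo_P)
  next
    fix x y u assume "x \<in> gcar G" "y \<in> gcar G" "u \<in> Pt"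
    then show "t_act (x + y) u = t_act x u + t_act y u"
      by (elim Pt_E) (simp add: t_act_til gcarG_add evo_add_left til_add)
  next
    fix x u w assume "x \<in> gcar G" "u \<in> Pt" "w \<in> Pt"
    then show "t_act x (u + w) = t_act x u + t_act x w"
      by (elim Pt_E) (simp add: til_add[symmetric] t_act_til P_add evo_add)
  next
    fix x u c assume "x \<in> gcar G" "u \<in> Pt"
    then show "t_act (d_scl c x) u = tscl c (t_act x u)"
      by (elim Pt_E) (simp add: t_act_til gcarG_scl evo_scl_left til_scl)
  next
    fix x u c assume "x \<in> gcar G" "u \<in> Pt"
    then show "t_act x (tscl c u) = tscl c (t_act x u)"
      by (elim Pt_E) (simp add: til_scl[symmetric] t_act_til P_scl evo_scl)
  next
    fix x i y j u assume xy: "x \<in> G i" "y \<in> G j" and "u \<in> Pt"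
    then obtain f where f: "f \<in> P" "u = til f" by (elim Pt_E)
    show "t_act (evo_bracket x y) u = t_act x (t_act y u) - tscl (psign (i * j)) (t_act y (t_act x u))"
      using xy f
      by (simp add: t_act_til G_gcarG[OF bracket_G[OF xy]] G_gcarG[OF xy(1)] G_gcarG[OF xy(2)] evo_P)
         (simp add: bracket_hom[OF xy] evo_commutator[OF xy] til_diff til_scl)
  qed
qed

lemma t_act_tr:
  assumes "x \<in> G k" "a \<in> Dp i" "b \<in> DD"
  shows "t_act x (tr a b) = tr (evo_d x a) b + tscl (psign (k * i)) (tr a (evo_d x b))"
  unfolding tr_def
  using form_pairing.Ev_gprod[OF G_evo_hom[OF assms(1)] assms(2) Dp_DD[OF assms(2)] assms(3), of "- 1"]
  by (simp add: t_act_til[OF G_gcarG[OF assms(1)] residue_P[OF Dp_DD[OF assms(2)] assms(3)]] til_add til_scl)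

section \<open>One-forms\<close>

lemma d_power_add: "d_power m (\<phi> + \<psi>) = d_power m \<phi> + d_power m \<psi>"
  by (rule ext) (simp add: d_power_def ah_ddx_pow_add ah_scl_add)

lemma d_power_scl: "d_power m (ah_scl c \<phi>) = d_scl c (d_power m \<phi>)"
  by (rule ext) (simp add: d_power_def d_scl_def ah_ddx_pow_scl ah_scl_scl mult.commute)

lemma d_power_zero [simp]: "d_power m 0 = 0"
  using d_power_add[of m 0 0] by simp

lemma order_le_power: "order_le m (d_power m \<psi>)"
  by (simp add: order_le_def d_power_def)

lemma d_power_Dp: "\<psi> \<in> Ah_part i \<Longrightarrow> d_power m \<psi> \<in> Dp i"
  unfolding Dp_iff using order_le_power[of m \<psi>] by (auto simp: d_power_def intro!: Ah_part_scl Ah_part_ddx_pow)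

lemma d_power_DD: "\<psi> \<in> Ah \<Longrightarrow> d_power m \<psi> \<in> DD"
  by (elim AhE) (simp add: d_power_add DD_add Dp_DD[OF d_power_Dp])

lemma Omega_sum:
  "finite S \<Longrightarrow> S \<subseteq> {- int \<iota> - 1..} \<Longrightarrow> (\<And>m. m \<in> S \<Longrightarrow> \<psi> m \<in> Ah) \<Longrightarrow> (\<Sum>m\<in>S. d_power m (\<psi> m)) \<in> \<Omega>"
  unfolding \<Omega>_def by blast

lemma Omega_E:
  assumes "w \<in> \<Omega>"
  obtains S \<psi> where "finite S" "S \<subseteq> {- int \<iota> - 1..}" "\<And>m. \<psi> m \<in> Ah" "w = (\<Sum>m\<in>S. d_power m (\<psi> m))"
proof -
  obtain S \<psi> where S: "finite S" "S \<subseteq> {- int \<iota> - 1..}" "\<forall>m\<in>S. \<psi> m \<in> Ah" "w = (\<Sum>m\<in>S. d_power m (\<psi> m))"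
    using assms unfolding \<Omega>_def by blast
  show ?thesis
    by (rule that[OF S(1,2), of "\<lambda>m. if m \<in> S then \<psi> m else 0"]) (use S in \<open>auto intro: sum.cong\<close>)
qed

lemma Omega_power: "m \<ge> - int \<iota> - 1 \<Longrightarrow> \<psi> \<in> Ah \<Longrightarrow> d_power m \<psi> \<in> \<Omega>"
  using Omega_sum[of "{m}" "\<lambda>_. \<psi>"] by simp

lemma Omega_add:
  assumes "w \<in> \<Omega>" "w' \<in> \<Omega>" shows "w + w' \<in> \<Omega>"
proof -
  obtain S \<psi> where S: "finite S" "S \<subseteq> {- int \<iota> - 1..}" "\<And>m. \<psi> m \<in> Ah" "w = (\<Sum>m\<in>S. d_power m (\<psi> m))"
    using assms(1) by (rule Omega_E) blast
  obtain T \<chi> where T: "finite T" "T \<subseteq> {- int \<iota> - 1..}" "\<And>m. \<chi> m \<in> Ah" "w' = (\<Sum>m\<in>T. d_power m (\<chi> m))"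
    using assms(2) by (rule Omega_E) blast
  have "w = (\<Sum>m\<in>S \<union> T. d_power m (if m \<in> S then \<psi> m else 0))" unfolding S(4)
    by (rule sum.mono_neutral_cong_left) (use S T in auto)
  moreover have "w' = (\<Sum>m\<in>S \<union> T. d_power m (if m \<in> T then \<chi> m else 0))" unfolding T(4)
    by (rule sum.mono_neutral_cong_left) (use S T in auto)
  ultimately have "w + w' = (\<Sum>m\<in>S \<union> T. d_power m ((if m \<in> S then \<psi> m else 0) + (if m \<in> T then \<chi> m else 0)))"
    by (simp only: d_power_add sum.distrib)
  also have "\<dots> \<in> \<Omega>" by (rule Omega_sum) (use S T in \<open>auto intro: Ah_add\<close>)
  finally show ?thesis .
qed

lemma Omega_zero [simp]: "0 \<in> \<Omega>"
  using Omega_sum[of "{}"] by simp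

lemma Omega_scl: "w \<in> \<Omega> \<Longrightarrow> d_scl c w \<in> \<Omega>"
proof -
  assume "w \<in> \<Omega>"
  then obtain S \<psi> where S: "finite S" "S \<subseteq> {- int \<iota> - 1..}" "\<And>m. \<psi> m \<in> Ah" "w = (\<Sum>m\<in>S. d_power m (\<psi> m))"
    by (rule Omega_E) blast
  have "d_scl c w = (\<Sum>m\<in>S. d_power m (ah_scl c (\<psi> m)))"
    unfolding S(4) d_power_scl additive_sum[of "d_scl c", OF d_scl_add] ..
  also have "\<dots> \<in> \<Omega>" by (rule Omega_sum) (use S in \<open>auto intro: Ah_scl\<close>)
  finally show ?thesis .
qed

lemma Omega_sum_closed: "(\<And>x. x \<in> B \<Longrightarrow> f x \<in> \<Omega>) \<Longrightarrow> sum f B \<in> \<Omega>"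
  by (induction B rule: infinite_finite_induct) (auto intro: Omega_add)

lemma DD_sum: "(\<And>x. x \<in> B \<Longrightarrow> f x \<in> DD) \<Longrightarrow> sum f B \<in> DD"
  by (induction B rule: infinite_finite_induct) (auto intro: DD_add)

lemma Omega_DD: "w \<in> \<Omega> \<Longrightarrow> w \<in> DD"
  by (elim Omega_E) (auto intro!: DD_sum d_power_DD)

lemma Omega_part:
  assumes "w \<in> \<Omega>" shows "d_part i w \<in> \<Omega>"
proof -
  obtain S \<psi> where S: "finite S" "S \<subseteq> {- int \<iota> - 1..}" "\<And>m. \<psi> m \<in> Ah" "w = (\<Sum>m\<in>S. d_power m (\<psi> m))"
    using assms by (rule Omega_E) blast
  have "d_part i (d_power m (\<psi> m)) = d_power m (ah_part i (\<psi> m))" for m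
  proof -
    have "d_part i (d_power m (ah_part 0 (\<psi> m) + ah_part 1 (\<psi> m))) = d_power m (ah_part i (\<psi> m))"
      using bit_cases2[of i] d_part_hom[OF d_power_Dp[OF ah_part_Ah_part[OF S(3)]]]
      by (auto simp: d_power_add d_part_add)
    then show ?thesis by (simp add: ah_part_sum)
  qed
  then have "d_part i w = (\<Sum>m\<in>S. d_power m (ah_part i (\<psi> m)))"
    unfolding S(4) by (simp add: additive_sum[of "d_part i", OF d_part_add])
  also have "\<dots> \<in> \<Omega>" by (rule Omega_sum) (use S ah_part_Ah_part Ah_part_Ah in blast)+
  finally show ?thesis .
qed

text \<open>Subtract the leading terms $\partial^ma_m$ one after another until the order drops
  below $-\iota-1$. Each of them lies in $\Omega$.\<close>

lemma Omega_approx: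
  assumes "a \<in> Dp i"
  shows "\<exists>w\<in>\<Omega> \<inter> Dp i. order_le (- int \<iota> - 2) (a - w)"
proof -
  (* n counts the orders of a that lie in the range allowed in \<Omega>. *)
  have "\<exists>w\<in>\<Omega> \<inter> Dp i. order_le (- int \<iota> - 2) (a - w)" if "a \<in> Dp i" "order_le (int n - int \<iota> - 2) a" for n
    using that
  proof (induction n arbitrary: a)
    case 0
    then show ?case by (intro bexI[of _ 0]) auto
  next
    case (Suc n)
    let ?m = "int n - int \<iota> - 1"
    have am: "a ?m \<in> Ah_part i" using Suc.prems(1) by (simp add: Dp_iff)
    let ?p = "d_power ?m (a ?m)"
    have "order_le (int n - int \<iota> - 2) (a - ?p)"
      unfolding order_le_def
    proof (intro allI impI)
      fix l assume l: "l > int n - int \<iota> - 2"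
      consider "l = ?m" | "l > ?m" using l by linarith
      then show "(a - ?p) l = 0"
        by cases (use Suc.prems(2) in \<open>auto simp: order_le_def d_power_def\<close>)
    qed
    moreover have "a - ?p \<in> Dp i" by (intro Dp_diff Suc.prems(1) d_power_Dp am)
    ultimately obtain w where w: "w \<in> \<Omega>" "w \<in> Dp i" "order_le (- int \<iota> - 2) (a - ?p - w)" using Suc.IH by blast
    have "?p + w \<in> \<Omega>" "?p + w \<in> Dp i"
      using w am by (auto intro!: Omega_add Omega_power Dp_add d_power_Dp Ah_part_Ah[OF am])
    moreover have "a - (?p + w) = a - ?p - w" by (simp add: algebra_simps)
    ultimately show ?case using w(3) by (metis IntI)
  qed
  moreover obtain N where "order_le N a" using assms by (auto simp: Dp_iff)
  then have "order_le (int (nat (N + int \<iota> + 2)) - int \<iota> - 2) a" by (rule order_le_mono) simp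
  ultimately show ?thesis using assms by blast
qed

text \<open>The term $v_j\partial^j\partial^m\psi$ contributes
  $\binom{m+j}N\langle v_j,\psi^{(N)}\rangle$ with $N=m+j+1$, by the Vandermonde identity. Since
  $0\le m+j<N$ unless $N=0$, only $j=-m-1$ survives.\<close>

lemma residue_power:
  assumes "v \<in> DD" "\<psi> \<in> Ah"
  shows "form_pairing.gprod v (d_power m \<psi>) (- 1) = ah_form (v (- m - 1)) \<psi>"
proof -
  obtain M where M: "order_le M v" using assms(1) by (auto simp: DD_iff)
  define K where "K = max M (- m - 1)"
  have K: "order_le K v" using M by (rule order_le_mono) (simp add: K_def)
  let ?S = "{- 1 - m..K}" and ?T = "{- 1 - K..m}"
  have "form_pairing.gprod v (d_power m \<psi>) (- 1) = (\<Sum>j\<in>?S. \<Sum>n\<in>?T. form_pairing.gterm j n (- 1) (v j) (d_power m \<psi> n))"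
    by (rule form_pairing.gprod_order_le_box[OF K order_le_power]) auto
  also have "\<dots> = (\<Sum>j\<in>?S. if j = - m - 1 then ah_form (v (- m - 1)) \<psi> else 0)"
  proof (rule sum.cong[OF refl])
    fix j assume j: "j \<in> ?S"
    define N where "N = nat (j + m + 1)"
    have N: "int N = j + m + 1" using j by (simp add: N_def)
    let ?X = "ah_form (v j) ((ah_ddx ^^ N) \<psi>)"
    have "(\<Sum>n\<in>?T. form_pairing.gterm j n (- 1) (v j) (d_power m \<psi> n)) =
        (\<Sum>n\<in>{- 1 - j..m}. form_pairing.gterm j n (- 1) (v j) (d_power m \<psi> n))"
      by (rule sum.mono_neutral_right) (use j in \<open>auto simp: form_pairing.gterm_def\<close>)
    also have "\<dots> = (\<Sum>q\<le>N. form_pairing.gterm j (m - int q) (- 1) (v j) (d_power m \<psi> (m - int q)))"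
      by (rule sum.reindex_bij_witness[of _ "\<lambda>q. m - int q" "\<lambda>n. nat (m - n)"]) (use N in auto)
    also have "\<dots> = (\<Sum>q\<le>N. scl ((of_int m gchoose q) * (of_int j gchoose (N - q))) ?X)"
    proof (rule sum.cong[OF refl])
      fix q assume q: "q \<in> {..N}"
      have q': "nat (j + (m - int q) - - 1) = N - q" "j + (m - int q) \<ge> - 1" using N q by auto
      have "(ah_ddx ^^ (N - q)) ((ah_ddx ^^ q) \<psi>) = (ah_ddx ^^ N) \<psi>"
        using q by (simp add: comp_apply[symmetric, of "ah_ddx ^^ _"] funpow_add[symmetric] del: comp_apply)
      moreover have "v j \<in> Ah" using assms(1) by (simp add: DD_iff)
      ultimately show "form_pairing.gterm j (m - int q) (- 1) (v j) (d_power m \<psi> (m - int q)) =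
          scl ((of_int m gchoose q) * (of_int j gchoose (N - q))) ?X"
        using q' assms by (simp add: form_pairing.gterm_def d_power_def ah_ddx_pow_scl ah_form_scl Ah_ddx_pow scl_scl mult.commute)
    qed
    also have "\<dots> = scl ((of_int m + of_int j) gchoose N) ?X"
      by (simp only: form_pairing.sc_sum_left[symmetric] gbinomial_Vandermonde atMost_atLeast0)
    also have "\<dots> = (if j = - m - 1 then ah_form (v (- m - 1)) \<psi> else 0)"
    proof (cases "j = - m - 1")
      case True
      then show ?thesis by (simp add: N_def)
    next
      case False
      have "0 \<le> m + j" "m + j < int N" using N False j by auto
      then have "(of_int (m + j) gchoose N :: 'f) = 0" by (rule gbinomial_int_zero)
      then show ?thesis using False by simp
    qed
    finally show "(\<Sum>n\<in>?T. form_pairing.gterm j n (- 1) (v j) (d_power m \<psi> n)) = (if j = - m - 1 then ah_form (v (- m - 1)) \<psi> else 0)" .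
  qed
  also have "\<dots> = ah_form (v (- m - 1)) \<psi>" by (subst sum.delta) (auto simp: K_def)
  finally show ?thesis .
qed

lemma tr_power: "v \<in> DD \<Longrightarrow> \<psi> \<in> Ah \<Longrightarrow> tr v (d_power m \<psi>) = til (ah_form (v (- m - 1)) \<psi>)"
  by (simp add: tr_def residue_power)

lemma right_coeff_add:
  assumes "order_le N v" "order_le N w"
  shows "right_coeff (v + w) m = right_coeff v m + right_coeff w m"
proof -
  have fin: "finite {p. ah_scl ((- 1) ^ p * (of_int (m + int p) gchoose p)) ((ah_ddx ^^ p) (u (m + int p))) \<noteq> 0}"
    if "order_le N u" for u :: "'f psdo"
  proof (rule finite_subset)
    show "{p. ah_scl ((- 1) ^ p * (of_int (m + int p) gchoose p)) ((ah_ddx ^^ p) (u (m + int p))) \<noteq> 0} \<subseteq> {..nat (N - m)}"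
    proof
      fix p assume "p \<in> {p. ah_scl ((- 1) ^ p * (of_int (m + int p) gchoose p)) ((ah_ddx ^^ p) (u (m + int p))) \<noteq> 0}"
      then have "u (m + int p) \<noteq> 0" by auto
      then have "m + int p \<le> N" using that by (metis order_le_def not_le)
      then show "p \<in> {..nat (N - m)}" by auto
    qed
  qed simp
  show ?thesis unfolding right_coeff_def
    by (subst Sum_any.distrib[OF fin[OF assms(1)] fin[OF assms(2)], symmetric])
       (simp add: ah_ddx_pow_add ah_scl_add)
qed

lemma right_coeff_sum:
  fixes \<psi> :: "int \<Rightarrow> 'f ahat"
  shows "finite S \<Longrightarrow> right_coeff (\<Sum>m\<in>S. d_power m (\<psi> m)) n = (if n \<in> S then \<psi> n else 0)"
proof (induction S rule: finite_induct)
  case empty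
  then show ?case by (simp add: right_coeff_def)
next
  case (insert m S)
  obtain N where N: "\<forall>k\<in>insert m S. k \<le> N" using insert(1) by (metis Max_ge finite_insert)
  have sum: "order_le N (\<Sum>m\<in>T. d_power m (\<psi> m))" if "T \<subseteq> insert m S" for T
    using that
  proof (induction T rule: infinite_finite_induct)
    case (insert x F)
    then have "order_le N (d_power x (\<psi> x))" using N order_le_mono[OF order_le_power] by blast
    then show ?case using insert by (simp add: order_le_def)
  qed (simp_all add: order_le_def)
  have "order_le N (d_power m (\<psi> m))" using N order_le_mono[OF order_le_power] by blast
  then have "right_coeff (d_power m (\<psi> m) + (\<Sum>m\<in>S. d_power m (\<psi> m))) n =
    right_coeff (d_power m (\<psi> m)) n + right_coeff (\<Sum>m\<in>S. d_power m (\<psi> m)) n"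
    by (rule right_coeff_add) (rule sum, blast)
  then have "right_coeff (\<Sum>m\<in>insert m S. d_power m (\<psi> m)) n =
    (if n = m then \<psi> m else 0) + (if n \<in> S then \<psi> n else 0)"
    unfolding sum.insert[OF insert(1,2)] by (simp only: right_coeff_power insert(3))
  then show ?case using insert(2) by auto
qed

lemma pairing_sum:
  assumes "v \<in> DD" "finite S" "\<And>m. \<psi> m \<in> Ah"
  shows "pairing v (\<Sum>m\<in>S. d_power m (\<psi> m)) = (\<Sum>m\<in>S. til (ah_form (v (- m - 1)) (\<psi> m)))"
proof -
  let ?w = "\<Sum>m\<in>S. d_power m (\<psi> m)"
  have rc: "right_coeff ?w n = (if n \<in> S then \<psi> n else 0)" for n using right_coeff_sum[OF assms(2)] .
  have "pairing v ?w = (\<Sum>j\<in>(\<lambda>m. - m - 1) ` S. til (ah_form (v j) (right_coeff ?w (- j - 1))))"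
    unfolding pairing_def
  proof (rule Sum_any.expand_superset)
    show "{j. til (ah_form (v j) (right_coeff ?w (- j - 1))) \<noteq> 0} \<subseteq> (\<lambda>m. - m - 1) ` S"
    proof
      fix j assume "j \<in> {j. til (ah_form (v j) (right_coeff ?w (- j - 1))) \<noteq> 0}"
      then have "- j - 1 \<in> S" by (auto simp: rc split: if_splits)
      then show "j \<in> (\<lambda>m. - m - 1) ` S" by (rule rev_image_eqI) simp
    qed
  qed (use assms in simp)
  also have "\<dots> = (\<Sum>m\<in>S. til (ah_form (v (- m - 1)) (right_coeff ?w (- (- m - 1) - 1))))"
    by (subst sum.reindex) (auto simp: inj_on_def)
  also have "\<dots> = (\<Sum>m\<in>S. til (ah_form (v (- m - 1)) (\<psi> m)))"
    by (rule sum.cong[OF refl]) (simp add: rc)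
  finally show ?thesis .
qed

lemma tr_zero_right [simp]: "v \<in> DD \<Longrightarrow> tr v 0 = 0"
  using tr_add_right[of v 0 0] by simp

lemma tr_sum_right:
  "v \<in> DD \<Longrightarrow> (\<And>x. x \<in> B \<Longrightarrow> f x \<in> DD) \<Longrightarrow> tr v (sum f B) = (\<Sum>x\<in>B. tr v (f x))"
proof (induction B rule: infinite_finite_induct)
  case (insert x B)
  then have "tr v (f x + sum f B) = tr v (f x) + tr v (sum f B)"
    by (intro tr_add_right DD_sum) auto
  with insert show ?case by (simp only: sum.insert[OF insert(1,2)]) simp
qed (simp_all add: tr_zero_right)

text \<open>Although the pairing uses the coefficients of \<open>w\<close> on the right, by
  \<open>residue_power\<close> it agrees with the residue form, which uses those on the left.\<close>

lemma pairing_tr: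
  assumes "v \<in> DD" "w \<in> \<Omega>" shows "pairing v w = tr v w"
proof -
  obtain S \<psi> where S: "finite S" "\<And>m. \<psi> m \<in> Ah" "w = (\<Sum>m\<in>S. d_power m (\<psi> m))"
    using assms(2) by (rule Omega_E) blast
  show ?thesis unfolding S(3) using assms(1) S
    by (simp add: pairing_sum tr_sum_right d_power_DD tr_power)
qed

section \<open>Nondegeneracy\<close>

definition dual_basis :: "bit \<Rightarrow> nat \<Rightarrow> 'a" where
  "dual_basis = (SOME d. \<forall>i. \<forall>l\<in>{1..dim (A i)}. d i l \<in> A i \<and>
     (\<forall>j. \<forall>k\<in>{1..dim (A j)}. form (e j k) (d i l) = (if j = i \<and> k = l then 1 else 0)))"

lemma dual_basis:
  assumes "l \<in> {1..dim (A i)}"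
  shows "dual_basis i l \<in> A i" "k \<in> {1..dim (A j)} \<Longrightarrow> form (e j k) (dual_basis i l) = (if j = i \<and> k = l then 1 else 0)"
  using someI_ex[OF dual_basis_exists, folded dual_basis_def] assms by blast+

lemma ah_form_tens_parts:
  assumes "a \<in> A i"
  shows "ah_form (tens f a) (tens g b) =
    scl (form a b) (f \<odot> sp_part 0 g) + scl (psign i * form a b) (f \<odot> sp_part 1 g)"
proof -
  have "tens g b = tens (sp_part 0 g) b + tens (sp_part 1 g) b"
    by (simp add: tens_add_left[symmetric] sp_part_sum)
  then show ?thesis
    by (simp add: ah_form_add_right ah_form_tens[OF assms sp_hom_sp_part] scl_scl mult.commute)
qed

lemma sum_pairs_delta:
  assumes l: "l \<in> {1..dim (A i)}"
    and F: "\<And>j k. k \<in> {1..dim (A j)} \<Longrightarrow> F j k = (if j = i \<and> k = l then (c::'b::comm_monoid_add) else 0)"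
  shows "(\<Sum>j\<in>{0, 1}. \<Sum>k = 1..dim (A j). F j k) = c"
proof -
  have "(\<Sum>k = 1..dim (A j). F j k) = (if j = i then c else 0)" for j
  proof -
    have "(\<Sum>k = 1..dim (A j). F j k) = (\<Sum>k = 1..dim (A j). if k = l then (if j = i then c else 0) else 0)"
      by (rule sum.cong) (auto simp: F)
    also have "\<dots> = (if j = i then c else 0)" using l by (subst sum.delta) auto
    finally show ?thesis .
  qed
  then show ?thesis using bit_cases2[of i] by auto
qed

lemma ah_form_dual_right:
  assumes "a \<in> Ah" "l \<in> {1..dim (A i)}" "sp_hom p g"
  shows "ah_form a (tens g (dual_basis i l)) = scl (psign (i * p)) (Poly_Mapping.lookup a (i, l) \<odot> g)"
proof -
  have "ah_form a (tens g (dual_basis i l)) = (\<Sum>j\<in>{0, 1}. \<Sum>k = 1..dim (A j).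
      ah_form (tens (Poly_Mapping.lookup a (j, k)) (e j k)) (tens g (dual_basis i l)))"
    by (subst ah_decomp[of a]) (use assms in \<open>auto simp: Ah_iff ah_form_sum_left ah_form_add_left\<close>)
  also have "\<dots> = scl (psign (i * p)) (Poly_Mapping.lookup a (i, l) \<odot> g)"
    by (rule sum_pairs_delta[OF assms(2)])
       (auto simp: ah_form_tens[OF e_in_A assms(3)] dual_basis[OF assms(2)])
  finally show ?thesis .
qed

text \<open>The sign twist on the even part of the coefficient is harmless: it can be undone once
  the twisted coefficient is known to vanish.\<close>

lemma ah_form_dual_left:
  assumes "a \<in> Ah" "l \<in> {1..dim (A i)}"
  shows "ah_form (tens f (dual_basis i l)) a =
    f \<odot> (scl (psign i) (sp_part 0 (Poly_Mapping.lookup a (i, l))) + sp_part 1 (Poly_Mapping.lookup a (i, l)))"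
proof -
  have "ah_form (tens f (dual_basis i l)) a = (\<Sum>j\<in>{0, 1}. \<Sum>k = 1..dim (A j).
      ah_form (tens f (dual_basis i l)) (tens (Poly_Mapping.lookup a (j, k)) (e j k)))"
    by (subst (1) ah_decomp[of a]) (use assms in \<open>auto simp: Ah_iff ah_form_sum_right ah_form_add_right\<close>)
  also have "\<dots> = f \<odot> (scl (psign i) (sp_part 0 (Poly_Mapping.lookup a (i, l))) + sp_part 1 (Poly_Mapping.lookup a (i, l)))"
  proof (rule sum_pairs_delta[OF assms(2)])
    fix j k assume k: "k \<in> {1..dim (A j)}"
    have "form (dual_basis i l) (e j k) = (if j = i \<and> k = l then psign i else 0)"
      using form_supersymmetric[OF dual_basis(1)[OF assms(2)] e_in_A[OF k]] dual_basis(2)[OF assms(2) k] by auto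
    then show "ah_form (tens f (dual_basis i l)) (tens (Poly_Mapping.lookup a (j, k)) (e j k)) =
       (if j = i \<and> k = l then f \<odot> (scl (psign i) (sp_part 0 (Poly_Mapping.lookup a (i, l))) + sp_part 1 (Poly_Mapping.lookup a (i, l))) else 0)"
      by (auto simp: ah_form_tens_parts[OF dual_basis(1)[OF assms(2)]] sp_mult_add_right sp_mult_scl_right)
  qed
  finally show ?thesis .
qed

text \<open>Testing with $u^{(N)}\otimes\varsigma^*$ for all \<open>N\<close> isolates one
  coefficient of \<open>a\<close>, to which \<open>mult_total_derivative_zero\<close> applies.\<close>

lemma ah_form_nondegenerate:
  assumes a: "a \<in> Ah" and z: "\<And>x. x \<in> Ah \<Longrightarrow> til (ah_form x a) = 0"
  shows "a = 0"
proof (rule poly_mapping_eqI, clarify)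
  fix i l
  show "Poly_Mapping.lookup a (i, l) = Poly_Mapping.lookup 0 (i, l)"
  proof (cases "l \<in> {1..dim (A i)}")
    case True
    let ?f = "Poly_Mapping.lookup a (i, l)"
    let ?F = "scl (psign i) (sp_part 0 ?f) + sp_part 1 ?f"
    have F: "?F = 0"
    proof (rule mult_total_derivative_zero)
      fix N
      have "(l, 0) \<in> I i" using True by (simp add: I_def)
      then have "U i (l, 0, N) \<in> P_part i" by (simp add: P_part_iff P_def spoly_on_U)
      then have "tens (U i (l, 0, N)) (dual_basis i l) \<in> Ah_part 0"
        by (intro tens_Ah[where i = i] dual_basis(1)[OF True]) simp
      from z[OF Ah_part_Ah[OF this]] show "\<exists>h. U i (l, 0, N) \<odot> ?F = ddx h"
        by (simp add: ah_form_dual_left[OF a True] til_eq_0)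
    qed
    have "sp_part 0 ?F = scl (psign i) (sp_part 0 ?f)" "sp_part 1 ?F = sp_part 1 ?f"
      by (simp_all add: sp_part_add sp_part_scl sp_part_hom[OF sp_hom_sp_part])
    then have "scl (psign i) (sp_part 0 ?f) = 0" "sp_part 1 ?f = 0" using F by simp_all
    then have "scl (psign i * psign i) (sp_part 0 ?f) = 0" by (simp only: scl_scl[symmetric] scl_zero)
    then have "sp_part 0 ?f + sp_part 1 ?f = 0" using \<open>sp_part 1 ?f = 0\<close> by simp
    then show ?thesis by (simp add: sp_part_sum)
  qed (use a in \<open>simp add: Ah_iff\<close>)
qed

lemma pairing_nondegenerate:
  assumes "w \<in> \<Omega>" "\<And>v. v \<in> gcar G \<Longrightarrow> pairing v w = 0"
  shows "w = 0"
proof -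
  obtain S \<psi> where S: "finite S" "S \<subseteq> {- int \<iota> - 1..}" "\<And>m. \<psi> m \<in> Ah" "w = (\<Sum>m\<in>S. d_power m (\<psi> m))"
    using assms(1) by (rule Omega_E) blast
  have "\<psi> m = 0" if m: "m \<in> S" for m
  proof (rule ah_form_nondegenerate[OF S(3)])
    fix x assume x: "x \<in> Ah"
    (* A vector field with a single coefficient; its order is at most \<iota> because m is at least
       -\<iota> - 1. *)
    define v where "v = (\<lambda>l. if l = - m - 1 then x else 0)"
    have "order_le (int \<iota>) v" using m S(2) by (auto simp: v_def order_le_def)
    moreover from this have "v \<in> DD" using x by (auto simp: DD_iff v_def)
    ultimately have v: "v \<in> gcar G" "v \<in> DD" by (auto simp: gcarG_iff)
    have "0 = (\<Sum>k\<in>S. til (ah_form (v (- k - 1)) (\<psi> k)))"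
      using assms(2)[OF v(1)] unfolding S(4) by (simp add: pairing_sum[OF v(2) S(1,3)])
    also have "\<dots> = (\<Sum>k\<in>S. if k = m then til (ah_form x (\<psi> m)) else 0)"
      by (rule sum.cong[OF refl]) (auto simp: v_def)
    also have "\<dots> = til (ah_form x (\<psi> m))" using m S(1) by simp
    finally show "til (ah_form x (\<psi> m)) = 0" by simp
  qed
  then show ?thesis unfolding S(4) by simp
qed

lemma partial_outside:
  fixes p :: "'f spoly"
  assumes "p \<in> spoly_on J" "(j1, j2) \<notin> J i"
  shows "sp_partial i (j1, j2, m) p = 0"
proof -
  have z: "sp_partial i (j1, j2, m) (mon s) = (0 :: 'f spoly)" if "s \<in> Poly_Mapping.keys p" for s
  proof -
    obtain a S where s: "s = (a, S)" by (cases s)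
    have "(a, S) \<in> monos_on J" using assms(1) that by (auto simp: spoly_on_def s)
    then have "i = 0 \<Longrightarrow> (j1, j2, m) \<notin># a" "i = 1 \<Longrightarrow> (j1, j2, m) |\<notin>| S"
      using assms(2) by (auto simp: monos_on_def)
    then show ?thesis using bit_cases2[of i]
      by (auto simp: s sp_partial_def lin_ext_single mono_partial_0 mono_partial_1 dsign_def not_in_iff
        simp del: mono_partial.simps)
  qed
  have "sp_partial i (j1, j2, m) (\<Sum>s\<in>Poly_Mapping.keys p. scl (Poly_Mapping.lookup p s) (mon s)) = 0"
    unfolding additive_sum[of "sp_partial i _", OF sp_partial_add] sp_partial_scl
    by (rule sum.neutral) (simp add: z)
  then show ?thesis by (simp only: spoly_decomp[symmetric])
qed

text \<open>Integration by parts: the symbol $u_{i,(j_1,j_2)}^{(m)}$ contributes the polynomial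
  $g=(-\partial)^m(\partial f/\partial u_{i,(j_1,j_2)}^{(m)})$ to the variational derivative. The
  dual basis element turns $g$ into the one-form $\partial^{-j_2-1}g\,\varsigma^*$, where
  $j_2\le\iota$ puts the power of $\partial$ into the range allowed in $\Omega$.\<close>

lemma differential_in_Omega:
  assumes f: "f \<in> P"
  shows "\<exists>\<phi>\<in>\<Omega>. \<forall>\<xi>\<in>gcar G. pairing \<xi> \<phi> = t_act \<xi> (til f)"
proof -
  define B where "B = {(i, w). sp_partial i w f \<noteq> 0}"
  have B: "finite B" unfolding B_def by (rule sp_partial_support)
  define g where "g = (\<lambda>(i, j1, j2, m). scl ((- 1) ^ m) ((ddx ^^ m) (sp_partial i (j1, j2, m) f)))"
  (* The form on an odd basis element and an odd polynomial carries a sign, which the factor psign i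
     compensates. *)
  define \<phi> where "\<phi> = (\<lambda>(i, j1, j2, m::nat). d_power (- j2 - 1)
     (tens (sp_part 0 (g (i, j1, j2, m))) (dual_basis i j1) +
      tens (scl (psign i) (sp_part 1 (g (i, j1, j2, m)))) (dual_basis i j1)))"
  have key: "\<phi> x \<in> \<Omega> \<and> (\<forall>\<xi>\<in>gcar G. tr \<xi> (\<phi> x) = (case x of (i, w) \<Rightarrow>
      til ((case w of (j1, j2, m) \<Rightarrow> (ddx ^^ m) (Poly_Mapping.lookup (\<xi> j2) (i, j1))) \<odot> sp_partial i w f)))"
    if x: "x \<in> B" for x
  proof -
    obtain i j1 j2 m where xe: "x = (i, j1, j2, m)" by (rule prod_cases4)
    have "(j1, j2) \<in> I i"
    proof (rule ccontr)
      assume "(j1, j2) \<notin> I i"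
      from partial_outside[OF f[unfolded P_def] this] show False using x by (simp add: xe B_def)
    qed
    then have j1: "j1 \<in> {1..dim (A i)}" and j2: "j2 \<le> int \<iota>" by (auto simp: I_def)
    let ?g = "g (i, j1, j2, m)"
    have gP: "?g \<in> P" using f by (simp add: g_def P_def spoly_on_scl spoly_on_ddx_pow spoly_on_partial)
    have Ah: "tens (sp_part 0 ?g) (dual_basis i j1) \<in> Ah_part i" "tens (scl (psign i) (sp_part 1 ?g)) (dual_basis i j1) \<in> Ah_part (i + 1)"
      by (rule tens_Ah[where i = i], simp_all add: P_part_iff P_sp_part P_scl gP sp_hom_scl dual_basis(1)[OF j1])+
    then have Ah': "tens (sp_part 0 ?g) (dual_basis i j1) + tens (scl (psign i) (sp_part 1 ?g)) (dual_basis i j1) \<in> Ah"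
      by (intro Ah_add Ah_part_Ah)
    have "\<phi> x \<in> \<Omega>" unfolding xe \<phi>_def prod.case by (rule Omega_power[OF _ Ah']) (use j2 in simp)
    moreover have "tr \<xi> (\<phi> x) = til ((ddx ^^ m) (Poly_Mapping.lookup (\<xi> j2) (i, j1)) \<odot> sp_partial i (j1, j2, m) f)"
      if \<xi>: "\<xi> \<in> gcar G" for \<xi>
    proof -
      have \<xi>j: "\<xi> j2 \<in> Ah" using gcarG_DD[OF \<xi>] by (simp add: DD_iff)
      have "tr \<xi> (\<phi> x) = til (ah_form (\<xi> j2) (tens (sp_part 0 ?g) (dual_basis i j1) + tens (scl (psign i) (sp_part 1 ?g)) (dual_basis i j1)))"
        unfolding xe \<phi>_def prod.case by (simp add: tr_power[OF gcarG_DD[OF \<xi>] Ah'])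
      also have "\<dots> = til (Poly_Mapping.lookup (\<xi> j2) (i, j1) \<odot> (sp_part 0 ?g + sp_part 1 ?g))"
        by (simp add: ah_form_add_right ah_form_dual_right[OF \<xi>j j1 sp_hom_sp_part]
          ah_form_dual_right[OF \<xi>j j1 sp_hom_scl[OF sp_hom_sp_part]] sp_mult_add_right sp_mult_scl_right scl_scl)
      also have "\<dots> = tscl ((- 1) ^ m) (til (Poly_Mapping.lookup (\<xi> j2) (i, j1) \<odot> (ddx ^^ m) (sp_partial i (j1, j2, m) f)))"
        unfolding sp_part_sum by (simp add: g_def sp_mult_scl_right til_scl)
      finally show ?thesis by (simp add: til_by_parts)
    qed
    ultimately show ?thesis by (simp add: xe)
  qed
  show ?thesis
  proof (intro bexI[of _ "sum \<phi> B"] ballI)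
    show Om: "sum \<phi> B \<in> \<Omega>" by (rule Omega_sum_closed) (use key in blast)
    fix \<xi> assume \<xi>: "\<xi> \<in> gcar G"
    have "pairing \<xi> (sum \<phi> B) = (\<Sum>x\<in>B. tr \<xi> (\<phi> x))"
      unfolding pairing_tr[OF gcarG_DD[OF \<xi>] Om]
      by (rule tr_sum_right[OF gcarG_DD[OF \<xi>]]) (use key Omega_DD in blast)
    also have "\<dots> = (\<Sum>(i, w)\<in>B. til ((case w of (j1, j2, m) \<Rightarrow>
        (ddx ^^ m) (Poly_Mapping.lookup (\<xi> j2) (i, j1))) \<odot> sp_partial i w f))"
      by (rule sum.cong[OF refl]) (use key \<xi> in blast)
    also have "\<dots> = til (\<Sum>(i, w)\<in>B. (case w of (j1, j2, m) \<Rightarrow>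
        (ddx ^^ m) (Poly_Mapping.lookup (\<xi> j2) (i, j1))) \<odot> sp_partial i w f)"
      by (simp add: til_sum case_prod_unfold)
    also have "\<dots> = til (evo \<xi> f)"
      unfolding evo_vfield by (subst vfield_superset[OF B]) (auto simp: B_def)
    finally show "pairing \<xi> (sum \<phi> B) = t_act \<xi> (til f)" by (simp add: t_act_til[OF \<xi> f])
  qed
qed

theorem hamiltonian_setting_G:
  "hamiltonian_setting d_scl G evo_bracket tscl Pt t_act d_scl \<Omega> (\<lambda>w v. pairing v w)"
proof -
  interpret M: lie_superalgebra_module d_scl G evo_bracket tscl Pt t_act by (rule module_Pt)
  show ?thesis
  proof unfold_locales
    show "M.VG.subspace \<Omega>" by (rule M.VG.subspaceI) (auto intro: Omega_add Omega_scl)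
  next
    fix \<phi> assume \<phi>: "\<phi> \<in> \<Omega>"
    have pt: "pairing x \<phi> \<in> Pt" if "x \<in> gcar G" for x
      using that \<phi> by (simp add: pairing_tr gcarG_DD tr_def til_Pt residue_P Omega_DD)
    have add: "pairing (x + y) \<phi> = pairing x \<phi> + pairing y \<phi>" "pairing (d_scl c x) \<phi> = tscl c (pairing x \<phi>)"
      if "x \<in> gcar G" "y \<in> gcar G" for x y c
      using that \<phi> by (simp_all add: pairing_tr gcarG_DD tr_add_left tr_scl_left Omega_DD DD_add DD_scl)
    show "(\<lambda>\<xi>s. pairing (hd \<xi>s) \<phi>) \<in> M.forms 1"
      unfolding M.forms_def
    proof (intro CollectI conjI allI impI)
      fix xs assume "set xs \<subseteq> gcar G \<and> length xs = 1"
      then show "pairing (hd xs) \<phi> \<in> Pt" by (cases xs) (auto intro: pt)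
    next
      fix xs ys x y c assume h: "set xs \<union> set ys \<union> {x, y} \<subseteq> gcar G \<and> length xs + length ys + 1 = 1"
      show "pairing (hd (xs @ (x + y) # ys)) \<phi> = pairing (hd (xs @ x # ys)) \<phi> + pairing (hd (xs @ y # ys)) \<phi>"
        using h add(1)[of x y] by simp
      show "pairing (hd (xs @ d_scl c x # ys)) \<phi> = tscl c (pairing (hd (xs @ x # ys)) \<phi>)"
        using h add(2)[of x y] by simp
    next
      fix xs ys :: "'f psdo list" and x y i j
      assume "set xs \<union> set ys \<subseteq> gcar G \<and> x \<in> G i \<and> y \<in> G j \<and> length xs + length ys + 2 = 1"
      then show "pairing (hd (xs @ x # y # ys)) \<phi> = - tscl (psign (i * j)) (pairing (hd (xs @ y # x # ys)) \<phi>)" by simp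
    qed
  next
    fix \<phi> \<psi> \<xi> assume h: "\<phi> \<in> \<Omega>" "\<psi> \<in> \<Omega>" "\<xi> \<in> gcar G"
    then show "pairing \<xi> (\<phi> + \<psi>) = pairing \<xi> \<phi> + pairing \<xi> \<psi>"
      by (simp add: pairing_tr gcarG_DD Omega_add tr_add_right Omega_DD)
  next
    fix \<phi> \<xi> c assume h: "\<phi> \<in> \<Omega>" "\<xi> \<in> gcar G"
    then show "pairing \<xi> (d_scl c \<phi>) = tscl c (pairing \<xi> \<phi>)"
      by (simp add: pairing_tr gcarG_DD Omega_scl tr_scl_right Omega_DD)
  next
    fix \<phi> \<psi> assume h: "\<phi> \<in> \<Omega>" "\<psi> \<in> \<Omega>" "\<And>\<xi>. \<xi> \<in> gcar G \<Longrightarrow> pairing \<xi> \<phi> = pairing \<xi> \<psi>"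
    have Om: "d_scl (- 1) \<psi> \<in> \<Omega>" by (rule Omega_scl[OF h(2)])
    have "\<phi> + d_scl (- 1) \<psi> = 0"
    proof (rule pairing_nondegenerate)
      show "\<phi> + d_scl (- 1) \<psi> \<in> \<Omega>" by (rule Omega_add[OF h(1) Om])
      fix \<xi> assume \<xi>: "\<xi> \<in> gcar G"
      then have "pairing \<xi> (\<phi> + d_scl (- 1) \<psi>) = tr \<xi> \<phi> + tscl (- 1) (tr \<xi> \<psi>)"
        using h(1,2) Om by (simp only: pairing_tr gcarG_DD Omega_add tr_add_right tr_scl_right Omega_DD)
      then show "pairing \<xi> (\<phi> + d_scl (- 1) \<psi>) = 0"
        using h(3)[OF \<xi>] h(1,2) \<xi> by (simp add: pairing_tr gcarG_DD)
    qed
    then show "\<phi> = \<psi>" by simp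
  next
    fix u assume "u \<in> Pt"
    then obtain f where "f \<in> P" "u = til f" by (rule Pt_E)
    then show "\<exists>\<phi>\<in>\<Omega>. \<forall>\<xi>\<in>gcar G. pairing \<xi> \<phi> = t_act \<xi> u" using differential_in_Omega by blast
  qed
qed

section \<open>Identities in the algebra of operators\<close>

notation d_mult (infixl "\<star>" 70)

lemmas DD_closed = DD_mult DD_add DD_diff DD_minus DD_uminus DD_scl

lemma d_mult_uminus_left: "v \<in> DD \<Longrightarrow> w \<in> DD \<Longrightarrow> (- v) \<star> w = - (v \<star> w)"
  using d_mult_scl_left[of v w "- 1"] by (simp add: d_scl_uminus_one)

lemma d_mult_uminus_right: "v \<in> DD \<Longrightarrow> w \<in> DD \<Longrightarrow> v \<star> (- w) = - (v \<star> w)"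
  using d_mult_scl_right[of v w "- 1"] by (simp add: d_scl_uminus_one)

lemma d_mult_diff_left: "\<lbrakk>v \<in> DD; v' \<in> DD; w \<in> DD\<rbrakk> \<Longrightarrow> (v - v') \<star> w = v \<star> w - v' \<star> w"
  using d_mult_add_left[of v "- v'" w] by (simp add: DD_uminus d_mult_uminus_left)

lemma d_mult_diff_right: "\<lbrakk>v \<in> DD; w \<in> DD; w' \<in> DD\<rbrakk> \<Longrightarrow> v \<star> (w - w') = v \<star> w - v \<star> w'"
  using d_mult_add_right[of v w "- w'"] by (simp add: DD_uminus d_mult_uminus_right)

lemmas d_mult_distribs = d_mult_add_left d_mult_add_right d_mult_diff_left d_mult_diff_right
  d_mult_uminus_left d_mult_uminus_right

lemma d_minus_diff: "d_minus (v - w) = d_minus v - d_minus w"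
  by (rule ext) (simp add: d_minus_def)

text \<open>The product of the parts of nonnegative order has no part of negative order; expand
  it. This is the identity behind both bracket formulas: it says that the projections satisfy a
  Rota-Baxter relation.\<close>

lemma d_minus_mult_split:
  assumes "u \<in> DD" "v \<in> DD"
  shows "d_minus (u \<star> v) = d_minus (d_minus u \<star> v) + d_minus (u \<star> d_minus v) - d_minus u \<star> d_minus v"
proof -
  have "0 = d_minus ((u - d_minus u) \<star> (v - d_minus v))" by (simp add: d_minus_mult_plus assms)
  also have "\<dots> = d_minus (u \<star> v) - d_minus (d_minus u \<star> v) - (d_minus (u \<star> d_minus v) - d_minus u \<star> d_minus v)"
    using assms by (simp add: d_mult_distribs DD_closed d_minus_diff d_minus_mult_minus)
  finally show ?thesis by (simp add: algebra_simps)
qed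

lemma tr_diff_left: "\<lbrakk>v \<in> DD; v' \<in> DD; w \<in> DD\<rbrakk> \<Longrightarrow> tr (v - v') w = tr v w - tr v' w"
  using tr_add_left[of v "- v'" w] tr_scl_left[of v' w "- 1"] by (simp add: DD_uminus d_scl_uminus_one)

lemma tr_diff_right: "\<lbrakk>v \<in> DD; w \<in> DD; w' \<in> DD\<rbrakk> \<Longrightarrow> tr v (w - w') = tr v w - tr v w'"
  using tr_add_right[of v w "- w'"] tr_scl_right[of v w' "- 1"] by (simp add: DD_uminus d_scl_uminus_one)

lemma tr_zero_left [simp]: "v \<in> DD \<Longrightarrow> tr 0 v = 0"
  using tr_add_left[of 0 0 v] by simp

lemma tr_uminus: "\<lbrakk>v \<in> DD; w \<in> DD\<rbrakk> \<Longrightarrow> tr (- v) w = - tr v w" "\<lbrakk>v \<in> DD; w \<in> DD\<rbrakk> \<Longrightarrow> tr v (- w) = - tr v w"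
  using tr_diff_left[of 0 v w] tr_diff_right[of v 0 w] by simp_all

lemmas tr_distribs = tr_add_left tr_add_right tr_diff_left tr_diff_right tr_scl_left tr_scl_right tr_uminus

text \<open>The residue form vanishes on two operators of nonnegative order; hence projecting the
  first argument to negative order amounts to projecting the second to nonnegative order.\<close>

lemma tr_minus_left:
  assumes "u \<in> DD" "v \<in> DD" shows "tr (d_minus u) v = tr u v - tr u (d_minus v)"
proof -
  have "0 = tr (u - d_minus u) (v - d_minus v)" by (simp add: tr_plus_plus assms)
  also have "\<dots> = tr u v - tr (d_minus u) v - tr u (d_minus v)"
    using assms by (simp add: tr_distribs DD_closed tr_minus_minus)
  finally show ?thesis by (simp add: algebra_simps)
qed

lemma tr_cyclic:
  assumes "u \<in> Dp i" "v \<in> Dp j" "w \<in> Dp k"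
  shows "tr u (v \<star> w) = tscl (psign (i * (j + k))) (tr v (w \<star> u))"
  using tr_supersym[OF assms(1) Dp_mult[OF assms(2,3)]] assms by (simp add: tr_assoc Dp_DD)

lemma tr_plus_plus3:
  assumes "u \<in> DD" "v \<in> DD" "w \<in> DD"
  shows "tr (u - d_minus u) ((v - d_minus v) \<star> (w - d_minus w)) = 0"
  using tr_plus_plus[OF assms(1), of "(v - d_minus v) \<star> (w - d_minus w)"] assms
  by (simp add: d_minus_mult_plus DD_closed)

lemma tr_minus_minus3: "tr (d_minus u) (d_minus v \<star> d_minus w) = 0"
  using tr_minus_minus[of u "d_minus v \<star> d_minus w"] by (simp add: d_minus_mult_minus)

text \<open>Split $u$, $v$ and $w$ into their parts of nonnegative and of negative order. Of the
  eight words in the expansion of \<open>tr u (v \<star> w)\<close>, the two with equal signs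
  vanish, and each of the other six occurs exactly once in the expansion of the left-hand side.
  The same holds for \<open>cyclic_sum_2\<close>.\<close>

lemma cyclic_sum_1:
  assumes "u \<in> Dp i" "v \<in> Dp j" "w \<in> Dp k"
  shows "tr (d_minus u) (v \<star> (w - d_minus w)) + tscl (psign (i * (j + k))) (tr (d_minus v) (w \<star> (u - d_minus u)))
    + tscl (psign (k * (i + j))) (tr (d_minus w) (u \<star> (v - d_minus v))) = tr u (v \<star> w)"
proof -
  note DD = Dp_DD[OF assms(1)] Dp_DD[OF assms(2)] Dp_DD[OF assms(3)]
  (* Rotate each summand so that u comes first. *)
  have 1: "tscl (psign (i * (j + k))) (tr (d_minus v) (w \<star> (u - d_minus u))) = tr (u - d_minus u) (d_minus v \<star> w)"
    by (rule tr_cyclic[symmetric]) (auto intro: assms Dp_minus Dp_diff)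
  have "tr (d_minus w) (u \<star> (v - d_minus v)) = tscl (psign (k * (i + j))) (tr u ((v - d_minus v) \<star> d_minus w))"
    by (rule tr_cyclic) (auto intro: assms Dp_minus Dp_diff)
  then have 2: "tscl (psign (k * (i + j))) (tr (d_minus w) (u \<star> (v - d_minus v))) = tr u ((v - d_minus v) \<star> d_minus w)"
    by (simp add: tscl_tscl)
  have "tr (u - d_minus u) ((v - d_minus v) \<star> (w - d_minus w)) = 0" by (rule tr_plus_plus3[OF DD])
  then show ?thesis unfolding 1 2 using DD tr_minus_minus3[of u v w]
    by (simp add: tr_distribs d_mult_distribs DD_closed algebra_simps)
qed

lemma cyclic_sum_2:
  assumes "u \<in> Dp i" "v \<in> Dp j" "w \<in> Dp k"
  shows "tr (d_minus u) ((v - d_minus v) \<star> w) + tscl (psign (i * (j + k))) (tr (d_minus v) ((w - d_minus w) \<star> u))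
    + tscl (psign (k * (i + j))) (tr (d_minus w) ((u - d_minus u) \<star> v)) = tr u (v \<star> w)"
proof -
  note DD = Dp_DD[OF assms(1)] Dp_DD[OF assms(2)] Dp_DD[OF assms(3)]
  (* Rotate each summand so that u comes first. *)
  have 1: "tscl (psign (i * (j + k))) (tr (d_minus v) ((w - d_minus w) \<star> u)) = tr u (d_minus v \<star> (w - d_minus w))"
    by (rule tr_cyclic[symmetric]) (auto intro: assms Dp_minus Dp_diff)
  have "tr (d_minus w) ((u - d_minus u) \<star> v) = tscl (psign (k * (i + j))) (tr (u - d_minus u) (v \<star> d_minus w))"
    by (rule tr_cyclic) (auto intro: assms Dp_minus Dp_diff)
  then have 2: "tscl (psign (k * (i + j))) (tr (d_minus w) ((u - d_minus u) \<star> v)) = tr (u - d_minus u) (v \<star> d_minus w)"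
    by (simp add: tscl_tscl)
  have "tr (u - d_minus u) ((v - d_minus v) \<star> (w - d_minus w)) = 0" by (rule tr_plus_plus3[OF DD])
  then show ?thesis unfolding 1 2 using DD tr_minus_minus3[of u v w]
    by (simp add: tr_distribs d_mult_distribs DD_closed algebra_simps)
qed

subsection \<open>The quadratic operator\<close>

lemma three_term_cancel:
  fixes v1 :: "'b::ab_group_add"
  assumes "v1 + v2 + v3 = w1 + w2 + w3" "y1 + y2 + y3 = z1 + z2 + z3"
  shows "v1 - y1 + z1 - w1 + (v2 - y2 + z2 - w2) + (v3 - y3 + z3 - w3) = 0"
proof -
  have "v1 - y1 + z1 - w1 + (v2 - y2 + z2 - w2) + (v3 - y3 + z3 - w3) =
      (v1 + v2 + v3) - (w1 + w2 + w3) + ((z1 + z2 + z3) - (y1 + y2 + y3))"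
    by (simp add: algebra_simps)
  then show ?thesis by (simp add: assms)
qed

definition quad_op :: "'f psdo \<Rightarrow> 'f psdo \<Rightarrow> 'f psdo" where
  "quad_op L a = d_minus (L \<star> a) \<star> L - L \<star> d_minus (a \<star> L)"

text \<open>With $u_+=u-u_-$ this is $a(Lb)_+-(aL)_-b$. Only its supercommutator enters the
  bracket and the adjoint.\<close>

definition quad_prod :: "'f psdo \<Rightarrow> 'f psdo \<Rightarrow> 'f psdo \<Rightarrow> 'f psdo" where
  "quad_prod L a b = a \<star> (L \<star> b - d_minus (L \<star> b)) - d_minus (a \<star> L) \<star> b"

text \<open>The derivative of \<open>quad_op L a\<close> with respect to \<open>L\<close> in
  direction \<open>x\<close>. The parameter \<open>s\<close> stands for the sign of moving
  \<open>x\<close> past \<open>a\<close>, which is determined by the arguments only if they are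
  homogeneous.\<close>

definition quad_diff :: "'f psdo \<Rightarrow> 'f \<Rightarrow> 'f psdo \<Rightarrow> 'f psdo \<Rightarrow> 'f psdo" where
  "quad_diff L s x a = d_minus (x \<star> a) \<star> L - x \<star> d_minus (a \<star> L) +
     d_scl s (d_minus (L \<star> a) \<star> x - L \<star> d_minus (a \<star> x))"

text \<open>In the difference of the derivative along $Ha$ applied to \<open>b\<close> and the
  derivative along $Hb$ applied to \<open>a\<close>, the left-hand side collects the terms in
  which \<open>a\<close> precedes \<open>b\<close>. For this reason no supersign appears, and the
  identity holds for inhomogeneous arguments. With $p=La$, $q=aL$, $r=Lb$, $s=bL$ it amounts to
  \<open>d_minus_mult_split\<close> for $pr$ and for $qs$.\<close>

lemma quad_op_prod:
  assumes L: "L \<in> DD" and a: "a \<in> DD" and b: "b \<in> DD"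
  shows "d_minus (quad_op L a \<star> b) \<star> L - quad_op L a \<star> d_minus (b \<star> L) - d_minus (L \<star> a) \<star> quad_op L b
    + L \<star> d_minus (a \<star> quad_op L b) = quad_op L (quad_prod L a b)"
proof -
  define p q r s where "p = L \<star> a" and "q = a \<star> L" and "r = L \<star> b" and "s = b \<star> L"
  have DD: "p \<in> DD" "q \<in> DD" "r \<in> DD" "s \<in> DD"
    using L a b by (simp_all add: p_def q_def r_def s_def DD_mult)
  have Ha: "quad_op L a = d_minus p \<star> L - L \<star> d_minus q" by (simp add: quad_op_def p_def q_def)
  have Hb: "quad_op L b = d_minus r \<star> L - L \<star> d_minus s" by (simp add: quad_op_def r_def s_def)
  have X: "quad_prod L a b = a \<star> (r - d_minus r) - d_minus q \<star> b" by (simp add: quad_prod_def r_def q_def)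
  have e1: "quad_op L a \<star> b = d_minus p \<star> r - L \<star> (d_minus q \<star> b)"
    unfolding Ha r_def using DD L a b by (simp add: d_mult_distribs d_mult_assoc DD_closed)
  have e2: "a \<star> quad_op L b = a \<star> (d_minus r \<star> L) - q \<star> d_minus s"
    unfolding Hb q_def using DD L a b by (simp add: d_mult_distribs d_mult_assoc DD_closed)
  have e3: "L \<star> quad_prod L a b = p \<star> r - p \<star> d_minus r - L \<star> (d_minus q \<star> b)"
    unfolding X p_def using DD L a b by (simp add: d_mult_distribs d_mult_assoc DD_closed)
  have "q \<star> s = a \<star> (r \<star> L)"
    unfolding q_def s_def r_def using L a b by (simp add: d_mult_assoc DD_closed)
  then have e4: "quad_prod L a b \<star> L = q \<star> s - a \<star> (d_minus r \<star> L) - d_minus q \<star> s"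
    unfolding X using DD L a b by (simp add: s_def d_mult_distribs d_mult_assoc DD_closed)
  show ?thesis
    unfolding e1 e2 quad_op_def[of L "quad_prod L a b"] e3 e4
    unfolding Ha Hb p_def[symmetric] s_def[symmetric] d_minus_diff
      d_minus_mult_split[OF DD(1,3)] d_minus_mult_split[OF DD(2,4)]
    using DD L a b by (simp add: d_mult_distribs d_mult_assoc DD_closed d_minus_diff algebra_simps)
qed

lemma Dp_0_mult: "L \<in> Dp 0 \<Longrightarrow> a \<in> Dp i \<Longrightarrow> L \<star> a \<in> Dp i" "L \<in> Dp 0 \<Longrightarrow> a \<in> Dp i \<Longrightarrow> a \<star> L \<in> Dp i"
  using Dp_mult[of L 0 a i] Dp_mult[of a i L 0] by simp_all

lemma quad_op_Dp: "L \<in> Dp 0 \<Longrightarrow> a \<in> Dp i \<Longrightarrow> quad_op L a \<in> Dp i"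
  by (simp add: quad_op_def Dp_diff Dp_0_mult Dp_minus)

lemma quad_prod_Dp: "L \<in> Dp 0 \<Longrightarrow> a \<in> Dp i \<Longrightarrow> b \<in> Dp j \<Longrightarrow> quad_prod L a b \<in> Dp (i + j)"
  by (simp add: quad_prod_def Dp_diff Dp_0_mult Dp_minus Dp_mult)

text \<open>Each of the four terms of the derivative is moved to the other side of the residue
  form by invariance and supersymmetry. A projection to negative order under the form becomes the
  projection to nonnegative order of the other argument (\<open>tr_minus_left\<close>), which is
  how the asymmetric product arises.\<close>

lemma quad_diff_adjoint:
  assumes L: "L \<in> Dp 0" and x: "x \<in> Dp k" and a: "a \<in> Dp i" and b: "b \<in> Dp j"
  shows "tr (quad_diff L (psign (k * i)) x a) b =
    tr x (quad_prod L a b - d_scl (psign (i * j)) (quad_prod L b a))"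
proof -
  note DD = Dp_DD[OF L] Dp_DD[OF x] Dp_DD[OF a] Dp_DD[OF b]
  have t1: "tr (d_minus (x \<star> a) \<star> L) b = tr x (a \<star> (L \<star> b - d_minus (L \<star> b)))"
    using DD by (simp add: tr_assoc tr_minus_left DD_closed tr_diff_right d_mult_diff_right)
  have t2: "tr (x \<star> d_minus (a \<star> L)) b = tr x (d_minus (a \<star> L) \<star> b)"
    using DD by (simp add: tr_assoc DD_closed)
  have "tr (d_minus (L \<star> a)) (x \<star> b) = tscl (psign (i * (k + j))) (tr x (b \<star> d_minus (L \<star> a)))"
    by (rule tr_cyclic) (auto intro: assms Dp_minus Dp_0_mult)
  then have t3: "tr (d_minus (L \<star> a) \<star> x) b = tscl (psign (i * (k + j))) (tr x (b \<star> d_minus (L \<star> a)))"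
    using DD by (simp add: tr_assoc DD_closed)
  have "tr (L \<star> d_minus (a \<star> x)) b = tr L (d_minus (a \<star> x) \<star> b)"
    using DD by (simp add: tr_assoc DD_closed)
  also have "\<dots> = tr (d_minus (a \<star> x)) (b \<star> L)"
    using tr_cyclic[OF L Dp_minus[OF Dp_mult[OF a x]] b] by simp
  also have "\<dots> = tr a (x \<star> (b \<star> L - d_minus (b \<star> L)))"
    using DD by (simp add: tr_minus_left DD_closed tr_diff_right tr_assoc d_mult_diff_right)
  also have "\<dots> = tscl (psign (i * (k + j))) (tr x ((b \<star> L - d_minus (b \<star> L)) \<star> a))"
    by (rule tr_cyclic) (auto intro: assms Dp_minus Dp_0_mult Dp_diff)
  finally have t4: "tr (L \<star> d_minus (a \<star> x)) b = tscl (psign (i * (k + j))) (tr x ((b \<star> L - d_minus (b \<star> L)) \<star> a))" .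
  have sgn: "psign (k * i) * psign (i * (k + j)) = (psign (i * j) :: 'f)"
    by (simp add: psign_add distrib_left mult.commute[of k i])
  have "tr (quad_diff L (psign (k * i)) x a) b = tr x (a \<star> (L \<star> b - d_minus (L \<star> b))) - tr x (d_minus (a \<star> L) \<star> b) +
     tscl (psign (i * j)) (tr x (b \<star> d_minus (L \<star> a)) - tr x ((b \<star> L - d_minus (b \<star> L)) \<star> a))"
    unfolding quad_diff_def using DD
    by (simp add: tr_distribs DD_closed t1 t2 t3 t4 tscl_tscl tscl_diff[symmetric] sgn)
  moreover have "b \<star> d_minus (L \<star> a) - (b \<star> L - d_minus (b \<star> L)) \<star> a = - quad_prod L b a"
    unfolding quad_prod_def using DD by (simp add: d_mult_distribs DD_closed d_mult_assoc)
  then have "tr x (b \<star> d_minus (L \<star> a)) - tr x ((b \<star> L - d_minus (b \<star> L)) \<star> a) = - tr x (quad_prod L b a)"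
    using DD by (subst tr_diff_right[symmetric]) (simp_all add: DD_closed tr_uminus Dp_DD[OF quad_prod_Dp[OF L b a]])
  moreover have "quad_prod L a b \<in> DD" "quad_prod L b a \<in> DD" using DD by (simp_all add: quad_prod_def DD_closed)
  ultimately show ?thesis using DD by (simp add: tr_distribs DD_closed, simp add: quad_prod_def tr_distribs DD_closed)
qed

lemma double_zero: "X + X = 0 \<Longrightarrow> X = (0 :: 'f tpoly)"
proof -
  assume "X + X = 0"
  then have "tscl (1 / 2) (tscl (1 + 1) X) = 0" by (simp only: tscl_add_left tscl_one tscl_zero)
  then show "X = 0" by (simp add: tscl_tscl)
qed

text \<open>The quadratic operator is homogeneous of degree two in \<open>L\<close>, so its
  derivative in the even direction \<open>L\<close> is twice the operator. By
  \<open>quad_diff_adjoint\<close> twice the left-hand side is the residue of \<open>L\<close>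
  with a supercommutator, which is super skew-symmetric.\<close>

lemma quad_op_skew:
  assumes L: "L \<in> Dp 0" and a: "a \<in> Dp i" and b: "b \<in> Dp j"
  shows "tr (quad_op L a) b = - tscl (psign (i * j)) (tr (quad_op L b) a)"
proof -
  note DD = Dp_DD[OF L] Dp_DD[OF a] Dp_DD[OF b]
  have two: "tr (quad_op L a) b + tr (quad_op L a) b = tr L (quad_prod L a b) - tscl (psign (i * j)) (tr L (quad_prod L b a))"
    if "a \<in> Dp i" "b \<in> Dp j" for a b i j
  proof -
    note D = DD(1) Dp_DD[OF that(1)] Dp_DD[OF that(2)]
    (* The direction L is even, so the sign of moving it past a is trivial. *)
    have "quad_diff L (psign (0 * i)) L a = quad_op L a + quad_op L a"
      by (simp add: quad_diff_def quad_op_def)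
    then show ?thesis
      using quad_diff_adjoint[OF L L that] D Dp_DD[OF quad_op_Dp[OF L that(1)]]
        Dp_DD[OF quad_prod_Dp[OF L that]] Dp_DD[OF quad_prod_Dp[OF L that(2,1)]]
      by (simp add: tr_distribs DD_closed)
  qed
  let ?Y = "tr (quad_op L a) b + tscl (psign (i * j)) (tr (quad_op L b) a)"
  have "?Y + ?Y = (tr (quad_op L a) b + tr (quad_op L a) b) + tscl (psign (i * j)) (tr (quad_op L b) a + tr (quad_op L b) a)"
    by (simp add: tscl_add)
  also have "\<dots> = 0" unfolding two[OF a b] two[OF b a] by (simp add: tscl_diff tscl_tscl mult.commute)
  finally have "?Y = 0" by (rule double_zero)
  then show ?thesis by (simp add: eq_neg_iff_add_eq_0)
qed

text \<open>With $p_a=La$ and $q_a=aL$ the residue of $Ha$ with $X(b,c)$ splits into four kinds of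
  terms. The words in three $p$'s sum cyclically to the residue of $p_ap_bp_c$, those in three
  $q$'s to that of $q_aq_bq_c$, and these residues agree, as one factor \<open>L\<close> can be
  moved around the cycle. The mixed words of the two remaining kinds are cyclic permutations of
  each other.\<close>

lemma quad_op_cyclic:
  assumes L: "L \<in> Dp 0" and a: "a \<in> Dp i" and b: "b \<in> Dp j" and c: "c \<in> Dp k"
  shows "tr (quad_op L a) (quad_prod L b c) + tscl (psign (i * (j + k))) (tr (quad_op L b) (quad_prod L c a)) +
    tscl (psign (k * (i + j))) (tr (quad_op L c) (quad_prod L a b)) = 0"
proof -
  let ?p = "\<lambda>a. L \<star> a" and ?q = "\<lambda>a. a \<star> L"
  (* Y and Z are the mixed words, V the words in p = La, and W those in q = aL. *)
  let ?Y = "\<lambda>a b c. tr (d_minus (?p a)) (L \<star> (d_minus (?q b) \<star> c))"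
  let ?Z = "\<lambda>a b c. tr (d_minus (?q a)) (b \<star> (d_minus (?p c) \<star> L))"
  let ?V = "\<lambda>a b c. tr (d_minus (?p a)) (?p b \<star> (?p c - d_minus (?p c)))"
  let ?W = "\<lambda>a b c. tr (d_minus (?q a)) ((?q b - d_minus (?q b)) \<star> ?q c)"
  have T: "tr (quad_op L a) (quad_prod L b c) = ?V a b c - ?Y a b c + ?Z a b c - ?W a b c"
    if h: "a \<in> Dp i" "b \<in> Dp j" "c \<in> Dp k" for a b c i j k
  proof -
    note DD = Dp_DD[OF L] Dp_DD[OF h(1)] Dp_DD[OF h(2)] Dp_DD[OF h(3)]
    have y: "quad_prod L b c \<in> Dp (j + k)" by (rule quad_prod_Dp[OF L h(2,3)])
    have "tr (L \<star> d_minus (?q a)) (quad_prod L b c) = tr L (d_minus (?q a) \<star> quad_prod L b c)"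
      using DD Dp_DD[OF y] by (simp add: tr_assoc DD_closed)
    also have "\<dots> = tr (d_minus (?q a)) (quad_prod L b c \<star> L)"
      using tr_cyclic[OF L Dp_minus[OF Dp_0_mult(2)[OF L h(1)]] y] by simp
    finally have 1: "tr (quad_op L a) (quad_prod L b c) = tr (d_minus (?p a)) (L \<star> quad_prod L b c) - tr (d_minus (?q a)) (quad_prod L b c \<star> L)"
      unfolding quad_op_def using DD Dp_DD[OF y] by (simp add: tr_diff_left tr_assoc DD_closed)
    have 2: "L \<star> quad_prod L b c = ?p b \<star> (?p c - d_minus (?p c)) - L \<star> (d_minus (?q b) \<star> c)"
      unfolding quad_prod_def using DD by (simp add: d_mult_distribs d_mult_assoc DD_closed)
    have 3: "quad_prod L b c \<star> L = (?q b - d_minus (?q b)) \<star> ?q c - b \<star> (d_minus (?p c) \<star> L)"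
      unfolding quad_prod_def using DD by (simp add: d_mult_distribs d_mult_assoc DD_closed)
    show ?thesis unfolding 1 2 3 using DD by (simp add: tr_diff_right DD_closed)
  qed
  have YZ: "?Y c a b = tscl (psign (k * (i + j))) (?Z a b c)"
    if h: "a \<in> Dp i" "b \<in> Dp j" "c \<in> Dp k" for a b c i j k
  proof -
    note DD = Dp_DD[OF L] Dp_DD[OF h(1)] Dp_DD[OF h(2)] Dp_DD[OF h(3)]
    have q: "d_minus (?q a) \<in> Dp i" "d_minus (?p c) \<in> Dp k"
      using h L by (simp_all add: Dp_minus Dp_0_mult)
    have qb: "d_minus (?q a) \<star> b \<in> Dp (i + j)" by (rule Dp_mult[OF q(1) h(2)])
    have "?Y c a b = tr (d_minus (?p c) \<star> L) (d_minus (?q a) \<star> b)"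
      using DD by (simp add: tr_assoc DD_closed)
    also have "\<dots> = tscl (psign (k * (i + j))) (tr (d_minus (?q a) \<star> b) (d_minus (?p c) \<star> L))"
      by (rule tr_supersym[OF Dp_0_mult(2)[OF L q(2)] qb])
    finally show ?thesis using DD by (simp add: tr_assoc DD_closed)
  qed
  have pq: "tr (?p a) (?p b \<star> ?p c) = tr (?q a) (?q b \<star> ?q c)"
  proof -
    note DD = Dp_DD[OF L] Dp_DD[OF a] Dp_DD[OF b] Dp_DD[OF c]
    have "tr (?p a) (?p b \<star> ?p c) = tr L (a \<star> (?p b \<star> ?p c))" using DD by (simp add: tr_assoc DD_closed)
    also have "\<dots> = tr a ((?p b \<star> ?p c) \<star> L)"
      using tr_cyclic[OF L a Dp_mult[OF Dp_0_mult(1)[OF L b] Dp_0_mult(1)[OF L c]]] by simp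
    finally show ?thesis using DD by (simp add: tr_assoc d_mult_assoc DD_closed)
  qed
  note p = Dp_0_mult(1)[OF L a] Dp_0_mult(1)[OF L b] Dp_0_mult(1)[OF L c]
  note q = Dp_0_mult(2)[OF L a] Dp_0_mult(2)[OF L b] Dp_0_mult(2)[OF L c]
  have "?V a b c + tscl (psign (i * (j + k))) (?V b c a) + tscl (psign (k * (i + j))) (?V c a b) =
     ?W a b c + tscl (psign (i * (j + k))) (?W b c a) + tscl (psign (k * (i + j))) (?W c a b)"
    unfolding cyclic_sum_1[OF p] cyclic_sum_2[OF q] by (rule pq)
  moreover have "?Y a b c + tscl (psign (i * (j + k))) (?Y b c a) + tscl (psign (k * (i + j))) (?Y c a b) =
     ?Z a b c + tscl (psign (i * (j + k))) (?Z b c a) + tscl (psign (k * (i + j))) (?Z c a b)"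
    unfolding YZ[OF b c a] YZ[OF c a b] YZ[OF a b c]
    using bit_cases2[of i] bit_cases2[of j] bit_cases2[of k] by (auto simp: tscl_tscl)
  ultimately show ?thesis unfolding T[OF a b c] T[OF b c a] T[OF c a b] tscl_diff tscl_add
    by (rule three_term_cancel)
qed

subsection \<open>The linear operator\<close>

text \<open>With $a_+=a-a_-$ this is $a_+b_+-a_-b_-$: parts of different kind multiply to zero,
  and the product of the negative parts is taken with the opposite sign. Its supercommutator is
  the R-bracket of classical r-matrix theory.\<close>

definition split_prod :: "'f psdo \<Rightarrow> 'f psdo \<Rightarrow> 'f psdo" where
  "split_prod a b = (a - d_minus a) \<star> (b - d_minus b) - d_minus a \<star> d_minus b"

text \<open>For \<open>s = 1\<close> and \<open>x = L\<close> this is $[L,a]_--[L,a_-]$. The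
  expression is linear in \<open>x\<close>, so it is its own derivative in direction
  \<open>x\<close>, with \<open>s\<close> the sign of moving \<open>x\<close> past
  \<open>a\<close>.\<close>

definition lin_diff :: "'f \<Rightarrow> 'f psdo \<Rightarrow> 'f psdo \<Rightarrow> 'f psdo" where
  "lin_diff s x a = d_minus (x \<star> a) - d_scl s (d_minus (a \<star> x)) - x \<star> d_minus a + d_scl s (d_minus a \<star> x)"

lemma split_prod_Dp: "a \<in> Dp i \<Longrightarrow> b \<in> Dp j \<Longrightarrow> split_prod a b \<in> Dp (i + j)"
  by (simp add: split_prod_def Dp_diff Dp_minus Dp_mult)

lemma split_prod_DD: "a \<in> DD \<Longrightarrow> b \<in> DD \<Longrightarrow> split_prod a b \<in> DD"
  by (simp add: split_prod_def DD_closed)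

lemma d_minus_split_prod: "a \<in> DD \<Longrightarrow> b \<in> DD \<Longrightarrow> d_minus (split_prod a b) = - (d_minus a \<star> d_minus b)"
  by (simp add: split_prod_def d_minus_diff d_minus_mult_plus d_minus_mult_minus)

text \<open>The product is a direct sum of the product of differential operators and the negated
  product of operators of negative order, and negating an associative product keeps it
  associative.\<close>

lemma split_prod_assoc:
  assumes "a \<in> DD" "b \<in> DD" "c \<in> DD"
  shows "split_prod a (split_prod b c) = split_prod (split_prod a b) c"
proof -
  have "split_prod u v - d_minus (split_prod u v) = (u - d_minus u) \<star> (v - d_minus v)" if "u \<in> DD" "v \<in> DD" for u v
    by (simp add: d_minus_split_prod that) (simp add: split_prod_def)
  then show ?thesis unfolding split_prod_def[of a "split_prod b c"] split_prod_def[of "split_prod a b" c]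
    using assms by (simp add: d_minus_split_prod d_mult_assoc d_mult_uminus_left d_mult_uminus_right DD_closed)
qed

text \<open>Commutation with \<open>L\<close> is a derivation $\delta$, and the linear operator is
  $\delta(a)_--\delta(a_-)$. Expanding $\delta$ of the split product and projecting with
  \<open>d_minus_mult_split\<close> gives the identity. As in the quadratic case, the left-hand
  side collects the terms in which \<open>a\<close> precedes \<open>b\<close>.\<close>

lemma lin_diff_prod:
  assumes L: "L \<in> DD" and a: "a \<in> DD" and b: "b \<in> DD"
  shows "d_minus (lin_diff 1 L a \<star> b) - lin_diff 1 L a \<star> d_minus b + d_minus (a \<star> lin_diff 1 L b) - d_minus a \<star> lin_diff 1 L b
    = lin_diff 1 L (split_prod a b)"
proof -
  define dl where "dl x = L \<star> x - x \<star> L" for x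
  have dl_DD: "dl x \<in> DD" if "x \<in> DD" for x using that L by (simp add: dl_def DD_closed)
  have dl_mult: "dl (x \<star> y) = dl x \<star> y + x \<star> dl y" if "x \<in> DD" "y \<in> DD" for x y
    using that L by (simp add: dl_def d_mult_distribs d_mult_assoc DD_closed)
  have dl_add: "dl (x - y) = dl x - dl y" if "x \<in> DD" "y \<in> DD" for x y
    using that L by (simp add: dl_def d_mult_distribs DD_closed)
  have h: "lin_diff 1 L x = d_minus (dl x) - dl (d_minus x)" for x
    by (simp add: lin_diff_def dl_def d_minus_diff)
  have z: "split_prod a b = a \<star> b - a \<star> d_minus b - d_minus a \<star> b"
    using a b by (simp add: split_prod_def d_mult_distribs DD_closed)
  have dz: "dl (split_prod a b) = dl a \<star> b + a \<star> dl b - (dl a \<star> d_minus b + a \<star> dl (d_minus b)) - (dl (d_minus a) \<star> b + d_minus a \<star> dl b)"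
    unfolding z using a b by (simp add: dl_add dl_mult DD_closed)
  have dm: "dl (d_minus (split_prod a b)) = - (dl (d_minus a) \<star> d_minus b + d_minus a \<star> dl (d_minus b))"
    using a b dl_add[of 0 "d_minus a \<star> d_minus b"] dl_add[of 0 0]
    by (simp add: d_minus_split_prod dl_mult DD_closed)
  show ?thesis
    unfolding h dz dm using a b
    by (simp add: d_mult_distribs DD_closed dl_DD d_minus_diff d_minus_add d_minus_mult_split[of "dl a" b]
        d_minus_mult_split[of a "dl b"] algebra_simps)
qed

lemma lin_diff_Dp: "x \<in> Dp k \<Longrightarrow> a \<in> Dp i \<Longrightarrow> lin_diff s x a \<in> Dp (k + i)"
proof -
  assume xa: "x \<in> Dp k" "a \<in> Dp i"
  have "a \<star> x \<in> Dp (k + i)" "d_minus a \<star> x \<in> Dp (k + i)"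
    using Dp_mult[OF xa(2,1)] Dp_mult[OF Dp_minus[OF xa(2)] xa(1)] by (simp_all add: add.commute)
  with xa show "lin_diff s x a \<in> Dp (k + i)"
    by (simp add: lin_diff_def Dp_diff Dp_add Dp_scl Dp_minus Dp_mult)
qed

text \<open>The same transposition as for the quadratic operator, without the outer factor
  \<open>L\<close>.\<close>

lemma lin_diff_adjoint:
  assumes x: "x \<in> Dp k" and a: "a \<in> Dp i" and b: "b \<in> Dp j"
  shows "tr (lin_diff (psign (k * i)) x a) b = tr x (split_prod a b - d_scl (psign (i * j)) (split_prod b a))"
proof -
  note DD = Dp_DD[OF x] Dp_DD[OF a] Dp_DD[OF b]
  have t1: "tr (d_minus (x \<star> a)) b = tr x (a \<star> (b - d_minus b))"
    using DD by (simp add: tr_minus_left tr_assoc DD_closed tr_diff_right d_mult_diff_right)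
  have "tr (d_minus (a \<star> x)) b = tr a (x \<star> (b - d_minus b))"
    using DD by (simp add: tr_minus_left tr_assoc DD_closed tr_diff_right d_mult_diff_right)
  also have "\<dots> = tscl (psign (i * (k + j))) (tr x ((b - d_minus b) \<star> a))"
    by (rule tr_cyclic) (auto intro: assms Dp_minus Dp_diff)
  finally have t2: "tr (d_minus (a \<star> x)) b = tscl (psign (i * (k + j))) (tr x ((b - d_minus b) \<star> a))" .
  have t3: "tr (x \<star> d_minus a) b = tr x (d_minus a \<star> b)" using DD by (simp add: tr_assoc DD_closed)
  have "tr (d_minus a \<star> x) b = tr (d_minus a) (x \<star> b)" using DD by (simp add: tr_assoc DD_closed)
  also have "\<dots> = tscl (psign (i * (k + j))) (tr x (b \<star> d_minus a))"
    by (rule tr_cyclic) (auto intro: assms Dp_minus)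
  finally have t4: "tr (d_minus a \<star> x) b = tscl (psign (i * (k + j))) (tr x (b \<star> d_minus a))" .
  have sgn: "psign (k * i) * psign (i * (k + j)) = (psign (i * j) :: 'f)"
    by (simp add: psign_add distrib_left mult.commute[of k i])
  have z: "split_prod u v = u \<star> (v - d_minus v) - d_minus u \<star> v" "split_prod v u = (v - d_minus v) \<star> u - v \<star> d_minus u"
    if "u \<in> DD" "v \<in> DD" for u v
    using that by (simp_all add: split_prod_def d_mult_distribs DD_closed)
  have "tr (lin_diff (psign (k * i)) x a) b = tr x (a \<star> (b - d_minus b)) - tscl (psign (i * j)) (tr x ((b - d_minus b) \<star> a))
      - tr x (d_minus a \<star> b) + tscl (psign (i * j)) (tr x (b \<star> d_minus a))"
    unfolding lin_diff_def using DD
    by (simp add: tr_add_left tr_diff_left tr_scl_left DD_closed t1 t2 t3 t4 tscl_tscl sgn)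
  moreover have "tr x (split_prod a b - d_scl (psign (i * j)) (split_prod b a)) =
      tr x (a \<star> (b - d_minus b)) - tr x (d_minus a \<star> b) -
      tscl (psign (i * j)) (tr x ((b - d_minus b) \<star> a) - tr x (b \<star> d_minus a))"
    unfolding z[OF DD(2,3)] using DD by (simp add: tr_diff_right tr_scl_right DD_closed)
  ultimately show ?thesis by (simp add: tscl_diff)
qed

text \<open>What the argument uses of $\kappa$: as an operator it is even, central, compatible
  with the projection to negative order, and constant, that is annihilated by evolutionary vector
  fields.\<close>

definition central_const :: "'f psdo \<Rightarrow> bool" where
  "central_const K \<longleftrightarrow> K \<in> Dp 0 \<and> order_le 0 K \<and> (\<forall>a\<in>DD. K \<star> a = a \<star> K \<and> d_minus (K \<star> a) = K \<star> d_minus a) \<and> (\<forall>v. evo_d v K = 0)"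

lemma central_const_emb:
  assumes "\<kappa> \<in> A 0" "\<And>a. \<kappa> * a = a * \<kappa>"
  shows "central_const (d_const (emb \<kappa>))"
proof -
  have "d_const (emb \<kappa>) \<star> a = a \<star> d_const (emb \<kappa>)" if "a \<in> DD" for a
    using that emb_central[OF assms]
    by (auto simp: d_mult_const_left[OF assms(1)] d_mult_const_right[OF assms(1)] DD_iff[of a])
  moreover have "d_minus (d_const (emb \<kappa>) \<star> a) = d_const (emb \<kappa>) \<star> d_minus a" if "a \<in> DD" for a
    unfolding d_mult_const_left[OF assms(1) that] d_mult_const_left[OF assms(1) DD_minus[OF that]]
    by (rule ext) (simp add: d_minus_def)
  moreover have "evo_d v (d_const (emb \<kappa>)) = 0" for v
    by (rule ext) (simp add: evo_d_apply d_const_def)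
  moreover have "order_le 0 (d_const (emb \<kappa>))" by (simp add: order_le_def d_const_def)
  ultimately show ?thesis using d_const_DD[OF assms(1)] by (simp add: central_const_def)
qed

lemma central_constD:
  assumes "central_const K"
  shows "K \<in> Dp 0" "K \<in> DD" "a \<in> DD \<Longrightarrow> a \<star> K = K \<star> a" "a \<in> DD \<Longrightarrow> d_minus (K \<star> a) = K \<star> d_minus a"
    "evo_d v K = 0" "a \<in> DD \<Longrightarrow> b \<in> DD \<Longrightarrow> a \<star> (K \<star> b) = K \<star> (a \<star> b)"
    "a \<in> DD \<Longrightarrow> b \<in> DD \<Longrightarrow> tr (K \<star> a) b = tr a (K \<star> b)" "order_le 0 K"
proof -
  show "order_le 0 K" using assms by (simp add: central_const_def)
  show K: "K \<in> Dp 0" "K \<in> DD" using assms Dp_DD by (auto simp: central_const_def)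
  show c: "a \<star> K = K \<star> a" if "a \<in> DD" for a using assms that by (simp add: central_const_def)
  show "a \<in> DD \<Longrightarrow> d_minus (K \<star> a) = K \<star> d_minus a" "evo_d v K = 0" using assms by (auto simp: central_const_def)
  show "a \<in> DD \<Longrightarrow> b \<in> DD \<Longrightarrow> a \<star> (K \<star> b) = K \<star> (a \<star> b)"
    using K c[of a] by (simp add: d_mult_assoc[symmetric])
  show "a \<in> DD \<Longrightarrow> b \<in> DD \<Longrightarrow> tr (K \<star> a) b = tr a (K \<star> b)"
    using K c[of a] by (simp add: tr_assoc[symmetric])
qed

lemma split_prod_central:
  assumes K: "central_const K" and ab: "a \<in> DD" "b \<in> DD"
  shows "split_prod (K \<star> a) b = K \<star> split_prod a b" "split_prod a (K \<star> b) = K \<star> split_prod a b"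
  using ab central_constD[OF K]
  by (simp_all add: split_prod_def d_mult_diff_right[symmetric] d_mult_assoc DD_closed)

lemma lin_diff_central:
  assumes K: "central_const K" and ab: "x \<in> DD" "a \<in> DD"
  shows "lin_diff s x (K \<star> a) = K \<star> lin_diff s x a" "lin_diff s (K \<star> x) a = K \<star> lin_diff s x a"
  using ab central_constD[OF K]
  by (simp_all add: lin_diff_def d_mult_distribs d_mult_scl_right d_mult_assoc DD_closed)

definition lin_op :: "'f psdo \<Rightarrow> 'f psdo \<Rightarrow> 'f psdo \<Rightarrow> 'f psdo" where
  "lin_op K L a = K \<star> lin_diff 1 L a"

lemma tr_lin_op:
  assumes K: "central_const K" and L: "L \<in> Dp 0" and a: "a \<in> Dp i" and b: "b \<in> Dp j"
  shows "tr (lin_op K L a) b = tr L (K \<star> (split_prod a b - d_scl (psign (i * j)) (split_prod b a)))"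
proof -
  note DD = Dp_DD[OF L] Dp_DD[OF a] Dp_DD[OF b] central_constD(2)[OF K]
  have l: "lin_diff 1 L a \<in> DD" using lin_diff_Dp[OF L a] Dp_DD by blast
  have "tr (lin_op K L a) b = tr (lin_diff (psign (0 * i)) L a) (K \<star> b)"
    using central_constD(7)[OF K l DD(3)] by (simp add: lin_op_def)
  also have "\<dots> = tr L (split_prod a (K \<star> b) - d_scl (psign (i * j)) (split_prod (K \<star> b) a))"
    by (rule lin_diff_adjoint[OF L a Dp_0_mult(1)[OF central_constD(1)[OF K] b]])
  finally show ?thesis using DD
    by (simp add: split_prod_central[OF K] d_mult_diff_right d_mult_scl_right split_prod_DD DD_closed)
qed

lemma lin_op_skew:
  assumes K: "central_const K" and L: "L \<in> Dp 0" and a: "a \<in> Dp i" and b: "b \<in> Dp j"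
  shows "tr (lin_op K L a) b = - tscl (psign (i * j)) (tr (lin_op K L b) a)"
proof -
  note DD = Dp_DD[OF L] Dp_DD[OF a] Dp_DD[OF b] central_constD(2)[OF K]
  show ?thesis
    unfolding tr_lin_op[OF K L a b] tr_lin_op[OF K L b a] using DD
    by (simp add: d_mult_diff_right d_mult_scl_right tr_diff_right tr_scl_right split_prod_DD DD_closed
        tscl_diff tscl_tscl mult.commute[of j i])
qed

text \<open>By \<open>tr_lin_op\<close> and associativity of the split product, each summand is a
  difference of two residues of \<open>L\<close> with triple products, and the cyclic sum
  telescopes.\<close>

lemma lin_op_cyclic:
  assumes K: "central_const K" and L: "L \<in> Dp 0" and a: "a \<in> Dp i" and b: "b \<in> Dp j" and c: "c \<in> Dp k"
  shows "tr (lin_op K L a) (K \<star> split_prod b c) + tscl (psign (i * (j + k))) (tr (lin_op K L b) (K \<star> split_prod c a)) +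
    tscl (psign (k * (i + j))) (tr (lin_op K L c) (K \<star> split_prod a b)) = 0"
proof -
  let ?T = "\<lambda>a b c. tr L (K \<star> (K \<star> split_prod a (split_prod b c)))"
  have T: "tr (lin_op K L a) (K \<star> split_prod b c) = ?T a b c - tscl (psign (i * (j + k))) (?T b c a)"
    if "a \<in> Dp i" "b \<in> Dp j" "c \<in> Dp k" for a b c i j k
  proof -
    note DD = Dp_DD[OF L] Dp_DD[OF that(1)] Dp_DD[OF that(2)] Dp_DD[OF that(3)] central_constD(2)[OF K]
    have bc: "K \<star> split_prod b c \<in> Dp (j + k)"
      by (rule Dp_0_mult(1)[OF central_constD(1)[OF K] split_prod_Dp[OF that(2,3)]])
    show ?thesis unfolding tr_lin_op[OF K L that(1) bc] using DD
      by (simp add: split_prod_central[OF K] split_prod_DD DD_closed d_mult_diff_right d_mult_scl_right tr_diff_right tr_scl_right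
          split_prod_assoc[of b c a])
  qed
  have sgn: "psign (i * (j + k)) * psign (j * (k + i)) = (psign (k * (i + j)) :: 'f)"
    "psign (k * (i + j)) * psign (k * (i + j)) = (1 :: 'f)"
    using bit_cases2[of i] bit_cases2[of j] bit_cases2[of k] by auto
  show ?thesis unfolding T[OF a b c] T[OF b c a] T[OF c a b] tscl_diff tscl_tscl sgn by simp
qed

end

section \<open>Hamiltonian operators from a transposed product\<close>

context hamiltonian_setting
begin

lemma sum_lessThan_3: "(\<Sum>l<3::nat. f l) = f 0 + f 1 + f 2" for f :: "nat \<Rightarrow> 'z::comm_monoid_add"
  by (simp add: eval_nat_numeral One_nat_def)
lemma sum_lessThan_1_2: "(\<Sum>l<1::nat. f l) = f 0" "(\<Sum>l<2::nat. f l) = f 0 + f 1" for f :: "nat \<Rightarrow> 'z::comm_monoid_add"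
  by (simp_all add: eval_nat_numeral One_nat_def)

lemma differential_3:
  "differential [i1, i2, i3] \<omega> [x1, x2, x3] =
     act x1 (\<omega> [x2, x3]) - scM (psign (i1 * i2)) (act x2 (\<omega> [x1, x3])) +
     scM (psign (i3 * (i1 + i2))) (act x3 (\<omega> [x1, x2])) - \<omega> [br x1 x2, x3] +
     scM (psign (i3 * i2)) (\<omega> [br x1 x3, x2]) - scM (psign ((i2 + i3) * i1)) (\<omega> [br x2 x3, x1])"
proof -
  have l: "length [x1, x2, x3] = 3" by simp
  have n: "[i1, i2, i3] ! 0 = i1" "[i1, i2, i3] ! 1 = i2" "[i1, i2, i3] ! 2 = i3"
    "[x1, x2, x3] ! 0 = x1" "[x1, x2, x3] ! 1 = x2" "[x1, x2, x3] ! 2 = x3"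
    by (simp_all add: One_nat_def numeral_2_eq_2)
  have d: "del 0 [x1, x2, x3] = [x2, x3]" "del 1 [x1, x2, x3] = [x1, x3]" "del 2 [x1, x2, x3] = [x1, x2]"
    "del 0 [x1, x3] = [x3]" "del 0 [x1, x2] = [x2]" "del 1 [x1, x2] = [x1]"
    by (simp_all add: del_def One_nat_def numeral_2_eq_2)
  have s: "(\<Sum>r<0. [i1, i2, i3] ! r) = 0" "(\<Sum>r = 0 + 1..<1. [i1, i2, i3] ! r) = 0"
     "(\<Sum>r = 0 + 1..<2. [i1, i2, i3] ! r) = i2" "(\<Sum>r = 1 + 1..<2. [i1, i2, i3] ! r) = 0"
    by (simp_all add: n numeral_2_eq_2 One_nat_def)
  show ?thesis
    unfolding differential_def l sum_lessThan_3 sum_lessThan_1_2 n d s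
    by (simp add: n mult.commute[of i2 i1])
qed

end

text \<open>\<open>H\<close> is considered on all operators and not only on $\Omega$, which
  \<open>H_low\<close> makes possible. \<open>H_adjoint\<close> says that the supercommutator of
  \<open>X\<close> is the transpose of the derivative of \<open>H\<close>, where the derivative
  along \<open>x\<close> is $\partial_x(Ha)-H(\partial_xa)$. The locale is closed under multiples.\<close>

locale poisson_operator = kp_superalgebra sA A form \<iota> e
  for sA :: "'f::real_or_complex \<Rightarrow> 'a::ring \<Rightarrow> 'a" and A form \<iota> e +
  fixes H :: "'f psdo \<Rightarrow> 'f psdo" and X :: "'f psdo \<Rightarrow> 'f psdo \<Rightarrow> 'f psdo"
  assumes H_G: "a \<in> Dp i \<Longrightarrow> H a \<in> G i"
    and H_add: "\<lbrakk>a \<in> DD; b \<in> DD\<rbrakk> \<Longrightarrow> H (a + b) = H a + H b"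
    and H_scl: "a \<in> DD \<Longrightarrow> H (d_scl t a) = d_scl t (H a)"
    and H_low: "\<lbrakk>a \<in> DD; order_le (- int \<iota> - 2) a\<rbrakk> \<Longrightarrow> H a = 0"
    and X_Dp: "\<lbrakk>a \<in> Dp i; b \<in> Dp j\<rbrakk> \<Longrightarrow> X a b \<in> Dp (i + j)"
    and H_skew: "\<lbrakk>a \<in> Dp i; b \<in> Dp j\<rbrakk> \<Longrightarrow> tr (H a) b = - tscl (psign (i * j)) (tr (H b) a)"
    and H_bracket: "\<lbrakk>a \<in> Dp i; b \<in> Dp j\<rbrakk> \<Longrightarrow> evo_bracket (H a) (H b) =
      H (evo_d (H a) b - d_scl (psign (i * j)) (evo_d (H b) a) + X a b - d_scl (psign (i * j)) (X b a))"
    and H_adjoint: "\<lbrakk>x \<in> G k; a \<in> Dp i; b \<in> Dp j\<rbrakk> \<Longrightarrow> tr (evo_d x (H a)) b =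
      tr (H (evo_d x a)) b + tr x (X a b - d_scl (psign (i * j)) (X b a))"
    and H_cyclic: "\<lbrakk>a \<in> Dp i; b \<in> Dp j; c \<in> Dp k\<rbrakk> \<Longrightarrow> tr (H a) (X b c) +
      tscl (psign (i * (j + k))) (tr (H b) (X c a)) + tscl (psign (k * (i + j))) (tr (H c) (X a b)) = 0"
begin

lemma H_diff: "a \<in> DD \<Longrightarrow> b \<in> DD \<Longrightarrow> H (a - b) = H a - H b"
  using H_add[of a "- b"] H_scl[of b "- 1"] by (simp add: d_scl_uminus_one DD_uminus)

lemma H_gcarG: "a \<in> DD \<Longrightarrow> H a \<in> gcar G"
  by (elim DD_E) (simp add: H_add Dp_DD gcarG_add G_gcarG[OF H_G])

text \<open>This is what \<open>H_low\<close> is for: the difference between an operator and its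
  approximation in $\Omega$ is annihilated by \<open>H\<close>.\<close>

lemma H_Omega_hom:
  assumes "a \<in> Dp i" shows "\<exists>w\<in>\<Omega> \<inter> Dp i. H w = H a"
proof -
  obtain w where w: "w \<in> \<Omega>" "w \<in> Dp i" "order_le (- int \<iota> - 2) (a - w)" using Omega_approx[OF assms] by blast
  then have "H (a - w) = 0" by (intro H_low) (auto intro: DD_diff Dp_DD assms)
  then show ?thesis using w assms by (auto simp: H_diff Dp_DD)
qed

lemma H_Omega:
  assumes "a \<in> DD" shows "\<exists>w\<in>\<Omega>. H w = H a"
proof -
  obtain a0 a1 where a: "a = a0 + a1" "a0 \<in> Dp 0" "a1 \<in> Dp 1" using assms by (rule DD_E)
  obtain w0 w1 where w: "w0 \<in> \<Omega>" "H w0 = H a0" "w1 \<in> \<Omega>" "H w1 = H a1"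
    using H_Omega_hom[OF a(2)] H_Omega_hom[OF a(3)] by blast
  then have "H (w0 + w1) = H a" using a by (simp add: H_add Omega_DD Dp_DD)
  then show ?thesis using w Omega_add by blast
qed

lemma d_part_H: "a \<in> DD \<Longrightarrow> d_part i (H a) = H (d_part i a)"
proof -
  assume a: "a \<in> DD"
  have "d_part i (H (d_part 0 a + d_part 1 a)) = H (d_part i a)"
    using bit_cases2[of i]
    by (auto simp: H_add[OF Dp_DD[OF d_part_Dp[OF a]] Dp_DD[OF d_part_Dp[OF a]]] d_part_add
        d_part_hom[OF G_Dp[OF H_G[OF d_part_Dp[OF a]]]])
  then show ?thesis by (simp add: d_part_sum)
qed

lemma image_hom:
  assumes "x \<in> H ` \<Omega>" "x \<in> G i" shows "\<exists>\<phi>\<in>\<Omega> \<inter> Dp i. H \<phi> = x"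
proof -
  obtain \<phi> where \<phi>: "\<phi> \<in> \<Omega>" "x = H \<phi>" using assms by blast
  have "H (d_part i \<phi>) = d_part i x" using d_part_H[OF Omega_DD[OF \<phi>(1)], of i] \<phi>(2) by simp
  also have "\<dots> = x" using d_part_hom[OF G_Dp[OF assms(2)], of i] by simp
  finally show ?thesis using Omega_part[OF \<phi>(1), of i] d_part_Dp[OF Omega_DD[OF \<phi>(1)], of i] by blast
qed

text \<open>The definition of super skew-symmetry refers to the parities of $Ha$ and $Hb$, while
  \<open>a\<close> and \<open>b\<close> themselves may be inhomogeneous. Their components of the
  wrong parity lie in the kernel of \<open>H\<close>, so by skew-symmetry they do not contribute.\<close>

lemma skew_inhom:
  assumes a: "a \<in> DD" and b: "b \<in> DD" and Ga: "H a \<in> G i" and Gb: "H b \<in> G j"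
  shows "tr (H a) b = - tscl (psign (i * j)) (tr (H b) a)"
proof -
  have z: "H (d_part k c) = 0" if "c \<in> DD" "H c \<in> G l" "k \<noteq> l" for c k l
    using d_part_H[OF that(1), of k] d_part_hom[OF G_Dp[OF that(2)], of k] that(3) by simp
  have e: "H (d_part l c) = H c" if "c \<in> DD" "H c \<in> G l" for c l
    using d_part_H[OF that(1), of l] d_part_hom[OF G_Dp[OF that(2)], of l] by simp
  have o: "tr (H c) (d_part k d) = 0" if "c \<in> DD" "d \<in> DD" "H c \<in> G l" "H d \<in> G m" "k \<noteq> m" for c d k l m
    using H_skew[OF d_part_Dp[OF that(1), of l] d_part_Dp[OF that(2), of k]] e[OF that(1,3)] z[OF that(2,4,5)]
      Dp_DD[OF d_part_Dp[OF that(1), of l]] by simp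
  have full: "tr (H c) d = tr (H c) (d_part m d)" if "c \<in> DD" "d \<in> DD" "H c \<in> G l" "H d \<in> G m" for c d l m
  proof -
    have "tr (H c) d = tr (H c) (d_part 0 d + d_part 1 d)" by (simp add: d_part_sum)
    also have "\<dots> = tr (H c) (d_part 0 d) + tr (H c) (d_part 1 d)"
      by (rule tr_add_right) (auto intro: gcarG_DD H_gcarG that Dp_DD d_part_Dp)
    finally show ?thesis using o[OF that, of 0] o[OF that, of 1] bit_cases2[of m] by auto
  qed
  show ?thesis
    unfolding full[OF a b Ga Gb] full[OF b a Gb Ga]
    using H_skew[OF d_part_Dp[OF a, of i] d_part_Dp[OF b, of j]] e[OF a Ga] e[OF b Gb] by simp
qed

text \<open>Skew-symmetry moves \<open>H\<close> onto \<open>d\<close>. Therefore the 2-form does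
  not depend on the preimage of its second argument, as \<open>form_of_tr\<close> states.\<close>

lemma H_kernel:
  assumes "d \<in> DD" "H d = 0" "x \<in> H ` \<Omega>" shows "tr x d = 0"
proof -
  obtain \<phi> where \<phi>: "\<phi> \<in> \<Omega>" "x = H \<phi>" using assms by blast
  note p = d_part_Dp[OF Omega_DD[OF \<phi>(1)]]
  have z: "tr (H (d_part i \<phi>)) d = 0" for i
    using skew_inhom[OF Dp_DD[OF p[of i]] assms(1) H_G[OF p[of i]], of 0] assms(2) Dp_DD[OF p] by simp
  have "x = H (d_part 0 \<phi>) + H (d_part 1 \<phi>)"
    unfolding \<phi>(2) using H_add[OF Dp_DD[OF p, of 0] Dp_DD[OF p, of 1]] by (simp add: d_part_sum)
  then show ?thesis using z[of 0] z[of 1] assms(1) Dp_DD[OF p] by (simp add: tr_add_left gcarG_DD[OF H_gcarG])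
qed

interpretation hs: hamiltonian_setting d_scl G evo_bracket tscl Pt t_act d_scl \<Omega> "\<lambda>w v. pairing v w"
  by (rule hamiltonian_setting_G)

lemma form_of_tr:
  assumes "x \<in> H ` \<Omega>" "\<phi> \<in> \<Omega>" shows "hs.form_of H [x, H \<phi>] = tr x \<phi>"
proof -
  define \<psi> where "\<psi> = inv_into \<Omega> H (H \<phi>)"
  have im: "H \<phi> \<in> H ` \<Omega>" using assms(2) by blast
  have \<psi>: "\<psi> \<in> \<Omega>" "H \<psi> = H \<phi>"
    unfolding \<psi>_def by (rule inv_into_into[OF im], rule f_inv_into_f[OF im])
  have x: "x \<in> gcar G" using assms H_gcarG Omega_DD by blast
  have "tr x (\<psi> - \<phi>) = 0"
    by (rule H_kernel) (use assms \<psi> in \<open>auto simp: DD_diff Omega_DD H_diff\<close>)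
  then have "tr x \<psi> = tr x \<phi>" using \<psi>(1) assms(2) by (simp add: tr_diff_right gcarG_DD[OF x] Omega_DD)
  then show ?thesis using \<psi>(1) x by (simp add: hs.form_of_def \<psi>_def[symmetric] pairing_tr gcarG_DD)
qed

lemma image_add: "x \<in> H ` \<Omega> \<Longrightarrow> y \<in> H ` \<Omega> \<Longrightarrow> x + y \<in> H ` \<Omega>"
  by (auto simp: H_add[symmetric] Omega_DD intro!: imageI Omega_add)

lemma image_bracket_hom:
  assumes "a \<in> Dp i" "b \<in> Dp j"
  shows "evo_d (H a) b - d_scl (psign (i * j)) (evo_d (H b) a) + X a b - d_scl (psign (i * j)) (X b a) \<in> Dp (i + j)"
  using assms evo_d_Dp[OF H_G[OF assms(1)] assms(2)] evo_d_Dp[OF H_G[OF assms(2)] assms(1)] X_Dp[OF assms] X_Dp[OF assms(2,1)]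
  by (simp add: Dp_diff Dp_add Dp_scl add.commute)

lemma image_bracket:
  assumes "x \<in> H ` \<Omega>" "y \<in> H ` \<Omega>" shows "evo_bracket x y \<in> H ` \<Omega>"
proof -
  obtain a b where ab: "a \<in> \<Omega>" "x = H a" "b \<in> \<Omega>" "y = H b" using assms by blast
  note p = d_part_Dp[OF Omega_DD[OF ab(1)]] d_part_Dp[OF Omega_DD[OF ab(3)]]
  have hom: "evo_bracket (H (d_part i a)) (H (d_part j b)) \<in> H ` \<Omega>" for i j
    unfolding H_bracket[OF p] using H_Omega[OF Dp_DD[OF image_bracket_hom[OF p]]] by (metis imageI)
  have "x = H (d_part 0 a) + H (d_part 1 a)" "y = H (d_part 0 b) + H (d_part 1 b)"
    unfolding ab using H_add[OF Dp_DD[OF p(1)] Dp_DD[OF p(1)], of 0 1] H_add[OF Dp_DD[OF p(2)] Dp_DD[OF p(2)], of 0 1]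
    by (simp_all add: d_part_sum)
  then show ?thesis by (simp add: bracket_add_left bracket_add_right) (intro image_add hom)
qed

lemma image_graded: "hs.graded (H ` \<Omega>)"
  unfolding hs.graded_def
proof (intro set_eqI iffI)
  fix x assume "x \<in> H ` \<Omega>"
  then obtain a where a: "a \<in> \<Omega>" "x = H a" by blast
  note p = d_part_Dp[OF Omega_DD[OF a(1)]]
  have "x = H (d_part 0 a) + H (d_part 1 a)"
    unfolding a using H_add[OF Dp_DD[OF p(1)] Dp_DD[OF p(1)], of 0 1] by (simp add: d_part_sum)
  then show "x \<in> {x + y |x y. x \<in> H ` \<Omega> \<inter> G 0 \<and> y \<in> H ` \<Omega> \<inter> G 1}"
    using H_G[OF p] Omega_part[OF a(1)] by blast
next
  fix x assume "x \<in> {x + y |x y. x \<in> H ` \<Omega> \<inter> G 0 \<and> y \<in> H ` \<Omega> \<inter> G 1}"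
  then show "x \<in> H ` \<Omega>" using image_add by blast
qed

lemma left_radical_eq: "hs.left_radical H = {x \<in> H ` \<Omega>. \<forall>\<phi>\<in>\<Omega>. tr x \<phi> = 0}"
  unfolding hs.left_radical_def by (auto simp: form_of_tr)

lemma right_radical_eq: "hs.right_radical H = H ` {\<phi> \<in> \<Omega>. \<forall>x\<in>H ` \<Omega>. tr x \<phi> = 0}"
  unfolding hs.right_radical_def by (auto simp: form_of_tr)

text \<open>If $x=x_0+x_1$ is orthogonal to a homogeneous one-form, the residues of $x_0$ and
  $x_1$ with it have different parities, so both vanish.\<close>

lemma left_radical_graded: "hs.graded (hs.left_radical H)"
  unfolding hs.graded_def
proof (intro set_eqI iffI)
  fix x assume "x \<in> hs.left_radical H"
  then have x: "x \<in> H ` \<Omega>" and z: "tr x \<phi> = 0" if "\<phi> \<in> \<Omega>" for \<phi> using that by (auto simp: left_radical_eq)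
  have xH: "x \<in> H ` \<Omega>" by (rule x[OF Omega_zero])
  then obtain x0 x1 where x01: "x = x0 + x1" "x0 \<in> H ` \<Omega>" "x0 \<in> G 0" "x1 \<in> H ` \<Omega>" "x1 \<in> G 1"
    using image_graded unfolding hs.graded_def by blast
  note Gd = gcarG_DD[OF G_gcarG[OF x01(3)]] gcarG_DD[OF G_gcarG[OF x01(5)]]
  have hom: "tr x0 \<phi> = 0 \<and> tr x1 \<phi> = 0" if "\<phi> \<in> \<Omega>" "\<phi> \<in> Dp j" for \<phi> j
  proof -
    have "tr x0 \<phi> + tr x1 \<phi> = 0" using z[OF that(1)] Gd Omega_DD[OF that(1)] by (simp add: x01(1) tr_add_left)
    from tr_parity_zero[OF G_Dp[OF x01(3)] that(2) G_Dp[OF x01(5)] that(2) _ this] show ?thesis by simp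
  qed
  have "tr x0 \<phi> = 0 \<and> tr x1 \<phi> = 0" if \<phi>: "\<phi> \<in> \<Omega>" for \<phi>
  proof -
    note p = d_part_Dp[OF Omega_DD[OF \<phi>]]
    have "tr y \<phi> = tr y (d_part 0 \<phi>) + tr y (d_part 1 \<phi>)" if "y \<in> DD" for y
      using tr_add_right[OF that Dp_DD[OF p[of 0]] Dp_DD[OF p[of 1]]] by (simp add: d_part_sum)
    then show ?thesis using hom[OF Omega_part[OF \<phi>] p] Gd by simp
  qed
  then show "x \<in> {x + y |x y. x \<in> hs.left_radical H \<inter> G 0 \<and> y \<in> hs.left_radical H \<inter> G 1}"
    using x01 unfolding left_radical_eq by blast
next
  fix x assume "x \<in> {x + y |x y. x \<in> hs.left_radical H \<inter> G 0 \<and> y \<in> hs.left_radical H \<inter> G 1}"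
  then obtain x0 x1 where x: "x = x0 + x1" "x0 \<in> hs.left_radical H" "x0 \<in> G 0" "x1 \<in> hs.left_radical H" "x1 \<in> G 1" by blast
  then show "x \<in> hs.left_radical H"
    by (auto simp: left_radical_eq image_add tr_add_left gcarG_DD[OF G_gcarG] Omega_DD)
qed

lemma right_radical_graded: "hs.graded (hs.right_radical H)"
  unfolding hs.graded_def
proof (intro set_eqI iffI)
  fix y assume "y \<in> hs.right_radical H"
  then obtain \<phi> where \<phi>: "\<phi> \<in> \<Omega>" "y = H \<phi>" and z: "\<And>x. x \<in> H ` \<Omega> \<Longrightarrow> tr x \<phi> = 0"
    unfolding right_radical_eq by blast
  note p = d_part_Dp[OF Omega_DD[OF \<phi>(1)]]
  have xz: "tr x (d_part j \<phi>) = 0" if x: "x \<in> H ` \<Omega>" for x j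
  proof -
    have hom: "tr x (d_part 0 \<phi>) = 0 \<and> tr x (d_part 1 \<phi>) = 0" if "x \<in> H ` \<Omega>" "x \<in> G i" for x i
    proof -
      have "tr x (d_part 0 \<phi>) + tr x (d_part 1 \<phi>) = 0"
        using z[OF that(1)] tr_add_right[OF gcarG_DD[OF G_gcarG[OF that(2)]] Dp_DD[OF p[of 0]] Dp_DD[OF p[of 1]]]
        by (simp add: d_part_sum)
      from tr_parity_zero[OF G_Dp[OF that(2)] p G_Dp[OF that(2)] p _ this] show ?thesis by simp
    qed
    obtain x0 x1 where x01: "x = x0 + x1" "x0 \<in> H ` \<Omega>" "x0 \<in> G 0" "x1 \<in> H ` \<Omega>" "x1 \<in> G 1"
      using image_graded x unfolding hs.graded_def by blast
    have "tr x (d_part j \<phi>) = tr x0 (d_part j \<phi>) + tr x1 (d_part j \<phi>)"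
      unfolding x01(1) by (rule tr_add_left[OF gcarG_DD[OF G_gcarG[OF x01(3)]] gcarG_DD[OF G_gcarG[OF x01(5)]] Dp_DD[OF p]])
    then show ?thesis using hom[OF x01(2,3)] hom[OF x01(4,5)] bit_cases2[of j] by auto
  qed
  have "y = H (d_part 0 \<phi>) + H (d_part 1 \<phi>)"
    unfolding \<phi>(2) using H_add[OF Dp_DD[OF p[of 0]] Dp_DD[OF p[of 1]]] by (simp add: d_part_sum)
  moreover have "H (d_part j \<phi>) \<in> hs.right_radical H \<inter> G j" for j
    unfolding right_radical_eq using xz Omega_part[OF \<phi>(1)] H_G[OF p] by blast
  ultimately show "y \<in> {x + y |x y. x \<in> hs.right_radical H \<inter> G 0 \<and> y \<in> hs.right_radical H \<inter> G 1}" by blast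
next
  fix y assume "y \<in> {x + y |x y. x \<in> hs.right_radical H \<inter> G 0 \<and> y \<in> hs.right_radical H \<inter> G 1}"
  then obtain \<phi>0 \<phi>1 where y: "y = H \<phi>0 + H \<phi>1" "\<phi>0 \<in> \<Omega>" "\<phi>1 \<in> \<Omega>"
    "\<And>x. x \<in> H ` \<Omega> \<Longrightarrow> tr x \<phi>0 = 0" "\<And>x. x \<in> H ` \<Omega> \<Longrightarrow> tr x \<phi>1 = 0"
    unfolding right_radical_eq by blast
  have "y = H (\<phi>0 + \<phi>1)" using y by (simp add: H_add Omega_DD)
  moreover have "tr x (\<phi>0 + \<phi>1) = 0" if "x \<in> H ` \<Omega>" for x
  proof -
    have "x \<in> DD" using that gcarG_DD[OF H_gcarG] Omega_DD by blast
    then show ?thesis using y that by (simp add: tr_add_right Omega_DD)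
  qed
  ultimately show "y \<in> hs.right_radical H" unfolding right_radical_eq using Omega_add[OF y(2,3)] by blast
qed

lemma eight_cases:
  fixes i j k :: bit
  obtains "i = 0" "j = 0" "k = 0" | "i = 0" "j = 0" "k = 1" | "i = 0" "j = 1" "k = 0" | "i = 0" "j = 1" "k = 1"
    | "i = 1" "j = 0" "k = 0" | "i = 1" "j = 0" "k = 1" | "i = 1" "j = 1" "k = 0" | "i = 1" "j = 1" "k = 1"
  using bit_cases2[of i] bit_cases2[of j] bit_cases2[of k] by blast

text \<open>Choose homogeneous $a,b,c\in\Omega$ with $x_1=Ha$, $x_2=Hb$, $x_3=Hc$. The Leibniz
  rule for the module action, the bracket formula and \<open>H_adjoint\<close> express everything
  through residues of the form \<open>tr (H a) b\<close>. The terms with derivatives of $a,b,c$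
  cancel by skew-symmetry, and what is left are the cyclic sums for $(a,b,c)$ and $(a,c,b)$.\<close>

lemma form_closed:
  assumes x: "x1 \<in> H ` \<Omega> \<inter> G i1" "x2 \<in> H ` \<Omega> \<inter> G i2" "x3 \<in> H ` \<Omega> \<inter> G i3"
  shows "hs.differential [i1, i2, i3] (hs.form_of H) [x1, x2, x3] = 0"
proof -
  obtain a b c where abc: "a \<in> \<Omega>" "a \<in> Dp i1" "x1 = H a" "b \<in> \<Omega>" "b \<in> Dp i2" "x2 = H b" "c \<in> \<Omega>" "c \<in> Dp i3" "x3 = H c"
    using image_hom[of x1 i1] image_hom[of x2 i2] image_hom[of x3 i3] x by blast
  have im: "H a \<in> H ` \<Omega>" "H b \<in> H ` \<Omega>" "H c \<in> H ` \<Omega>" using abc by blast+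
  have Gs: "H a \<in> G i1" "H b \<in> G i2" "H c \<in> G i3" using x abc by auto
  note DD = Dp_DD[OF abc(2)] Dp_DD[OF abc(5)] Dp_DD[OF abc(8)]
  note HD = gcarG_DD[OF G_gcarG[OF Gs(1)]] gcarG_DD[OF G_gcarG[OF Gs(2)]] gcarG_DD[OF G_gcarG[OF Gs(3)]]
  have diff: "hs.differential [i1, i2, i3] (hs.form_of H) [x1, x2, x3] =
      t_act (H a) (tr (H b) c) - tscl (psign (i1 * i2)) (t_act (H b) (tr (H a) c)) +
      tscl (psign (i3 * (i1 + i2))) (t_act (H c) (tr (H a) b)) - tr (evo_bracket (H a) (H b)) c +
      tscl (psign (i3 * i2)) (tr (evo_bracket (H a) (H c)) b) -
      tscl (psign ((i2 + i3) * i1)) (tr (evo_bracket (H b) (H c)) a)"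
    unfolding abc(3,6,9) hs.differential_3 form_of_tr[OF im(1) abc(4)] form_of_tr[OF im(1) abc(7)]
      form_of_tr[OF im(2) abc(7)] form_of_tr[OF image_bracket[OF im(1,2)] abc(7)]
      form_of_tr[OF image_bracket[OF im(1,3)] abc(4)] form_of_tr[OF image_bracket[OF im(2,3)] abc(1)] ..
  have act: "t_act (H a) (tr (H b) c) = tr (evo_d (H a) (H b)) c + tscl (psign (i1 * i2)) (tr (H b) (evo_d (H a) c))"
    "t_act (H b) (tr (H a) c) = tr (evo_d (H b) (H a)) c + tscl (psign (i2 * i1)) (tr (H a) (evo_d (H b) c))"
    "t_act (H c) (tr (H a) b) = tr (evo_d (H c) (H a)) b + tscl (psign (i3 * i1)) (tr (H a) (evo_d (H c) b))"
    by (rule t_act_tr[OF Gs(1) G_Dp[OF Gs(2)] DD(3)] t_act_tr[OF Gs(2) G_Dp[OF Gs(1)] DD(3)] t_act_tr[OF Gs(3) G_Dp[OF Gs(1)] DD(2)])+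
  note evDp = evo_d_Dp[OF Gs(1) abc(8)] evo_d_Dp[OF Gs(3) abc(2)] evo_d_Dp[OF Gs(2) abc(8)] evo_d_Dp[OF Gs(3) abc(5)]
  note XDp = X_Dp[OF abc(2) abc(5)] X_Dp[OF abc(5) abc(2)] X_Dp[OF abc(2) abc(8)] X_Dp[OF abc(8) abc(2)]
    X_Dp[OF abc(5) abc(8)] X_Dp[OF abc(8) abc(5)]
  note closed = Dp_DD[OF evDp(1)] Dp_DD[OF evDp(2)] Dp_DD[OF evDp(3)] Dp_DD[OF evDp(4)]
    Dp_DD[OF XDp(1)] Dp_DD[OF XDp(2)] Dp_DD[OF XDp(3)] Dp_DD[OF XDp(4)] Dp_DD[OF XDp(5)] Dp_DD[OF XDp(6)]
  have e3: "tr (evo_d (H c) (H a)) b = - tscl (psign ((i3 + i1) * i2)) (tr (H b) (evo_d (H c) a)) +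
      (tr (H c) (X a b) - tscl (psign (i1 * i2)) (tr (H c) (X b a)))"
    unfolding H_adjoint[OF Gs(3) abc(2) abc(5)] H_skew[OF evDp(2) abc(5)]
    using closed HD by (simp add: tr_diff_right tr_scl_right DD_closed)
  have b12: "tr (evo_bracket (H a) (H b)) c = tr (evo_d (H a) (H b)) c - tscl (psign (i1 * i2)) (tr (evo_d (H b) (H a)) c)"
    unfolding bracket_hom[OF Gs(1,2)] using evo_d_DD[OF Gs(1) HD(2)] evo_d_DD[OF Gs(2) HD(1)] DD
    by (simp add: tr_diff_left tr_scl_left DD_closed)
  have b13: "tr (evo_bracket (H a) (H c)) b = - tscl (psign ((i1 + i3) * i2)) (tr (H b) (evo_d (H a) c) -
      tscl (psign (i1 * i3)) (tr (H b) (evo_d (H c) a)) + tr (H b) (X a c) - tscl (psign (i1 * i3)) (tr (H b) (X c a)))"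
    unfolding H_bracket[OF abc(2) abc(8)] H_skew[OF image_bracket_hom[OF abc(2) abc(8)] abc(5)]
    using closed HD by (simp add: tr_diff_right tr_add_right tr_scl_right DD_closed)
  have b23: "tr (evo_bracket (H b) (H c)) a = - tscl (psign ((i2 + i3) * i1)) (tr (H a) (evo_d (H b) c) -
      tscl (psign (i2 * i3)) (tr (H a) (evo_d (H c) b)) + tr (H a) (X b c) - tscl (psign (i2 * i3)) (tr (H a) (X c b)))"
    unfolding H_bracket[OF abc(5) abc(8)] H_skew[OF image_bracket_hom[OF abc(5) abc(8)] abc(2)]
    using closed HD by (simp add: tr_diff_right tr_add_right tr_scl_right DD_closed)
  have c1: "tr (H a) (X b c) = - tscl (psign (i1 * (i2 + i3))) (tr (H b) (X c a)) - tscl (psign (i3 * (i1 + i2))) (tr (H c) (X a b))"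
    using H_cyclic[OF abc(2) abc(5) abc(8)] by (simp add: eq_neg_iff_add_eq_0 algebra_simps)
  have c2: "tr (H a) (X c b) = - tscl (psign (i1 * (i3 + i2))) (tr (H c) (X b a)) - tscl (psign (i2 * (i1 + i3))) (tr (H b) (X a c))"
    using H_cyclic[OF abc(2) abc(8) abc(5)] by (simp add: eq_neg_iff_add_eq_0 algebra_simps)
  (* What is left is a linear identity in residues whose coefficients are products of signs; it is
     checked for each of the eight choices of parities. *)
  show ?thesis
    unfolding diff act e3 b12 b13 b23 c1 c2
    by (cases i1 i2 i3 rule: eight_cases) (simp_all add: tscl_add tscl_diff tscl_tscl)
qed

theorem hamiltonian: "hs.hamiltonian_superoperator H"
proof -
  have "hs.linear_map H"
    unfolding hs.linear_map_def using H_gcarG Omega_DD by (auto simp: H_add H_scl)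
  moreover have "hs.super_skew_symmetric H"
    unfolding hs.super_skew_symmetric_def
  proof (intro ballI allI impI)
    fix \<phi>1 \<phi>2 i1 i2 assume \<phi>: "\<phi>1 \<in> \<Omega>" "\<phi>2 \<in> \<Omega>" and G: "H \<phi>1 \<in> G i1 \<and> H \<phi>2 \<in> G i2"
    have "tr (H \<phi>2) \<phi>1 = - tscl (psign (i2 * i1)) (tr (H \<phi>1) \<phi>2)"
      by (rule skew_inhom) (use \<phi> G Omega_DD in auto)
    then show "pairing (H \<phi>2) \<phi>1 = - tscl (psign (i1 * i2)) (pairing (H \<phi>1) \<phi>2)"
      using \<phi> G by (simp add: pairing_tr gcarG_DD[OF H_gcarG[OF Omega_DD]] mult.commute[of i2 i1])
  qed
  ultimately show ?thesis
    unfolding hs.hamiltonian_superoperator_def hs.graded_linear_map_def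
  proof (intro conjI)
    show "\<forall>x\<in>H ` \<Omega>. \<forall>y\<in>H ` \<Omega>. evo_bracket x y \<in> H ` \<Omega>" using image_bracket by blast
    show "\<forall>i1 i2 i3. \<forall>x1\<in>H ` \<Omega> \<inter> G i1. \<forall>x2\<in>H ` \<Omega> \<inter> G i2. \<forall>x3\<in>H ` \<Omega> \<inter> G i3.
        hs.differential [i1, i2, i3] (hs.form_of H) [x1, x2, x3] = 0"
      using form_closed by blast
  qed (simp_all add: image_graded left_radical_graded right_radical_graded)
qed

lemma graded_linear: "hs.graded_linear_map H"
  using hamiltonian unfolding hs.hamiltonian_superoperator_def by blast

lemma poisson_operator_scale: "poisson_operator sA A form \<iota> e (\<lambda>a. d_scl t (H a)) (\<lambda>a b. d_scl t (X a b))"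
proof unfold_locales
  fix a b c x i j k s
  show "a \<in> Dp i \<Longrightarrow> d_scl t (H a) \<in> G i" by (simp add: G_scl H_G)
  show "a \<in> DD \<Longrightarrow> b \<in> DD \<Longrightarrow> d_scl t (H (a + b)) = d_scl t (H a) + d_scl t (H b)"
    by (simp add: H_add d_scl_add)
  show "a \<in> DD \<Longrightarrow> d_scl t (H (d_scl s a)) = d_scl s (d_scl t (H a))"
    by (simp add: H_scl d_scl_d_scl mult.commute)
  show "a \<in> DD \<Longrightarrow> order_le (- int \<iota> - 2) a \<Longrightarrow> d_scl t (H a) = 0" by (simp add: H_low)
  show "a \<in> Dp i \<Longrightarrow> b \<in> Dp j \<Longrightarrow> d_scl t (X a b) \<in> Dp (i + j)" by (simp add: Dp_scl X_Dp)
  note GD = gcarG_DD[OF H_gcarG]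
  show "tr (d_scl t (H a)) b = - tscl (psign (i * j)) (tr (d_scl t (H b)) a)" if "a \<in> Dp i" "b \<in> Dp j"
    using H_skew[OF that] that by (simp add: tr_scl_left GD Dp_DD tscl_tscl mult.commute)
  show "evo_bracket (d_scl t (H a)) (d_scl t (H b)) = d_scl t (H (evo_d (d_scl t (H a)) b -
      d_scl (psign (i * j)) (evo_d (d_scl t (H b)) a) + d_scl t (X a b) - d_scl (psign (i * j)) (d_scl t (X b a))))"
    if "a \<in> Dp i" "b \<in> Dp j"
  proof -
    let ?z = "evo_d (H a) b - d_scl (psign (i * j)) (evo_d (H b) a) + X a b - d_scl (psign (i * j)) (X b a)"
    have "evo_d (d_scl t (H a)) b - d_scl (psign (i * j)) (evo_d (d_scl t (H b)) a) + d_scl t (X a b) -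
        d_scl (psign (i * j)) (d_scl t (X b a)) = d_scl t ?z"
      by (simp add: evo_d_scl_left d_scl_add d_scl_diff d_scl_d_scl mult.commute)
    then show ?thesis
      using H_bracket[OF that] by (simp add: bracket_scl_left bracket_scl_right H_scl[OF Dp_DD[OF image_bracket_hom[OF that]]])
  qed
  show "tr (evo_d x (d_scl t (H a))) b = tr (d_scl t (H (evo_d x a))) b +
      tr x (d_scl t (X a b) - d_scl (psign (i * j)) (d_scl t (X b a)))" if "x \<in> G k" "a \<in> Dp i" "b \<in> Dp j"
  proof -
    have z: "d_scl t (X a b) - d_scl (psign (i * j)) (d_scl t (X b a)) = d_scl t (X a b - d_scl (psign (i * j)) (X b a))"
      by (simp add: d_scl_diff d_scl_d_scl mult.commute)
    have "X a b - d_scl (psign (i * j)) (X b a) \<in> DD"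
      using X_Dp[OF that(2,3)] X_Dp[OF that(3,2)] by (simp add: DD_diff DD_scl Dp_DD)
    moreover have "evo_d x (H a) \<in> DD" by (rule evo_d_DD[OF that(1) GD[OF Dp_DD[OF that(2)]]])
    ultimately show ?thesis unfolding z
      using H_adjoint[OF that] that evo_d_DD[OF that(1) Dp_DD[OF that(2)]]
      by (simp add: evo_d_scl tr_scl_left tr_scl_right Dp_DD GD gcarG_DD[OF G_gcarG] tscl_add)
  qed
  show "tr (d_scl t (H a)) (d_scl t (X b c)) + tscl (psign (i * (j + k))) (tr (d_scl t (H b)) (d_scl t (X c a))) +
      tscl (psign (k * (i + j))) (tr (d_scl t (H c)) (d_scl t (X a b))) = 0" if "a \<in> Dp i" "b \<in> Dp j" "c \<in> Dp k"
  proof -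
    (* The cyclic sum is quadratic in the pair (H, X). *)
    have "tscl (t * t) (tr (H a) (X b c) + tscl (psign (i * (j + k))) (tr (H b) (X c a)) +
        tscl (psign (k * (i + j))) (tr (H c) (X a b))) = 0"
      by (simp only: H_cyclic[OF that] tscl_zero)
    then show ?thesis using that
      by (simp add: tr_scl_left tr_scl_right Dp_DD GD Dp_DD[OF X_Dp] DD_scl tscl_tscl tscl_add mult_ac)
  qed
qed

lemma poisson_operator_cong:
  assumes "\<And>a. a \<in> DD \<Longrightarrow> H' a = H a"
  shows "poisson_operator sA A form \<iota> e H' X"
proof unfold_locales
  fix a b c x i j k s
  show "a \<in> Dp i \<Longrightarrow> H' a \<in> G i" by (simp add: assms Dp_DD H_G)
  show "a \<in> DD \<Longrightarrow> b \<in> DD \<Longrightarrow> H' (a + b) = H' a + H' b" by (simp add: assms DD_add H_add)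
  show "a \<in> DD \<Longrightarrow> H' (d_scl s a) = d_scl s (H' a)" by (simp add: assms DD_scl H_scl)
  show "a \<in> DD \<Longrightarrow> order_le (- int \<iota> - 2) a \<Longrightarrow> H' a = 0" by (simp add: assms H_low)
  show "a \<in> Dp i \<Longrightarrow> b \<in> Dp j \<Longrightarrow> X a b \<in> Dp (i + j)" by (rule X_Dp)
  show "tr (H' a) b = - tscl (psign (i * j)) (tr (H' b) a)" if "a \<in> Dp i" "b \<in> Dp j"
    using H_skew[OF that] that by (simp add: assms Dp_DD)
  show "evo_bracket (H' a) (H' b) = H' (evo_d (H' a) b - d_scl (psign (i * j)) (evo_d (H' b) a) + X a b -
      d_scl (psign (i * j)) (X b a))" if "a \<in> Dp i" "b \<in> Dp j"
    using H_bracket[OF that] that by (simp add: assms Dp_DD Dp_DD[OF image_bracket_hom[OF that]])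
  show "tr (evo_d x (H' a)) b = tr (H' (evo_d x a)) b + tr x (X a b - d_scl (psign (i * j)) (X b a))"
    if "x \<in> G k" "a \<in> Dp i" "b \<in> Dp j"
    using H_adjoint[OF that] that by (simp add: assms Dp_DD evo_d_DD[OF that(1)])
  show "tr (H' a) (X b c) + tscl (psign (i * (j + k))) (tr (H' b) (X c a)) + tscl (psign (k * (i + j))) (tr (H' c) (X a b)) = 0"
    if "a \<in> Dp i" "b \<in> Dp j" "c \<in> Dp k"
    using H_cyclic[OF that] that by (simp add: assms Dp_DD)
qed

end

context kp_superalgebra
begin

section \<open>The two operators\<close>

text \<open>The condition $\partial_vL=v$ says that the coefficients of $L$ are, up to constants,
  the coordinates on which evolutionary vector fields act. It makes derivatives of expressions in
  $L$ explicit.\<close>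

definition coordinate_op :: "'f psdo \<Rightarrow> bool" where
  "coordinate_op L \<longleftrightarrow> L \<in> Dp 0 \<and> order_le (int \<iota> + 1) L \<and> (\<forall>k. \<forall>v\<in>G k. evo_d v L = v)"

lemma coordinate_opD:
  assumes "coordinate_op L"
  shows "L \<in> Dp 0" "L \<in> DD" "order_le (int \<iota> + 1) L" "v \<in> G k \<Longrightarrow> evo_d v L = v"
  using assms Dp_DD by (auto simp: coordinate_op_def)

lemma Dp_G: "a \<in> Dp i \<Longrightarrow> order_le (int \<iota>) a \<Longrightarrow> a \<in> G i"
  by (simp add: G_iff Dp_iff)

lemma order_le_diff: "order_le N v \<Longrightarrow> order_le N w \<Longrightarrow> order_le N (v - w)"
  by (simp add: order_le_def)

lemma order_le_plus: "order_le N v \<Longrightarrow> order_le N w \<Longrightarrow> order_le N (v + w)"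
  by (simp add: order_le_def)

lemma quad_op_poisson:
  assumes "coordinate_op L"
  shows "poisson_operator sA A form \<iota> e (quad_op L) (quad_prod L)"
proof unfold_locales
  note L = coordinate_opD[OF assms]
  fix a b c x i j k s
  show GH: "quad_op L a \<in> G i" if "a \<in> Dp i" for a i
  proof (rule Dp_G[OF quad_op_Dp[OF L(1) that]])
    show "order_le (int \<iota>) (quad_op L a)" unfolding quad_op_def
      by (intro order_le_diff order_le_mono[OF order_le_mult[OF order_le_d_minus L(3)]] order_le_mono[OF order_le_mult[OF L(3) order_le_d_minus]]) simp_all
  qed
  show "a \<in> DD \<Longrightarrow> b \<in> DD \<Longrightarrow> quad_op L (a + b) = quad_op L a + quad_op L b"
    using L by (simp add: quad_op_def d_mult_distribs d_minus_add DD_closed)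
  show "a \<in> DD \<Longrightarrow> quad_op L (d_scl s a) = d_scl s (quad_op L a)"
    using L by (simp add: quad_op_def d_mult_scl_left d_mult_scl_right d_minus_scl d_scl_diff DD_closed)
  show "quad_op L a = 0" if "a \<in> DD" "order_le (- int \<iota> - 2) a"
  proof -
    have "order_le (- 1) (L \<star> a)" "order_le (- 1) (a \<star> L)"
      using order_le_mult[OF L(3) that(2)] order_le_mult[OF that(2) L(3)] by (simp_all add: order_le_def)
    then show ?thesis using that L by (simp add: quad_op_def order_le_neg d_mult_assoc)
  qed
  show "a \<in> Dp i \<Longrightarrow> b \<in> Dp j \<Longrightarrow> quad_prod L a b \<in> Dp (i + j)" by (rule quad_prod_Dp[OF L(1)])
  show "a \<in> Dp i \<Longrightarrow> b \<in> Dp j \<Longrightarrow> tr (quad_op L a) b = - tscl (psign (i * j)) (tr (quad_op L b) a)"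
    by (rule quad_op_skew[OF L(1)])
  show "a \<in> Dp i \<Longrightarrow> b \<in> Dp j \<Longrightarrow> c \<in> Dp k \<Longrightarrow> tr (quad_op L a) (quad_prod L b c) +
      tscl (psign (i * (j + k))) (tr (quad_op L b) (quad_prod L c a)) +
      tscl (psign (k * (i + j))) (tr (quad_op L c) (quad_prod L a b)) = 0"
    by (rule quad_op_cyclic[OF L(1)])
  have evo: "evo_d x (quad_op L a) = quad_op L (evo_d x a) + quad_diff L (psign (k * i)) x a"
    if "x \<in> G k" "a \<in> Dp i" for x a k i
  proof -
    note DD = L(2) Dp_DD[OF that(2)] gcarG_DD[OF G_gcarG[OF that(1)]] evo_d_DD[OF that(1) Dp_DD[OF that(2)]]
    have 1: "evo_d x (L \<star> a) = x \<star> a + L \<star> evo_d x a" "evo_d x (a \<star> L) = evo_d x a \<star> L + d_scl (psign (k * i)) (a \<star> x)"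
      using evo_d_mult[OF that(1) L(1) DD(2)] evo_d_mult[OF that(1,2) DD(1)] L(4)[OF that(1)] by simp_all
    have "evo_d x (d_minus (L \<star> a) \<star> L) = d_minus (evo_d x (L \<star> a)) \<star> L + d_scl (psign (k * i)) (d_minus (L \<star> a) \<star> x)"
      using evo_d_mult[OF that(1) Dp_minus[OF Dp_0_mult(1)[OF L(1) that(2)]] L(2)] L(4)[OF that(1)] by (simp add: evo_d_minus)
    moreover have "evo_d x (L \<star> d_minus (a \<star> L)) = x \<star> d_minus (a \<star> L) + L \<star> d_minus (evo_d x (a \<star> L))"
      using evo_d_mult[OF that(1) L(1), of "d_minus (a \<star> L)"] DD L(4)[OF that(1)] by (simp add: evo_d_minus DD_closed)
    ultimately show ?thesis unfolding quad_op_def[of L a] evo_d_diff 1 quad_op_def[of L "evo_d x a"] quad_diff_def using DD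
      by (simp add: d_mult_distribs d_mult_scl_right d_minus_add d_minus_scl d_scl_diff DD_closed)
  qed
  show "tr (evo_d x (quad_op L a)) b = tr (quad_op L (evo_d x a)) b +
      tr x (quad_prod L a b - d_scl (psign (i * j)) (quad_prod L b a))" if "x \<in> G k" "a \<in> Dp i" "b \<in> Dp j"
  proof -
    note DD = L(2) Dp_DD[OF that(2)] Dp_DD[OF that(3)] gcarG_DD[OF G_gcarG[OF that(1)]] evo_d_DD[OF that(1) Dp_DD[OF that(2)]]
    have "tr (evo_d x (quad_op L a)) b = tr (quad_op L (evo_d x a)) b + tr (quad_diff L (psign (k * i)) x a) b"
      unfolding evo[OF that(1,2)] by (rule tr_add_left) (use DD in \<open>simp_all add: quad_op_def quad_diff_def DD_closed\<close>)
    then show ?thesis unfolding quad_diff_adjoint[OF L(1) G_Dp[OF that(1)] that(2,3)] .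
  qed
  show "evo_bracket (quad_op L a) (quad_op L b) = quad_op L (evo_d (quad_op L a) b -
      d_scl (psign (i * j)) (evo_d (quad_op L b) a) + quad_prod L a b - d_scl (psign (i * j)) (quad_prod L b a))"
    if "a \<in> Dp i" "b \<in> Dp j"
  proof -
    let ?s = "psign (i * j) :: 'f"
    note G = GH[OF that(1)] GH[OF that(2)]
    note DD = L(2) Dp_DD[OF that(1)] Dp_DD[OF that(2)] gcarG_DD[OF G_gcarG[OF G(1)]] gcarG_DD[OF G_gcarG[OF G(2)]]
      evo_d_DD[OF G(1) Dp_DD[OF that(2)]] evo_d_DD[OF G(2) Dp_DD[OF that(1)]]
      Dp_DD[OF quad_prod_Dp[OF L(1) that]] Dp_DD[OF quad_prod_Dp[OF L(1) that(2,1)]]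
    have add: "quad_op L (u + v) = quad_op L u + quad_op L v" "quad_op L (d_scl s u) = d_scl s (quad_op L u)"
      "quad_op L (u - v) = quad_op L u - quad_op L v"
      if "u \<in> DD" "v \<in> DD" for u v s
      using L that by (simp_all add: quad_op_def d_mult_distribs d_mult_scl_left d_mult_scl_right d_minus_scl d_scl_diff
         d_minus_add d_minus_diff DD_closed)
    have "quad_op L (evo_d (quad_op L a) b - d_scl ?s (evo_d (quad_op L b) a) + quad_prod L a b - d_scl ?s (quad_prod L b a))
      = quad_op L (evo_d (quad_op L a) b) - d_scl ?s (quad_op L (evo_d (quad_op L b) a)) +
        (quad_op L (quad_prod L a b) - d_scl ?s (quad_op L (quad_prod L b a)))"
      using DD by (simp add: add DD_closed)
    moreover have "quad_op L (quad_prod L a b) - d_scl ?s (quad_op L (quad_prod L b a)) =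
      quad_diff L ?s (quad_op L a) b - d_scl ?s (quad_diff L ?s (quad_op L b) a)"
      unfolding quad_op_prod[OF DD(1,2,3), symmetric] quad_op_prod[OF DD(1,3,2), symmetric] quad_diff_def
      by (simp add: d_scl_add d_scl_diff d_scl_d_scl)
    ultimately show ?thesis
      unfolding bracket_hom[OF G] evo[OF G(1) that(2)] evo[OF G(2) that(1)] mult.commute[of j i]
      by (simp add: d_scl_add)
  qed
qed

lemma lin_op_poisson:
  assumes "coordinate_op L" and K: "central_const K"
  shows "poisson_operator sA A form \<iota> e (lin_op K L) (\<lambda>a b. K \<star> split_prod a b)"
proof unfold_locales
  note L = coordinate_opD[OF assms(1)] and Kc = central_constD[OF K]
  fix a b c x i j k s
  have lin_DD: "lin_diff r u a \<in> DD" if "u \<in> DD" "a \<in> DD" for u a r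
    using that by (simp add: lin_diff_def DD_closed)
  show GH: "lin_op K L a \<in> G i" if "a \<in> Dp i" for a i
  proof (rule Dp_G)
    show "lin_op K L a \<in> Dp i" unfolding lin_op_def using Dp_0_mult(1)[OF Kc(1)] lin_diff_Dp[OF L(1) that] by simp
    have "order_le (int \<iota>) (lin_diff 1 L a)" unfolding lin_diff_def d_scl_one
      by (intro order_le_diff order_le_plus order_le_mono[OF order_le_d_minus] order_le_mono[OF order_le_mult[OF order_le_d_minus L(3)]]
          order_le_mono[OF order_le_mult[OF L(3) order_le_d_minus]]) simp_all
    then show "order_le (int \<iota>) (lin_op K L a)"
      unfolding lin_op_def using order_le_mult[OF Kc(8), of "int \<iota>" "lin_diff 1 L a"] by simp
  qed
  have add: "lin_op K L (u + v) = lin_op K L u + lin_op K L v" "lin_op K L (d_scl s u) = d_scl s (lin_op K L u)"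
      "lin_op K L (u - v) = lin_op K L u - lin_op K L v"
      if "u \<in> DD" "v \<in> DD" for u v s
      using L Kc that by (simp_all add: lin_op_def lin_diff_def d_mult_distribs d_mult_scl_left d_mult_scl_right d_minus_scl d_scl_diff
         d_scl_add d_minus_add d_minus_diff DD_closed)
  show "a \<in> DD \<Longrightarrow> b \<in> DD \<Longrightarrow> lin_op K L (a + b) = lin_op K L a + lin_op K L b" by (rule add)
  show "a \<in> DD \<Longrightarrow> lin_op K L (d_scl s a) = d_scl s (lin_op K L a)" by (rule add)
  show "lin_op K L a = 0" if "a \<in> DD" "order_le (- int \<iota> - 2) a"
  proof -
    have "order_le (- 1) (L \<star> a)" "order_le (- 1) (a \<star> L)" "order_le (- 1) a"
      using order_le_mult[OF L(3) that(2)] order_le_mult[OF that(2) L(3)] that(2) by (simp_all add: order_le_def)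
    then have "lin_diff 1 L a = 0" by (simp add: lin_diff_def order_le_neg)
    then show ?thesis using d_mult_scl_right[OF Kc(2) DD_zero, of 0] by (simp add: lin_op_def)
  qed
  show "a \<in> Dp i \<Longrightarrow> b \<in> Dp j \<Longrightarrow> K \<star> split_prod a b \<in> Dp (i + j)"
    by (rule Dp_0_mult(1)[OF Kc(1) split_prod_Dp])
  show "a \<in> Dp i \<Longrightarrow> b \<in> Dp j \<Longrightarrow> tr (lin_op K L a) b = - tscl (psign (i * j)) (tr (lin_op K L b) a)"
    by (rule lin_op_skew[OF K L(1)])
  show "a \<in> Dp i \<Longrightarrow> b \<in> Dp j \<Longrightarrow> c \<in> Dp k \<Longrightarrow> tr (lin_op K L a) (K \<star> split_prod b c) +
      tscl (psign (i * (j + k))) (tr (lin_op K L b) (K \<star> split_prod c a)) +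
      tscl (psign (k * (i + j))) (tr (lin_op K L c) (K \<star> split_prod a b)) = 0"
    by (rule lin_op_cyclic[OF K L(1)])
  have evo: "evo_d x (lin_op K L a) = lin_op K L (evo_d x a) + K \<star> lin_diff (psign (k * i)) x a"
    if "x \<in> G k" "a \<in> Dp i" for x a k i
  proof -
    note DD = L(2) Dp_DD[OF that(2)] gcarG_DD[OF G_gcarG[OF that(1)]] evo_d_DD[OF that(1) Dp_DD[OF that(2)]]
    have 1: "evo_d x (L \<star> a) = x \<star> a + L \<star> evo_d x a" "evo_d x (a \<star> L) = evo_d x a \<star> L + d_scl (psign (k * i)) (a \<star> x)"
      if "a \<in> Dp i" for a
      using evo_d_mult[OF \<open>x \<in> G k\<close> L(1) Dp_DD[OF that]] evo_d_mult[OF \<open>x \<in> G k\<close> that L(2)] L(4)[OF \<open>x \<in> G k\<close>] by simp_all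
    have "evo_d x (lin_diff 1 L a) = lin_diff 1 L (evo_d x a) + lin_diff (psign (k * i)) x a"
      using 1[OF that(2)] 1[OF Dp_minus[OF that(2)]]
      by (simp add: lin_diff_def evo_d_add evo_d_diff evo_d_minus d_minus_add d_minus_scl)
    moreover have "evo_d x (K \<star> lin_diff 1 L a) = K \<star> evo_d x (lin_diff 1 L a)"
      using evo_d_mult[OF that(1) Kc(1) lin_DD[OF DD(1,2)]] Kc(5) d_mult_scl_left[OF DD_zero lin_DD[OF DD(1,2)], of 0 1] by simp
    ultimately show ?thesis unfolding lin_op_def using DD Kc(2) by (simp add: d_mult_add_right lin_DD)
  qed
  show "tr (evo_d x (lin_op K L a)) b = tr (lin_op K L (evo_d x a)) b +
      tr x (K \<star> split_prod a b - d_scl (psign (i * j)) (K \<star> split_prod b a))" if "x \<in> G k" "a \<in> Dp i" "b \<in> Dp j"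
  proof -
    note DD = L(2) Dp_DD[OF that(2)] Dp_DD[OF that(3)] gcarG_DD[OF G_gcarG[OF that(1)]] evo_d_DD[OF that(1) Dp_DD[OF that(2)]]
    have "tr (evo_d x (lin_op K L a)) b = tr (lin_op K L (evo_d x a)) b + tr (K \<star> lin_diff (psign (k * i)) x a) b"
      unfolding evo[OF that(1,2)] by (rule tr_add_left) (use DD Kc(2) in \<open>simp_all add: lin_op_def lin_DD DD_closed\<close>)
    also have "tr (K \<star> lin_diff (psign (k * i)) x a) b = tr x (split_prod a (K \<star> b) - d_scl (psign (i * j)) (split_prod (K \<star> b) a))"
      unfolding Kc(7)[OF lin_DD[OF DD(4,2)] DD(3)]
      by (rule lin_diff_adjoint[OF G_Dp[OF that(1)] that(2) Dp_0_mult(1)[OF Kc(1) that(3)]])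
    finally show ?thesis unfolding split_prod_central[OF K DD(3,2)] split_prod_central[OF K DD(2,3)] .
  qed
  show "evo_bracket (lin_op K L a) (lin_op K L b) = lin_op K L (evo_d (lin_op K L a) b -
      d_scl (psign (i * j)) (evo_d (lin_op K L b) a) + K \<star> split_prod a b - d_scl (psign (i * j)) (K \<star> split_prod b a))"
    if "a \<in> Dp i" "b \<in> Dp j"
  proof -
    let ?s = "psign (i * j) :: 'f" and ?x = "lin_op K L a" and ?y = "lin_op K L b"
    note G = GH[OF that(1)] GH[OF that(2)]
    note DD = L(2) Dp_DD[OF that(1)] Dp_DD[OF that(2)] gcarG_DD[OF G_gcarG[OF G(1)]] gcarG_DD[OF G_gcarG[OF G(2)]]
      evo_d_DD[OF G(1) Dp_DD[OF that(2)]] evo_d_DD[OF G(2) Dp_DD[OF that(1)]]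
    have e: "lin_op K L (K \<star> split_prod a b) = K \<star> (d_minus (lin_op K L a \<star> b) - lin_op K L a \<star> d_minus b +
        d_minus (a \<star> lin_op K L b) - d_minus a \<star> lin_op K L b)" if "a \<in> DD" "b \<in> DD" for a b
    proof -
      have "lin_diff 1 L (K \<star> split_prod a b) = K \<star> lin_diff 1 L (split_prod a b)"
        by (rule lin_diff_central[OF K L(2) split_prod_DD[OF that]])
      also have "\<dots> = d_minus (lin_op K L a \<star> b) - lin_op K L a \<star> d_minus b + d_minus (a \<star> lin_op K L b) - d_minus a \<star> lin_op K L b"
        unfolding lin_diff_prod[OF L(2) that, symmetric] lin_op_def using Kc that L(2)
        by (simp add: d_mult_distribs d_mult_assoc lin_DD DD_closed)
      finally show ?thesis by (simp add: lin_op_def)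
    qed
    have "lin_op K L (evo_d ?x b - d_scl ?s (evo_d ?y a) + K \<star> split_prod a b - d_scl ?s (K \<star> split_prod b a))
      = lin_op K L (evo_d ?x b) - d_scl ?s (lin_op K L (evo_d ?y a)) +
        (lin_op K L (K \<star> split_prod a b) - d_scl ?s (lin_op K L (K \<star> split_prod b a)))"
      using DD Kc(2) by (simp add: add DD_closed split_prod_DD)
    moreover have "lin_op K L (K \<star> split_prod a b) - d_scl ?s (lin_op K L (K \<star> split_prod b a)) =
      K \<star> lin_diff ?s ?x b - d_scl ?s (K \<star> lin_diff ?s ?y a)"
      unfolding e[OF DD(2,3)] e[OF DD(3,2)] lin_diff_def using DD Kc(2)
      by (simp add: d_mult_distribs d_mult_scl_right DD_closed d_scl_add d_scl_diff d_scl_d_scl)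
    ultimately show ?thesis
      unfolding bracket_hom[OF G] evo[OF G(1) that(2)] evo[OF G(2) that(1)] mult.commute[of j i]
      by (simp add: d_scl_add)
  qed
qed

section \<open>The Lax operator\<close>

lemma I_iff: "(j, l) \<in> I i \<longleftrightarrow> j \<in> {1..dim (A i)} \<and> l \<le> int \<iota>"
  by (auto simp: I_def)

lemma lookup_Lax:
  "Poly_Mapping.lookup (Lax \<sigma> l) (i, j) = sp_const (coord (\<sigma> l) i j) + (if (j, l) \<in> I i then U i (j, l, 0) else 0)"
proof -
  have fin: "finite {j1. (j1, l) \<in> I k}" for k
    by (rule finite_subset[of _ "{1..dim (A k)}"]) (auto simp: I_iff)
  have "(\<Sum>j1 | (j1, l) \<in> I k. Poly_Mapping.lookup (Poly_Mapping.single (k, j1) (U k (j1, l, 0))) (i, j)) =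
      (if k = i \<and> (j, l) \<in> I i then U i (j, l, 0) else (0 :: 'f spoly))" for k
  proof -
    have "(\<Sum>j1 | (j1, l) \<in> I k. Poly_Mapping.lookup (Poly_Mapping.single (k, j1) (U k (j1, l, 0))) (i, j)) =
        (\<Sum>j1 | (j1, l) \<in> I k. if j1 = j then (if k = i then U i (j, l, 0) else 0) else (0 :: 'f spoly))"
      by (rule sum.cong[OF refl]) (auto simp: lookup_single when_def)
    then show ?thesis using fin by auto
  qed
  then show ?thesis using bit_cases2[of i] by (auto simp: Lax_def lookup_add lookup_sum lookup_emb)
qed

lemma evo_const: "evo v (sp_const c) = 0"
  by (simp add: evo_vfield)

text \<open>The coordinate $u_{i,j}$ is sent to the coefficient of \<open>v\<close> by
  $\partial_v$, and constants are sent to zero. The index set allows all orders up to $\iota$, so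
  every coefficient of an element of $\mathcal G$ is reached.\<close>

lemma Lax_coordinate_op:
  assumes \<sigma>: "\<And>m. \<sigma> m \<in> A 0" "\<And>m. m > int \<iota> + 1 \<Longrightarrow> \<sigma> m = 0"
  shows "coordinate_op (Lax \<sigma>)"
proof -
  have hom: "Lax \<sigma> l \<in> Ah_part 0" for l
    unfolding Ah_part_def
  proof (intro CollectI allI conjI impI)
    fix i j
    have "Poly_Mapping.lookup (emb (\<sigma> l)) (i, j) \<in> P_part (0 + i)" by (rule Ah_partD(1)[OF emb_Ah[OF \<sigma>(1)]])
    moreover have "(j, l) \<in> I i \<Longrightarrow> U i (j, l, 0) \<in> P_part (0 + i)" by (simp add: P_part_iff P_def spoly_on_U)
    ultimately show "Poly_Mapping.lookup (Lax \<sigma> l) (i, j) \<in> P_part (0 + i)"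
      unfolding lookup_Lax lookup_emb by (auto intro: P_part_intros)
  next
    fix i j assume "j \<notin> {1..dim (A i)}"
    then show "Poly_Mapping.lookup (Lax \<sigma> l) (i, j) = 0"
      unfolding lookup_Lax coord_out[OF \<open>j \<notin> _\<close>] by (auto simp: I_iff sp_const_def)
  qed
  have coord0: "coord 0 i j = 0" for i j using coord_scale[of 0 0 i j] by simp
  have order_le: "order_le (int \<iota> + 1) (Lax \<sigma>)"
    unfolding order_le_def
    by (intro allI impI poly_mapping_eqI, clarify) (simp add: lookup_Lax \<sigma>(2) I_iff coord0 sp_const_def)
  have "evo_d v (Lax \<sigma>) = v" if v: "v \<in> G k" for v k
  proof (rule ext, rule poly_mapping_eqI, clarify)
    fix l i j
    have "(j, l) \<notin> I i \<Longrightarrow> Poly_Mapping.lookup (v l) (i, j) = 0"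
      using v Ah_partD(2)[of "v l" k j i] by (cases "l \<le> int \<iota>") (auto simp: I_iff G_def)
    then show "Poly_Mapping.lookup (evo_d v (Lax \<sigma>) l) (i, j) = Poly_Mapping.lookup (v l) (i, j)"
      by (cases "(j, l) \<in> I i") (simp_all add: evo_d_apply lookup_Lax evo_add evo_U evo_const)
  qed
  then show ?thesis using hom order_le by (auto simp: coordinate_op_def Dp_iff)
qed

lemma Lax_shift: "Lax (\<sigma>(0 := \<sigma> 0 + sA t \<kappa>)) = Lax \<sigma> + d_scl t (d_const (emb \<kappa>))"
  by (rule ext) (auto simp: Lax_def d_scl_def d_const_def emb_add emb_scale)

lemma H2_eq: "H2 \<sigma> = quad_op (Lax \<sigma>)"
  by (rule ext) (simp add: H2_def quad_op_def)

lemma bracket_even: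
  assumes "L \<in> Dp 0" "a \<in> DD"
  shows "d_bracket L a = L \<star> a - a \<star> L" "d_bracket a L = a \<star> L - L \<star> a"
proof -
  note p = d_part_Dp[OF assms(2)]
  note D = Dp_DD[OF assms(1)] Dp_DD[OF p[of 0]] Dp_DD[OF p[of 1]]
  have z: "0 \<star> x = 0" "x \<star> 0 = 0" if "x \<in> DD" for x
    using that d_mult_scl_left[of 0 x 0] d_mult_scl_right[of x 0 0] by simp_all
  have s: "x \<star> a = x \<star> d_part 0 a + x \<star> d_part 1 a" "a \<star> x = d_part 0 a \<star> x + d_part 1 a \<star> x" if "x \<in> DD" for x
    using that D d_mult_add_right[of x "d_part 0 a" "d_part 1 a"] d_mult_add_left[of "d_part 0 a" "d_part 1 a" x]
    by (simp_all add: d_part_sum)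
  show "d_bracket L a = L \<star> a - a \<star> L" "d_bracket a L = a \<star> L - L \<star> a"
    using D by (simp_all add: d_bracket_def d_part_hom[OF assms(1)] z s algebra_simps)
qed

text \<open>The projection to negative order and $\kappa$ commute, so $\kappa$ can be pulled out
  of both terms.\<close>

lemma H1_eq:
  assumes K: "central_const (d_const (emb \<kappa>))" and L: "coordinate_op (Lax \<sigma>)" and a: "a \<in> DD"
  shows "H1 \<sigma> \<kappa> a = lin_op (d_const (emb \<kappa>)) (Lax \<sigma>) a"
proof -
  note L = coordinate_opD[OF L] and Kc = central_constD[OF K]
  show ?thesis using L Kc a
    by (simp add: H1_def bracket_even DD_closed lin_op_def lin_diff_def d_mult_distribs d_mult_assoc d_minus_diff)
qed

lemma quad_op_add_coeff:
  assumes "L \<in> DD" "N \<in> DD" "a \<in> DD"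
  shows "quad_op (L + N) a = quad_op L a +
    (d_minus (N \<star> a) \<star> L + d_minus (L \<star> a) \<star> N - L \<star> d_minus (a \<star> N) - N \<star> d_minus (a \<star> L)) + quad_op N a"
  using assms by (simp add: quad_op_def d_mult_distribs d_minus_add DD_closed)

text \<open>The term linear in \<open>t\<close> is
  $(\kappa a)_-L+(La)_-\kappa-L(a\kappa)_--\kappa(aL)_-$, which is $H_1(a)$ since $\kappa$ is
  central. The quadratic term $(\kappa a)_-\kappa-\kappa(a\kappa)_-$ vanishes for the same reason.\<close>

lemma quad_op_shift:
  assumes K: "central_const K" and L: "L \<in> DD" and a: "a \<in> DD"
  shows "quad_op (L + d_scl t K) a = quad_op L a + d_scl t (lin_op K L a)"
proof -
  note Kc = central_constD[OF K]
  have "d_minus a \<star> (K \<star> K) = K \<star> (K \<star> d_minus a)"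
    using Kc(3)[OF DD_minus[OF a]] Kc(6)[OF DD_minus[OF a] Kc(2)] by (simp only:)
  then have "quad_op K a = 0"
    unfolding quad_op_def Kc(3)[OF a] Kc(4)[OF a] using Kc(3)[OF DD_mult[OF Kc(2) DD_minus[OF a]]] by simp
  then have K0: "quad_op (d_scl t K) a = 0"
    using Kc(2) a by (simp add: quad_op_def d_mult_scl_left d_mult_scl_right d_minus_scl DD_closed
        d_scl_diff[symmetric])
  have "d_minus (K \<star> a) \<star> L + d_minus (L \<star> a) \<star> K - L \<star> d_minus (a \<star> K) - K \<star> d_minus (a \<star> L) = lin_op K L a"
    unfolding Kc(3)[OF a] Kc(4)[OF a] Kc(3)[OF DD_minus[OF DD_mult[OF L a]]] Kc(6)[OF L DD_minus[OF a]]
    using L Kc(2) a by (simp add: lin_op_def lin_diff_def d_mult_distribs d_mult_assoc DD_closed)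
  then show ?thesis
    using L Kc(2) a
    by (simp add: quad_op_add_coeff DD_scl K0 d_mult_scl_left d_mult_scl_right d_minus_scl DD_closed
        d_scl_diff[symmetric] d_scl_add[symmetric])
qed

theorem hamiltonian_superpair_Lax:
  assumes \<sigma>: "\<And>m. \<sigma> m \<in> A 0" "\<And>m. m > int \<iota> + 1 \<Longrightarrow> \<sigma> m = 0"
    and \<kappa>: "\<kappa> \<in> A 0" "\<And>a. \<kappa> * a = a * \<kappa>"
  shows "hamiltonian_setting.hamiltonian_superpair d_scl G evo_bracket tscl t_act d_scl \<Omega>
    (\<lambda>w v. pairing v w) (H1 \<sigma> \<kappa>) (H2 \<sigma>)"
proof -
  interpret hs: hamiltonian_setting d_scl G evo_bracket tscl Pt t_act d_scl \<Omega> "\<lambda>w v. pairing v w"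
    by (rule hamiltonian_setting_G)
  let ?K = "d_const (emb \<kappa>)"
  have K: "central_const ?K" by (rule central_const_emb[OF \<kappa>])
  have L: "coordinate_op (Lax \<sigma>)" by (rule Lax_coordinate_op[OF \<sigma>])
  have lin: "poisson_operator sA A form \<iota> e (H1 \<sigma> \<kappa>) (\<lambda>a b. ?K \<star> split_prod a b)"
    by (rule poisson_operator.poisson_operator_cong[OF lin_op_poisson[OF L K] H1_eq[OF K L]])
  have quad: "poisson_operator sA A form \<iota> e (H2 \<sigma>) (quad_prod (Lax \<sigma>))"
    unfolding H2_eq by (rule quad_op_poisson[OF L])
  have pencil: "\<exists>X. poisson_operator sA A form \<iota> e (\<lambda>a. d_scl c1 (H1 \<sigma> \<kappa> a) + d_scl c2 (H2 \<sigma> a)) X" for c1 c2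
  (* Apart from multiples of H1, the pencil consists of multiples of the quadratic operators of
     shifted Lax operators. *)
  proof (cases "c2 = 0")
    case True
    then show ?thesis using poisson_operator.poisson_operator_scale[OF lin, of c1] by auto
  next
    case False
    define t where "t = c1 / c2"
    let ?\<sigma> = "\<sigma>(0 := \<sigma> 0 + sA t \<kappa>)"
    have "coordinate_op (Lax ?\<sigma>)"
      by (rule Lax_coordinate_op) (use \<sigma> \<kappa> in \<open>auto intro: A_add A_scale\<close>)
    from poisson_operator.poisson_operator_scale[OF quad_op_poisson[OF this], of c2]
    have "poisson_operator sA A form \<iota> e (\<lambda>a. d_scl c1 (H1 \<sigma> \<kappa> a) + d_scl c2 (H2 \<sigma> a)) (\<lambda>a b. d_scl c2 (quad_prod (Lax ?\<sigma>) a b))"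
    proof (rule poisson_operator.poisson_operator_cong)
      fix a assume a: "a \<in> DD"
      have "quad_op (Lax ?\<sigma>) a = H2 \<sigma> a + d_scl t (H1 \<sigma> \<kappa> a)"
        unfolding Lax_shift H2_eq H1_eq[OF K L a] by (rule quad_op_shift[OF K coordinate_opD(2)[OF L] a])
      then show "d_scl c1 (H1 \<sigma> \<kappa> a) + d_scl c2 (H2 \<sigma> a) = d_scl c2 (quad_op (Lax ?\<sigma>) a)"
        using False by (simp add: d_scl_add d_scl_d_scl t_def add.commute)
    qed
    then show ?thesis by blast
  qed
  show ?thesis unfolding hs.hamiltonian_superpair_def
  proof (intro conjI allI)
    show "hs.graded_linear_map (H1 \<sigma> \<kappa>)" by (rule poisson_operator.graded_linear[OF lin])
    show "hs.graded_linear_map (H2 \<sigma>)" by (rule poisson_operator.graded_linear[OF quad])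
    fix c1 c2
    obtain X where "poisson_operator sA A form \<iota> e (\<lambda>a. d_scl c1 (H1 \<sigma> \<kappa> a) + d_scl c2 (H2 \<sigma> a)) X"
      using pencil by blast
    then show "hs.hamiltonian_superoperator (\<lambda>a. d_scl c1 (H1 \<sigma> \<kappa> a) + d_scl c2 (H2 \<sigma> a))"
      by (rule poisson_operator.hamiltonian)
  qed
qed

end

section \<open>The Hamiltonian superpair\<close>

theorem theorem5p1:
  fixes sA :: "'f::real_or_complex \<Rightarrow> 'a::ring \<Rightarrow> 'a"
    and A :: "bit \<Rightarrow> 'a set" and form :: "'a \<Rightarrow> 'a \<Rightarrow> 'f"
    and \<iota> :: nat and e :: "bit \<Rightarrow> nat \<Rightarrow> 'a"
    and \<sigma> :: "int \<Rightarrow> 'a" and \<kappa> :: 'a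
  assumes "kp_superalgebra sA A form e"
    and "\<And>m. \<sigma> m \<in> A 0"
    and "\<And>m. m > int \<iota> + 1 \<Longrightarrow> \<sigma> m = 0"
    and "\<kappa> \<in> A 0" and "\<And>a. \<kappa> * a = a * \<kappa>"
  shows "hamiltonian_setting d_scl (kp_superalgebra.G sA A \<iota>) evo_bracket
           tscl (kp_superalgebra.Pt sA A \<iota>) (kp_superalgebra.t_act sA A \<iota>)
           d_scl (kp_superalgebra.\<Omega> sA A \<iota>) (\<lambda>w v. kp_superalgebra.pairing form e v w) \<and>
         hamiltonian_setting.hamiltonian_superpair d_scl (kp_superalgebra.G sA A \<iota>) evo_bracket
           tscl (kp_superalgebra.t_act sA A \<iota>)
           d_scl (kp_superalgebra.\<Omega> sA A \<iota>) (\<lambda>w v. kp_superalgebra.pairing form e v w)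
           (kp_superalgebra.H1 sA A \<iota> e \<sigma> \<kappa>) (kp_superalgebra.H2 sA A \<iota> e \<sigma>)"
proof -
  interpret kp_superalgebra sA A form \<iota> e by (rule assms(1))
  show ?thesis
    by (intro conjI hamiltonian_setting_G hamiltonian_superpair_Lax) (fact assms)+
qed

end
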